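(* Let $G$ be a compactly generated locally compact metabelian group. Then $G$ is compactly presentable if and only if $\Gamma(G)$ contains no line through the origin, i.e. $\Gamma(G)\cap(-\Gamma(G))=\{0\}$ (equivalently, $\Gamma(G)$ does not contain two opposite nonzero characters).
   Context: A locally compact group is metabelian if $[G,G]$ is abelian; compactly generated means generated as an abstract group by a compact subset $S$; it is compactly presentable if moreover, for some such $S$, $G$ is the quotient of the free group on $S$ by the normal subgroup generated by relators of bounded length. $G^*$ denotes the set of continuous homomorphisms $G\to\mathbf{R}$; for $\chi\in G^*$, $G_\chi=\{g\in G:\chi(g)\ge0\}$. For a submonoid $S'\subseteq G$, the closed normal subgroup $H=\overline{[G,G]}$ is compactly generated over $S'$ if there is a compact $K\subseteq H$ such that $H$ is generated as an abstract group by $\{gkg^{-1}:g\in S',k\in K\}$. Define $\Gamma(G)=\{0\}\cup\{\chi\in G^*: \overline{[G,G]} \text{ is not compactly generated over any compactly generated submonoid of } G_\chi\}$. (Equivalently, if $M$ is any closed normal abelian subgroup with $Q=G/M$ abelian, $\Gamma(G)$ consists of $0$ and the $\chi\in\mathrm{Hom}(Q,\mathbf{R})\subseteq G^*$ such that $M$ is not compactly generated as a module over $Q_\chi=\{q:\chi(q)\ge0\}$.) *)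

theory Defs
  imports "HOL-Analysis.Analysis" "HOL-Algebra.Generated_Groups"
begin

definition lc_group :: "('a, 'b) monoid_scheme \<Rightarrow> 'a topology \<Rightarrow> bool" where
  "lc_group G T \<longleftrightarrow> group G \<and> topspace T = carrier G
     \<and> continuous_map (prod_topology T T) T (\<lambda>(x, y). x \<otimes>\<^bsub>G\<^esub> y)
     \<and> continuous_map T T (\<lambda>x. inv\<^bsub>G\<^esub> x)
     \<and> Hausdorff_space T \<and> locally_compact_space T"

definition metabelian :: "('a, 'b) monoid_scheme \<Rightarrow> bool" where
  "metabelian G \<longleftrightarrow> (\<forall>a \<in> derived G (carrier G). \<forall>b \<in> derived G (carrier G).
      a \<otimes>\<^bsub>G\<^esub> b = b \<otimes>\<^bsub>G\<^esub> a)"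

definition compactly_generated :: "('a, 'b) monoid_scheme \<Rightarrow> 'a topology \<Rightarrow> bool" where
  "compactly_generated G T \<longleftrightarrow>
     (\<exists>S. S \<subseteq> carrier G \<and> compactin T S \<and> generate G S = carrier G)"

text \<open>Words in the free group on a set of letters: (x, True) stands for x, (x, False) for x^-1.\<close>
type_synonym 'a word = "('a \<times> bool) list"

definition eval_word :: "('a, 'b) monoid_scheme \<Rightarrow> 'a word \<Rightarrow> 'a" where
  "eval_word G w = foldr (\<lambda>(x, b) acc. (if b then x else inv\<^bsub>G\<^esub> x) \<otimes>\<^bsub>G\<^esub> acc) w \<one>\<^bsub>G\<^esub>"

definition inv_word :: "'a word \<Rightarrow> 'a word" where
  "inv_word w = rev (map (\<lambda>(x, b). (x, \<not> b)) w)"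

definition word_over :: "'a set \<Rightarrow> 'a word \<Rightarrow> bool" where
  "word_over S w \<longleftrightarrow> fst ` set w \<subseteq> S"

text \<open>Words over S representing elements of the normal closure of R in the free group on S
(closed under free insertion / cancellation of letter pairs x x^-1).\<close>
inductive_set normal_closure_words :: "'a set \<Rightarrow> 'a word set \<Rightarrow> 'a word set"
  for S :: "'a set" and R :: "'a word set" where
  nil: "[] \<in> normal_closure_words S R"
| conj: "\<lbrakk>w \<in> normal_closure_words S R; r \<in> R; word_over S u\<rbrakk>
          \<Longrightarrow> w @ u @ r @ inv_word u \<in> normal_closure_words S R"
| conj_inv: "\<lbrakk>w \<in> normal_closure_words S R; r \<in> R; word_over S u\<rbrakk>
          \<Longrightarrow> w @ u @ inv_word r @ inv_word u \<in> normal_closure_words S R"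
| ins: "\<lbrakk>u @ v \<in> normal_closure_words S R; x \<in> S\<rbrakk>
          \<Longrightarrow> u @ [(x, b), (x, \<not> b)] @ v \<in> normal_closure_words S R"
| del: "u @ [(x, b), (x, \<not> b)] @ v \<in> normal_closure_words S R
          \<Longrightarrow> u @ v \<in> normal_closure_words S R"

definition compactly_presentable :: "('a, 'b) monoid_scheme \<Rightarrow> 'a topology \<Rightarrow> bool" where
  "compactly_presentable G T \<longleftrightarrow>
     (\<exists>S (n::nat). S \<subseteq> carrier G \<and> compactin T S \<and> generate G S = carrier G \<and>
        (\<forall>w. word_over S w \<and> eval_word G w = \<one>\<^bsub>G\<^esub> \<longrightarrow>
           w \<in> normal_closure_words S
                 {r. word_over S r \<and> length r \<le> n \<and> eval_word G r = \<one>\<^bsub>G\<^esub>}))"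

definition Gstar :: "('a, 'b) monoid_scheme \<Rightarrow> 'a topology \<Rightarrow> ('a \<Rightarrow> real) set" where
  "Gstar G T = {c. (\<forall>x \<in> carrier G. \<forall>y \<in> carrier G. c (x \<otimes>\<^bsub>G\<^esub> y) = c x + c y)
                     \<and> continuous_map T euclideanreal c}"

definition Gchi :: "('a, 'b) monoid_scheme \<Rightarrow> ('a \<Rightarrow> real) \<Rightarrow> 'a set" where
  "Gchi G c = {g \<in> carrier G. c g \<ge> 0}"

inductive_set monoid_gen :: "('a, 'b) monoid_scheme \<Rightarrow> 'a set \<Rightarrow> 'a set"
  for G and K where
  one: "\<one>\<^bsub>G\<^esub> \<in> monoid_gen G K"
| mult: "\<lbrakk>k \<in> K; m \<in> monoid_gen G K\<rbrakk> \<Longrightarrow> k \<otimes>\<^bsub>G\<^esub> m \<in> monoid_gen G K"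

definition cg_submonoid :: "('a, 'b) monoid_scheme \<Rightarrow> 'a topology \<Rightarrow> 'a set \<Rightarrow> bool" where
  "cg_submonoid G T M \<longleftrightarrow>
     (\<exists>K. K \<subseteq> carrier G \<and> compactin T K \<and> M = monoid_gen G K)"

definition cg_over :: "('a, 'b) monoid_scheme \<Rightarrow> 'a topology \<Rightarrow> 'a set \<Rightarrow> 'a set \<Rightarrow> bool" where
  "cg_over G T H M \<longleftrightarrow>
     (\<exists>K. K \<subseteq> H \<and> compactin T K \<and>
        generate G {g \<otimes>\<^bsub>G\<^esub> k \<otimes>\<^bsub>G\<^esub> inv\<^bsub>G\<^esub> g | g k. g \<in> M \<and> k \<in> K} = H)"

definition GammaG :: "('a, 'b) monoid_scheme \<Rightarrow> 'a topology \<Rightarrow> ('a \<Rightarrow> real) set" where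
  "GammaG G T = {c. (\<forall>x \<in> carrier G. c x = 0) \<or>
      (c \<in> Gstar G T \<and>
       \<not> (\<exists>M. cg_submonoid G T M \<and> M \<subseteq> Gchi G c \<and>
              cg_over G T (T closure_of derived G (carrier G)) M))}"

end

theory Submission
  imports Defs "HOL-Real_Asymp.Real_Asymp" "HOL-Library.Sublist"
begin

text \<open>
  Let \<open>N\<close> be the closure of \<open>[G,G]\<close>; it is abelian and \<open>Q = G/N\<close> is abelian with a
  cocompact lattice \<open>\<int>\<^sup>n\<close>, lifted to elements \<open>t\<^sup>a\<close> of \<open>G\<close>.

  If \<open>G\<close> is compactly presentable and \<open>\<xi> \<noteq> 0\<close>, let \<open>E\<close> be the set of points of the Cayley graph that are
  connected to \<open>1\<close> inside a thick strip \<open>|\<xi>| \<le> L\<close>. The signed number of times a loop crosses \<open>\<xi> = 0\<close> inside \<open>E\<close>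
  vanishes on short relators, hence on all loops. Applied to the commutator of an element of \<open>N\<close>
  reached through \<open>\<xi> \<ge> 0\<close> and one reached through \<open>\<xi> \<le> 0\<close>, this forces one of them into \<open>E\<close>, so \<open>N\<close> is
  already reached inside one of the two half spaces; this makes \<open>N\<close> compactly generated over \<open>G\<^sub>\<xi>\<close> or over \<open>G\<^sub>-\<^sub>\<xi>\<close>.

  Conversely, if \<open>\<Gamma>(G)\<close> contains no line, compactness of the sphere yields one compact set \<open>K \<subseteq> N\<close> such that in each
  direction \<open>v\<close> of \<open>\<real>\<^sup>n\<close>, \<open>K\<close> is contained in a product of conjugates \<open>t\<^sup>b K t\<^sup>-\<^sup>b\<close> with all \<open>b\<close> on one side of the
  hyperplane orthogonal to \<open>v\<close>. Let \<open>H\<close> be the group presented by the triangle relations of a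
  large compact set. By induction on \<open>|a|\<^sup>2\<close>, replacing \<open>a\<close> by the shorter vectors \<open>a + b\<close>,
  all conjugates of \<open>K\<close> under the lattice commute in \<open>H\<close>, so \<open>H\<close> is metabelian and the kernel of \<open>H \<rightarrow> G\<close> is a
  submodule of an abelian normal subgroup. That submodule meets the subgroup generated by a neighbourhood
  of \<open>1\<close> trivially, and a Groebner basis argument shows that it is finitely generated. Adding
  finitely many relators to \<open>H\<close> therefore gives a presentation of \<open>G\<close>.
\<close>

text \<open>The group \<open>H\<close> of the converse carries no topology, and the map
  \<open>s\<close> into it is multiplicative only on a ball of the word metric. Every relation of
  \<open>G\<close> needed in \<open>H\<close> must therefore be witnessed by products of bounded
  length. Compact covers and Baire category supply these bounds, and the radius of the ball is
  chosen last. The lifts of the lattice commute only up to elements of \<open>K\<close>, so a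
  shorter vector cannot simply be substituted: words have to be sorted. The induction survives
  because a contraction lowers the squared norm by about \<open>2 * nm n a\<close>, while the pieces
  of words that matter outside the ball already treated have displacement of the order of the square
  root of \<open>nm n a\<close>. In the Groebner argument the constants form only an abelian group,
  possibly not finitely generated. All coefficients that are divided are integers, so the structure
  of this group never enters. In the forward direction the thickness of the strip, compared with the
  length of relators, makes the crossing count invariant under insertion of relators.\<close>

context group
begin

lemma mult_inv_cancel [simp]:
  "x \<in> carrier G \<Longrightarrow> y \<in> carrier G \<Longrightarrow> x \<otimes> (inv x \<otimes> y) = y"
  "x \<in> carrier G \<Longrightarrow> y \<in> carrier G \<Longrightarrow> inv x \<otimes> (x \<otimes> y) = y"
  by (simp_all flip: m_assoc)

lemmas group_normalize = m_assoc inv_mult_group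

text \<open>Replaces induction on \<open>generate\<close>, whose product case multiplies two unknown
  elements, by an induction that appends one generator or one inverse at a time.\<close>

lemma generate_subset_right_closed:
  assumes "S \<subseteq> carrier G" "Y \<subseteq> carrier G" "\<one> \<in> Y"
    and "\<And>y s. y \<in> Y \<Longrightarrow> s \<in> S \<Longrightarrow> y \<otimes> s \<in> Y"
    and "\<And>y s. y \<in> Y \<Longrightarrow> s \<in> S \<Longrightarrow> y \<otimes> inv s \<in> Y"
  shows "generate G S \<subseteq> Y"
proof -
  \<comment> \<open>Quantifying over the left factor turns the product case into a composition of
    two right translations.\<close>
  have "\<forall>y\<in>Y. y \<otimes> g \<in> Y" if "g \<in> generate G S" for g
    using that
  proof induction
    case (eng h1 h2)
    then have "h1 \<in> carrier G" "h2 \<in> carrier G" using generate_in_carrier[OF assms(1)] by auto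
    then show ?case using eng assms(2) by (auto simp flip: m_assoc)
  qed (use assms in auto)
  then show ?thesis
    by (metis assms(1,3) generate_in_carrier l_one subsetI)
qed

lemma generate_centralizes:
  assumes "S \<subseteq> carrier G" "x \<in> carrier G" "\<And>s. s \<in> S \<Longrightarrow> s \<otimes> x = x \<otimes> s" "g \<in> generate G S"
  shows "g \<otimes> x = x \<otimes> g"
  using assms(4)
proof induction
  case (inv h)
  then have h: "h \<in> carrier G" "h \<otimes> x = x \<otimes> h" using assms by auto
  have "inv h \<otimes> (h \<otimes> x) \<otimes> inv h = inv h \<otimes> (x \<otimes> h) \<otimes> inv h" using h by simp
  then show ?case using h(1) assms(2) by (simp add: m_assoc)
next
  case (eng h1 h2)
  then have c: "h1 \<in> carrier G" "h2 \<in> carrier G" using generate_in_carrier[OF assms(1)] by auto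
  have "h1 \<otimes> h2 \<otimes> x = h1 \<otimes> (x \<otimes> h2)" using c eng assms(2) by (simp add: m_assoc)
  also have "\<dots> = (x \<otimes> h1) \<otimes> h2" using c eng assms(2) by (simp flip: m_assoc)
  finally show ?case using c assms(2) by (simp add: m_assoc)
qed (use assms in auto)

lemma generate_conj_closed:
  assumes "S \<subseteq> carrier G" "x \<in> carrier G" "subgroup K G"
    "\<And>s. s \<in> S \<Longrightarrow> x \<otimes> s \<otimes> inv x \<in> K" "g \<in> generate G S"
  shows "x \<otimes> g \<otimes> inv x \<in> K"
  using assms(5)
proof induction
  case one
  then show ?case using assms by (simp add: subgroup.one_closed)
next
  case (incl h) then show ?case using assms by simp
next
  case (inv h)
  then have "inv (x \<otimes> h \<otimes> inv x) \<in> K" using assms by (simp add: subgroup.m_inv_closed)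
  moreover have "h \<in> carrier G" using inv assms by auto
  ultimately show ?case using assms(2) by (simp add: group_normalize)
next
  case (eng h1 h2)
  then have c: "h1 \<in> carrier G" "h2 \<in> carrier G" using generate_in_carrier[OF assms(1)] by auto
  have "(x \<otimes> h1 \<otimes> inv x) \<otimes> (x \<otimes> h2 \<otimes> inv x) \<in> K"
    using eng assms(3) by (simp add: subgroup.m_closed)
  then show ?case using c assms(2) by (simp add: group_normalize)
qed

end

section \<open>Sets of conjugates, integer vectors and ordered powers\<close>

definition conjs :: "('a, 'b) monoid_scheme \<Rightarrow> 'a set \<Rightarrow> 'a set \<Rightarrow> 'a set" where
  "conjs G A K = {g \<otimes>\<^bsub>G\<^esub> k \<otimes>\<^bsub>G\<^esub> inv\<^bsub>G\<^esub> g | g k. g \<in> A \<and> k \<in> K}"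

lemma conjsI: "g \<in> A \<Longrightarrow> k \<in> K \<Longrightarrow> g \<otimes>\<^bsub>G\<^esub> k \<otimes>\<^bsub>G\<^esub> inv\<^bsub>G\<^esub> g \<in> conjs G A K"
  unfolding conjs_def by auto

lemma conjsE:
  assumes "x \<in> conjs G A K"
  obtains g k where "g \<in> A" "k \<in> K" "x = g \<otimes>\<^bsub>G\<^esub> k \<otimes>\<^bsub>G\<^esub> inv\<^bsub>G\<^esub> g"
  using assms unfolding conjs_def by auto

lemma conjs_mono: "A \<subseteq> A' \<Longrightarrow> K \<subseteq> K' \<Longrightarrow> conjs G A K \<subseteq> conjs G A' K'"
  unfolding conjs_def by blast

lemma (in group) conjs_carrier: "A \<subseteq> carrier G \<Longrightarrow> K \<subseteq> carrier G \<Longrightarrow> conjs G A K \<subseteq> carrier G"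
  unfolding conjs_def by blast

text \<open>Integer vectors are functions vanishing from \<open>n\<close> on: the type does not
  depend on the rank, and equality of functions is equality of vectors.\<close>

definition Zn :: "nat \<Rightarrow> (nat \<Rightarrow> int) set" where
  "Zn n = {a. \<forall>i\<ge>n. a i = 0}"

lemma Zn_0 [simp]: "(\<lambda>_. 0) \<in> Zn n" by (simp add: Zn_def)

lemma Zn_add [simp]: "a \<in> Zn n \<Longrightarrow> b \<in> Zn n \<Longrightarrow> (\<lambda>i. a i + b i) \<in> Zn n" by (simp add: Zn_def)

lemma Zn_diff [simp]: "a \<in> Zn n \<Longrightarrow> b \<in> Zn n \<Longrightarrow> (\<lambda>i. a i - b i) \<in> Zn n" by (simp add: Zn_def)

lemma Zn_uminus [simp]: "a \<in> Zn n \<Longrightarrow> (\<lambda>i. - a i) \<in> Zn n" by (simp add: Zn_def)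

text \<open>The order of the factors is fixed because the \<open>t i\<close> need not commute; in a
  commutative group this is a homomorphism of the lattice.\<close>

primrec tpow :: "('a, 'b) monoid_scheme \<Rightarrow> (nat \<Rightarrow> 'a) \<Rightarrow> nat \<Rightarrow> (nat \<Rightarrow> int) \<Rightarrow> 'a" where
  "tpow G t 0 a = \<one>\<^bsub>G\<^esub>"
| "tpow G t (Suc n) a = tpow G t n a \<otimes>\<^bsub>G\<^esub> t n [^]\<^bsub>G\<^esub> a n"

lemma tpow_cong: "(\<And>i. i < n \<Longrightarrow> t i = t' i) \<Longrightarrow> (\<And>i. i < n \<Longrightarrow> a i = a' i) \<Longrightarrow> tpow G t n a = tpow G t' n a'"
  by (induction n) auto

lemma (in group) tpow_closed [simp]: "(\<And>i. i < n \<Longrightarrow> t i \<in> carrier G) \<Longrightarrow> tpow G t n a \<in> carrier G"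
  by (induction n) auto

lemma (in group) tpow_0 [simp]: "(\<And>i. i < n \<Longrightarrow> t i \<in> carrier G) \<Longrightarrow> tpow G t n (\<lambda>_. 0) = \<one>"
  by (induction n) auto

lemma tpow_hom:
  assumes "group G" "group H" "h \<in> hom G H" "\<And>i. i < n \<Longrightarrow> t i \<in> carrier G"
  shows "h (tpow G t n a) = tpow H (h \<circ> t) n a"
  using assms(4)
proof (induction n)
  case 0
  then show ?case using assms hom_one by fastforce
next
  case (Suc n)
  interpret G: group G by fact
  interpret H: group H by fact
  interpret group_hom G H h using assms by (simp add: group_hom_def group_hom_axioms_def)
  show ?case using Suc by (simp add: hom_int_pow)
qed

lemma (in comm_group) tpow_add:
  assumes "\<And>i. i < n \<Longrightarrow> t i \<in> carrier G"
  shows "tpow G t n (\<lambda>i. a i + b i) = tpow G t n a \<otimes> tpow G t n b"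
  using assms
proof (induction n)
  case (Suc n)
  then have "tpow G t n a \<in> carrier G" "tpow G t n b \<in> carrier G" by auto
  then show ?case using Suc by (simp add: int_pow_mult m_ac)
qed auto

lemma (in comm_group) tpow_uminus:
  assumes "\<And>i. i < n \<Longrightarrow> t i \<in> carrier G"
  shows "tpow G t n (\<lambda>i. - a i) = inv (tpow G t n a)"
proof -
  have "tpow G t n (\<lambda>i. - a i) \<otimes> tpow G t n a = tpow G t n (\<lambda>i. - a i + a i)"
    using tpow_add[of n t "\<lambda>i. - a i" a, OF assms] by simp
  also have "\<dots> = \<one>" using assms by simp
  finally show ?thesis using assms by (metis inv_equality tpow_closed)
qed

lemma (in comm_group) tpow_diff:
  assumes "\<And>i. i < n \<Longrightarrow> t i \<in> carrier G"
  shows "tpow G t n (\<lambda>i. a i - b i) = tpow G t n a \<otimes> inv (tpow G t n b)"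
  using tpow_add[of n t a "\<lambda>i. - b i", OF assms] tpow_uminus[of n t b, OF assms] by simp

section \<open>Commuting conjugates over a lattice\<close>

type_synonym lword = "(nat \<times> bool) list"

definition ldisp :: "nat \<times> bool \<Rightarrow> nat \<Rightarrow> int" where
  "ldisp y j = (if j = fst y then (if snd y then 1 else - 1) else 0)"

definition disp :: "lword \<Rightarrow> nat \<Rightarrow> int" where
  "disp w j = sum_list (map (\<lambda>y. ldisp y j) w)"

lemma disp_simps [simp]: "disp [] j = 0" "disp (y # w) j = ldisp y j + disp w j"
  "disp (u @ w) j = disp u j + disp w j"
  by (auto simp: disp_def)

text \<open>The word that spells \<open>tpow\<close>, sorted by coordinate and free of cancellation,
  so that its length is the 1-norm of the first \<open>n\<close> entries.\<close>

primrec clist :: "nat \<Rightarrow> (nat \<Rightarrow> int) \<Rightarrow> lword" where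
  "clist 0 a = []"
| "clist (Suc n) a = clist n a @ replicate (nat \<bar>a n\<bar>) (n, a n \<ge> 0)"

lemma clist_cong: "(\<And>i. i < n \<Longrightarrow> a i = a' i) \<Longrightarrow> clist n a = clist n a'"
  by (induction n) auto

lemma clist_letters: "y \<in> set (clist n a) \<Longrightarrow> fst y < n"
  by (induction n) (auto simp: less_Suc_eq)

lemma disp_replicate: "disp (replicate k (n, b)) j = (if j = n then (if b then int k else - int k) else 0)"
  by (induction k) (auto simp: ldisp_def)

lemma disp_clist: "disp (clist n a) j = (if j < n then a j else 0)"
  by (induction n) (auto simp: disp_replicate)

lemma disp_clist_Zn: "a \<in> Zn n \<Longrightarrow> disp (clist n a) = a"
  by (auto simp: disp_clist Zn_def fun_eq_iff)

definition betw :: "(nat \<Rightarrow> int) \<Rightarrow> (nat \<Rightarrow> int) \<Rightarrow> bool" where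
  "betw p a \<longleftrightarrow> (\<forall>j. (0 \<le> p j \<and> p j \<le> a j) \<or> (a j \<le> p j \<and> p j \<le> 0))"

text \<open>Along a sorted word each coordinate moves monotonically from 0 to its final value, one
  coordinate after the other. A prefix is therefore itself a normal form, and it stays in the box
  with corners 0 and \<open>a\<close>.\<close>

lemma clist_prefix:
  assumes "clist n a = P @ R"
  shows "P = clist n (disp P) \<and> (\<forall>j<n. (0 \<le> disp P j \<and> disp P j \<le> a j) \<or> (a j \<le> disp P j \<and> disp P j \<le> 0))
    \<and> (\<forall>j\<ge>n. disp P j = 0)"
  using assms
proof (induction n arbitrary: R P)
  case 0
  then show ?case by auto
next
  case (Suc n)
  let ?k = "nat \<bar>a n\<bar>"
  consider (a) U where "clist n a = P @ U" | (b) U where "P = clist n a @ U" "U @ R = replicate ?k (n, a n \<ge> 0)"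
    using Suc.prems by (auto simp: append_eq_append_conv2)
  then show ?case
  proof cases
    case a
    note IH = Suc.IH[OF a]
    have "disp P n = 0" using IH by auto
    then show ?thesis using IH by (auto simp: less_Suc_eq le_Suc_eq)
  next
    case b
    define l where "l = length U"
    have U: "U = replicate l (n, a n \<ge> 0)" and l: "l \<le> ?k"
      using b(2) l_def by (metis append_eq_conv_conj take_replicate min.absorb1 length_append length_replicate le_add1)+
    have d: "disp P j = (if j < n then a j else if j = n then (if a n \<ge> 0 then int l else - int l) else 0)" for j
      using b U by (simp add: disp_clist disp_replicate)
    have "clist (Suc n) (disp P) = clist n (disp P) @ replicate (nat \<bar>disp P n\<bar>) (n, disp P n \<ge> 0)" by simp
    also have "clist n (disp P) = clist n a" using d by (intro clist_cong) auto
    also have "replicate (nat \<bar>disp P n\<bar>) (n, disp P n \<ge> 0) = U"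
      using d[of n] U by (cases "l = 0") auto
    finally have "P = clist (Suc n) (disp P)" using b(1) by metis
    moreover have "\<forall>j<Suc n. (0 \<le> disp P j \<and> disp P j \<le> a j) \<or> (a j \<le> disp P j \<and> disp P j \<le> 0)"
      using d l by (auto simp: less_Suc_eq)
    moreover have "\<forall>j\<ge>Suc n. disp P j = 0" using d by auto
    ultimately show ?thesis by blast
  qed
qed

lemma clist_prefix_betw:
  assumes "clist n a = P @ R" "a \<in> Zn n"
  shows "P = clist n (disp P)" "betw (disp P) a" "disp P \<in> Zn n"
  using clist_prefix[OF assms(1)] assms(2) unfolding betw_def Zn_def
  by (auto simp: not_less) (metis linorder_not_less order_refl)+

section \<open>Norms of lattice vectors and displacements\<close>

definition nsq :: "nat \<Rightarrow> (nat \<Rightarrow> int) \<Rightarrow> int" where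
  "nsq n a = (\<Sum>i<n. (a i)\<^sup>2)"

lemma nsq_nonneg [simp]: "0 \<le> nsq n a" by (simp add: nsq_def sum_nonneg)

text \<open>In the box, \<open>p\<close> and \<open>a - p\<close> never have coordinates of opposite
  sign, so their inner product is nonnegative and the squares of their norms add up to at most the
  square of the norm of \<open>a\<close>.\<close>

lemma betw_nsq:
  assumes "betw p a"
  shows "nsq n (\<lambda>i. a i - p i) \<le> nsq n a - nsq n p" "nsq n p \<le> nsq n a"
proof -
  have "(a i - p i)\<^sup>2 + (p i)\<^sup>2 \<le> (a i)\<^sup>2" for i
  proof -
    have "p i * (a i - p i) \<ge> 0" using assms by (auto simp: betw_def zero_le_mult_iff)
    then show ?thesis by (simp add: power2_eq_square algebra_simps)
  qed
  then have "(\<Sum>i<n. (a i - p i)\<^sup>2 + (p i)\<^sup>2) \<le> nsq n a" unfolding nsq_def by (intro sum_mono)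
  then show *: "nsq n (\<lambda>i. a i - p i) \<le> nsq n a - nsq n p" by (simp add: nsq_def sum.distrib)
  then show "nsq n p \<le> nsq n a" using nsq_nonneg[of n "\<lambda>i. a i - p i"] by linarith
qed

definition nm :: "nat \<Rightarrow> (nat \<Rightarrow> int) \<Rightarrow> real" where
  "nm n a = sqrt (real_of_int (nsq n a))"

lemma nm_L2: "nm n a = L2_set (\<lambda>i. real_of_int (a i)) {..<n}"
  by (simp add: nm_def nsq_def L2_set_def)

lemma nm_triangle: "nm n (\<lambda>i. a i + b i) \<le> nm n a + nm n b"
  using L2_set_triangle_ineq[of "\<lambda>i. real_of_int (a i)" "\<lambda>i. real_of_int (b i)" "{..<n}"] by (simp add: nm_L2)

lemma nm_uminus: "nm n (\<lambda>i. - a i) = nm n a" by (simp add: nm_def nsq_def)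

lemma nm_nonneg [simp]: "0 \<le> nm n a" by (simp add: nm_def)

lemma nm_sq: "(nm n a)\<^sup>2 = real_of_int (nsq n a)" by (simp add: nm_def)

lemma nm_0 [simp]: "nm n (\<lambda>_. 0) = 0" by (simp add: nm_def nsq_def)

lemma nm_letter: "nm n (ldisp y) \<le> 1"
proof -
  have "nsq n (ldisp y) = (\<Sum>i<n. if i = fst y then 1 else 0)" unfolding nsq_def
    by (intro sum.cong) (auto simp: ldisp_def)
  also have "\<dots> \<le> 1" by simp
  finally show ?thesis by (simp add: nm_def)
qed

lemma nm_disp_le: "nm n (disp w) \<le> real (length w)"
proof (induction w)
  case Nil
  have "disp [] = (\<lambda>_. 0)" by auto
  then show ?case by simp
next
  case (Cons y w)
  have "nm n (disp (y # w)) = nm n (\<lambda>i. ldisp y i + disp w i)" by (simp add: nm_def nsq_def)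
  also have "\<dots> \<le> nm n (ldisp y) + nm n (disp w)" by (rule nm_triangle)
  finally have "nm n (disp (y # w)) \<le> 1 + real (length w)" using Cons nm_letter[of n y] by linarith
  then show ?case by (simp del: disp_simps)
qed

lemma nm_app: "nm n (disp (u @ w)) \<le> nm n (disp u) + nm n (disp w)"
proof -
  have "disp (u @ w) = (\<lambda>i. disp u i + disp w i)" by auto
  then show ?thesis using nm_triangle by metis
qed

lemma nm_app_ge: "nm n (disp w) \<le> nm n (disp (u @ w)) + nm n (disp u)"
proof -
  have e: "disp w = (\<lambda>i. disp (u @ w) i + (\<lambda>i. - disp u i) i)" by auto
  have "nm n (disp w) = nm n (\<lambda>i. disp (u @ w) i + (\<lambda>i. - disp u i) i)" by (rule arg_cong[OF e])
  also have "\<dots> \<le> nm n (disp (u @ w)) + nm n (\<lambda>i. - disp u i)" by (rule nm_triangle)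
  finally show ?thesis using nm_uminus[of n "disp u"] by simp
qed

text \<open>\<open>Comm w\<close> says that \<open>B\<close> commutes elementwise with its conjugate by \<open>w\<close>. Commutators of the letters lie in \<open>B\<close>, so
  sorting a word into normal form amounts to deleting elements of \<open>B\<close> from the middle of \<open>w\<close>, which preserves
  \<open>Comm\<close> as soon as the part of \<open>w\<close> before or after the deleted element satisfies \<open>Comm\<close>.\<close>

locale commuting_conjugates = group H for H (structure) +
  fixes n :: nat and x :: "nat \<Rightarrow> 'a" and B :: "'a set"
  assumes x_closed: "\<And>i. i < n \<Longrightarrow> x i \<in> carrier H"
    and B_sub: "B \<subseteq> carrier H"
begin

definition lval :: "nat \<times> bool \<Rightarrow> 'a" where
  "lval y = (if snd y then x (fst y) else inv (x (fst y)))"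

definition val :: "lword \<Rightarrow> 'a" where
  "val w = foldr (\<lambda>y acc. lval y \<otimes> acc) w \<one>"

definition over :: "lword \<Rightarrow> bool" where "over w \<longleftrightarrow> (\<forall>y\<in>set w. fst y < n)"

lemma over_simps [simp]: "over []" "over (y # w) \<longleftrightarrow> fst y < n \<and> over w" "over (u @ w) \<longleftrightarrow> over u \<and> over w"
  by (auto simp: over_def)

lemma over_clist [simp]: "over (clist n a)" using clist_letters over_def by blast

lemma lval_closed [simp]: "fst y < n \<Longrightarrow> lval y \<in> carrier H" by (simp add: lval_def x_closed)

lemma val_Nil [simp]: "val [] = \<one>" and val_Cons [simp]: "val (y # w) = lval y \<otimes> val w"
  by (simp_all add: val_def)

lemma val_closed [simp]: "over w \<Longrightarrow> val w \<in> carrier H" by (induction w) auto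

lemma val_append [simp]: "over u \<Longrightarrow> over w \<Longrightarrow> val (u @ w) = val u \<otimes> val w"
  by (induction u) (auto simp: m_assoc)

lemma val_replicate: "i < n \<Longrightarrow> val (replicate (nat \<bar>k\<bar>) (i, k \<ge> 0)) = x i [^] k"
proof -
  assume i: "i < n"
  have 1: "val (replicate m (i, True)) = x i [^] m" for m
  proof (induction m)
    case (Suc m)
    then show ?case using i nat_pow_Suc2[OF x_closed[OF i], of m] by (simp add: lval_def)
  qed simp
  have 2: "val (replicate m (i, False)) = inv (x i [^] m)" for m
  proof (induction m)
    case (Suc m)
    have "inv (x i [^] m \<otimes> x i) = inv (x i) \<otimes> inv (x i [^] m)"
      using x_closed[OF i] by (intro inv_mult_group) auto
    then show ?case using Suc by (simp add: lval_def)
  qed simp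
  show ?thesis
  proof (cases "k \<ge> 0")
    case True
    then obtain m where "k = int m" using nonneg_int_cases by blast
    then show ?thesis using 1[of m] by (simp add: int_pow_int)
  next
    case False
    then obtain m where "k = - int m" "m > 0" by (metis not_le neg_int_cases)
    then show ?thesis using 2[of m] int_pow_neg_int[OF x_closed[OF i], of m] by simp
  qed
qed

lemma val_clist_le: "k \<le> n \<Longrightarrow> val (clist k a) = tpow H x k a \<and> over (clist k a)"
proof (induction k)
  case (Suc k)
  then show ?case using val_replicate[of k "a k"] by (auto simp: over_def)
qed auto

lemma val_clist: "val (clist n a) = tpow H x n a" using val_clist_le by blast

definition inv_list :: "lword \<Rightarrow> lword" where
  "inv_list w = rev (map (\<lambda>(i, b). (i, \<not> b)) w)"

lemma inv_list_props: "over w \<Longrightarrow> over (inv_list w) \<and> val (inv_list w) = inv (val w) \<and> length (inv_list w) = length w"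
proof (induction w)
  case Nil then show ?case by (simp add: inv_list_def)
next
  case (Cons y w)
  obtain i b where y: "y = (i, b)" by (cases y)
  have "inv_list (y # w) = inv_list w @ [(i, \<not> b)]" by (simp add: inv_list_def y)
  then show ?case using Cons by (auto simp: y lval_def inv_mult_group x_closed)
qed

definition Comm :: "'a \<Rightarrow> bool" where
  "Comm w \<longleftrightarrow> (\<forall>u\<in>B. \<forall>v\<in>B. u \<otimes> (w \<otimes> v \<otimes> inv w) = (w \<otimes> v \<otimes> inv w) \<otimes> u)"

text \<open>Conjugation by \<open>w1 k w3\<close> is conjugation by \<open>w1 w3\<close> followed by
  conjugation by \<open>w1 k inv w1\<close>. If \<open>Comm w1\<close>, then \<open>u\<close>
  commutes with the latter element; if \<open>Comm w3\<close>, then \<open>k\<close> commutes with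
  the conjugate of \<open>v\<close> by \<open>w3\<close> and drops out.\<close>

lemma Comm_swap:
  assumes c: "w1 \<in> carrier H" "w3 \<in> carrier H" "k \<in> B"
    and C: "Comm w1 \<or> Comm w3" "Comm (w1 \<otimes> w3)"
  shows "Comm (w1 \<otimes> k \<otimes> w3)"
  unfolding Comm_def
proof (intro ballI)
  fix u v assume u: "u \<in> B" and v: "v \<in> B"
  have k: "k \<in> carrier H" "u \<in> carrier H" "v \<in> carrier H" using B_sub c u v by auto
  let ?N = "w1 \<otimes> k \<otimes> inv w1" and ?X = "w1 \<otimes> w3 \<otimes> v \<otimes> inv (w1 \<otimes> w3)"
  have e: "w1 \<otimes> k \<otimes> w3 \<otimes> v \<otimes> inv (w1 \<otimes> k \<otimes> w3) = ?N \<otimes> ?X \<otimes> inv ?N"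
    using c k by (simp add: group_normalize)
  have cl: "?N \<in> carrier H" "?X \<in> carrier H" using c k by auto
  have uX: "u \<otimes> ?X = ?X \<otimes> u" using C(2) u v by (auto simp: Comm_def)
  show "u \<otimes> (w1 \<otimes> k \<otimes> w3 \<otimes> v \<otimes> inv (w1 \<otimes> k \<otimes> w3)) = w1 \<otimes> k \<otimes> w3 \<otimes> v \<otimes> inv (w1 \<otimes> k \<otimes> w3) \<otimes> u"
    using C(1)
  proof
    assume "Comm w1"
    then have uN: "u \<otimes> ?N = ?N \<otimes> u" using u c by (auto simp: Comm_def)
    have iN: "u \<otimes> inv ?N = inv ?N \<otimes> u"
    proof -
      have "inv ?N \<otimes> (u \<otimes> ?N) \<otimes> inv ?N = inv ?N \<otimes> (?N \<otimes> u) \<otimes> inv ?N" using uN by simp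
      moreover have "inv ?N \<otimes> (u \<otimes> ?N) \<otimes> inv ?N = inv ?N \<otimes> u"
        using cl(1) k(2) by (simp add: m_assoc del: inv_mult_group)
      moreover have "inv ?N \<otimes> (?N \<otimes> u) \<otimes> inv ?N = u \<otimes> inv ?N"
        using cl(1) k(2) by (simp flip: m_assoc)
      ultimately show ?thesis by simp
    qed
    have "u \<otimes> (?N \<otimes> ?X \<otimes> inv ?N) = (u \<otimes> ?N) \<otimes> ?X \<otimes> inv ?N" using cl k(2) by (simp add: m_assoc)
    also have "\<dots> = ?N \<otimes> (u \<otimes> ?X) \<otimes> inv ?N" unfolding uN using cl k(2) by (simp add: m_assoc)
    also have "\<dots> = ?N \<otimes> ?X \<otimes> (u \<otimes> inv ?N)" unfolding uX using cl k(2) by (simp add: m_assoc)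
    also have "\<dots> = ?N \<otimes> ?X \<otimes> inv ?N \<otimes> u" unfolding iN using cl k(2) by (simp add: m_assoc)
    finally show ?thesis unfolding e .
  next
    assume "Comm w3"
    then have "k \<otimes> (w3 \<otimes> v \<otimes> inv w3) = w3 \<otimes> v \<otimes> inv w3 \<otimes> k" using c v by (auto simp: Comm_def)
    then have "w1 \<otimes> (k \<otimes> (w3 \<otimes> v \<otimes> inv w3)) \<otimes> inv k \<otimes> inv w1 = w1 \<otimes> (w3 \<otimes> v \<otimes> inv w3 \<otimes> k) \<otimes> inv k \<otimes> inv w1" by simp
    then have "?N \<otimes> ?X \<otimes> inv ?N = ?X" using c k by (simp add: group_normalize)
    then show ?thesis unfolding e using uX by simp
  qed
qed

end

text \<open>By \<open>comm_B\<close>, exchanging two adjacent letters costs one element of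
  \<open>B\<close> in front of them, exactly the insertion that \<open>Comm_swap\<close>
  allows.\<close>

locale normal_form_conjugates = commuting_conjugates +
  assumes comm_B: "\<And>y z. fst y < n \<Longrightarrow> fst z < n \<Longrightarrow> lval z \<otimes> lval y \<otimes> inv (lval z) \<otimes> inv (lval y) \<in> B"
begin

text \<open>The letter \<open>y\<close> is carried to the right through \<open>Z\<close>, one
  exchange per letter. At the exchange with \<open>z\<close> the word in front is
  \<open>A Z1\<close> and the word behind is \<open>y z Z2 r\<close>; \<open>Comm\<close> must be
  known for one of the two.\<close>

lemma Comm_move:
  assumes "over A" "over Z" "fst y < n" "r \<in> carrier H"
    and "\<And>Z1 z Z2. Z = Z1 @ z # Z2 \<Longrightarrow> Comm (val (A @ Z1)) \<or> Comm (lval y \<otimes> val (z # Z2) \<otimes> r)"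
    and "Comm (val (A @ [y] @ Z) \<otimes> r)"
  shows "Comm (val (A @ Z @ [y]) \<otimes> r)"
  using assms
\<comment> \<open>Induction from the right: the last letter of \<open>Z\<close> is first absorbed
  into the tail \<open>r\<close>, and the exchange with it comes last.\<close>
proof (induction Z arbitrary: r rule: rev_induct)
  case Nil
  then show ?case by simp
next
  case (snoc z Z)
  note o = snoc.prems(1-4)
  let ?k = "lval z \<otimes> lval y \<otimes> inv (lval z) \<otimes> inv (lval y)"
  let ?w1 = "val (A @ Z)" and ?w3 = "lval y \<otimes> (lval z \<otimes> r)"
  have c: "lval z \<in> carrier H" "lval y \<in> carrier H" "?w1 \<in> carrier H" using o by auto
  have "Comm (val (A @ Z @ [y]) \<otimes> (lval z \<otimes> r))"
  proof (rule snoc.IH)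
    fix Z1 z' Z2 assume "Z = Z1 @ z' # Z2"
    then have "Comm (val (A @ Z1)) \<or> Comm (lval y \<otimes> val (z' # Z2 @ [z]) \<otimes> r)"
      using snoc.prems(5)[of Z1 z' "Z2 @ [z]"] by simp
    then show "Comm (val (A @ Z1)) \<or> Comm (lval y \<otimes> val (z' # Z2) \<otimes> (lval z \<otimes> r))"
      using o \<open>Z = _\<close> by (simp add: m_assoc)
  next
    show "Comm (val (A @ [y] @ Z) \<otimes> (lval z \<otimes> r))" using snoc.prems(6) o by (simp add: m_assoc)
  qed (use o in auto)
  then have 1: "Comm (?w1 \<otimes> ?w3)" using o by (simp add: m_assoc)
  have 2: "Comm ?w1 \<or> Comm ?w3" using snoc.prems(5)[of Z z "[]"] o by (simp add: m_assoc)
  have "Comm (?w1 \<otimes> ?k \<otimes> ?w3)" using Comm_swap[OF _ _ _ 2 1] comm_B[of y z] o by auto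
  moreover have "?w1 \<otimes> ?k \<otimes> ?w3 = val (A @ (Z @ [z]) @ [y]) \<otimes> r" using o by (simp add: m_assoc)
  ultimately show ?case by simp
qed

text \<open>The new letter goes to the end of the block of its own coordinate, where it changes the
  exponent by one. It may cancel there, so the two sides agree as values but not as words.\<close>

lemma clist_insert:
  assumes "fst y < n"
  shows "\<exists>A Z. clist n a = A @ Z \<and> over A \<and> over Z \<and> val (A @ [y] @ Z) = val (clist n (\<lambda>j. a j + ldisp y j))"
proof -
  let ?a' = "\<lambda>j. a j + ldisp y j"
  let ?i = "fst y"
  have *: "k \<le> n \<Longrightarrow> ?i < k \<Longrightarrow> \<exists>A Z. clist k a = A @ Z \<and> over A \<and> over Z \<and> val (A @ [y] @ Z) = val (clist k ?a')" for k
  proof (induction k)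
    case (Suc k)
    show ?case
    proof (cases "?i < k")
      case True
      then obtain A Z where AZ: "clist k a = A @ Z" "over A" "over Z" "val (A @ [y] @ Z) = val (clist k ?a')"
        using Suc by auto
      let ?R = "replicate (nat \<bar>a k\<bar>) (k, a k \<ge> 0)"
      have R: "over ?R" using Suc by (auto simp: over_def)
      have "?a' k = a k" using True by (auto simp: ldisp_def)
      then have "val (clist (Suc k) ?a') = val (clist k ?a') \<otimes> val ?R"
        using R val_clist_le[of k ?a'] Suc.prems by simp
      moreover have "val (A @ [y] @ Z @ ?R) = val (A @ [y] @ Z) \<otimes> val ?R"
        using AZ(1-3) R assms by (simp add: m_assoc)
      ultimately have fin: "val (A @ [y] @ Z @ ?R) = val (clist (Suc k) ?a')" using AZ(4) by metis
      show ?thesis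
      proof (intro exI conjI)
        show "clist (Suc k) a = A @ (Z @ ?R)" using AZ by simp
        show "over A" "over (Z @ ?R)" using AZ R by auto
      qed (fact fin)
    next
      case False
      then have ik: "?i = k" using Suc by auto
      have o: "over (clist (Suc k) a)" using val_clist_le Suc by blast
      have "clist k ?a' = clist k a" by (rule clist_cong) (use ik in \<open>auto simp: ldisp_def\<close>)
      then have "val (clist (Suc k) ?a') = tpow H x k a \<otimes> x k [^] (a k + ldisp y k)"
        using val_clist_le[of "Suc k" ?a'] val_clist_le[of k ?a'] val_clist_le[of k a] Suc.prems by simp
      also have "x k [^] (a k + ldisp y k) = x k [^] a k \<otimes> lval y"
        using ik x_closed[of k] Suc.prems by (simp add: int_pow_mult ldisp_def lval_def int_pow_neg)
      finally have "val (clist (Suc k) ?a') = val (clist (Suc k) a) \<otimes> lval y"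
        using val_clist_le[of "Suc k" a] Suc.prems x_closed[of k] ik by (simp add: m_assoc x_closed)
      then have fin: "val (clist (Suc k) a @ [y] @ []) = val (clist (Suc k) ?a')"
        using o assms by (simp del: clist.simps)
      show ?thesis
      proof (intro exI conjI)
        show "clist (Suc k) a = clist (Suc k) a @ []" by simp
      qed (use o fin in simp_all)
    qed
  qed auto
  show ?thesis using *[of n] assms by blast
qed

lemma ldisp_Zn: "fst y < n \<Longrightarrow> ldisp y \<in> Zn n" by (auto simp: ldisp_def Zn_def)

lemma disp_Zn: "over w \<Longrightarrow> disp w \<in> Zn n" by (induction w) (auto simp: Zn_def ldisp_def)

text \<open>The letters of \<open>w\<close> are sorted into the normal form from left to right. Each
  exchange happens behind a prefix \<open>P\<close> of the current normal form. If \<open>P\<close>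
  lies in the ball, the first hypothesis settles it; otherwise \<open>Comm\<close> must be known for
  the rest \<open>y R w2\<close>, which is what the last hypothesis provides.\<close>

lemma Comm_reroute:
  assumes m: "\<And>a. a \<in> Zn n \<Longrightarrow> nsq n a \<le> m \<Longrightarrow> Comm (tpow H x n a)"
    and "over w" "a \<in> Zn n"
    and "nsq n (\<lambda>i. a i + disp w i) \<le> m"
    and "\<And>w1 y w2 P R. w = w1 @ y # w2 \<Longrightarrow> clist n (\<lambda>i. a i + disp w1 i) = P @ R \<Longrightarrow>
      m < nsq n (disp P) \<Longrightarrow> Comm (val (y # R @ w2))"
  shows "Comm (val (clist n a @ w))"
  using assms(2-)
proof (induction w arbitrary: a)
  case Nil
  then show ?case using m by (simp add: val_clist)
next
  case (Cons y w)
  obtain A Z where AZ: "clist n a = A @ Z" "over A" "over Z" "val (A @ [y] @ Z) = val (clist n (\<lambda>j. a j + ldisp y j))"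
    using clist_insert Cons.prems by (metis over_simps(2))
  have "Comm (val (clist n (\<lambda>j. a j + ldisp y j) @ w))"
  proof (rule Cons.IH)
    show "(\<lambda>j. a j + ldisp y j) \<in> Zn n" using Cons.prems ldisp_Zn by simp
    show "nsq n (\<lambda>i. a i + ldisp y i + disp w i) \<le> m" using Cons.prems by (simp add: add.assoc)
    fix w1 y' w2 P R
    assume "w = w1 @ y' # w2" "clist n (\<lambda>i. a i + ldisp y i + disp w1 i) = P @ R" "m < nsq n (disp P)"
    then show "Comm (val (y' # R @ w2))" using Cons.prems(4)[of "y # w1" y' w2 P R] by (simp add: add.assoc)
  qed (use Cons.prems in auto)
  then have 1: "Comm (val (A @ [y] @ Z) \<otimes> val w)" using AZ Cons.prems by simp
  have "Comm (val (A @ Z @ [y]) \<otimes> val w)"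
  proof (rule Comm_move)
    fix Z1 z Z2 assume Z: "Z = Z1 @ z # Z2"
    then have c: "clist n a = (A @ Z1) @ (z # Z2)" using AZ by simp
    note pf = clist_prefix_betw[OF c Cons.prems(2)]
    show "Comm (val (A @ Z1)) \<or> Comm (lval y \<otimes> val (z # Z2) \<otimes> val w)"
    proof (cases "nsq n (disp (A @ Z1)) \<le> m")
      case True
      then show ?thesis using m[of "disp (A @ Z1)"] pf val_clist by metis
    next
      case False
      then have "Comm (val (y # (z # Z2) @ w))"
        using Cons.prems(4)[of "[]" y w "A @ Z1" "z # Z2"] c by (simp del: disp_simps(3))
      moreover have "val (y # (z # Z2) @ w) = lval y \<otimes> val (z # Z2) \<otimes> val w"
        using AZ(3) Z Cons.prems by (simp add: m_assoc)
      ultimately show ?thesis by simp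
    qed
  qed (use AZ Cons.prems 1 in auto)
  then show ?case using AZ Cons.prems by (simp add: m_assoc)
qed

text \<open>Sorting a word whose prefixes stay in the ball never leaves the ball, because the
  prefixes of a normal form lie in the box of its endpoint. The exceptional case of
  \<open>Comm_reroute\<close> therefore does not arise.\<close>

lemma Comm_word:
  assumes m: "\<And>a. a \<in> Zn n \<Longrightarrow> nsq n a \<le> m \<Longrightarrow> Comm (tpow H x n a)"
    and "over w" and "\<And>w1 w2. w = w1 @ w2 \<Longrightarrow> nsq n (disp w1) \<le> m"
  shows "Comm (val w)"
proof -
  have "Comm (val (clist n (\<lambda>_. 0) @ w))"
  proof (rule Comm_reroute[OF m])
    show "nsq n (\<lambda>i. 0 + disp w i) \<le> m" using assms(3)[of w "[]"] by simp
    fix w1 y w2 P R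
    assume a: "w = w1 @ y # w2" "clist n (\<lambda>i. 0 + disp w1 i) = P @ R" "m < nsq n (disp P)"
    have "over w1" using a assms by simp
    then have "betw (disp P) (disp w1)" using clist_prefix_betw[of n "disp w1" P R] a disp_Zn by auto
    then have "nsq n (disp P) \<le> m" using betw_nsq(2) assms(3)[of w1 "y # w2"] a by (meson order.trans)
    then show "Comm (val (y # R @ w2))" using a by simp
  qed (use assms in auto)
  moreover have "clist k (\<lambda>_. 0) = []" for k by (induction k) auto
  ultimately show ?thesis by simp
qed

text \<open>The word leaves the ball of squared radius \<open>m\<close> only towards the end of
  \<open>clist n a\<close>. From then on the unsorted rest \<open>v2\<close> and the tail
  \<open>R\<close> of the current normal form have small displacement, so \<open>y R v2\<close> is a
  word inside the ball and \<open>Comm_word\<close> applies. The left side of the last hypothesis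
  adds up the bounds for these pieces.\<close>

lemma Comm_extend:
  assumes J: "\<And>a. a \<in> Zn n \<Longrightarrow> nsq n a \<le> m \<Longrightarrow> Comm (tpow H x n a)"
    and a: "a \<in> Zn n" "nsq n a = m + 1" and m0: "m \<ge> 0"
    and w: "over w0" "over w1" "length w0 \<le> l" "length w1 \<le> l"
    and e: "nsq n (disp (w0 @ clist n a @ w1)) \<le> m"
    and l: "l \<le> sqrt m" "2 + sqrt ((sqrt (m + 1) + 2 * l)\<^sup>2 - m) + sqrt (m + 1 - (sqrt m - l)\<^sup>2) + 2 * l \<le> sqrt m"
  shows "Comm (val (w0 @ clist n a @ w1))"
proof -
  let ?w = "w0 @ clist n a @ w1"
  have nma: "nm n a = sqrt (m + 1)" using a by (simp add: nm_def)
  have lt: "m < nsq n b \<longleftrightarrow> sqrt m < nm n b" "nsq n b \<le> m \<longleftrightarrow> nm n b \<le> sqrt m" for b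
    by (simp_all add: nm_def)
  have lw: "nm n (disp v) \<le> l" if "length v \<le> l" for v
    using nm_disp_le[of n v] that by linarith
  \<comment> \<open>What \<open>clist n a\<close> still contributes after \<open>v1\<close> is
    bounded by the Pythagorean inequality for boxes, since \<open>v1\<close> has already used up
    almost all of the norm; the borders \<open>w0\<close> and \<open>w1\<close> add at most
    \<open>2 * l\<close>.\<close>
  have far: "nm n (disp v2) \<le> sqrt (m + 1 - (sqrt m - l)\<^sup>2) + 2 * l \<and> nm n (disp v1) \<le> sqrt (m + 1) + 2 * l"
    if "?w = v1 @ v2 @ v3" "sqrt m < nm n (disp v1)" for v1 v2 v3
  proof -
    have v1a: "nm n (disp v1) \<le> sqrt (m + 1) + 2 * l"
    proof -
      have "prefix v1 ?w" using that(1) by (auto simp: prefix_def)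
      then consider "prefix v1 w0" | P where "v1 = w0 @ P" "prefix P (clist n a)"
        | Q where "v1 = w0 @ clist n a @ Q" "prefix Q w1"
        unfolding prefix_append by blast
      then show ?thesis
      proof cases
        case 1
        then have "length v1 \<le> l" using w by (meson le_trans prefix_length_le)
        then show ?thesis using lw[of v1] nm_nonneg[of n a] nma by linarith
      next
        case 2
        then obtain R where R: "clist n a = P @ R" by (auto simp: prefix_def)
        have "nsq n (disp P) \<le> nsq n a" using clist_prefix_betw[OF R a(1)] betw_nsq by blast
        then have "nm n (disp P) \<le> nm n a" by (simp add: nm_def)
        then show ?thesis using 2 nm_app[of n w0 P] lw[OF w(3)] nma by simp
      next
        case 3
        have "nm n (disp Q) \<le> l" using 3 w by (intro lw) (meson le_trans prefix_length_le)
        then show ?thesis using 3 nm_app[of n w0 "clist n a @ Q"] nm_app[of n "clist n a" Q] lw[OF w(3)] nma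
          disp_clist_Zn[OF a(1)] by simp
      qed
    qed
    have "prefix v1 ?w" "prefix (v1 @ v2) ?w" using that(1) by (auto simp: prefix_def)
    moreover have "\<not> prefix v1 w0"
    proof
      assume "prefix v1 w0"
      then have "length v1 \<le> l" using w by (meson le_trans prefix_length_le)
      then show False using lw[of v1] that l by linarith
    qed
    ultimately obtain v1' where v1': "v1 = w0 @ v1'" "prefix (v1' @ v2) (clist n a @ w1)" "prefix v1' (clist n a @ w1)"
      by (auto simp: prefix_append)
    have l2: "0 \<le> sqrt (m + 1 - (sqrt m - l)\<^sup>2)"
    proof -
      have "(sqrt m - l)\<^sup>2 \<le> (sqrt m)\<^sup>2" using l by (intro power_mono) auto
      then show ?thesis using m0 by simp
    qed
    have "nm n (disp v2) \<le> sqrt (m + 1 - (sqrt m - l)\<^sup>2) + 2 * l"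
    proof (cases "prefix v1' (clist n a)")
      case False
      then obtain Q where "v1' = clist n a @ Q" "prefix (Q @ v2) w1" using v1' by (auto simp: prefix_append)
      then have "length v2 \<le> l" using w by (metis add_leE le_trans length_append prefix_length_le)
      then show ?thesis using lw[of v2] l2 by linarith
    next
      case True
      then obtain R where R: "clist n a = v1' @ R" by (auto simp: prefix_def)
      note pf = clist_prefix_betw[OF R a(1)]
      have big: "sqrt m - l < nm n (disp v1')" using that(2) v1' nm_app[of n w0 v1'] lw[OF w(3)] by simp
      have sq: "(sqrt m - l)\<^sup>2 \<le> nsq n (disp v1')" unfolding nm_sq[symmetric] using big l by (intro power_mono) auto
      have pre: "nm n (disp P) \<le> sqrt (m + 1 - (sqrt m - l)\<^sup>2)" if "R = P @ R'" for P R'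
      proof -
        have c2: "clist n a = (v1' @ P) @ R'" using R that by simp
        note pf2 = clist_prefix_betw[OF c2 a(1)]
        have "clist n (disp (v1' @ P)) = v1' @ P" using pf2(1) by simp
        then have "betw (disp v1') (disp (v1' @ P))" using clist_prefix_betw(2) pf2(3) by blast
        then have "nsq n (\<lambda>i. disp (v1' @ P) i - disp v1' i) \<le> nsq n (disp (v1' @ P)) - nsq n (disp v1')"
          by (rule betw_nsq)
        then have "nsq n (disp P) \<le> nsq n (disp (v1' @ P)) - nsq n (disp v1')" by simp
        also have "\<dots> \<le> m + 1 - nsq n (disp v1')" using betw_nsq(2)[OF pf2(2), of n] a by simp
        finally have "real_of_int (nsq n (disp P)) \<le> m + 1 - (sqrt m - l)\<^sup>2" using sq by linarith
        then show ?thesis by (simp add: nm_def)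
      qed
      have "prefix v2 (R @ w1)" using v1'(2) R by simp
      then consider "prefix v2 R" | Q where "v2 = R @ Q" "prefix Q w1" by (auto simp: prefix_append)
      then show ?thesis
      proof cases
        case 1
        then obtain zs where "R = v2 @ zs" by (auto simp: prefix_def)
        from pre[OF this] show ?thesis by linarith
      next
        case 2
        have "nm n (disp Q) \<le> l" using 2 w by (intro lw) (meson le_trans prefix_length_le)
        then show ?thesis using 2 pre[of R "[]"] nm_app[of n R Q] by simp
      qed
    qed
    then show ?thesis using v1a by blast
  qed
  have "Comm (val (clist n (\<lambda>_. 0) @ ?w))"
  proof (rule Comm_reroute[OF J])
    show "nsq n (\<lambda>i. 0 + disp ?w i) \<le> m" using e by (simp del: disp_simps)
    fix v1 y v2 P R
    assume A: "?w = v1 @ y # v2" "clist n (\<lambda>i. 0 + disp v1 i) = P @ R" "m < nsq n (disp P)"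
    have ov: "over v1" "fst y < n" "over v2" using A(1) w over_simps over_clist by metis+
    have v1: "disp v1 \<in> Zn n" using ov disp_Zn by blast
    have c1: "clist n (disp v1) = P @ R" using A(2) by simp
    note pf = clist_prefix_betw[OF c1 v1]
    have oR: "over R" using c1 over_clist over_simps by metis
    have m1: "m < nsq n (disp v1)" using betw_nsq(2)[OF pf(2), of n] A(3) by linarith
    \<comment> \<open>The additional 1 pays for removing the letter \<open>y\<close> from the
      front.\<close>
    have far': "nm n (disp u) \<le> sqrt (m + 1 - (sqrt m - l)\<^sup>2) + 2 * l + 1" if "v2 = u @ u'" for u u'
    proof -
      have "nm n (disp (y # u)) \<le> sqrt (m + 1 - (sqrt m - l)\<^sup>2) + 2 * l"
        using far[of v1 "y # u" u'] A(1) that m1 lt by simp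
      moreover have "nm n (disp [y]) \<le> 1" using nm_disp_le[of n "[y]"] by simp
      ultimately show ?thesis using nm_app_ge[of n u "[y]"] by simp
    qed
    have v1b: "nm n (disp v1) \<le> sqrt (m + 1) + 2 * l" using far[of v1 "[]" "y # v2"] A(1) m1 lt by simp
    \<comment> \<open>\<open>P\<close> lies outside the ball and \<open>R\<close> completes it
      inside the box of \<open>disp v1\<close>, so the squared displacement of each prefix of
      \<open>R\<close> is at most the excess of the squared norm of \<open>disp v1\<close> over
      \<open>m\<close>.\<close>
    have farR: "nm n (disp R1) \<le> sqrt ((sqrt (m + 1) + 2 * l)\<^sup>2 - m)" if "R = R1 @ R2" for R1 R2
    proof -
      have c2: "clist n (disp v1) = (P @ R1) @ R2" using c1 that by simp
      note pf2 = clist_prefix_betw[OF c2 v1]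
      have "clist n (disp (P @ R1)) = P @ R1" using pf2(1) by simp
      then have "betw (disp P) (disp (P @ R1))" using clist_prefix_betw(2) pf2(3) by blast
      then have "nsq n (\<lambda>i. disp (P @ R1) i - disp P i) \<le> nsq n (disp (P @ R1)) - nsq n (disp P)"
        by (rule betw_nsq)
      then have "nsq n (disp R1) \<le> nsq n (disp (P @ R1)) - nsq n (disp P)" by simp
      also have "\<dots> \<le> nsq n (disp v1) - m" using betw_nsq(2)[OF pf2(2), of n] A(3) by simp
      finally have "real_of_int (nsq n (disp R1)) \<le> (nm n (disp v1))\<^sup>2 - m" unfolding nm_sq by linarith
      also have "\<dots> \<le> (sqrt (m + 1) + 2 * l)\<^sup>2 - m" using v1b by (simp add: power_mono)
      finally show ?thesis by (simp add: nm_def)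
    qed
    have y1: "nm n (disp [y]) \<le> 1" using nm_disp_le[of n "[y]"] by simp
    have l2: "0 \<le> sqrt (m + 1 - (sqrt m - l)\<^sup>2)"
    proof -
      have "(sqrt m - l)\<^sup>2 \<le> (sqrt m)\<^sup>2" using l by (intro power_mono) auto
      then show ?thesis using m0 by simp
    qed
    show "Comm (val (y # R @ v2))"
    proof (rule Comm_word[OF J])
      fix u1 u2 assume u: "y # R @ v2 = u1 @ u2"
      have "prefix u1 ([y] @ R @ v2)" using u by (auto simp: prefix_def)
      then consider "u1 = []" | R1 R2 where "u1 = [y] @ R1" "R = R1 @ R2" | u u' where "u1 = [y] @ R @ u" "v2 = u @ u'"
        by (cases u1) (auto simp: prefix_append, auto simp: prefix_def)
      then have "nm n (disp u1) \<le> sqrt m"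
      proof cases
        case 1
        have "disp [] = (\<lambda>_. 0)" by auto
        then show ?thesis using 1 m0 by (metis nm_0 of_int_0_le_iff real_sqrt_ge_zero)
      next
        case 2
        have "nm n (disp u1) \<le> nm n (disp [y]) + nm n (disp R1)" using nm_app[of n "[y]" R1] 2(1) by simp
        moreover have "nm n (disp R1) \<le> sqrt ((sqrt (real_of_int m + 1) + 2 * real l)\<^sup>2 - real_of_int m)"
          using farR[OF 2(2)] by simp
        moreover have "0 \<le> sqrt (real_of_int m + 1 - (sqrt (real_of_int m) - real l)\<^sup>2)" using l2 by simp
        ultimately show ?thesis using y1 l by linarith
      next
        case 3
        then show ?thesis using y1 farR[of R "[]"] far'[OF 3(2)] nm_app[of n "[y]" "R @ u"] nm_app[of n R u] l by simp
      qed
      then show "nsq n (disp u1) \<le> m" using lt by blast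
    qed (use ov oR in auto)
  qed (use w in auto)
  moreover have "clist k (\<lambda>_. 0) = []" for k by (induction k) auto
  ultimately show ?thesis by simp
qed

text \<open>Induction on the squared norm. Adding to \<open>a\<close> the vectors of a suitable
  \<open>E\<close>, or subtracting them, lowers the squared norm by at least
  \<open>2 * nm n a - l^2\<close>, which is at least 1 above the threshold. So \<open>Comm\<close>
  holds at the moved points, and it passes to \<open>a\<close> because the conjugates of
  \<open>B\<close> over \<open>E\<close> generate a group containing \<open>B\<close>.\<close>

lemma Comm_tpow:
  fixes \<E> :: "(nat \<Rightarrow> int) set set"
  assumes E: "\<And>E. E \<in> \<E> \<Longrightarrow> E \<subseteq> Zn n \<and> B \<subseteq> generate H (conjs H (tpow H x n ` E) B)"
    and len: "\<And>E b. E \<in> \<E> \<Longrightarrow> b \<in> E \<Longrightarrow> length (clist n b) \<le> l"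
    and dir: "\<And>a. a \<in> Zn n \<Longrightarrow> nsq n a > 0 \<Longrightarrow> \<exists>E\<in>\<E>.
      (\<forall>b\<in>E. real_of_int (\<Sum>i<n. a i * b i) \<le> - nm n a) \<or> (\<forall>b\<in>E. real_of_int (\<Sum>i<n. a i * b i) \<ge> nm n a)"
    and M: "\<And>m::int. m \<ge> M \<Longrightarrow> l \<le> sqrt m \<and> 1 + (real l)\<^sup>2 \<le> 2 * sqrt (m + 1) \<and>
      2 + sqrt ((sqrt (m + 1) + 2 * l)\<^sup>2 - m) + sqrt (m + 1 - (sqrt m - l)\<^sup>2) + 2 * l \<le> sqrt m"
    and base: "\<And>a. a \<in> Zn n \<Longrightarrow> nsq n a \<le> M \<Longrightarrow> Comm (tpow H x n a)" and M0: "M \<ge> 0"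
    and a: "a \<in> Zn n"
  shows "Comm (tpow H x n a)"
proof -
  have "\<forall>a\<in>Zn n. nsq n a \<le> m \<longrightarrow> Comm (tpow H x n a)" if "M \<le> m" for m
    using that
  proof (induction m rule: int_ge_induct)
    case base
    then show ?case using assms(5) by blast
  next
    case (step m)
    then have J: "\<And>a. a \<in> Zn n \<Longrightarrow> nsq n a \<le> m \<Longrightarrow> Comm (tpow H x n a)" by blast
    have Mm: "l \<le> sqrt m" "1 + (real l)\<^sup>2 \<le> 2 * sqrt (m + 1)"
      "2 + sqrt ((sqrt (m + 1) + 2 * l)\<^sup>2 - m) + sqrt (m + 1 - (sqrt m - l)\<^sup>2) + 2 * l \<le> sqrt m"
      using M[OF step.hyps] by auto
    show ?case
    proof (intro ballI impI)
      fix a assume a: "a \<in> Zn n" "nsq n a \<le> m + 1"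
      show "Comm (tpow H x n a)"
      proof (cases "nsq n a \<le> m")
        case True then show ?thesis using J a by blast
      next
        case False
        then have am: "nsq n a = m + 1" and pos: "nsq n a > 0" and m: "m \<ge> 0" using a step M0 by auto
        have nma: "nm n a = sqrt (m + 1)" using am by (simp add: nm_def)
        obtain E where EE: "E \<in> \<E>" and
          or: "(\<forall>b\<in>E. real_of_int (\<Sum>i<n. a i * b i) \<le> - nm n a) \<or> (\<forall>b\<in>E. real_of_int (\<Sum>i<n. a i * b i) \<ge> nm n a)"
          using dir[OF a(1) pos] by blast
        have bZ: "b \<in> Zn n" "length (clist n b) \<le> l" if "b \<in> E" for b using E[OF EE] len[OF EE] that by auto
        have nb: "real_of_int (nsq n b) \<le> (real l)\<^sup>2" if "b \<in> E" for b
        proof -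
          have "nm n b \<le> l" using nm_disp_le[of n "clist n b"] bZ[OF that] disp_clist_Zn by fastforce
          then show ?thesis unfolding nm_sq[symmetric] by (simp add: power_mono)
        qed
        have exp: "nsq n (\<lambda>i. a i + s * b i) = nsq n a + 2 * s * (\<Sum>i<n. a i * b i) + s\<^sup>2 * nsq n b" for b s
          unfolding nsq_def by (simp add: power2_sum power_mult_distrib sum.distrib sum_distrib_left algebra_simps)
        \<comment> \<open>The sign \<open>s\<close> treats both half spaces at once. Here the
          condition that \<open>2 * sqrt (m + 1)\<close> is at least \<open>1 + l^2\<close> is used
          up.\<close>
        have close: "nsq n (\<lambda>i. a i + s * b i) \<le> m"
          if "b \<in> E" "s\<^sup>2 = 1" "real_of_int (s * (\<Sum>i<n. a i * b i)) \<le> - nm n a" for b s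
        proof -
          have "real_of_int (nsq n (\<lambda>i. a i + s * b i)) = real_of_int (m + 1) + 2 * real_of_int (s * (\<Sum>i<n. a i * b i)) + real_of_int (nsq n b)"
            unfolding exp that am by simp
          also have "\<dots> \<le> real_of_int (m + 1) - 2 * nm n a + (real l)\<^sup>2" using nb[OF that(1)] that(3) by linarith
          also have "\<dots> \<le> m" using Mm(2) nma by simp
          finally show ?thesis by simp
        qed
        have ta: "tpow H x n a \<in> carrier H" using x_closed by simp
        have tb: "tpow H x n ` E \<subseteq> carrier H" using x_closed by auto
        have cc: "conjs H (tpow H x n ` E) B \<subseteq> carrier H" using conjs_carrier[OF tb B_sub] .
        let ?t = "tpow H x n a"
        from or show ?thesis
        proof
          \<comment> \<open>In this case \<open>t^b\<close> multiplies \<open>t^a\<close> on the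
            right, so the generation property is applied to \<open>v\<close>. In the other case the
            inverse of \<open>t^b\<close> multiplies on the left, and the property is applied to
            \<open>u\<close>.\<close>
          assume neg: "\<forall>b\<in>E. real_of_int (\<Sum>i<n. a i * b i) \<le> - nm n a"
          have cb: "Comm (?t \<otimes> tpow H x n b)" if "b \<in> E" for b
          proof -
            have "Comm (val ([] @ clist n a @ clist n b))"
            proof (rule Comm_extend[OF J a(1) am m])
              have "disp ([] @ clist n a @ clist n b) = (\<lambda>i. a i + 1 * b i)" using disp_clist_Zn a bZ that by (auto simp: fun_eq_iff)
              then show "nsq n (disp ([] @ clist n a @ clist n b)) \<le> m" using close[of b 1] neg that by simp
            qed (use Mm bZ that in auto)
            then show ?thesis by (simp add: val_clist)
          qed
          show ?thesis unfolding Comm_def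
          proof (intro ballI)
            fix u v assume u: "u \<in> B" and v: "v \<in> B"
            have uc: "u \<in> carrier H" using u B_sub by auto
            have v': "v \<in> generate H (conjs H (tpow H x n ` E) B)" using E[OF EE] v by blast
            have "v \<otimes> (inv ?t \<otimes> u \<otimes> ?t) = (inv ?t \<otimes> u \<otimes> ?t) \<otimes> v"
            proof (rule generate_centralizes[OF cc _ _ v'])
              fix s assume "s \<in> conjs H (tpow H x n ` E) B"
              then obtain b k where bk: "b \<in> E" "k \<in> B" "s = tpow H x n b \<otimes> k \<otimes> inv (tpow H x n b)"
                by (auto elim: conjsE)
              let ?b = "tpow H x n b"
              have c: "?b \<in> carrier H" "k \<in> carrier H" using bk B_sub x_closed by auto
              have "u \<otimes> (?t \<otimes> ?b \<otimes> k \<otimes> inv (?t \<otimes> ?b)) = (?t \<otimes> ?b \<otimes> k \<otimes> inv (?t \<otimes> ?b)) \<otimes> u"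
                using cb[OF bk(1)] u bk(2) by (auto simp: Comm_def)
              then have "inv ?t \<otimes> (u \<otimes> (?t \<otimes> ?b \<otimes> k \<otimes> inv (?t \<otimes> ?b))) \<otimes> ?t = inv ?t \<otimes> ((?t \<otimes> ?b \<otimes> k \<otimes> inv (?t \<otimes> ?b)) \<otimes> u) \<otimes> ?t" by simp
              then show "s \<otimes> (inv ?t \<otimes> u \<otimes> ?t) = (inv ?t \<otimes> u \<otimes> ?t) \<otimes> s"
                using c ta uc bk(3) by (simp add: group_normalize)
            qed (use ta uc in auto)
            then have "?t \<otimes> (v \<otimes> (inv ?t \<otimes> u \<otimes> ?t)) \<otimes> inv ?t = ?t \<otimes> ((inv ?t \<otimes> u \<otimes> ?t) \<otimes> v) \<otimes> inv ?t" by simp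
            moreover have "v \<in> carrier H" using v B_sub by auto
            ultimately show "u \<otimes> (?t \<otimes> v \<otimes> inv ?t) = ?t \<otimes> v \<otimes> inv ?t \<otimes> u"
              using ta uc by (simp add: group_normalize)
          qed
        next
          assume neg: "\<forall>b\<in>E. real_of_int (\<Sum>i<n. a i * b i) \<ge> nm n a"
          have cb: "Comm (inv (tpow H x n b) \<otimes> ?t)" if "b \<in> E" for b
          proof -
            note il = inv_list_props[OF over_clist, of b]
            have dil: "disp (inv_list w) j = - disp w j" for w j
              by (induction w) (auto simp: inv_list_def ldisp_def)
            have "Comm (val (inv_list (clist n b) @ clist n a @ []))"
            proof (rule Comm_extend[OF J a(1) am m])
              have "disp (inv_list (clist n b) @ clist n a @ []) = (\<lambda>i. a i + (- 1) * b i)"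
                using disp_clist_Zn a bZ that by (auto simp: fun_eq_iff dil)
              then show "nsq n (disp (inv_list (clist n b) @ clist n a @ [])) \<le> m" using close[of b "- 1"] neg that by simp
            qed (use Mm bZ that il in auto)
            then show ?thesis using il by (simp add: val_clist)
          qed
          show ?thesis unfolding Comm_def
          proof (intro ballI)
            fix u v assume u: "u \<in> B" and v: "v \<in> B"
            have vc: "v \<in> carrier H" using v B_sub by auto
            have u': "u \<in> generate H (conjs H (tpow H x n ` E) B)" using E[OF EE] u by blast
            show "u \<otimes> (?t \<otimes> v \<otimes> inv ?t) = ?t \<otimes> v \<otimes> inv ?t \<otimes> u"
            proof (rule generate_centralizes[OF cc _ _ u'])
              fix s assume "s \<in> conjs H (tpow H x n ` E) B"
              then obtain b k where bk: "b \<in> E" "k \<in> B" "s = tpow H x n b \<otimes> k \<otimes> inv (tpow H x n b)"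
                by (auto elim: conjsE)
              let ?b = "tpow H x n b"
              have c: "?b \<in> carrier H" "k \<in> carrier H" using bk B_sub x_closed by auto
              let ?w = "inv ?b \<otimes> ?t"
              have "k \<otimes> (?w \<otimes> v \<otimes> inv ?w) = (?w \<otimes> v \<otimes> inv ?w) \<otimes> k"
                using cb[OF bk(1)] v bk(2) by (auto simp: Comm_def)
              then have "?b \<otimes> (k \<otimes> (?w \<otimes> v \<otimes> inv ?w)) \<otimes> inv ?b = ?b \<otimes> ((?w \<otimes> v \<otimes> inv ?w) \<otimes> k) \<otimes> inv ?b" by simp
              then show "s \<otimes> (?t \<otimes> v \<otimes> inv ?t) = (?t \<otimes> v \<otimes> inv ?t) \<otimes> s"
                using c ta vc bk(3) by (simp add: group_normalize)
            qed (use ta vc in auto)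
          qed
        qed
      qed
    qed
  qed
  from this[of "max M (nsq n a)"] a show ?thesis by auto
qed

text \<open>Every word stays in a ball whose radius is its length. Once \<open>Comm\<close> is known
  for all normal forms it therefore holds for all words.\<close>

lemma Comm_generate:
  assumes "\<And>a. a \<in> Zn n \<Longrightarrow> Comm (tpow H x n a)" "g \<in> generate H (x ` {..<n})"
  shows "Comm g"
proof -
  have "generate H (x ` {..<n}) \<subseteq> {val w |w. over w}"
  proof (rule generate_subset_right_closed)
    show "\<one> \<in> {val w |w. over w}" using over_simps(1) val_Nil by (metis (mono_tags) mem_Collect_eq)
    fix y s assume "y \<in> {val w |w. over w}" "s \<in> x ` {..<n}"
    then obtain w i where w: "y = val w" "over w" "i < n" "s = x i" by auto
    have "y \<otimes> s = val (w @ [(i, True)])" "y \<otimes> inv s = val (w @ [(i, False)])"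
      using w x_closed by (auto simp: lval_def)
    moreover have "over (w @ [(i, True)])" "over (w @ [(i, False)])" using w by auto
    ultimately show "y \<otimes> s \<in> {val w |w. over w}" "y \<otimes> inv s \<in> {val w |w. over w}" by blast+
  qed (use x_closed val_closed in auto)
  then obtain w where w: "g = val w" "over w" using assms(2) by blast
  have "nsq n (disp w1) \<le> (int (length w))\<^sup>2" if "w = w1 @ w2" for w1 w2
  proof -
    have "nm n (disp w1) \<le> real (length w)" using nm_disp_le[of n w1] that by simp
    then have "(nm n (disp w1))\<^sup>2 \<le> (real (length w))\<^sup>2" by (simp add: power_mono)
    then have "real_of_int (nsq n (disp w1)) \<le> real_of_int ((int (length w))\<^sup>2)" unfolding nm_sq by simp
    then show ?thesis by linarith
  qed
  then show ?thesis using Comm_word[of "(int (length w))\<^sup>2" w] assms w by blast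
qed

end

text \<open>For fixed \<open>l\<close>, the terms quadratic in \<open>sqrt m\<close> cancel under
  both roots of the third condition, so the roots grow at most like the fourth root of
  \<open>m\<close>.\<close>

lemma reroute_threshold:
  "\<exists>M::int. M \<ge> 0 \<and> (\<forall>m::int. m \<ge> M \<longrightarrow> real l \<le> sqrt m \<and> 1 + (real l)\<^sup>2 \<le> 2 * sqrt (m + 1) \<and>
      2 + sqrt ((sqrt (m + 1) + 2 * l)\<^sup>2 - m) + sqrt (m + 1 - (sqrt m - l)\<^sup>2) + 2 * l \<le> sqrt m)"
proof -
  have "\<forall>\<^sub>F m::real in at_top. real l \<le> sqrt m \<and> 1 + (real l)\<^sup>2 \<le> 2 * sqrt (m + 1) \<and>
      2 + sqrt ((sqrt (m + 1) + 2 * real l)\<^sup>2 - m) + sqrt (m + 1 - (sqrt m - real l)\<^sup>2) + 2 * real l \<le> sqrt m"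
  \<comment> \<open>For \<open>l = 0\<close> the leading terms under the roots vanish and the
    asymptotic expansion is a different one.\<close>
  proof (cases "l = 0")
    case True
    have "\<forall>\<^sub>F m::real in at_top. 2 + sqrt ((sqrt (m + 1))\<^sup>2 - m) + sqrt (m + 1 - (sqrt m)\<^sup>2) \<le> sqrt m" by real_asymp
    moreover have "\<forall>\<^sub>F m::real in at_top. 0 \<le> sqrt m \<and> 1 \<le> 2 * sqrt (m + 1)" by (intro eventually_conj) real_asymp+
    ultimately show ?thesis using True by (auto elim: eventually_elim2)
  next
    case False
    define c where "c = real l"
    have c: "c > 0" using False by (simp add: c_def)
    have "\<forall>\<^sub>F m::real in at_top. 2 + sqrt ((sqrt (m + 1) + 2 * c)\<^sup>2 - m) + sqrt (m + 1 - (sqrt m - c)\<^sup>2) + 2 * c \<le> sqrt m"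
      using c by real_asymp
    moreover have "\<forall>\<^sub>F m::real in at_top. c \<le> sqrt m \<and> 1 + c\<^sup>2 \<le> 2 * sqrt (m + 1)" by (intro eventually_conj) real_asymp+
    ultimately show ?thesis unfolding c_def[symmetric] by (auto elim: eventually_elim2)
  qed
  then obtain M :: real where M: "\<And>m. m \<ge> M \<Longrightarrow> real l \<le> sqrt m \<and> 1 + (real l)\<^sup>2 \<le> 2 * sqrt (m + 1) \<and>
      2 + sqrt ((sqrt (m + 1) + 2 * real l)\<^sup>2 - m) + sqrt (m + 1 - (sqrt m - real l)\<^sup>2) + 2 * real l \<le> sqrt m"
    by (auto simp: eventually_at_top_linorder)
  have MM: "M \<le> real_of_int m" if "max 0 \<lceil>M\<rceil> \<le> m" for m :: int using that by linarith
  show ?thesis using M[OF MM] by (intro exI[of _ "max 0 \<lceil>M\<rceil>"]) auto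
qed

section \<open>Invariant subgroups of modules over a monoid ring\<close>

text \<open>A monotone subsequence that is not nondecreasing is nonincreasing, hence constant from
  the place where it takes its least value.\<close>

lemma nat_nondecreasing_subsequence:
  fixes a :: "nat \<Rightarrow> nat"
  shows "\<exists>r::nat \<Rightarrow> nat. strict_mono r \<and> (\<forall>i j. i \<le> j \<longrightarrow> a (r i) \<le> a (r j))"
proof -
  obtain r :: "nat \<Rightarrow> nat" where r: "strict_mono r" "monoseq (\<lambda>n. a (r n))" using seq_monosub by blast
  show ?thesis
  proof (cases "\<forall>m n. m \<le> n \<longrightarrow> a (r m) \<le> a (r n)")
    case True then show ?thesis using r(1) by (intro exI[of _ r]) simp
  next
    case False
    then have dec: "\<And>m n. m \<le> n \<Longrightarrow> a (r n) \<le> a (r m)" using r(2) unfolding monoseq_def by blast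
    define v where "v = (LEAST v. \<exists>n. v = a (r n))"
    have "\<exists>n. v = a (r n)" unfolding v_def by (rule LeastI_ex) blast
    then obtain n0 where n0: "v = a (r n0)" by blast
    have ge: "v \<le> a (r n)" for n unfolding v_def by (rule Least_le) blast
    have "a (r (n0 + n)) = v" for n using ge[of "n0 + n"] dec[of n0 "n0 + n"] n0 by simp
    moreover have "strict_mono (\<lambda>n. r (n0 + n))" using r(1) by (simp add: strict_mono_def)
    ultimately show ?thesis by (metis order_refl)
  qed
qed

text \<open>Dickson's lemma, stated for a whole ascending subsequence instead of one pair; this is
  the form that survives the induction on the number of coordinates.\<close>

lemma dickson:
  fixes f :: "nat \<Rightarrow> nat list"
  assumes "\<And>i. length (f i) = K"
  shows "\<exists>g::nat \<Rightarrow> nat. strict_mono g \<and> (\<forall>i j. i \<le> j \<longrightarrow> list_all2 (\<le>) (f (g i)) (f (g j)))"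
  using assms
proof (induction K arbitrary: f)
  case 0
  then show ?case by (intro exI[of _ id]) (auto simp: strict_mono_def)
next
  case (Suc K)
  have "length (tl (f i)) = K" for i using Suc.prems[of i] by simp
  then obtain g :: "nat \<Rightarrow> nat" where g: "strict_mono g" "\<And>i j. i \<le> j \<Longrightarrow> list_all2 (\<le>) (tl (f (g i))) (tl (f (g j)))"
    using Suc.IH[of "\<lambda>i. tl (f i)"] by metis
  obtain r :: "nat \<Rightarrow> nat" where r: "strict_mono r" "\<And>i j. i \<le> j \<Longrightarrow> hd (f (g (r i))) \<le> hd (f (g (r j)))"
    using nat_nondecreasing_subsequence[of "\<lambda>i. hd (f (g i))"] by metis
  have "list_all2 (\<le>) (f (g (r i))) (f (g (r j)))" if "i \<le> j" for i j
  proof -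
    have "r i \<le> r j" using r(1) that by (simp add: strict_mono_less_eq)
    moreover have "f k = hd (f k) # tl (f k)" for k using Suc.prems[of k] by (cases "f k") auto
    ultimately show ?thesis using r(2)[OF that] g(2) by (metis list.rel_intros(2))
  qed
  moreover have "strict_mono (\<lambda>i. g (r i))" using g(1) r(1) by (simp add: strict_mono_def)
  ultimately show ?case by (intro exI[of _ "\<lambda>i. g (r i)"]) simp
qed

text \<open>Without a finite basis, repeatedly picking an element of \<open>I\<close> that lies
  above none of the earlier choices would give a sequence with no good pair.\<close>

lemma finite_basis_if_good:
  assumes good: "\<And>s::nat \<Rightarrow> 'x. (\<And>i. s i \<in> I) \<Longrightarrow> \<exists>i j. i < j \<and> R (s i) (s j)"
  shows "\<exists>B. finite B \<and> B \<subseteq> I \<and> (\<forall>x\<in>I. \<exists>b\<in>B. R b x)"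
proof (rule ccontr)
  assume "\<not> ?thesis"
  then have ex: "\<exists>x. x \<in> I \<and> (\<forall>b\<in>B. \<not> R b x)" if "finite B" "B \<subseteq> I" for B using that by auto
  define pick where "pick B = (SOME x. x \<in> I \<and> (\<forall>b\<in>B. \<not> R b x))" for B
  have pick: "pick B \<in> I \<and> (\<forall>b\<in>B. \<not> R b (pick B))" if "finite B" "B \<subseteq> I" for B
    unfolding pick_def using someI_ex[OF ex[OF that]] .
  define S where "S = rec_nat {} (\<lambda>_ S. insert (pick S) S)"
  have S: "S 0 = {}" "S (Suc n) = insert (pick (S n)) (S n)" for n by (simp_all add: S_def)
  have fin: "finite (S n) \<and> S n \<subseteq> I" for n by (induction n) (use S pick in auto)
  have mem: "pick (S i) \<in> S n" if "i < n" for i n using that by (induction n) (auto simp: S less_Suc_eq)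
  obtain i j where "i < j" "R (pick (S i)) (pick (S j))" using good[of "\<lambda>i. pick (S i)"] pick fin by blast
  then show False using pick[of "S j"] fin mem by blast
qed

section \<open>Exponent vectors, the monomial order and leading coefficients\<close>

definition madd :: "nat list \<Rightarrow> nat list \<Rightarrow> nat list" where
  "madd m m' = map2 (+) m m'"

lemma length_madd [simp]: "length m = k \<Longrightarrow> length m' = k \<Longrightarrow> length (madd m m') = k"
  by (simp add: madd_def)

lemma madd_simps [simp]: "madd [] [] = []" "madd (x # xs) (y # ys) = (x + y) # madd xs ys"
  by (simp_all add: madd_def)

lemma madd_0: "length m = k \<Longrightarrow> madd m (replicate k 0) = m"
  by (induction m arbitrary: k) auto

lemma madd_lex:
  "length e = length m \<Longrightarrow> length m' = length m \<Longrightarrow> (m', m) \<in> lex less_than \<Longrightarrow> (madd e m', madd e m) \<in> lex less_than"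
proof (induction e arbitrary: m m')
  case (Cons a e)
  then obtain x y xs ys where "m = x # xs" "m' = y # ys" by (metis length_Suc_conv)
  then show ?case using Cons by auto
qed auto

lemma zero_lex: "length m = k \<Longrightarrow> m \<noteq> replicate k 0 \<Longrightarrow> (replicate k 0, m) \<in> lex less_than"
proof (induction m arbitrary: k)
  case (Cons a m)
  then obtain k' where k: "k = Suc k'" "length m = k'" by auto
  then show ?case using Cons by (cases "a = 0") auto
qed auto

lemma lex_trans: "(a, b) \<in> lex less_than \<Longrightarrow> (b, c) \<in> lex less_than \<Longrightarrow> (a, c) \<in> lex less_than"
  by (metis lexord_lex lexord_trans trans_less_than)

lemma lex_linear: "length a = length b \<Longrightarrow> (a, b) \<in> lex less_than \<or> a = b \<or> (b, a) \<in> lex less_than"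
  using lexord_linear[of less_than a b] lexord_lex by (metis less_than_iff linorder_neqE_nat)

lemma list_le_madd:
  "list_all2 (\<le>) m0 m \<Longrightarrow> \<exists>e. length e = length m \<and> m = madd e m0"
proof (induction m0 m rule: list_all2_induct)
  case Nil then show ?case by auto
next
  case (Cons x xs y ys)
  obtain e where e: "length e = length ys" "ys = madd e xs" using Cons.IH by blast
  have "length ((y - x) # e) = length (y # ys)" using e(1) by simp
  moreover have "y # ys = madd ((y - x) # e) (x # xs)" using Cons.hyps e(2) by simp
  ultimately show ?case by blast
qed

definition munit :: "nat \<Rightarrow> nat \<Rightarrow> nat list" where "munit k i = (replicate k 0)[i := 1]"

lemma length_munit [simp]: "length (munit k i) = k" by (simp add: munit_def)

text \<open>Peels one variable off a nonzero exponent; the decreasing sum of entries drives the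
  induction in \<open>act_V_lex\<close>.\<close>

lemma madd_munit:
  assumes "length e = k" "e \<noteq> replicate k 0"
  shows "\<exists>i e'. i < k \<and> length e' = k \<and> e = madd (munit k i) e' \<and> sum_list e' < sum_list e"
proof -
  obtain i where i: "i < k" "e ! i > 0" using assms by (metis gr0I length_replicate nth_equalityI nth_replicate)
  let ?e' = "e[i := e ! i - 1]"
  have "e = madd (munit k i) ?e'"
    by (rule nth_equalityI) (use assms i in \<open>auto simp: madd_def munit_def nth_list_update\<close>)
  moreover have "sum_list ?e' < sum_list e"
  proof -
    have "e ! i \<le> sum_list e" using elem_le_sum_list[of i e] i assms by simp
    then show ?thesis using i assms by (simp add: sum_list_update)
  qed
  ultimately show ?thesis using i assms by (intro exI[of _ i] exI[of _ ?e']) auto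
qed

text \<open>The monoid \<open>\<nat>\<^sup>k\<close> acts on \<open>A\<close> through \<open>act\<close>, exponent vectors being lists of length \<open>k\<close>. The subgroup \<open>V\<close> plays
  the role of the ring of constants: a variable maps it into \<open>V\<close> up to finitely many new monomials.
  Below, \<open>L i\<close> is the group of leading coefficients at the monomial \<open>i\<close> and \<open>\<delta> i\<close> its nonnegative generator.\<close>

locale monomial_module = comm_group A for A (structure) +
  fixes k :: nat and act :: "nat list \<Rightarrow> 'a \<Rightarrow> 'a" and V :: "'a set" and fs :: "'a list" and D :: "'a set"
  assumes act_hom: "\<And>m. length m = k \<Longrightarrow> act m \<in> hom A A"
    and act_madd: "\<And>m m' x. length m = k \<Longrightarrow> length m' = k \<Longrightarrow> x \<in> carrier A \<Longrightarrow> act (madd m m') x = act m (act m' x)"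
    and act_0: "\<And>x. x \<in> carrier A \<Longrightarrow> act (replicate k 0) x = x"
    and V: "subgroup V A" and fs: "set fs \<subseteq> V"
    and act_V: "\<And>i v. i < k \<Longrightarrow> v \<in> V \<Longrightarrow> act (munit k i) v \<in> generate A (V \<union> act (munit k i) ` set fs)"
    and gen_V: "carrier A = generate A {act m v |m v. length m = k \<and> v \<in> V}"
    and D: "subgroup D A" and act_D: "\<And>m d. length m = k \<Longrightarrow> d \<in> D \<Longrightarrow> act m d \<in> D"
    and DV: "D \<inter> V = {\<one>}"
begin

definition I :: "(nat list \<times> nat) set" where "I = {(m, j). length m = k \<and> j < length fs}"
definition lt :: "((nat list \<times> nat) \<times> (nat list \<times> nat)) set" where "lt = lex less_than <*lex*> less_than"
definition X :: "nat list \<times> nat \<Rightarrow> 'a" where "X i = act (fst i) (fs ! snd i)"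
text \<open>The elements whose leading monomial is smaller than \<open>i\<close>, where all of
  \<open>V\<close> counts as lower than every monomial.\<close>

definition Alt :: "nat list \<times> nat \<Rightarrow> 'a set" where "Alt i = generate A (V \<union> X ` {i' \<in> I. (i', i) \<in> lt})"
definition Ale :: "nat list \<times> nat \<Rightarrow> 'a set" where "Ale i = generate A (V \<union> X ` {i' \<in> I. (i', i) \<in> lt \<or> i' = i})"
definition L :: "nat list \<times> nat \<Rightarrow> int set" where "L i = {c. \<exists>d\<in>D. \<exists>a\<in>Alt i. d = X i [^] c \<otimes> a}"
definition \<delta> :: "nat list \<times> nat \<Rightarrow> nat" where
  "\<delta> i = (if \<exists>c::nat. c > 0 \<and> int c \<in> L i then (LEAST c::nat. c > 0 \<and> int c \<in> L i) else 0)"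

lemma wf_lt: "wf lt" unfolding lt_def by (intro wf_lex_prod wf_lex wf_less_than)

lemma lt_trans: "(a, b) \<in> lt \<Longrightarrow> (b, c) \<in> lt \<Longrightarrow> (a, c) \<in> lt"
  unfolding lt_def by (cases a; cases b; cases c) (auto intro: lex_trans)

lemma lt_linear: "a \<in> I \<Longrightarrow> b \<in> I \<Longrightarrow> (a, b) \<in> lt \<or> a = b \<or> (b, a) \<in> lt"
proof (cases a; cases b)
  fix m j m' j' assume ab: "a \<in> I" "b \<in> I" "a = (m, j)" "b = (m', j')"
  then have "(m, m') \<in> lex less_than \<or> m = m' \<or> (m', m) \<in> lex less_than" by (intro lex_linear) (auto simp: I_def)
  then show ?thesis using ab by (auto simp: lt_def)
qed

lemma V_carrier: "v \<in> V \<Longrightarrow> v \<in> carrier A" using V subgroup.mem_carrier by metis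
lemma D_carrier: "v \<in> D \<Longrightarrow> v \<in> carrier A" using D subgroup.mem_carrier by metis

lemma act_closed: "length m = k \<Longrightarrow> x \<in> carrier A \<Longrightarrow> act m x \<in> carrier A"
  using act_hom hom_in_carrier by metis

lemma X_closed: "i \<in> I \<Longrightarrow> X i \<in> carrier A"
  unfolding X_def I_def using act_closed V_carrier fs nth_mem by fastforce

lemma gens_closed: "J \<subseteq> I \<Longrightarrow> V \<union> X ` J \<subseteq> carrier A" using X_closed V_carrier by auto

lemma Alt_subgroup: "subgroup (Alt i) A" and Ale_subgroup: "subgroup (Ale i) A"
  unfolding Alt_def Ale_def by (intro generate_is_subgroup gens_closed; auto)+

lemma V_sub_Alt: "V \<subseteq> Alt i" unfolding Alt_def by (auto intro: generate.incl)

lemma Ale_mono: "(i, j) \<in> lt \<or> i = j \<Longrightarrow> Ale i \<subseteq> Ale j"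
  unfolding Ale_def by (rule mono_generate) (auto intro: lt_trans)

text \<open>The groups \<open>Ale i\<close> form a chain because \<open>lt\<close> is total on
  \<open>I\<close>. So the finitely many groups needed for one element are contained in one of them,
  and the element has a leading index unless it lies in \<open>V\<close>.\<close>

lemma generate_chain:
  assumes "J \<subseteq> I" "x \<in> generate A (V \<union> X ` J)"
  shows "x \<in> V \<or> (\<exists>i\<in>J. x \<in> Ale i)"
  using assms(2)
proof induction
  case one then show ?case using V subgroup.one_closed by blast
next
  case (incl h)
  then show ?case unfolding Ale_def using assms(1) by (auto intro!: generate.incl)
next
  case (inv h)
  then show ?case unfolding Ale_def using assms(1) V by (auto intro!: generate.inv simp: subgroup.m_inv_closed)
next
  case (eng h1 h2)
  have VA: "V \<subseteq> Ale i" for i unfolding Ale_def by (auto intro: generate.incl)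
  have m: "h1 \<otimes> h2 \<in> Ale i" if "h1 \<in> Ale i" "h2 \<in> Ale i" for i
    using that Ale_subgroup subgroup.m_closed by metis
  from eng consider "h1 \<in> V" "h2 \<in> V" | i where "i \<in> J" "h1 \<in> V" "h2 \<in> Ale i" | i where "i \<in> J" "h1 \<in> Ale i" "h2 \<in> V"
    | i j where "i \<in> J" "j \<in> J" "h1 \<in> Ale i" "h2 \<in> Ale j" by blast
  then show ?case
  proof cases
    case 1 then show ?thesis using V subgroup.m_closed by metis
  next
    case 2 then show ?thesis using VA m by blast
  next
    case 3 then show ?thesis using VA m by blast
  next
    case 4
    then have "Ale i \<subseteq> Ale j \<or> Ale j \<subseteq> Ale i" using lt_linear[of i j] assms(1) Ale_mono by blast
    then show ?thesis using 4 m by blast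
  qed
qed

lemma Ale_decompose:
  assumes "i \<in> I" "d \<in> Ale i"
  shows "\<exists>c::int. \<exists>a\<in>Alt i. d = X i [^] c \<otimes> a"
  using assms(2) unfolding Ale_def
proof induction
  case one
  show ?case using Alt_subgroup[of i] subgroup.one_closed by (intro exI[of _ 0] bexI[of _ \<one>]) auto
next
  case (incl h)
  show ?case
  proof (cases "h = X i")
    case True
    then show ?thesis using Alt_subgroup[of i] subgroup.one_closed X_closed[OF assms(1)]
      by (intro exI[of _ 1] bexI[of _ \<one>]) auto
  next
    case False
    then have "h \<in> Alt i" using incl unfolding Alt_def by (auto intro: generate.incl)
    then show ?thesis using subgroup.mem_carrier[OF Alt_subgroup[of i]] by (intro exI[of _ 0] bexI[of _ h]) auto
  qed
next
  case (inv h)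
  show ?case
  proof (cases "h = X i")
    case True
    then show ?thesis using Alt_subgroup[of i] subgroup.one_closed X_closed[OF assms(1)]
      by (intro exI[of _ "- 1"] bexI[of _ \<one>]) (auto simp: int_pow_neg)
  next
    case False
    then have "inv h \<in> Alt i" using inv unfolding Alt_def by (auto intro: generate.inv)
    then show ?thesis using subgroup.mem_carrier[OF Alt_subgroup[of i]] by (intro exI[of _ 0] bexI[of _ "inv h"]) auto
  qed
next
  case (eng h1 h2)
  then obtain c1 a1 c2 a2 where *: "a1 \<in> Alt i" "h1 = X i [^] (c1::int) \<otimes> a1" "a2 \<in> Alt i" "h2 = X i [^] (c2::int) \<otimes> a2" by blast
  have cl: "a1 \<in> carrier A" "a2 \<in> carrier A" "X i \<in> carrier A"
    using * subgroup.mem_carrier[OF Alt_subgroup[of i]] X_closed[OF assms(1)] by auto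
  then have "h1 \<otimes> h2 = X i [^] (c1 + c2) \<otimes> (a1 \<otimes> a2)" using * by (simp add: int_pow_mult m_ac)
  then show ?case using * subgroup.m_closed[OF Alt_subgroup[of i]] by blast
qed

lemma L_diff: "i \<in> I \<Longrightarrow> c \<in> L i \<Longrightarrow> c' \<in> L i \<Longrightarrow> c - c' \<in> L i"
proof -
  assume i: "i \<in> I" and "c \<in> L i" "c' \<in> L i"
  then obtain d a d' a' where *: "d \<in> D" "a \<in> Alt i" "d = X i [^] c \<otimes> a" "d' \<in> D" "a' \<in> Alt i" "d' = X i [^] c' \<otimes> a'"
    unfolding L_def by blast
  have cl: "a \<in> carrier A" "a' \<in> carrier A" "X i \<in> carrier A"
    using * subgroup.mem_carrier[OF Alt_subgroup[of i]] X_closed[OF i] by auto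
  then have "d \<otimes> inv d' = X i [^] (c - c') \<otimes> (a \<otimes> inv a')"
    using * by (simp add: int_pow_diff inv_mult m_ac)
  moreover have "d \<otimes> inv d' \<in> D" "a \<otimes> inv a' \<in> Alt i"
    using * D Alt_subgroup[of i] by (simp_all add: subgroup.m_closed subgroup.m_inv_closed)
  ultimately show ?thesis unfolding L_def by blast
qed

lemma L_0: "i \<in> I \<Longrightarrow> 0 \<in> L i"
proof -
  assume i: "i \<in> I"
  have "\<one> = X i [^] (0::int) \<otimes> \<one>" using X_closed[OF i] by simp
  then show ?thesis using subgroup.one_closed[OF D] subgroup.one_closed[OF Alt_subgroup[of i]] unfolding L_def by blast
qed

text \<open>\<open>L i\<close> is a group of integers, so division with remainder by its least
  positive element applies; the value 0 stands for the trivial group.\<close>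

lemma \<delta>_dvd:
  assumes i: "i \<in> I" and c: "c \<in> L i"
  shows "int (\<delta> i) dvd c"
proof -
  have um: "- x \<in> L i" if "x \<in> L i" for x using L_diff[OF i L_0[OF i] that] by simp
  have ad: "x + y \<in> L i" if "x \<in> L i" "y \<in> L i" for x y using L_diff[OF i that(1) um[OF that(2)]] by simp
  have natmul: "int q * x \<in> L i" if "x \<in> L i" for q x
    by (induction q) (use ad that L_0[OF i] in \<open>auto simp: algebra_simps\<close>)
  have mul: "q * x \<in> L i" if "x \<in> L i" for q x
  proof (cases "q \<ge> 0")
    case True then show ?thesis using natmul[OF that, of "nat q"] by simp
  next
    case False then show ?thesis using um[OF natmul[OF that, of "nat (- q)"]] by simp
  qed
  show ?thesis
  proof (cases "\<exists>c::nat. c > 0 \<and> int c \<in> L i")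
    case False
    have "c = 0"
    proof (rule ccontr)
      assume "c \<noteq> 0"
      then have "int (nat \<bar>c\<bar>) \<in> L i \<and> nat \<bar>c\<bar> > 0" using c um[OF c] by (cases "c \<ge> 0") auto
      then show False using False by blast
    qed
    then show ?thesis by simp
  next
    case True
    then have d: "\<delta> i > 0 \<and> int (\<delta> i) \<in> L i" unfolding \<delta>_def using LeastI_ex[OF True] by simp
    have least: "\<delta> i \<le> c'" if "c' > 0" "int c' \<in> L i" for c'
      unfolding \<delta>_def using that True by (simp add: Least_le)
    have "c mod int (\<delta> i) \<in> L i"
      using L_diff[OF i c mul[OF conjunct2[OF d], of "c div int (\<delta> i)"]] by (simp add: minus_div_mult_eq_mod)
    moreover have "0 \<le> c mod int (\<delta> i)" "c mod int (\<delta> i) < int (\<delta> i)" using d by auto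
    ultimately have "c mod int (\<delta> i) = 0" using least[of "nat (c mod int (\<delta> i))"]
      by (metis int_nat_eq linorder_not_less nat_less_iff of_nat_0_less_iff order_le_less)
    then show ?thesis by auto
  qed
qed

lemma \<delta>_least: "c > 0 \<Longrightarrow> int c \<in> L i \<Longrightarrow> 0 < \<delta> i \<and> \<delta> i \<le> c"
proof -
  assume c: "c > 0" "int c \<in> L i"
  then have ex: "\<exists>c::nat. c > 0 \<and> int c \<in> L i" by blast
  show ?thesis unfolding \<delta>_def using ex LeastI_ex[OF ex] c by (simp add: Least_le)
qed

lemma \<delta>_in_L: "\<delta> i > 0 \<Longrightarrow> int (\<delta> i) \<in> L i"
proof -
  assume "\<delta> i > 0"
  then have ex: "\<exists>c::nat. c > 0 \<and> int c \<in> L i" unfolding \<delta>_def by presburger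
  show ?thesis unfolding \<delta>_def using LeastI_ex[OF ex] ex by simp
qed

lemma act_generate:
  assumes "length e = k" "S \<subseteq> carrier A" "x \<in> generate A S" "subgroup K A" "\<And>s. s \<in> S \<Longrightarrow> act e s \<in> K"
  shows "act e x \<in> K"
  using assms(3)
proof induction
  case one then show ?case using act_hom[OF assms(1)] assms(4) hom_one subgroup.one_closed
    by (metis is_group)
next
  case (incl h) then show ?case using assms by blast
next
  case (inv h)
  interpret h: group_hom A A "act e" using act_hom[OF assms(1)] by unfold_locales
  show ?case using inv assms by (metis h.hom_inv subgroup.m_inv_closed subsetD)
next
  case (eng h1 h2)
  then have "h1 \<in> carrier A" "h2 \<in> carrier A" using generate_in_carrier[OF assms(2)] by auto
  then show ?case using eng act_hom[OF assms(1)] hom_mult subgroup.m_closed[OF assms(4)] by metis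
qed

lemma act_X: "length e = k \<Longrightarrow> (m, j) \<in> I \<Longrightarrow> act e (X (m, j)) = X (madd e m, j)"
proof -
  assume a: "length e = k" "(m, j) \<in> I"
  then have "fs ! j \<in> set fs" "length m = k" by (auto simp: I_def)
  then have "fs ! j \<in> carrier A" "length m = k" using V_carrier fs by blast+
  then show ?thesis using a act_madd by (simp add: X_def)
qed

text \<open>Variables are applied one at a time. By \<open>act_V\<close>, each of them returns
  \<open>V\<close> to \<open>V\<close> up to monomials of that single variable and shifts the
  monomials already present; no exponent above \<open>e\<close> appears.\<close>

lemma act_V_lex:
  assumes "length e = k" "v \<in> V"
  shows "act e v \<in> generate A (V \<union> X ` {i \<in> I. fst i = e \<or> (fst i, e) \<in> lex less_than})"
  using assms
proof (induction "sum_list e" arbitrary: e v rule: less_induct)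
  case less
  show ?case
  proof (cases "e = replicate k 0")
    case True
    then show ?thesis using act_0 V_carrier less by (auto intro: generate.incl)
  next
    case False
    then obtain i e' where i: "i < k" "length e' = k" "e = madd (munit k i) e'" "sum_list e' < sum_list e"
      using madd_munit less by metis
    let ?J = "\<lambda>e. {i \<in> I. fst i = e \<or> (fst i, e) \<in> lex less_than}"
    have IH: "act e' v \<in> generate A (V \<union> X ` ?J e')" using less i by blast
    have sg: "subgroup (generate A (V \<union> X ` ?J e)) A" by (intro generate_is_subgroup gens_closed) auto
    have eq: "act e v = act (munit k i) (act e' v)" using act_madd i V_carrier less by simp
    show ?thesis unfolding eq
    proof (rule act_generate[OF _ _ IH sg])
      fix s assume "s \<in> V \<union> X ` ?J e'"
      then show "act (munit k i) s \<in> generate A (V \<union> X ` ?J e)"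
      proof
        assume "s \<in> V"
        then have "act (munit k i) s \<in> generate A (V \<union> act (munit k i) ` set fs)" using act_V i by blast
        moreover have "V \<union> act (munit k i) ` set fs \<subseteq> V \<union> X ` ?J e"
        proof -
          have "munit k i = e \<or> (munit k i, e) \<in> lex less_than"
            using madd_lex[of "munit k i" e' "replicate k 0"] zero_lex[of e' k] madd_0[of "munit k i" k] i by (metis length_munit length_replicate)
          then have "act (munit k i) f \<in> X ` ?J e" if "f \<in> set fs" for f
            using that unfolding X_def I_def in_set_conv_nth by (auto intro!: image_eqI[of _ _ "(munit k i, _)"])
          then show ?thesis by blast
        qed
        ultimately show ?thesis using mono_generate by blast
      next
        assume "s \<in> X ` ?J e'"
        then obtain m j where mj: "(m, j) \<in> I" "m = e' \<or> (m, e') \<in> lex less_than" "s = X (m, j)" by auto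
        then have "act (munit k i) s = X (madd (munit k i) m, j)" using act_X by simp
        moreover have "(madd (munit k i) m, j) \<in> ?J e"
          using mj i madd_lex[of "munit k i" e' m] by (auto simp: I_def)
        ultimately show ?thesis by (auto intro: generate.incl)
      qed
    qed (use gens_closed in auto)
  qed
qed

text \<open>The action shifts monomials compatibly with the order, but it also lifts
  \<open>V\<close> up to exponent \<open>e\<close>. This stays below \<open>madd e m\<close> only if
  \<open>m\<close> is nonzero, which is why exponent 0 is excluded.\<close>

lemma act_Alt:
  assumes "length e = k" "(m, j) \<in> I" "m \<noteq> replicate k 0" "x \<in> Alt (m, j)"
  shows "act e x \<in> Alt (madd e m, j)"
proof (rule act_generate[OF assms(1) _ assms(4)[unfolded Alt_def] Alt_subgroup])
  fix s assume "s \<in> V \<union> X ` {i' \<in> I. (i', (m, j)) \<in> lt}"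
  then show "act e s \<in> Alt (madd e m, j)"
  proof
    assume "s \<in> V"
    then have "act e s \<in> generate A (V \<union> X ` {i \<in> I. fst i = e \<or> (fst i, e) \<in> lex less_than})"
      using act_V_lex assms by blast
    moreover have "(e, madd e m) \<in> lex less_than"
      using madd_lex[of e m "replicate k 0"] zero_lex[of m k] madd_0[of e k] assms by (auto simp: I_def)
    then have "(i, (madd e m, j)) \<in> lt" if "fst i = e \<or> (fst i, e) \<in> lex less_than" for i
      using that lex_trans unfolding lt_def by (cases i) auto
    then have "V \<union> X ` {i \<in> I. fst i = e \<or> (fst i, e) \<in> lex less_than} \<subseteq> V \<union> X ` {i' \<in> I. (i', (madd e m, j)) \<in> lt}"
      by blast
    ultimately show ?thesis unfolding Alt_def using mono_generate by blast
  next
    assume "s \<in> X ` {i' \<in> I. (i', (m, j)) \<in> lt}"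
    then obtain m' j' where mj: "(m', j') \<in> I" "((m', j'), (m, j)) \<in> lt" "s = X (m', j')" by auto
    then have "((madd e m', j'), (madd e m, j)) \<in> lt" using madd_lex[of e m m'] assms by (auto simp: lt_def I_def)
    moreover have "(madd e m', j') \<in> I" using mj assms by (auto simp: I_def)
    ultimately show ?thesis using mj act_X[OF assms(1) mj(1)] unfolding Alt_def by (auto intro: generate.incl)
  qed
qed (use gens_closed in auto)

text \<open>Since \<open>D\<close> is invariant, multiplying an element of \<open>D\<close> by a
  monomial shifts its leading term and keeps the coefficient.\<close>

lemma L_mono:
  assumes "length e = k" "(m, j) \<in> I" "m \<noteq> replicate k 0"
  shows "L (m, j) \<subseteq> L (madd e m, j)"
proof
  fix c assume "c \<in> L (m, j)"
  then obtain d a where *: "d \<in> D" "a \<in> Alt (m, j)" "d = X (m, j) [^] c \<otimes> a" unfolding L_def by blast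
  interpret h: group_hom A A "act e" using act_hom[OF assms(1)] by unfold_locales
  have "a \<in> carrier A" using * subgroup.mem_carrier[OF Alt_subgroup] by blast
  then have "act e d = X (madd e m, j) [^] c \<otimes> act e a"
    using * act_X[OF assms(1,2)] X_closed[OF assms(2)] by (simp add: h.hom_int_pow)
  then show "c \<in> L (madd e m, j)" unfolding L_def using act_D[OF assms(1) *(1)] act_Alt[OF assms *(2)] by blast
qed

text \<open>A Groebner basis. By Dickson's lemma, every monomial of nonzero exponent is a multiple
  of one of finitely many, with the same index in \<open>fs\<close> and the same
  \<open>\<delta>\<close>. Dividing leading terms by the corresponding elements of \<open>D\<close>
  ends in \<open>D \<inter> V\<close>, which is trivial.\<close>

theorem invariant_subgroup_finitely_generated:
  "\<exists>E. finite E \<and> E \<subseteq> D \<and> D = generate A {act m e |m e. length m = k \<and> e \<in> E}"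
proof -
  let ?I = "{i \<in> I. fst i \<noteq> replicate k 0}"
  define R where "R b i \<longleftrightarrow> snd b = snd i \<and> list_all2 (\<le>) (fst b) (fst i) \<and> \<delta> b = \<delta> i" for b i :: "nat list \<times> nat"
  have "\<exists>B. finite B \<and> B \<subseteq> ?I \<and> (\<forall>i\<in>?I. \<exists>b\<in>B. R b i)"
  proof (rule finite_basis_if_good)
    fix s :: "nat \<Rightarrow> nat list \<times> nat" assume s: "\<And>i. s i \<in> ?I"
    \<comment> \<open>An index and its complement to the length of \<open>fs\<close> can both grow
      only if they are equal; in the same way the two indicators force \<open>\<delta>\<close> to
      vanish at both places or at neither.\<close>
    define f where "f i = [snd (s i), length fs - snd (s i), \<delta> (s i), (if \<delta> (s i) = 0 then 0 else 1), (if \<delta> (s i) = 0 then 1 else 0)] @ fst (s i)" for i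
    have fl: "length (f i) = k + 5" for i using s[of i] by (auto simp: f_def I_def)
    obtain g :: "nat \<Rightarrow> nat" where g: "strict_mono g" "\<And>i j. i \<le> j \<Longrightarrow> list_all2 (\<le>) (f (g i)) (f (g j))"
      using dickson[of f, OF fl] by metis
    let ?a = "s (g 0)" and ?b = "s (g 1)"
    have le: "list_all2 (\<le>) (f (g 0)) (f (g 1))" using g by simp
    have ai: "?a \<in> ?I" "?b \<in> ?I" using s by auto
    then have js: "snd ?a < length fs" "snd ?b < length fs" by (auto simp: I_def)
    have 1: "snd ?a = snd ?b" "list_all2 (\<le>) (fst ?a) (fst ?b)" "\<delta> ?a \<le> \<delta> ?b" "\<delta> ?a = 0 \<longleftrightarrow> \<delta> ?b = 0"
    proof -
      have h: "snd ?a \<le> snd ?b" "length fs - snd ?a \<le> length fs - snd ?b" "\<delta> ?a \<le> \<delta> ?b"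
        "(if \<delta> ?a = 0 then 0 else 1::nat) \<le> (if \<delta> ?b = 0 then 0 else 1)"
        "(if \<delta> ?a = 0 then 1 else 0::nat) \<le> (if \<delta> ?b = 0 then 1 else 0)" "list_all2 (\<le>) (fst ?a) (fst ?b)"
        using le unfolding f_def by simp_all
      show "snd ?a = snd ?b" using h(1,2) js by linarith
      show "list_all2 (\<le>) (fst ?a) (fst ?b)" "\<delta> ?a \<le> \<delta> ?b" using h by blast+
      show "\<delta> ?a = 0 \<longleftrightarrow> \<delta> ?b = 0" using h(4,5) by presburger
    qed
    obtain e where e: "length e = length (fst ?b)" "fst ?b = madd e (fst ?a)" using list_le_madd 1 by blast
    have "length e = k" "(fst ?a, snd ?a) \<in> I" "fst ?a \<noteq> replicate k 0" using ai e(1) by (auto simp: I_def)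
    then have "L (fst ?a, snd ?a) \<subseteq> L (madd e (fst ?a), snd ?a)" by (rule L_mono)
    then have LL: "L ?a \<subseteq> L ?b" using e 1 by (metis prod.collapse)
    \<comment> \<open>Dickson's lemma gives one inequality. For positive \<open>\<delta>\<close> the
      inclusion of the leading coefficient groups gives the other.\<close>
    have "\<delta> ?a = \<delta> ?b"
    proof (cases "\<delta> ?a = 0")
      case True then show ?thesis using 1 by simp
    next
      case False
      then show ?thesis using \<delta>_least[of "\<delta> ?a" ?b] \<delta>_in_L[of ?a] LL 1 by auto
    qed
    moreover have "g 0 < g 1" using g(1) by (simp add: strict_mono_def)
    ultimately show "\<exists>i j. i < j \<and> R (s i) (s j)" using 1 unfolding R_def by blast
  qed
  then obtain B where B: "finite B" "B \<subseteq> ?I" "\<And>i. i \<in> ?I \<Longrightarrow> \<exists>b\<in>B. R b i" by blast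
  have "\<forall>b. \<exists>d a. \<delta> b > 0 \<longrightarrow> d \<in> D \<and> a \<in> Alt b \<and> d = X b [^] int (\<delta> b) \<otimes> a"
    using \<delta>_in_L unfolding L_def by blast
  then obtain ed ea where ed: "\<And>b. \<delta> b > 0 \<Longrightarrow> ed b \<in> D \<and> ea b \<in> Alt b \<and> ed b = X b [^] int (\<delta> b) \<otimes> ea b" by metis
  let ?E = "ed ` {b \<in> B. \<delta> b > 0}"
  let ?S = "{act m e |m e. length m = k \<and> e \<in> ?E}"
  let ?W = "generate A ?S"
  have SD: "?S \<subseteq> D" using ed act_D by blast
  have Sc: "?S \<subseteq> carrier A" using SD D_carrier by blast
  have W: "subgroup ?W A" using generate_is_subgroup[OF Sc] .
  have WD: "?W \<subseteq> D" using generate_subgroup_incl[OF SD D] .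
  \<comment> \<open>One division step: an element of \<open>?W\<close> removes the leading
    term.\<close>
  have red: "\<exists>w\<in>?W. d \<otimes> inv w \<in> Alt i" if i: "i \<in> I" "d \<in> D" "d \<in> Ale i" for i d
  proof -
    obtain c a where ca: "a \<in> Alt i" "d = X i [^] (c::int) \<otimes> a" using Ale_decompose i by blast
    have acl: "a \<in> carrier A" using ca subgroup.mem_carrier[OF Alt_subgroup] by blast
    note dc = D_carrier[OF i(2)]
    show ?thesis
    proof (cases "fst i = replicate k 0")
      \<comment> \<open>At exponent 0 the monomial is a member of \<open>fs\<close> and already lies
        in \<open>V\<close>, so there is nothing to divide.\<close>
      case True
      then have "X i \<in> V" using i fs unfolding X_def I_def
        by (metis (no_types, lifting) V_carrier act_0 case_prod_unfold mem_Collect_eq nth_mem subsetD)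
      then have "X i \<in> Alt i" using V_sub_Alt by blast
      then have "X i [^] c \<in> Alt i" using Alt_subgroup[of i] by (simp add: subgroup_int_pow_closed)
      then have "d \<in> Alt i" using ca Alt_subgroup[of i] subgroup.m_closed by metis
      then show ?thesis using subgroup.one_closed[OF W] dc by (intro bexI[of _ \<one>]) auto
    next
      case False
      then obtain b where b: "b \<in> B" "R b i" using B i by blast
      have cL: "c \<in> L i" using ca i unfolding L_def by blast
      then have dv: "int (\<delta> i) dvd c" using \<delta>_dvd i by blast
      show ?thesis
      proof (cases "\<delta> i = 0")
        case True
        then have "d = a" using dv ca acl X_closed i by simp
        then show ?thesis using ca acl subgroup.one_closed[OF W] by (intro bexI[of _ \<one>]) auto
      next
        case False
        then have db: "\<delta> b > 0" "\<delta> b = \<delta> i" using b by (auto simp: R_def)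
        obtain q where q: "c = int (\<delta> i) * q" using dv by blast
        obtain e where e: "length e = length (fst i)" "fst i = madd e (fst b)" using list_le_madd b unfolding R_def by blast
        have ek: "length e = k" using e(1) i(1) by (auto simp: I_def)
        have ib: "i = (madd e (fst b), snd b)" using e b unfolding R_def by (metis prod.collapse)
        have bI: "(fst b, snd b) \<in> I" "fst b \<noteq> replicate k 0" using B b by auto
        interpret h: group_hom A A "act e" using act_hom[OF ek] by unfold_locales
        have ea: "ea b \<in> Alt (fst b, snd b)" "ed b \<in> D" "ed b = X (fst b, snd b) [^] int (\<delta> b) \<otimes> ea b"
          using ed[OF db(1)] unfolding prod.collapse by blast+
        have eac: "ea b \<in> carrier A" using ea subgroup.mem_carrier[OF Alt_subgroup] by blast
        have eA: "act e (ea b) \<in> Alt i" using act_Alt[OF ek bI ea(1)] ib by simp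
        have eAc: "act e (ea b) \<in> carrier A" using eA subgroup.mem_carrier[OF Alt_subgroup] by blast
        have ae: "act e (ed b) = X i [^] int (\<delta> i) \<otimes> act e (ea b)"
        proof -
          have "act e (ed b) = act e (X (fst b, snd b)) [^] int (\<delta> b) \<otimes> act e (ea b)"
            unfolding ea(3) using X_closed[OF bI(1)] eac by (simp add: h.hom_int_pow)
          then show ?thesis using act_X[OF ek bI(1)] ib db(2) by metis
        qed
        let ?w = "act e (ed b) [^] q"
        have "act e (ed b) \<in> ?S" using ek b(1) db(1) by blast
        then have "act e (ed b) \<in> ?W" by (rule generate.incl)
        then have wW: "?w \<in> ?W" using W by (simp add: subgroup_int_pow_closed)
        have Xc: "X i \<in> carrier A" using X_closed i by blast
        have "?w = X i [^] c \<otimes> act e (ea b) [^] q" unfolding ae q using Xc eAc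
          by (simp add: int_pow_distrib int_pow_pow)
        then have "d \<otimes> inv ?w = a \<otimes> inv (act e (ea b) [^] q)"
          using ca acl Xc eAc by (simp add: inv_mult m_ac)
        moreover have "a \<otimes> inv (act e (ea b) [^] q) \<in> Alt i"
          using ca eA Alt_subgroup[of i] by (simp add: subgroup.m_closed subgroup.m_inv_closed subgroup_int_pow_closed)
        ultimately show ?thesis using wW by (intro bexI[of _ ?w]) simp_all
      qed
    qed
  qed
  have main: "d \<in> ?W" if "i \<in> I" "d \<in> D" "d \<in> Ale i" for i d
    using that
  proof (induction i arbitrary: d rule: wf_induct_rule[OF wf_lt])
    case (1 i)
    obtain w where w: "w \<in> ?W" "d \<otimes> inv w \<in> Alt i" using red 1 by blast
    have wD: "w \<in> D" using w WD by blast
    have dw: "d \<otimes> inv w \<in> D" using 1 wD D by (simp add: subgroup.m_closed subgroup.m_inv_closed)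
    have "d \<otimes> inv w \<in> V \<or> (\<exists>i'\<in>{i' \<in> I. (i', i) \<in> lt}. d \<otimes> inv w \<in> Ale i')"
      using generate_chain[of "{i' \<in> I. (i', i) \<in> lt}"] w unfolding Alt_def by auto
    then have "d \<otimes> inv w \<in> ?W"
    proof
      assume "d \<otimes> inv w \<in> V"
      then have "d \<otimes> inv w = \<one>" using dw DV by blast
      then show ?thesis using subgroup.one_closed[OF W] by simp
    qed (use 1 dw in blast)
    then have "d \<otimes> inv w \<otimes> w \<in> ?W" using w(1) by (rule subgroup.m_closed[OF W])
    then show ?case using D_carrier[OF wD] D_carrier[OF 1(3)] by (simp add: m_assoc)
  qed
  have "D \<subseteq> ?W"
  proof
    fix d assume d: "d \<in> D"
    have sg: "subgroup (generate A (V \<union> X ` I)) A" by (intro generate_is_subgroup gens_closed) simp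
    have "{act m v |m v. length m = k \<and> v \<in> V} \<subseteq> generate A (V \<union> X ` I)"
    proof
      fix x assume "x \<in> {act m v |m v. length m = k \<and> v \<in> V}"
      then obtain m v where mv: "length m = k" "v \<in> V" "x = act m v" by blast
      have "V \<union> X ` {i \<in> I. fst i = m \<or> (fst i, m) \<in> lex less_than} \<subseteq> V \<union> X ` I" by blast
      from mono_generate[OF this] show "x \<in> generate A (V \<union> X ` I)" using act_V_lex[OF mv(1,2)] mv(3) by blast
    qed
    then have "generate A {act m v |m v. length m = k \<and> v \<in> V} \<subseteq> generate A (V \<union> X ` I)"
      using sg by (rule generate_subgroup_incl)
    then have "d \<in> generate A (V \<union> X ` I)" using gen_V D_carrier[OF d] by (metis subsetD)
    then have "d \<in> V \<or> (\<exists>i\<in>I. d \<in> Ale i)" using generate_chain by blast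
    then show "d \<in> ?W"
    proof
      assume "d \<in> V"
      then have "d = \<one>" using d DV by blast
      then show ?thesis using subgroup.one_closed[OF W] by simp
    qed (use main d in blast)
  qed
  then have "D = ?W" using WD by blast
  moreover have "finite ?E" "?E \<subseteq> D" using B(1) ed by (simp, blast)
  ultimately show ?thesis by blast
qed

end

section \<open>Presentations by words\<close>

lemma inv_word_simps [simp]:
  "inv_word [] = []" "inv_word (u @ v) = inv_word v @ inv_word u" "inv_word ((x, b) # v) = inv_word v @ [(x, \<not> b)]"
  "inv_word (inv_word w) = w"
proof -
  have "map ((\<lambda>(x, b). (x, \<not> b)) \<circ> (\<lambda>(x, b). (x, \<not> b))) w = w" by (induction w) auto
  then show "inv_word (inv_word w) = w" by (simp add: inv_word_def rev_map)
qed (auto simp: inv_word_def)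

lemma word_over_simps [simp]:
  "word_over S []" "word_over S (u @ v) \<longleftrightarrow> word_over S u \<and> word_over S v"
  "word_over S (y # v) \<longleftrightarrow> fst y \<in> S \<and> word_over S v" "word_over S (inv_word w) \<longleftrightarrow> word_over S w"
proof -
  have "fst ` (\<lambda>x. case x of (x, b) \<Rightarrow> (x, \<not> b)) ` set w = fst ` set w" by force
  then show "word_over S (inv_word w) \<longleftrightarrow> word_over S w" by (simp add: word_over_def inv_word_def)
qed (auto simp: word_over_def)

context group
begin

lemma eval_word_simps [simp]:
  "eval_word G [] = \<one>" "eval_word G ((x, b) # w) = (if b then x else inv x) \<otimes> eval_word G w"
  by (simp_all add: eval_word_def)

lemma eval_word_closed [simp]: "S \<subseteq> carrier G \<Longrightarrow> word_over S w \<Longrightarrow> eval_word G w \<in> carrier G"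
  by (induction w) auto

lemma eval_word_append:
  "S \<subseteq> carrier G \<Longrightarrow> word_over S u \<Longrightarrow> word_over S v \<Longrightarrow> eval_word G (u @ v) = eval_word G u \<otimes> eval_word G v"
proof (induction u)
  case (Cons y u)
  obtain x b where "y = (x, b)" by (cases y)
  moreover have "x \<in> carrier G" using Cons \<open>y = (x, b)\<close> by auto
  ultimately show ?case using Cons eval_word_closed[of S u] eval_word_closed[of S v] by (auto simp: m_assoc)
qed auto

lemma eval_word_inv:
  "S \<subseteq> carrier G \<Longrightarrow> word_over S u \<Longrightarrow> eval_word G (inv_word u) = inv (eval_word G u)"
proof (induction u)
  case (Cons y u)
  obtain x b where y: "y = (x, b)" by (cases y)
  then have "eval_word G (inv_word (y # u)) = eval_word G (inv_word u) \<otimes> eval_word G [(x, \<not> b)]"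
    using Cons by (simp add: eval_word_append[of S])
  moreover have "x \<in> carrier G" using Cons y by auto
  ultimately show ?case using Cons y eval_word_closed[of S u] by (auto simp: inv_mult_group)
qed auto

end

locale words =
  fixes S :: "'a set" and R :: "'a word set"
  assumes R_over: "\<And>r. r \<in> R \<Longrightarrow> word_over S r"
begin

abbreviation NC where "NC \<equiv> normal_closure_words S R"

lemma NC_nil [simp]: "[] \<in> NC" by (rule normal_closure_words.nil)

lemma NC_over: "w \<in> NC \<Longrightarrow> word_over S w"
  by (induction rule: normal_closure_words.induct) (auto simp: R_over)

lemma NC_append: "v \<in> NC \<Longrightarrow> u \<in> NC \<Longrightarrow> u @ v \<in> NC"
proof (induction arbitrary: rule: normal_closure_words.induct)
  case nil then show ?case by simp
next
  case (conj w r x)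
  then show ?case using normal_closure_words.conj[of "u @ w" S R r x] by simp
next
  case (conj_inv w r x)
  then show ?case using normal_closure_words.conj_inv[of "u @ w" S R r x] by simp
next
  case (ins a b x c)
  then show ?case using normal_closure_words.ins[of "u @ a" b S R x c] by simp
next
  case (del a x c b)
  then show ?case using normal_closure_words.del[of "u @ a" x c b S R] by simp
qed

lemma NC_ins_word: "word_over S x \<Longrightarrow> u @ v \<in> NC \<Longrightarrow> u @ x @ inv_word x @ v \<in> NC"
proof (induction x arbitrary: u v)
  case (Cons y x)
  obtain a b where y: "y = (a, b)" by (cases y)
  have "u @ [(a, b), (a, \<not> b)] @ v \<in> NC" using Cons y by (intro normal_closure_words.ins) auto
  then show ?case using Cons.IH[of "u @ [(a, b)]" "[(a, \<not> b)] @ v"] Cons.prems y by simp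
qed simp

lemma NC_del_word: "u @ x @ inv_word x @ v \<in> NC \<Longrightarrow> u @ v \<in> NC"
proof (induction x arbitrary: u v)
  case (Cons y x)
  obtain a b where y: "y = (a, b)" by (cases y)
  have "u @ [(a, b), (a, \<not> b)] @ v \<in> NC" using Cons.IH[of "u @ [(a, b)]" "[(a, \<not> b)] @ v"] Cons.prems y by simp
  then show ?case by (rule normal_closure_words.del)
qed simp

lemma NC_del_word': "u @ inv_word x @ x @ v \<in> NC \<Longrightarrow> u @ v \<in> NC"
  using NC_del_word[of u "inv_word x" v] by simp

lemma NC_conj: "w \<in> NC \<Longrightarrow> word_over S x \<Longrightarrow> x @ w @ inv_word x \<in> NC"
proof (induction rule: normal_closure_words.induct)
  case nil then show ?case using NC_ins_word[of x "[]" "[]"] normal_closure_words.nil by simp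
next
  case (conj w r u)
  then have "(x @ w @ inv_word x) @ (x @ u) @ r @ inv_word (x @ u) \<in> NC" by (intro normal_closure_words.conj) auto
  then show ?case using NC_del_word'[of "x @ w" x "u @ r @ inv_word u @ inv_word x"] by simp
next
  case (conj_inv w r u)
  then have "(x @ w @ inv_word x) @ (x @ u) @ inv_word r @ inv_word (x @ u) \<in> NC" by (intro normal_closure_words.conj_inv) auto
  then show ?case using NC_del_word'[of "x @ w" x "u @ inv_word r @ inv_word u @ inv_word x"] by simp
next
  case (ins a b y c)
  then show ?case using normal_closure_words.ins[of "x @ a" "b @ inv_word x" S R y c] by simp
next
  case (del a y c b)
  then show ?case using normal_closure_words.del[of "x @ a" y c "b @ inv_word x" S R] by simp
qed

lemma NC_inv: "w \<in> NC \<Longrightarrow> inv_word w \<in> NC"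
proof (induction rule: normal_closure_words.induct)
  case nil then show ?case using normal_closure_words.nil by simp
next
  case (conj w r u)
  then show ?case using NC_append[of "inv_word w" "u @ inv_word r @ inv_word u"]
      normal_closure_words.conj_inv[OF normal_closure_words.nil, where r = r and R = R and u = u and S = S] by simp
next
  case (conj_inv w r u)
  then show ?case using NC_append[of "inv_word w" "u @ r @ inv_word u"]
      normal_closure_words.conj[OF normal_closure_words.nil, where r = r and R = R and u = u and S = S] by simp
next
  case (ins a b y c)
  then show ?case using normal_closure_words.ins[of "inv_word b" "inv_word a" S R y c] by simp
next
  case (del a y c b)
  then show ?case using normal_closure_words.del[of "inv_word b" y c "inv_word a" S R] by simp
qed

text \<open>Cosets of the normal closure in the free group, formed without reduced words:
  \<open>NC\<close> is closed under free insertion and deletion, so the quotient of two words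
  decides their equality.\<close>

definition cls :: "'a word \<Rightarrow> 'a word set" where
  "cls w = {v. word_over S v \<and> v @ inv_word w \<in> NC}"

definition PG :: "'a word set monoid" where
  "PG = \<lparr>carrier = cls ` {w. word_over S w}, mult = (\<lambda>A B. cls ((SOME a. a \<in> A) @ (SOME b. b \<in> B))), one = cls []\<rparr>"

lemma cls_self: "word_over S w \<Longrightarrow> w \<in> cls w"
  using NC_ins_word[of w "[]" "[]"] by (simp add: cls_def)

lemma NC_trans: "a @ inv_word b \<in> NC \<Longrightarrow> b @ inv_word c \<in> NC \<Longrightarrow> a @ inv_word c \<in> NC"
  using NC_append[of "b @ inv_word c" "a @ inv_word b"] NC_del_word'[of a b "inv_word c"] by simp

lemma NC_sym: "a @ inv_word b \<in> NC \<Longrightarrow> b @ inv_word a \<in> NC"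
  using NC_inv[of "a @ inv_word b"] by simp

lemma cls_eq_iff: "word_over S u \<Longrightarrow> word_over S v \<Longrightarrow> cls u = cls v \<longleftrightarrow> u @ inv_word v \<in> NC"
proof
  assume "word_over S u" "word_over S v" "cls u = cls v"
  then show "u @ inv_word v \<in> NC" using cls_self[of u] by (simp add: cls_def)
next
  assume "u @ inv_word v \<in> NC"
  then show "cls u = cls v" unfolding cls_def using NC_trans NC_sym by blast
qed

text \<open>Independence of the representatives chosen in \<open>PG\<close>: if \<open>a\<close>
  replaces \<open>u\<close> and \<open>b\<close> replaces \<open>v\<close>, then \<open>a b\<close>
  differs from \<open>u v\<close> by a conjugate of the defect of \<open>b\<close> times the defect
  of \<open>a\<close>.\<close>

lemma mult_cls: "word_over S u \<Longrightarrow> word_over S v \<Longrightarrow> cls u \<otimes>\<^bsub>PG\<^esub> cls v = cls (u @ v)"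
proof -
  assume uv: "word_over S u" "word_over S v"
  define a where "a = (SOME a. a \<in> cls u)"
  define b where "b = (SOME b. b \<in> cls v)"
  have a: "a \<in> cls u" and b: "b \<in> cls v" unfolding a_def b_def using cls_self uv by (metis someI)+
  have "a @ (b @ inv_word v) @ inv_word a \<in> NC" using a b by (intro NC_conj) (auto simp: cls_def)
  then have "(a @ (b @ inv_word v) @ inv_word a) @ (a @ inv_word u) \<in> NC" using a by (intro NC_append[of "a @ inv_word u" "a @ (b @ inv_word v) @ inv_word a"]) (auto simp: cls_def)
  then have "(a @ b) @ inv_word (u @ v) \<in> NC" using NC_del_word'[of "a @ b @ inv_word v" a "inv_word u"] by simp
  then have "cls (a @ b) = cls (u @ v)" using a b uv by (subst cls_eq_iff) (auto simp: cls_def)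
  then show ?thesis by (simp add: PG_def a_def b_def)
qed

lemma carrier_PG: "carrier PG = cls ` {w. word_over S w}" by (simp add: PG_def)

lemma one_PG: "\<one>\<^bsub>PG\<^esub> = cls []" by (simp add: PG_def)

lemma group_PG: "group PG"
proof (rule groupI)
  fix x assume "x \<in> carrier PG"
  then obtain w where w: "x = cls w" "word_over S w" by (auto simp: carrier_PG)
  have "cls (inv_word w) \<otimes>\<^bsub>PG\<^esub> x = cls []"
    using w NC_ins_word[of "inv_word w" "[]" "[]"] by (auto simp: mult_cls cls_eq_iff)
  moreover have "cls (inv_word w) \<in> carrier PG" using w by (auto simp: carrier_PG)
  ultimately show "\<exists>y\<in>carrier PG. y \<otimes>\<^bsub>PG\<^esub> x = \<one>\<^bsub>PG\<^esub>" unfolding one_PG by blast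
  show "\<one>\<^bsub>PG\<^esub> \<otimes>\<^bsub>PG\<^esub> x = x" using w by (simp add: one_PG mult_cls)
next
  fix x y assume "x \<in> carrier PG" "y \<in> carrier PG"
  then show "x \<otimes>\<^bsub>PG\<^esub> y \<in> carrier PG" by (auto simp: carrier_PG mult_cls)
next
  fix x y z assume "x \<in> carrier PG" "y \<in> carrier PG" "z \<in> carrier PG"
  then show "x \<otimes>\<^bsub>PG\<^esub> y \<otimes>\<^bsub>PG\<^esub> z = x \<otimes>\<^bsub>PG\<^esub> (y \<otimes>\<^bsub>PG\<^esub> z)" by (auto simp: carrier_PG mult_cls)
qed (auto simp: carrier_PG one_PG)

lemma inv_cls: "word_over S w \<Longrightarrow> inv\<^bsub>PG\<^esub> (cls w) = cls (inv_word w)"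
proof -
  assume w: "word_over S w"
  interpret group PG by (rule group_PG)
  have "cls (inv_word w) \<otimes>\<^bsub>PG\<^esub> cls w = cls []"
    using w NC_ins_word[of "inv_word w" "[]" "[]"] by (auto simp: mult_cls cls_eq_iff)
  then show ?thesis using w by (intro inv_equality) (auto simp: one_PG carrier_PG)
qed

lemma generate_PG: "generate PG ((\<lambda>x. cls [(x, True)]) ` S) = carrier PG"
proof
  interpret group PG by (rule group_PG)
  have sub: "(\<lambda>x. cls [(x, True)]) ` S \<subseteq> carrier PG" by (auto simp: carrier_PG)
  show "generate PG ((\<lambda>x. cls [(x, True)]) ` S) \<subseteq> carrier PG" using generate_incl[OF sub] .
  have "cls w \<in> generate PG ((\<lambda>x. cls [(x, True)]) ` S)" if "word_over S w" for w
    using that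
  proof (induction w)
    case Nil then show ?case using generate.one[of PG] by (simp add: one_PG)
  next
    case (Cons y w)
    obtain x b where y: "y = (x, b)" by (cases y)
    have "cls [(x, b)] \<in> generate PG ((\<lambda>x. cls [(x, True)]) ` S)"
    proof (cases b)
      case True then show ?thesis using Cons y by (auto intro: generate.incl)
    next
      case False
      then have "cls [(x, b)] = inv\<^bsub>PG\<^esub> (cls [(x, True)])" using Cons y by (simp add: inv_cls)
      then show ?thesis using Cons y by (auto intro: generate.inv)
    qed
    then have "cls [(x, b)] \<otimes>\<^bsub>PG\<^esub> cls w \<in> generate PG ((\<lambda>x. cls [(x, True)]) ` S)" using Cons by (intro generate.eng) auto
    then show ?case using Cons y by (simp add: mult_cls)
  qed
  then show "carrier PG \<subseteq> generate PG ((\<lambda>x. cls [(x, True)]) ` S)" by (auto simp: carrier_PG)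
qed

end

lemma normal_closure_words_mono: "w \<in> normal_closure_words S R \<Longrightarrow> R \<subseteq> R' \<Longrightarrow> w \<in> normal_closure_words S R'"
proof (induction rule: normal_closure_words.induct)
  case (ins u v x b)
  then show ?case by (intro normal_closure_words.ins) auto
qed (auto intro: normal_closure_words.intros)

context group
begin

lemma NC_eval:
  assumes "S \<subseteq> carrier G" "\<And>r. r \<in> R \<Longrightarrow> word_over S r \<and> eval_word G r = \<one>" "w \<in> normal_closure_words S R"
  shows "word_over S w \<and> eval_word G w = \<one>"
  using assms(3)
proof (induction rule: normal_closure_words.induct)
  case (conj w r u)
  then show ?case using assms eval_word_closed[of S u] by (auto simp: eval_word_append[of S] eval_word_inv[of S])
next
  case (conj_inv w r u)
  then show ?case using assms eval_word_closed[of S u] by (auto simp: eval_word_append[of S] eval_word_inv[of S])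
next
  case (ins u v x b)
  then have "u @ v \<in> normal_closure_words S R" "word_over S u" "word_over S v" "x \<in> carrier G" using assms by auto
  then show ?case using ins assms eval_word_closed[of S u] eval_word_closed[of S v]
    by (auto simp: eval_word_append[of S])
next
  case (del u x b v)
  then have "word_over S u" "word_over S v" "x \<in> carrier G" "x \<in> S" using assms by auto
  then show ?case using del assms eval_word_closed[of S u] eval_word_closed[of S v]
    by (cases b) (auto simp: eval_word_append[of S])
qed auto

text \<open>\<open>crit\<close> is applied to the group presented by all relators of length at most
  3; among these the triangles \<open>x y inv (x y)\<close> yield the partial multiplicativity of
  \<open>s\<close>. Finitely many further relators have a common length bound, so adding them keeps
  the relators bounded. The type of \<open>H\<close> is that of classes of words.\<close>

theorem compactly_presentable_if_kernel_finitely_generated: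
  assumes S: "S \<subseteq> carrier G" "compactin T S" "generate G S = carrier G"
    and crit: "\<And>(H :: 'a word set monoid) s \<pi>. \<lbrakk>group H; s ` S \<subseteq> carrier H; generate H (s ` S) = carrier H; \<pi> \<in> hom H G;
      \<And>x. x \<in> S \<Longrightarrow> \<pi> (s x) = x; \<And>x y. x \<in> S \<Longrightarrow> y \<in> S \<Longrightarrow> x \<otimes> y \<in> S \<Longrightarrow> s x \<otimes>\<^bsub>H\<^esub> s y = s (x \<otimes> y)\<rbrakk> \<Longrightarrow>
      \<exists>E. finite E \<and> E \<subseteq> carrier H \<and> (\<forall>e\<in>E. \<pi> e = \<one>) \<and>
        (\<forall>h\<in>carrier H. \<pi> h = \<one> \<longrightarrow> h \<in> generate H (conjs H (carrier H) E))"
  shows "compactly_presentable G T"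
proof -
  define R where "R n = {r. word_over S r \<and> length r \<le> n \<and> eval_word G r = \<one>}" for n :: nat
  interpret W: words S "R 3" by unfold_locales (auto simp: R_def)
  let ?H = "W.PG"
  define \<pi> where "\<pi> A = eval_word G (SOME a. a \<in> A)" for A :: "'a word set"
  have ev: "eval_word G w = \<one>" if "w \<in> normal_closure_words S (R n)" for w n
    using NC_eval[of S "R n" w] that S by (auto simp: R_def)
  have \<pi>: "\<pi> (W.cls w) = eval_word G w" if w: "word_over S w" for w
  proof -
    let ?a = "SOME a. a \<in> W.cls w"
    have "?a \<in> W.cls w" using W.cls_self[OF w] by (rule someI)
    then have a: "word_over S ?a" "?a @ inv_word w \<in> W.NC" by (auto simp: W.cls_def)
    then have "eval_word G ?a \<otimes> inv (eval_word G w) = \<one>" using ev[OF a(2)] w S by (simp add: eval_word_append[of S] eval_word_inv[of S])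
    then show ?thesis using a(1) w S unfolding \<pi>_def by (metis eval_word_closed inv_closed inv_equality inv_inv)
  qed
  interpret H: group ?H by (rule W.group_PG)
  have hom: "\<pi> \<in> hom ?H G"
    by (rule homI) (use S in \<open>auto simp: W.carrier_PG \<pi> W.mult_cls eval_word_append[of S]\<close>)
  have "\<exists>E. finite E \<and> E \<subseteq> carrier ?H \<and> (\<forall>e\<in>E. \<pi> e = \<one>) \<and>
        (\<forall>h\<in>carrier ?H. \<pi> h = \<one> \<longrightarrow> h \<in> generate ?H (conjs ?H (carrier ?H) E))"
  proof (rule crit[of ?H "\<lambda>x. W.cls [(x, True)]" \<pi>, OF W.group_PG _ W.generate_PG hom])
    show "(\<lambda>x. W.cls [(x, True)]) ` S \<subseteq> carrier ?H" by (auto simp: W.carrier_PG)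
    show "\<pi> (W.cls [(x, True)]) = x" if "x \<in> S" for x using that S by (auto simp: \<pi>)
    fix x y assume xy: "x \<in> S" "y \<in> S" "x \<otimes> y \<in> S"
    let ?r = "[(x, True), (y, True), (x \<otimes> y, False)]"
    have "?r \<in> R 3" using xy S by (auto simp: R_def m_assoc subset_iff inv_mult_group)
    then have "?r \<in> W.NC" using normal_closure_words.conj[OF normal_closure_words.nil, where r = ?r and R = "R 3" and u = "[]" and S = S] by simp
    then show "W.cls [(x, True)] \<otimes>\<^bsub>?H\<^esub> W.cls [(y, True)] = W.cls [(x \<otimes> y, True)]"
      using xy by (simp add: W.mult_cls W.cls_eq_iff)
  qed
  then obtain E where E: "finite E" "E \<subseteq> carrier ?H" "\<And>e. e \<in> E \<Longrightarrow> \<pi> e = \<one>"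
    and ker: "\<And>h. h \<in> carrier ?H \<Longrightarrow> \<pi> h = \<one> \<Longrightarrow> h \<in> generate ?H (conjs ?H (carrier ?H) E)" by blast
  have "\<forall>e\<in>E. \<exists>w. word_over S w \<and> e = W.cls w" using E(2) unfolding W.carrier_PG by blast
  then obtain we where we: "\<And>e. e \<in> E \<Longrightarrow> word_over S (we e) \<and> e = W.cls (we e)" by metis
  \<comment> \<open>The 3 retains the relators of \<open>H\<close>; the other entries are the
    lengths of one word for each element of \<open>E\<close>.\<close>
  define n where "n = Max (insert 3 ((\<lambda>e. length (we e)) ` E))"
  have n3: "3 \<le> n" and nE: "length (we e) \<le> n" if "e \<in> E" for e using E(1) that by (auto simp: n_def)
  have n3: "3 \<le> n" using E(1) by (simp add: n_def)
  interpret W': words S "R n" by unfold_locales (auto simp: R_def)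
  have mono: "w \<in> W'.NC" if "w \<in> W.NC" for w
    by (rule normal_closure_words_mono[OF that]) (use n3 in \<open>auto simp: R_def\<close>)
  \<comment> \<open>The kernel of the passage from relators of length 3 to relators of length
    \<open>n\<close>, seen inside \<open>?H\<close>.\<close>
  define Y where "Y = W.cls ` W'.NC"
  have Ysub: "subgroup Y ?H"
  proof (rule H.subgroupI)
    show "Y \<subseteq> carrier ?H" using W'.NC_over by (auto simp: Y_def W.carrier_PG)
    show "Y \<noteq> {}" unfolding Y_def using normal_closure_words.nil by blast
    fix a assume "a \<in> Y"
    then obtain w where w: "w \<in> W'.NC" "a = W.cls w" by (auto simp: Y_def)
    then show "inv\<^bsub>?H\<^esub> a \<in> Y" using W'.NC_inv W'.NC_over by (auto simp: Y_def W.inv_cls)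
    fix b assume "b \<in> Y"
    then obtain v where v: "v \<in> W'.NC" "b = W.cls v" by (auto simp: Y_def)
    then show "a \<otimes>\<^bsub>?H\<^esub> b \<in> Y" using w W'.NC_append W'.NC_over by (auto simp: Y_def W.mult_cls)
  qed
  have cY: "conjs ?H (carrier ?H) E \<subseteq> Y"
  proof
    fix y assume "y \<in> conjs ?H (carrier ?H) E"
    then obtain g e where ge: "g \<in> carrier ?H" "e \<in> E" "y = g \<otimes>\<^bsub>?H\<^esub> e \<otimes>\<^bsub>?H\<^esub> inv\<^bsub>?H\<^esub> g" by (rule conjsE)
    obtain u where u: "g = W.cls u" "word_over S u" using ge by (auto simp: W.carrier_PG)
    have "eval_word G (we e) = \<one>" using E(3)[OF ge(2)] we[OF ge(2)] \<pi> by metis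
    then have "we e \<in> R n" using we ge nE by (auto simp: R_def)
    then have "u @ we e @ inv_word u \<in> W'.NC"
      using normal_closure_words.conj[OF normal_closure_words.nil, where r = "we e" and R = "R n" and u = u and S = S] u by simp
    moreover have "y = W.cls (u @ we e @ inv_word u)"
      using ge u we[OF ge(2)] by (metis W.inv_cls W.mult_cls append_assoc word_over_simps(2,4))
    ultimately show "y \<in> Y" by (auto simp: Y_def)
  qed
  have "w \<in> W'.NC" if w: "word_over S w" "eval_word G w = \<one>" for w
  proof -
    have "W.cls w \<in> carrier ?H" "\<pi> (W.cls w) = \<one>" using w \<pi> by (auto simp: W.carrier_PG)
    then have "W.cls w \<in> generate ?H (conjs ?H (carrier ?H) E)" by (rule ker)
    then have "W.cls w \<in> Y" using H.generate_subgroup_incl[OF cY Ysub] by blast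
    then obtain v where v: "v \<in> W'.NC" "W.cls w = W.cls v" by (auto simp: Y_def)
    then have "w @ inv_word v \<in> W'.NC" using mono w W'.NC_over W.cls_eq_iff by metis
    then have "(w @ inv_word v) @ v \<in> W'.NC" using v W'.NC_append by blast
    then show ?thesis using W'.NC_del_word'[of w v "[]"] by simp
  qed
  then show ?thesis unfolding compactly_presentable_def using S unfolding R_def by blast
qed

end

section \<open>Cocompact lattices in abelian quotients\<close>

text \<open>Products of exactly \<open>j\<close> factors. If the set contains the identity, these
  are the balls of its word metric and they increase with \<open>j\<close>.\<close>

primrec prodn :: "('a, 'b) monoid_scheme \<Rightarrow> 'a set \<Rightarrow> nat \<Rightarrow> 'a set" where
  "prodn G A 0 = {\<one>\<^bsub>G\<^esub>}"
| "prodn G A (Suc j) = A <#>\<^bsub>G\<^esub> prodn G A j"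

context group
begin

lemma set_mult_memI: "a \<in> A \<Longrightarrow> b \<in> B \<Longrightarrow> a \<otimes> b \<in> A <#> B" by (auto simp: set_mult_def)

lemma prodn_carrier: "A \<subseteq> carrier G \<Longrightarrow> prodn G A j \<subseteq> carrier G"
  by (induction j) (auto simp: set_mult_def)

lemma prodn_add: "A \<subseteq> carrier G \<Longrightarrow> x \<in> prodn G A i \<Longrightarrow> y \<in> prodn G A j \<Longrightarrow> x \<otimes> y \<in> prodn G A (i + j)"
proof (induction i arbitrary: x)
  case 0
  then have "y \<in> carrier G" using prodn_carrier[of A j] by blast
  then show ?case using 0 by simp
next
  case (Suc i)
  then obtain a z where az: "a \<in> A" "z \<in> prodn G A i" "x = a \<otimes> z" by (auto simp: set_mult_def)
  then have "a \<otimes> (z \<otimes> y) \<in> A <#> prodn G A (i + j)" using Suc by (intro set_mult_memI) auto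
  moreover have "a \<in> carrier G" "z \<in> carrier G" "y \<in> carrier G" using az Suc.prems prodn_carrier by blast+
  ultimately show ?case using az by (simp add: m_assoc)
qed

lemma prodn_mono: "A \<subseteq> B \<Longrightarrow> prodn G A j \<subseteq> prodn G B j"
  by (induction j) (auto simp: set_mult_def)

lemma prodn_1: "A \<subseteq> carrier G \<Longrightarrow> prodn G A 1 = A"
  by (auto simp: set_mult_def subset_iff)

lemma prodn_le: "A \<subseteq> carrier G \<Longrightarrow> \<one> \<in> A \<Longrightarrow> i \<le> j \<Longrightarrow> prodn G A i \<subseteq> prodn G A j"
proof -
  assume A: "A \<subseteq> carrier G" "\<one> \<in> A" and "i \<le> j"
  have one: "\<one> \<in> prodn G A d" for d by (induction d) (use A in \<open>auto simp: set_mult_def intro!: bexI[of _ \<one>]\<close>)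
  show ?thesis
  proof
    fix x assume x: "x \<in> prodn G A i"
    then have "x \<otimes> \<one> \<in> prodn G A (i + (j - i))" using one A by (intro prodn_add) auto
    moreover have "x \<in> carrier G" using x A prodn_carrier by blast
    ultimately show "x \<in> prodn G A j" using \<open>i \<le> j\<close> by simp
  qed
qed

lemma prodn_inv: 
  assumes "A \<subseteq> carrier G" "\<And>a. a \<in> A \<Longrightarrow> inv a \<in> A" "x \<in> prodn G A j"
  shows "inv x \<in> prodn G A j"
  using assms(3)
proof (induction j arbitrary: x)
  case (Suc j)
  then obtain a z where az: "a \<in> A" "z \<in> prodn G A j" "x = a \<otimes> z" by (auto simp: set_mult_def)
  have "inv z \<otimes> inv a \<in> prodn G A (j + 1)"
    using az Suc assms prodn_1[OF assms(1)] by (intro prodn_add) auto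
  moreover have "a \<in> carrier G" "z \<in> carrier G" using az assms prodn_carrier by blast+
  ultimately show ?case using az by (simp add: inv_mult_group)
qed auto

lemma prodn_subset_generate: "A \<subseteq> carrier G \<Longrightarrow> prodn G A j \<subseteq> generate G A"
  by (induction j) (auto simp: set_mult_def intro: generate.one generate.eng generate.incl)

lemma generate_prodn:
  assumes "A \<subseteq> carrier G" "\<one> \<in> A" "\<And>a. a \<in> A \<Longrightarrow> inv a \<in> A"
  shows "generate G A = (\<Union>j. prodn G A j)"
proof
  show "generate G A \<subseteq> (\<Union>j. prodn G A j)"
  proof
    fix x assume "x \<in> generate G A"
    then show "x \<in> (\<Union>j. prodn G A j)"
    proof induction
      case one
      have "\<one> \<in> prodn G A 0" by simp
      then show ?case by blast
    next
      case (incl h) then show ?case using prodn_1[OF assms(1)] by blast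
    next
      case (inv h) then show ?case using prodn_1[OF assms(1)] assms(3) by blast
    next
      case (eng h1 h2) then show ?case using prodn_add[OF assms(1)] by blast
    qed
  qed
qed (use prodn_subset_generate assms in blast)

end

section \<open>Compact and open sets in locally compact groups\<close>

locale lc_grp = group G for G (structure) +
  fixes T :: "'a topology"
  assumes lc: "lc_group G T"
begin

lemma topspace: "topspace T = carrier G" and Haus: "Hausdorff_space T" and loc_compact: "locally_compact_space T"
  using lc by (auto simp: lc_group_def)

lemma cont_mult:
  assumes "continuous_map X T f" "continuous_map X T g"
  shows "continuous_map X T (\<lambda>x. f x \<otimes> g x)"
proof -
  have "continuous_map X (prod_topology T T) (\<lambda>x. (f x, g x))" using assms by (rule continuous_map_pairedI)
  moreover have "continuous_map (prod_topology T T) T (\<lambda>(x, y). x \<otimes> y)" using lc by (simp add: lc_group_def)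
  ultimately have "continuous_map X T ((\<lambda>(x, y). x \<otimes> y) \<circ> (\<lambda>x. (f x, g x)))" by (rule continuous_map_compose)
  then show ?thesis by (simp add: o_def)
qed

lemma cont_inv:
  assumes "continuous_map X T f" shows "continuous_map X T (\<lambda>x. inv f x)"
proof -
  have "continuous_map T T (\<lambda>x. inv x)" using lc by (simp add: lc_group_def)
  with assms have "continuous_map X T ((\<lambda>x. inv x) \<circ> f)" by (rule continuous_map_compose)
  then show ?thesis by (simp add: o_def)
qed

lemma cont_const: "c \<in> carrier G \<Longrightarrow> continuous_map X T (\<lambda>x. c)" by (simp add: topspace)

lemma compact_carrier: "compactin T A \<Longrightarrow> A \<subseteq> carrier G" using compactin_subset_topspace topspace by metis

lemma compact_image2:
  assumes "compactin T A" "compactin T B" "continuous_map (prod_topology T T) T (\<lambda>p. f (fst p) (snd p))"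
  shows "compactin T {f a b |a b. a \<in> A \<and> b \<in> B}"
proof -
  have "compactin (prod_topology T T) (A \<times> B)" using assms by (simp add: compactin_Times)
  then have "compactin T ((\<lambda>p. f (fst p) (snd p)) ` (A \<times> B))" using assms(3) image_compactin by blast
  moreover have "(\<lambda>p. f (fst p) (snd p)) ` (A \<times> B) = {f a b |a b. a \<in> A \<and> b \<in> B}" by force
  ultimately show ?thesis by simp
qed

lemmas cont_intros = cont_mult cont_inv cont_const continuous_map_fst continuous_map_snd

lemma compact_mult: "compactin T A \<Longrightarrow> compactin T B \<Longrightarrow> compactin T (A <#> B)"
proof -
  assume "compactin T A" "compactin T B"
  then have "compactin T {a \<otimes> b |a b. a \<in> A \<and> b \<in> B}" by (rule compact_image2) (intro cont_intros)
  moreover have "A <#> B = {a \<otimes> b |a b. a \<in> A \<and> b \<in> B}" by (auto simp: set_mult_def)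
  ultimately show ?thesis by simp
qed

lemma compact_inv: "compactin T A \<Longrightarrow> compactin T (m_inv G ` A)"
  using image_compactin[OF _ cont_inv[OF continuous_map_id[unfolded id_def]]] by blast

lemma compact_conjs: "compactin T A \<Longrightarrow> compactin T B \<Longrightarrow> compactin T (conjs G A B)"
  unfolding conjs_def by (rule compact_image2) (intro cont_intros | assumption)+

lemma compact_prodn: "compactin T A \<Longrightarrow> compactin T (prodn G A j)"
proof (induction j)
  case 0 then show ?case by (simp add: topspace)
qed (auto intro: compact_mult)

lemma compact_finite: "finite A \<Longrightarrow> A \<subseteq> carrier G \<Longrightarrow> compactin T A"
  by (rule finite_imp_compactin) (simp_all add: topspace)

lemma compact_closed: "compactin T A \<Longrightarrow> closedin T A" using compactin_imp_closedin Haus by blast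

lemma open_translate: "openin T W \<Longrightarrow> x \<in> carrier G \<Longrightarrow> openin T (x <# W)"
proof -
  assume W: "openin T W" and x: "x \<in> carrier G"
  have "continuous_map T T (\<lambda>y. inv x \<otimes> y)" using x by (intro cont_mult cont_const) auto
  then have "openin T {y \<in> topspace T. inv x \<otimes> y \<in> W}" using W by (rule openin_continuous_map_preimage)
  moreover have "{y \<in> topspace T. inv x \<otimes> y \<in> W} = x <# W"
  proof (intro equalityI subsetI)
    fix y assume y: "y \<in> {y \<in> topspace T. inv x \<otimes> y \<in> W}"
    then have "y = x \<otimes> (inv x \<otimes> y)" using x topspace by simp
    then show "y \<in> x <# W" using y by (auto simp: l_coset_def)
  next
    fix y assume "y \<in> x <# W"
    then obtain w where w: "w \<in> W" "y = x \<otimes> w" by (auto simp: l_coset_def)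
    then have "w \<in> carrier G" using openin_subset[OF W] topspace by auto
    then show "y \<in> {y \<in> topspace T. inv x \<otimes> y \<in> W}" using w x topspace by simp
  qed
  ultimately show ?thesis by simp
qed

lemma compact_nbhd_one: "\<exists>W V. openin T W \<and> \<one> \<in> W \<and> W \<subseteq> V \<and> compactin T V"
  using loc_compact topspace unfolding locally_compact_space_def by (metis one_closed)

lemma div_nbhd:
  assumes "openin T O'" "\<one> \<in> O'"
  shows "\<exists>W. openin T W \<and> \<one> \<in> W \<and> (\<forall>x\<in>W. \<forall>y\<in>W. inv x \<otimes> y \<in> O')"
proof -
  have "continuous_map (prod_topology T T) T (\<lambda>p. inv (fst p) \<otimes> snd p)" by (intro cont_intros)
  then have "openin (prod_topology T T) {p \<in> topspace (prod_topology T T). inv (fst p) \<otimes> snd p \<in> O'}"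
    using assms(1) by (rule openin_continuous_map_preimage)
  then have op: "\<forall>x y. (x, y) \<in> {p \<in> topspace (prod_topology T T). inv (fst p) \<otimes> snd p \<in> O'} \<longrightarrow>
      (\<exists>U V. openin T U \<and> openin T V \<and> x \<in> U \<and> y \<in> V \<and>
        U \<times> V \<subseteq> {p \<in> topspace (prod_topology T T). inv (fst p) \<otimes> snd p \<in> O'})"
    unfolding openin_prod_topology_alt .
  have "(\<one>, \<one>) \<in> {p \<in> topspace (prod_topology T T). inv (fst p) \<otimes> snd p \<in> O'}"
    using assms by (simp add: topspace)
  with op have "\<exists>U V. openin T U \<and> openin T V \<and> \<one> \<in> U \<and> \<one> \<in> V \<and>
        U \<times> V \<subseteq> {p \<in> topspace (prod_topology T T). inv (fst p) \<otimes> snd p \<in> O'}"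
    by (elim allE impE)
  then obtain U V where UV: "openin T U" "openin T V" "\<one> \<in> U" "\<one> \<in> V"
    "U \<times> V \<subseteq> {p \<in> topspace (prod_topology T T). inv (fst p) \<otimes> snd p \<in> O'}"
    by (elim exE conjE)
  show ?thesis by (rule exI[of _ "U \<inter> V"]) (use UV in auto)
qed

lemma compact_cover:
  assumes "compactin T L" "openin T W" "\<one> \<in> W"
  shows "\<exists>F. finite F \<and> F \<subseteq> L \<and> L \<subseteq> (\<Union>x\<in>F. x <# W)"
proof -
  have Lc: "L \<subseteq> carrier G" using assms compact_carrier by blast
  let ?U = "(\<lambda>x. x <# W) ` L"
  have "\<And>U. U \<in> ?U \<Longrightarrow> openin T U" using open_translate assms(2) Lc by blast
  moreover have "L \<subseteq> \<Union>?U"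
  proof
    fix x assume "x \<in> L"
    then have "x \<in> x <# W" using Lc assms(3) by (force simp: l_coset_def)
    then show "x \<in> \<Union>?U" using \<open>x \<in> L\<close> by blast
  qed
  ultimately obtain \<F> where F: "finite \<F>" "\<F> \<subseteq> ?U" "L \<subseteq> \<Union>\<F>"
    using assms(1) unfolding compactin_def by (metis (no_types, lifting))
  obtain F where "finite F" "F \<subseteq> L" "\<F> = (\<lambda>x. x <# W) ` F" using finite_subset_image[OF F(1,2)] by blast
  then show ?thesis using F by blast
qed

lemma compact_symmetric:
  assumes "compactin T L"
  shows "\<exists>V. compactin T V \<and> L \<subseteq> V \<and> \<one> \<in> V \<and> (\<forall>v\<in>V. inv v \<in> V)"
proof (intro exI conjI)
  let ?V = "L \<union> m_inv G ` L \<union> {\<one>}"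
  show "compactin T ?V" using assms compact_inv[OF assms] compact_finite[of "{\<one>}"] by (intro compactin_Un) auto
  show "\<forall>v\<in>?V. inv v \<in> ?V" using compact_carrier[OF assms] by auto
qed auto

end

section \<open>Proper lattices in an abelian quotient\<close>

locale lc_ab = lc_grp G T + Q: comm_group Q for G (structure) and T :: "'a topology" and Q :: "('c, 'd) monoid_scheme" (structure) +
  fixes q :: "'a \<Rightarrow> 'c"
  assumes q_hom: "q \<in> hom G Q" and q_surj: "q ` carrier G = carrier Q"
begin

lemma q_closed [simp]: "x \<in> carrier G \<Longrightarrow> q x \<in> carrier Q" using q_hom hom_in_carrier by metis
lemma q_mult [simp]: "x \<in> carrier G \<Longrightarrow> y \<in> carrier G \<Longrightarrow> q (x \<otimes> y) = q x \<otimes>\<^bsub>Q\<^esub> q y" using q_hom hom_mult by metis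
lemma q_group_hom: "group_hom G Q q" using q_hom by (simp add: group_hom_def group_hom_axioms_def)
lemma q_one [simp]: "q \<one> = \<one>\<^bsub>Q\<^esub>" using q_group_hom group_hom.hom_one by blast
lemma q_inv [simp]: "x \<in> carrier G \<Longrightarrow> q (inv x) = inv\<^bsub>Q\<^esub> (q x)" using q_group_hom group_hom.hom_inv by metis
lemma q_int_pow [simp]: "x \<in> carrier G \<Longrightarrow> q (x [^] (k::int)) = q x [^]\<^bsub>Q\<^esub> k" using q_group_hom group_hom.hom_int_pow by metis

abbreviation tp where "tp n t a \<equiv> tpow Q (\<lambda>i. q (t i)) n a"

lemma q_tpow: "(\<And>i. i < n \<Longrightarrow> t i \<in> carrier G) \<Longrightarrow> q (tpow G t n a) = tp n t a"
  using tpow_hom[OF is_group Q.is_group q_hom, of n t a] by (simp add: o_def)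

text \<open>\<open>Q\<close> is an abstract group; its compact sets are represented by images of
  compact sets of \<open>G\<close>. Properness contains both the discreteness of the lattice and the
  independence of its generators.\<close>

definition proper :: "nat \<Rightarrow> (nat \<Rightarrow> 'a) \<Rightarrow> bool" where
  "proper n t \<longleftrightarrow> (\<forall>D. compactin T D \<longrightarrow> finite {a \<in> Zn n. tp n t a \<in> q ` D})"

text \<open>If \<open>f\<close> is not a new independent direction, infinitely many of its powers
  return close to the lattice. A recurrence argument shows that the return times have bounded gaps,
  so all powers of \<open>f\<close> stay within a compact set of the lattice.\<close>

lemma dichotomy:
  assumes t: "\<And>i. i < n \<Longrightarrow> t i \<in> carrier G" and f: "f \<in> carrier G"
    and pr: "proper n t" and npr: "\<not> proper (Suc n) (t(n := f))"
  shows "\<exists>C. compactin T C \<and> (\<forall>k::int. \<exists>c\<in>C. \<exists>a\<in>Zn n. q f [^]\<^bsub>Q\<^esub> k = q c \<otimes>\<^bsub>Q\<^esub> tp n t a)"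
proof -
  have tc: "\<And>i. i < n \<Longrightarrow> q (t i) \<in> carrier Q" using t by simp
  have tpc [simp]: "tp n t a \<in> carrier Q" for a using Q.tpow_closed[OF tc] by simp
  note tpa = Q.tpow_add[of n "\<lambda>i. q (t i)", OF tc] and tpu = Q.tpow_uminus[of n "\<lambda>i. q (t i)", OF tc]
  note tpd = Q.tpow_diff[of n "\<lambda>i. q (t i)", OF tc]
  have qf [simp]: "q f \<in> carrier Q" using f by simp
  obtain D where D: "compactin T D" and inf: "infinite {a \<in> Zn (Suc n). tp (Suc n) (t(n := f)) a \<in> q ` D}"
    using npr unfolding proper_def by blast
  have Dc: "D \<subseteq> carrier G" using D compact_carrier by blast
  have tpS: "tp (Suc n) (t(n := f)) a = tp n t a \<otimes>\<^bsub>Q\<^esub> q f [^]\<^bsub>Q\<^esub> a n" for a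
  proof -
    have "tp n (t(n := f)) a = tp n t a" by (rule tpow_cong) auto
    then show ?thesis by simp
  qed
  \<comment> \<open>The return times of the powers of \<open>f\<close> to the lattice thickened by
    \<open>V\<close>.\<close>
  define Rr where "Rr V = {k::int. \<exists>d\<in>V. \<exists>a\<in>Zn n. q f [^]\<^bsub>Q\<^esub> k = q d \<otimes>\<^bsub>Q\<^esub> tp n t a}" for V
  have infR: "infinite (Rr D)"
  proof
    assume fin: "finite (Rr D)"
    have "{a \<in> Zn (Suc n). tp (Suc n) (t(n := f)) a \<in> q ` D} \<subseteq>
      (\<Union>k\<in>Rr D. (\<lambda>a. a(n := k)) ` {a \<in> Zn n. tp n t a \<in> q ` (D <#> {f [^] (- k)})})"
    proof
      fix a assume "a \<in> {a \<in> Zn (Suc n). tp (Suc n) (t(n := f)) a \<in> q ` D}"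
      then obtain d where a: "a \<in> Zn (Suc n)" and d: "d \<in> D" "tp n t a \<otimes>\<^bsub>Q\<^esub> q f [^]\<^bsub>Q\<^esub> a n = q d"
        unfolding tpS by auto
      let ?b = "a(n := 0)"
      have b: "?b \<in> Zn n" using a by (auto simp: Zn_def)
      have tb: "tp n t ?b = tp n t a" by (rule tpow_cong) auto
      have dc: "d \<in> carrier G" using d Dc by blast
      have "q f [^]\<^bsub>Q\<^esub> a n = q d \<otimes>\<^bsub>Q\<^esub> inv\<^bsub>Q\<^esub> (tp n t ?b)"
        using d(2) dc unfolding tb by (metis Q.int_pow_closed Q.inv_solve_right' Q.m_comm q_closed qf tpc)
      then have "q f [^]\<^bsub>Q\<^esub> a n = q d \<otimes>\<^bsub>Q\<^esub> tp n t (\<lambda>i. - ?b i)" using tpu[of ?b] by simp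
      then have k: "a n \<in> Rr D" unfolding Rr_def using d(1) Zn_uminus[OF b] by blast
      have "tp n t ?b = q (d \<otimes> f [^] (- a n))"
      proof -
        have "q (d \<otimes> f [^] (- a n)) = q d \<otimes>\<^bsub>Q\<^esub> inv\<^bsub>Q\<^esub> (q f [^]\<^bsub>Q\<^esub> a n)" using dc f by (simp add: Q.int_pow_neg)
        then show ?thesis unfolding d(2)[symmetric] tb using dc by (simp add: Q.m_assoc)
      qed
      then have "tp n t ?b \<in> q ` (D <#> {f [^] (- a n)})" using d(1) by (auto simp: set_mult_def)
      moreover have "a = ?b(n := a n)" by auto
      ultimately show "a \<in> (\<Union>k\<in>Rr D. (\<lambda>a. a(n := k)) ` {a \<in> Zn n. tp n t a \<in> q ` (D <#> {f [^] (- k)})})"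
        using k b by blast
    qed
    moreover have "finite {a \<in> Zn n. tp n t a \<in> q ` (D <#> {f [^] (- k)})}" for k :: int
      using pr compact_mult[OF D compact_finite[of "{f [^] (- k)}"]] f unfolding proper_def by auto
    ultimately show False using inf fin by (meson finite_UN_I finite_imageI finite_subset)
  qed
  obtain W0 V0 where W0: "openin T W0" "\<one> \<in> W0" "W0 \<subseteq> V0" "compactin T V0" using compact_nbhd_one by blast
  obtain V where V: "compactin T V" "V0 \<union> D \<subseteq> V" "\<one> \<in> V" "\<And>v. v \<in> V \<Longrightarrow> inv v \<in> V"
    using compact_symmetric[OF compactin_Un[OF W0(4) D]] by blast
  have Vc: "V \<subseteq> carrier G" using V compact_carrier by blast
  obtain W where W: "openin T W" "\<one> \<in> W" "\<And>x y. x \<in> W \<Longrightarrow> y \<in> W \<Longrightarrow> inv x \<otimes> y \<in> W0" using div_nbhd W0 by metis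
  have Wc: "W \<subseteq> carrier G" using openin_subset[OF W(1)] topspace by auto
  obtain F where F: "finite F" "F \<subseteq> V" "V \<subseteq> (\<Union>x\<in>F. x <# W)" using compact_cover[OF V(1) W(1,2)] by blast
  let ?R = "Rr V"
  have "Rr D \<subseteq> ?R" using V(2) unfolding Rr_def by blast
  then have infV: "infinite ?R" using infR finite_subset by blast
  have sym: "- k \<in> ?R" if k: "k \<in> ?R" for k
  proof -
    obtain d a where da: "d \<in> V" "a \<in> Zn n" "q f [^]\<^bsub>Q\<^esub> k = q d \<otimes>\<^bsub>Q\<^esub> tp n t a" using k by (auto simp: Rr_def)
    have dc: "d \<in> carrier G" using da Vc by blast
    have "q f [^]\<^bsub>Q\<^esub> (- k) = q (inv d) \<otimes>\<^bsub>Q\<^esub> tp n t (\<lambda>i. - a i)"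
      using da dc by (simp add: Q.int_pow_neg tpu Q.inv_mult)
    then show ?thesis unfolding Rr_def using V(4)[OF da(1)] Zn_uminus[OF da(2)] by blast
  qed
  have unb: "\<exists>k\<in>?R. k \<ge> m" for m
  proof (rule ccontr)
    assume "\<not> (\<exists>k\<in>?R. k \<ge> m)"
    then have "?R \<subseteq> {- m .. m}" using sym by force
    then show False using infV finite_subset by blast
  qed
  \<comment> \<open>The quotient of two points of one cell \<open>x <# W\<close> lies in
    \<open>W0\<close>, so the difference of two return times to the same cell is again a return time
    to \<open>V\<close>.\<close>
  have diff: "k - k' \<in> ?R" if "x \<in> F" "k \<in> Rr (x <# W)" "k' \<in> Rr (x <# W)" for x k k'
  proof -
    note k = that
    obtain w a w' a' where *: "w \<in> W" "a \<in> Zn n" "q f [^]\<^bsub>Q\<^esub> k = q (x \<otimes> w) \<otimes>\<^bsub>Q\<^esub> tp n t a"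
      "w' \<in> W" "a' \<in> Zn n" "q f [^]\<^bsub>Q\<^esub> k' = q (x \<otimes> w') \<otimes>\<^bsub>Q\<^esub> tp n t a'"
      using k(2,3) by (auto simp: Rr_def l_coset_def)
    have c: "x \<in> carrier G" "w \<in> carrier G" "w' \<in> carrier G" using * that(1) F Vc Wc by auto
    have "q f [^]\<^bsub>Q\<^esub> (k - k') = q f [^]\<^bsub>Q\<^esub> k \<otimes>\<^bsub>Q\<^esub> inv\<^bsub>Q\<^esub> (q f [^]\<^bsub>Q\<^esub> k')" by (simp add: Q.int_pow_diff)
    also have "\<dots> = (q x \<otimes>\<^bsub>Q\<^esub> inv\<^bsub>Q\<^esub> (q x)) \<otimes>\<^bsub>Q\<^esub> ((inv\<^bsub>Q\<^esub> (q w') \<otimes>\<^bsub>Q\<^esub> q w) \<otimes>\<^bsub>Q\<^esub> (tp n t a \<otimes>\<^bsub>Q\<^esub> inv\<^bsub>Q\<^esub> (tp n t a')))"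
      unfolding *(3,6) using c by (simp add: Q.inv_mult Q.m_ac del: Q.r_inv)
    also have "\<dots> = q (inv w' \<otimes> w) \<otimes>\<^bsub>Q\<^esub> tp n t (\<lambda>i. a i - a' i)" using c by (simp add: tpd)
    finally have "q f [^]\<^bsub>Q\<^esub> (k - k') = q (inv w' \<otimes> w) \<otimes>\<^bsub>Q\<^esub> tp n t (\<lambda>i. a i - a' i)" .
    moreover have "inv w' \<otimes> w \<in> V" using W(3)[OF *(4,1)] W0(3) V(2) by blast
    ultimately show ?thesis unfolding Rr_def using Zn_diff[OF *(2,5)] by blast
  qed
  \<comment> \<open>One positive return time for each cell; subtracting it is the descent. For a
    cell without positive return times the value is arbitrary and can only enlarge
    \<open>K\<close>.\<close>
  define kk where "kk x = (SOME k. k > 0 \<and> k \<in> Rr (x <# W))" for x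
  define K where "K = Max (insert 1 (kk ` F))"
  have KF: "kk x \<le> K" if "x \<in> F" for x unfolding K_def using F(1) that by (intro Max_ge) auto
  have desc: "\<exists>i. 1 \<le> i \<and> i \<le> K \<and> k - i \<in> ?R" if k: "k \<in> ?R" "k > 0" for k
  proof -
    obtain d a where da: "d \<in> V" "a \<in> Zn n" "q f [^]\<^bsub>Q\<^esub> k = q d \<otimes>\<^bsub>Q\<^esub> tp n t a" using k by (auto simp: Rr_def)
    obtain x where x: "x \<in> F" "d \<in> x <# W" using F(3) da(1) by blast
    have kx: "k \<in> Rr (x <# W)" unfolding Rr_def using da x by blast
    have "kk x > 0 \<and> kk x \<in> Rr (x <# W)" unfolding kk_def by (rule someI[of _ k]) (use k kx in auto)
    then show ?thesis using diff[OF x(1) kx] KF[OF x(1)] by (intro exI[of _ "kk x"]) auto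
  qed
  have near: "\<exists>k\<in>?R. m \<le> k \<and> k \<le> m + K" if m: "m \<ge> 0" for m
  proof -
    obtain k0 where k0: "k0 \<in> ?R" "m \<le> k0" using unb by blast
    \<comment> \<open>The smallest return time from \<open>m\<close> on is within \<open>K\<close>
      of \<open>m\<close>, since otherwise \<open>desc\<close> would yield a smaller one that is
      still at least \<open>m\<close>.\<close>
    obtain k where k: "k \<in> ?R \<and> m \<le> k" and min: "\<And>y. y \<in> ?R \<and> m \<le> y \<Longrightarrow> nat (k - m) \<le> nat (y - m)"
      using ex_has_least_nat[of "\<lambda>k. k \<in> ?R \<and> m \<le> k" k0 "\<lambda>k. nat (k - m)"] k0 by blast
    have "k \<le> m + K"
    proof (rule ccontr)
      assume "\<not> k \<le> m + K"
      then have km: "k > m + K" by simp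
      have "K \<ge> 1" unfolding K_def using F(1) by (intro Max_ge) auto
      then obtain i where i: "1 \<le> i" "i \<le> K" "k - i \<in> ?R" using desc[of k] k km m by auto
      then have "nat (k - m) \<le> nat (k - i - m)" using min[of "k - i"] km by auto
      then show False using i km by auto
    qed
    then show ?thesis using k by blast
  qed
  \<comment> \<open>At most \<open>K\<close> inverse factors of \<open>f\<close> lead from the
    nearby return time back to the given exponent.\<close>
  define C1 where "C1 = V <#> (\<lambda>j. f [^] (- j)) ` {0..K}"
  have C1: "compactin T C1" unfolding C1_def using f by (intro compact_mult[OF V(1)] compact_finite) auto
  have C1c: "C1 \<subseteq> carrier G" using C1 compact_carrier by blast
  have pos: "\<exists>c\<in>C1. \<exists>a\<in>Zn n. q f [^]\<^bsub>Q\<^esub> m = q c \<otimes>\<^bsub>Q\<^esub> tp n t a" if m: "m \<ge> 0" for m :: int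
  proof -
    obtain k where k: "k \<in> ?R" "m \<le> k" "k \<le> m + K" using near[OF m] by blast
    obtain d a where da: "d \<in> V" "a \<in> Zn n" "q f [^]\<^bsub>Q\<^esub> k = q d \<otimes>\<^bsub>Q\<^esub> tp n t a" using k by (auto simp: Rr_def)
    have dc: "d \<in> carrier G" using da Vc by blast
    have "q f [^]\<^bsub>Q\<^esub> m = q f [^]\<^bsub>Q\<^esub> (k + (- (k - m)))" by simp
    also have "\<dots> = q f [^]\<^bsub>Q\<^esub> k \<otimes>\<^bsub>Q\<^esub> q f [^]\<^bsub>Q\<^esub> (- (k - m))" using qf by (rule Q.int_pow_mult)
    also have "\<dots> = q (d \<otimes> f [^] (- (k - m))) \<otimes>\<^bsub>Q\<^esub> tp n t a" unfolding da using dc f by (simp add: Q.m_ac)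
    finally have e: "q f [^]\<^bsub>Q\<^esub> m = q (d \<otimes> f [^] (- (k - m))) \<otimes>\<^bsub>Q\<^esub> tp n t a" .
    have "d \<otimes> f [^] (- (k - m)) \<in> C1" unfolding C1_def using da(1) k by (intro set_mult_memI imageI) auto
    then show ?thesis using e da(2) by blast
  qed
  have "\<exists>c\<in>C1 \<union> m_inv G ` C1. \<exists>a\<in>Zn n. q f [^]\<^bsub>Q\<^esub> m = q c \<otimes>\<^bsub>Q\<^esub> tp n t a" for m :: int
  proof (cases "m \<ge> 0")
    case True then show ?thesis using pos by blast
  next
    case False
    then obtain c a where ca: "c \<in> C1" "a \<in> Zn n" "q f [^]\<^bsub>Q\<^esub> (- m) = q c \<otimes>\<^bsub>Q\<^esub> tp n t a" using pos[of "- m"] by auto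
    have cc: "c \<in> carrier G" using ca C1c by blast
    have "q f [^]\<^bsub>Q\<^esub> m = inv\<^bsub>Q\<^esub> (q f [^]\<^bsub>Q\<^esub> (- m))" by (simp add: Q.int_pow_neg)
    also have "\<dots> = q (inv c) \<otimes>\<^bsub>Q\<^esub> tp n t (\<lambda>i. - a i)" unfolding ca using cc by (simp add: tpu Q.inv_mult)
    finally show ?thesis using ca Zn_uminus by blast
  qed
  moreover have "compactin T (C1 \<union> m_inv G ` C1)" using C1 by (intro compactin_Un compact_inv)
  ultimately show ?thesis by blast
qed

text \<open>Generators are added one by one: each of them either extends the lattice or is absorbed
  by enlarging the compact set.\<close>

lemma lattice_of_finite:
  assumes "finite F" "F \<subseteq> carrier G"
  shows "\<exists>n t C. (\<forall>i<n. t i \<in> carrier G) \<and> proper n t \<and> compactin T C \<and>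
    (\<forall>x\<in>generate Q (q ` F). \<exists>c\<in>C. \<exists>a\<in>Zn n. x = q c \<otimes>\<^bsub>Q\<^esub> tp n t a)"
  using assms
proof (induction F)
  case empty
  have Zn0: "Zn 0 = {\<lambda>_. 0}" by (auto simp: Zn_def)
  have "proper 0 (\<lambda>_. \<one>)" by (simp add: proper_def Zn0)
  moreover have "generate Q (q ` {}) = {\<one>\<^bsub>Q\<^esub>}" using Q.generate_empty by simp
  moreover have "compactin T {\<one>}" by (intro compact_finite) auto
  ultimately show ?case using Zn0 by (intro exI[of _ 0] exI[of _ "\<lambda>_. \<one>"] exI[of _ "{\<one>}"]) auto
next
  case (insert f F)
  then obtain n t C where t: "\<And>i. i < n \<Longrightarrow> t i \<in> carrier G" and pr: "proper n t" and C: "compactin T C"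
    and dec: "\<And>x. x \<in> generate Q (q ` F) \<Longrightarrow> \<exists>c\<in>C. \<exists>a\<in>Zn n. x = q c \<otimes>\<^bsub>Q\<^esub> tp n t a" by (metis insert_subset)
  have f: "f \<in> carrier G" and Fc: "q ` F \<subseteq> carrier Q" using insert by auto
  have qf: "q f \<in> carrier Q" using f by simp
  have tc: "\<And>i. i < n \<Longrightarrow> q (t i) \<in> carrier Q" using t by simp
  have tpc [simp]: "tp n t a \<in> carrier Q" for a using Q.tpow_closed[OF tc] by simp
  have split: "\<exists>y\<in>generate Q (q ` F). \<exists>k::int. x = y \<otimes>\<^bsub>Q\<^esub> q f [^]\<^bsub>Q\<^esub> k" if "x \<in> generate Q (q ` insert f F)" for x
  proof -
    let ?Y = "{y \<otimes>\<^bsub>Q\<^esub> q f [^]\<^bsub>Q\<^esub> k |y k. y \<in> generate Q (q ` F) \<and> k \<in> (UNIV::int set)}"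
    have gc: "\<And>y. y \<in> generate Q (q ` F) \<Longrightarrow> y \<in> carrier Q" using Q.generate_in_carrier[OF Fc] by blast
    have "generate Q (q ` insert f F) \<subseteq> ?Y"
    proof (rule Q.generate_subset_right_closed)
      show "\<one>\<^bsub>Q\<^esub> \<in> ?Y" using generate.one[of Q "q ` F"] by (force intro!: exI[of _ "\<one>\<^bsub>Q\<^esub>"] exI[of _ 0])
      fix y s assume "y \<in> ?Y" "s \<in> q ` insert f F"
      then obtain z k where zk: "z \<in> generate Q (q ` F)" "y = z \<otimes>\<^bsub>Q\<^esub> q f [^]\<^bsub>Q\<^esub> (k::int)" by blast
      have zc: "z \<in> carrier Q" using gc zk by blast
      show "y \<otimes>\<^bsub>Q\<^esub> s \<in> ?Y"
      proof (cases "s = q f")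
        case True
        then have "y \<otimes>\<^bsub>Q\<^esub> s = z \<otimes>\<^bsub>Q\<^esub> q f [^]\<^bsub>Q\<^esub> (k + 1)" using zk zc qf by (simp add: Q.int_pow_mult Q.m_assoc)
        then show ?thesis using zk by blast
      next
        case False
        then have s: "s \<in> q ` F" using \<open>s \<in> q ` insert f F\<close> by auto
        then have "y \<otimes>\<^bsub>Q\<^esub> s = (z \<otimes>\<^bsub>Q\<^esub> s) \<otimes>\<^bsub>Q\<^esub> q f [^]\<^bsub>Q\<^esub> k" using zk zc qf Fc by (auto simp: Q.m_ac)
        then show ?thesis using zk s generate.eng[OF zk(1) generate.incl[OF s]] by blast
      qed
      show "y \<otimes>\<^bsub>Q\<^esub> inv\<^bsub>Q\<^esub> s \<in> ?Y"
      proof (cases "s = q f")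
        case True
        then have "y \<otimes>\<^bsub>Q\<^esub> inv\<^bsub>Q\<^esub> s = z \<otimes>\<^bsub>Q\<^esub> q f [^]\<^bsub>Q\<^esub> (k + (- 1))" using zk zc qf
          by (simp only: Q.int_pow_mult Q.int_pow_neg Q.m_assoc Q.int_pow_closed Q.inv_closed Q.int_pow_1)
        then show ?thesis using zk by blast
      next
        case False
        then have s: "s \<in> q ` F" using \<open>s \<in> q ` insert f F\<close> by auto
        then have "s \<in> carrier Q" using Fc by blast
        then have "y \<otimes>\<^bsub>Q\<^esub> inv\<^bsub>Q\<^esub> s = (z \<otimes>\<^bsub>Q\<^esub> inv\<^bsub>Q\<^esub> s) \<otimes>\<^bsub>Q\<^esub> q f [^]\<^bsub>Q\<^esub> k" using zk zc qf by (simp add: Q.m_ac)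
        then show ?thesis using zk s generate.eng[OF zk(1) generate.inv[OF s]] by blast
      qed
    qed (use Fc qf gc in auto)
    then show ?thesis using that by blast
  qed
  show ?case
  proof (cases "proper (Suc n) (t(n := f))")
    case True
    have "\<exists>c\<in>C. \<exists>a\<in>Zn (Suc n). x = q c \<otimes>\<^bsub>Q\<^esub> tp (Suc n) (t(n := f)) a" if x: "x \<in> generate Q (q ` insert f F)" for x
    proof -
      obtain y k where yk: "y \<in> generate Q (q ` F)" "x = y \<otimes>\<^bsub>Q\<^esub> q f [^]\<^bsub>Q\<^esub> (k::int)" using split[OF x] by blast
      obtain c a where ca: "c \<in> C" "a \<in> Zn n" "y = q c \<otimes>\<^bsub>Q\<^esub> tp n t a" using dec[OF yk(1)] by blast
      let ?b = "a(n := k)"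
      have "tp n (t(n := f)) ?b = tp n t a" by (rule tpow_cong) auto
      then have "x = q c \<otimes>\<^bsub>Q\<^esub> tp (Suc n) (t(n := f)) ?b" using yk ca qf C compact_carrier by (auto simp: Q.m_assoc subset_iff)
      moreover have "?b \<in> Zn (Suc n)" using ca by (auto simp: Zn_def)
      ultimately show ?thesis using ca by blast
    qed
    moreover have "\<forall>i<Suc n. (t(n := f)) i \<in> carrier G" using t f by auto
    ultimately show ?thesis using True C by blast
  next
    case False
    obtain C' where C': "compactin T C'" "\<And>k::int. \<exists>c\<in>C'. \<exists>a\<in>Zn n. q f [^]\<^bsub>Q\<^esub> k = q c \<otimes>\<^bsub>Q\<^esub> tp n t a"
      using dichotomy[OF t f pr False] by blast
    have "\<exists>c\<in>C <#> C'. \<exists>a\<in>Zn n. x = q c \<otimes>\<^bsub>Q\<^esub> tp n t a" if x: "x \<in> generate Q (q ` insert f F)" for x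
    proof -
      obtain y k where yk: "y \<in> generate Q (q ` F)" "x = y \<otimes>\<^bsub>Q\<^esub> q f [^]\<^bsub>Q\<^esub> (k::int)" using split[OF x] by blast
      obtain c a where ca: "c \<in> C" "a \<in> Zn n" "y = q c \<otimes>\<^bsub>Q\<^esub> tp n t a" using dec[OF yk(1)] by blast
      obtain c' a' where ca': "c' \<in> C'" "a' \<in> Zn n" "q f [^]\<^bsub>Q\<^esub> k = q c' \<otimes>\<^bsub>Q\<^esub> tp n t a'" using C'(2) by blast
      have cc: "c \<in> carrier G" "c' \<in> carrier G" using ca ca' C C' compact_carrier by blast+
      have "x = q (c \<otimes> c') \<otimes>\<^bsub>Q\<^esub> tp n t (\<lambda>i. a i + a' i)"
        unfolding yk(2) ca(3) ca'(3) using cc Q.tpow_add[of n "\<lambda>i. q (t i)" a a', OF tc] by (simp add: Q.m_ac)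
      then show ?thesis using set_mult_memI[OF ca(1) ca'(1)] Zn_add[OF ca(2) ca'(2)] by blast
    qed
    then show ?thesis using t pr compact_mult[OF C C'(1)] by blast
  qed
qed

text \<open>With \<open>V\<close> symmetric and containing a neighbourhood of the identity,
  \<open>V V\<close> is covered by finitely many translates \<open>f W0\<close> contained in
  \<open>f V\<close>. So each new letter of a word can be traded for an element of \<open>F\<close>,
  and the group generated by the finite set \<open>F\<close> is already cocompact in
  \<open>Q\<close>.\<close>

theorem lattice_exists:
  assumes "compactly_generated G T"
  shows "\<exists>n t C. (\<forall>i<n. t i \<in> carrier G) \<and> proper n t \<and> compactin T C \<and>
    (\<forall>g\<in>carrier G. \<exists>c\<in>C. \<exists>a\<in>Zn n. q g = q c \<otimes>\<^bsub>Q\<^esub> tp n t a)"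
proof -
  obtain S where S: "S \<subseteq> carrier G" "compactin T S" "generate G S = carrier G"
    using assms unfolding compactly_generated_def by blast
  obtain W0 V0 where W0: "openin T W0" "\<one> \<in> W0" "W0 \<subseteq> V0" "compactin T V0" using compact_nbhd_one by blast
  obtain V where V: "compactin T V" "V0 \<union> S \<subseteq> V" "\<one> \<in> V" "\<And>v. v \<in> V \<Longrightarrow> inv v \<in> V"
    using compact_symmetric[OF compactin_Un[OF W0(4) S(2)]] by blast
  have Vc: "V \<subseteq> carrier G" using V compact_carrier by blast
  obtain F where F: "finite F" "F \<subseteq> V <#> V" "V <#> V \<subseteq> (\<Union>x\<in>F. x <# W0)"
    using compact_cover[OF compact_mult[OF V(1) V(1)] W0(1,2)] by blast
  have Fc: "F \<subseteq> carrier G" using F compact_carrier[OF compact_mult[OF V(1) V(1)]] by blast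
  obtain n t C where t: "\<And>i. i < n \<Longrightarrow> t i \<in> carrier G" and pr: "proper n t" and C: "compactin T C"
    and dec: "\<And>x. x \<in> generate Q (q ` F) \<Longrightarrow> \<exists>c\<in>C. \<exists>a\<in>Zn n. x = q c \<otimes>\<^bsub>Q\<^esub> tp n t a"
    using lattice_of_finite[OF F(1) Fc] by blast
  let ?Y = "{g \<in> carrier G. \<exists>x\<in>generate Q (q ` F). \<exists>v\<in>V. q g = x \<otimes>\<^bsub>Q\<^esub> q v}"
  have qFc: "q ` F \<subseteq> carrier Q" using Fc by auto
  have step: "y \<otimes> s \<in> ?Y" if "y \<in> ?Y" "s \<in> V" for y s
  proof -
    obtain x v where xv: "x \<in> generate Q (q ` F)" "v \<in> V" "q y = x \<otimes>\<^bsub>Q\<^esub> q v" "y \<in> carrier G" using \<open>y \<in> ?Y\<close> by blast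
    have "v \<otimes> s \<in> V <#> V" using xv that by (intro set_mult_memI)
    then obtain f w where fw: "f \<in> F" "w \<in> W0" "v \<otimes> s = f \<otimes> w" using F(3) by (auto simp: l_coset_def)
    have c: "v \<in> carrier G" "s \<in> carrier G" "f \<in> carrier G" "w \<in> carrier G" "x \<in> carrier Q"
      using xv that Vc Fc fw W0 V Q.generate_in_carrier[OF qFc] by auto
    have "q (y \<otimes> s) = x \<otimes>\<^bsub>Q\<^esub> q (v \<otimes> s)" using xv c by (simp add: Q.m_assoc)
    also have "\<dots> = (x \<otimes>\<^bsub>Q\<^esub> q f) \<otimes>\<^bsub>Q\<^esub> q w" unfolding fw using c by (simp add: Q.m_assoc)
    finally have e: "q (y \<otimes> s) = (x \<otimes>\<^bsub>Q\<^esub> q f) \<otimes>\<^bsub>Q\<^esub> q w" .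
    have "x \<otimes>\<^bsub>Q\<^esub> q f \<in> generate Q (q ` F)" using generate.eng[OF xv(1) generate.incl] fw(1) by blast
    moreover have "w \<in> V" using fw W0 V by blast
    ultimately show ?thesis using e xv(4) c by blast
  qed
  have "generate G S \<subseteq> ?Y"
  proof (rule generate_subset_right_closed)
    have "q \<one> = \<one>\<^bsub>Q\<^esub> \<otimes>\<^bsub>Q\<^esub> q \<one>" by simp
    then show "\<one> \<in> ?Y" using generate.one[of Q "q ` F"] V(3) by blast
    show "S \<subseteq> carrier G" by (rule S(1))
    show "?Y \<subseteq> carrier G" by blast
    fix y s assume ys: "y \<in> ?Y" "s \<in> S"
    have s: "s \<in> V" using ys V(2) by blast
    show "y \<otimes> s \<in> ?Y" by (rule step[OF ys(1) s])
    show "y \<otimes> inv s \<in> ?Y" by (rule step[OF ys(1) V(4)[OF s]])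
  qed
  then have Y: "carrier G \<subseteq> ?Y" unfolding S(3) .
  have "\<exists>c\<in>C <#> V. \<exists>a\<in>Zn n. q g = q c \<otimes>\<^bsub>Q\<^esub> tp n t a" if g: "g \<in> carrier G" for g
  proof -
    obtain x v where xv: "x \<in> generate Q (q ` F)" "v \<in> V" "q g = x \<otimes>\<^bsub>Q\<^esub> q v"
      using subsetD[OF Y g] by blast
    obtain c a where ca: "c \<in> C" "a \<in> Zn n" "x = q c \<otimes>\<^bsub>Q\<^esub> tp n t a" using dec[OF xv(1)] by blast
    have cc: "c \<in> carrier G" "v \<in> carrier G" using ca xv C Vc compact_carrier by blast+
    have tc: "\<And>i. i < n \<Longrightarrow> q (t i) \<in> carrier Q" using t by simp
    have "tp n t a \<in> carrier Q" using Q.tpow_closed[OF tc] by simp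
    then have "q g = q (c \<otimes> v) \<otimes>\<^bsub>Q\<^esub> tp n t a" using xv ca cc by (simp add: Q.m_ac)
    then show ?thesis using set_mult_memI[OF ca(1) xv(2)] ca(2) by blast
  qed
  then show ?thesis using t pr compact_mult[OF C V(1)] by blast
qed

end

section \<open>Extension of partial homomorphisms\<close>

text \<open>Hyers' argument: \<open>f (x^(2^k)) / 2^k\<close> converges because consecutive terms
  differ by at most \<open>D / 2^(k+1)\<close>. Commutativity lets powers distribute over products,
  so the defect disappears in the limit.\<close>

lemma (in comm_group) quasi_hom_close_to_hom:
  fixes f :: "'a \<Rightarrow> real"
  assumes D: "\<And>x y. x \<in> carrier G \<Longrightarrow> y \<in> carrier G \<Longrightarrow> \<bar>f (x \<otimes> y) - f x - f y\<bar> \<le> D"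
  shows "\<exists>\<phi>. (\<forall>x\<in>carrier G. \<forall>y\<in>carrier G. \<phi> (x \<otimes> y) = \<phi> x + \<phi> y) \<and> (\<forall>x\<in>carrier G. \<bar>\<phi> x - f x\<bar> \<le> D)"
proof -
  define g where "g k x = f (x [^] ((2::nat) ^ k)) / 2 ^ k" for k :: nat and x
  have D0: "0 \<le> D" using D[OF one_closed one_closed] by linarith
  have step: "\<bar>g (Suc k) x - g k x\<bar> \<le> D * (1/2) ^ Suc k" if x: "x \<in> carrier G" for k x
  proof -
    let ?y = "x [^] ((2::nat) ^ k)"
    have "x [^] ((2::nat) ^ Suc k) = ?y \<otimes> ?y" using x by (simp add: nat_pow_mult mult_2)
    then have "\<bar>f (x [^] ((2::nat) ^ Suc k)) - 2 * f ?y\<bar> \<le> D" using D[of ?y ?y] x by simp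
    moreover have "g (Suc k) x - g k x = (f (x [^] ((2::nat) ^ Suc k)) - 2 * f ?y) / 2 ^ Suc k"
      by (simp add: g_def field_simps)
    ultimately have "\<bar>g (Suc k) x - g k x\<bar> \<le> D / 2 ^ Suc k" by (simp add: abs_divide divide_right_mono del: power_Suc)
    then show ?thesis by (simp add: power_divide)
  qed
  have geo: "summable (\<lambda>k. D * (1/2::real) ^ Suc k)" by (intro summable_mult) (simp add: summable_geometric)
  have bd: "\<bar>g K x - g 0 x\<bar> \<le> D" if x: "x \<in> carrier G" for K x
  proof -
    have "\<bar>g K x - g 0 x\<bar> \<le> D * (1 - (1/2) ^ K)"
    proof (induction K)
      case (Suc K)
      have "\<bar>g (Suc K) x - g 0 x\<bar> \<le> D * (1/2) ^ Suc K + D * (1 - (1/2) ^ K)" using Suc step[OF x, of K] by linarith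
      also have "\<dots> = D * (1 - (1/2) ^ Suc K)" by (simp add: algebra_simps)
      finally show ?case .
    qed simp
    also have "\<dots> \<le> D * 1" using D0 by (intro mult_left_mono) auto
    finally show ?thesis by simp
  qed
  have conv: "convergent (\<lambda>k. g k x)" if x: "x \<in> carrier G" for x
  proof -
    have "summable (\<lambda>k. g (Suc k) x - g k x)"
      by (rule summable_comparison_test'[OF geo, of 0]) (use step[OF x] in simp)
    then have "convergent (\<lambda>n. \<Sum>k<n. g (Suc k) x - g k x)" by (simp add: summable_iff_convergent)
    moreover have "(\<lambda>n. \<Sum>k<n. g (Suc k) x - g k x) = (\<lambda>n. g n x - g 0 x)" 
    proof
      show "(\<Sum>k<n. g (Suc k) x - g k x) = g n x - g 0 x" for n by (induction n) auto
    qed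
    ultimately have "convergent (\<lambda>n. g n x - g 0 x)" by simp
    then have "convergent (\<lambda>n. (g n x - g 0 x) + g 0 x)" by (intro convergent_add convergent_const)
    then show ?thesis by simp
  qed
  define \<phi> where "\<phi> x = lim (\<lambda>k. g k x)" for x
  have lim: "(\<lambda>k. g k x) \<longlonglongrightarrow> \<phi> x" if "x \<in> carrier G" for x
    using conv[OF that] unfolding \<phi>_def by (simp add: convergent_LIMSEQ_iff)
  have "\<bar>\<phi> x - f x\<bar> \<le> D" if x: "x \<in> carrier G" for x
  proof -
    have "(\<lambda>k. \<bar>g k x - g 0 x\<bar>) \<longlonglongrightarrow> \<bar>\<phi> x - g 0 x\<bar>" using lim[OF x] by (intro tendsto_intros)
    then have "\<bar>\<phi> x - g 0 x\<bar> \<le> D" using bd[OF x] by (intro LIMSEQ_le_const2) auto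
    then show ?thesis using x by (simp add: g_def)
  qed
  moreover have "\<phi> (x \<otimes> y) = \<phi> x + \<phi> y" if x: "x \<in> carrier G" and y: "y \<in> carrier G" for x y
  proof -
    have b1: "\<bar>g k (x \<otimes> y) - g k x - g k y\<bar> \<le> D * (1/2) ^ k" for k
    proof -
      let ?m = "(2::nat) ^ k"
      have "(x \<otimes> y) [^] ?m = x [^] ?m \<otimes> y [^] ?m" using x y by (simp add: nat_pow_distrib)
      then have "\<bar>f ((x \<otimes> y) [^] ?m) - f (x [^] ?m) - f (y [^] ?m)\<bar> \<le> D" using D[of "x [^] ?m" "y [^] ?m"] x y by simp
      moreover have "g k (x \<otimes> y) - g k x - g k y = (f ((x \<otimes> y) [^] ?m) - f (x [^] ?m) - f (y [^] ?m)) / 2 ^ k"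
        by (simp add: g_def diff_divide_distrib)
      ultimately have "\<bar>g k (x \<otimes> y) - g k x - g k y\<bar> \<le> D / 2 ^ k" by (simp add: abs_divide divide_right_mono)
      then show ?thesis by (simp add: power_divide)
    qed
    have "(\<lambda>k. D * (1/2::real) ^ k) \<longlonglongrightarrow> D * 0" by (intro tendsto_mult tendsto_const LIMSEQ_power_zero) simp
    then have b2: "(\<lambda>k. D * (1/2::real) ^ k) \<longlonglongrightarrow> 0" by simp
    have "(\<lambda>k. g k (x \<otimes> y) - g k x - g k y) \<longlonglongrightarrow> 0"
      by (rule Lim_null_comparison[OF _ b2]) (rule always_eventually, use b1 in \<open>simp del: One_nat_def\<close>)
    moreover have "(\<lambda>k. g k (x \<otimes> y) - g k x - g k y) \<longlonglongrightarrow> \<phi> (x \<otimes> y) - \<phi> x - \<phi> y"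
      using lim x y by (intro tendsto_diff) auto
    ultimately have "\<phi> (x \<otimes> y) - \<phi> x - \<phi> y = 0" using LIMSEQ_unique by blast
    then show ?thesis by simp
  qed
  ultimately show ?thesis by blast
qed

section \<open>Additive characters and bounded generation by Baire category\<close>

context lc_grp
begin

lemma additive_one: "(\<And>x y. x \<in> carrier G \<Longrightarrow> y \<in> carrier G \<Longrightarrow> (c :: 'a \<Rightarrow> real) (x \<otimes> y) = c x + c y) \<Longrightarrow> c \<one> = 0"
  using one_closed r_one by (metis add_cancel_right_right)

lemma additive_inv:
  assumes "\<And>x y. x \<in> carrier G \<Longrightarrow> y \<in> carrier G \<Longrightarrow> (c :: 'a \<Rightarrow> real) (x \<otimes> y) = c x + c y" "x \<in> carrier G"
  shows "c (inv x) = - c x"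
  using assms(1)[of x "inv x"] assms(2) additive_one[of c, OF assms(1)] by simp

lemma additive_pow:
  assumes "\<And>x y. x \<in> carrier G \<Longrightarrow> y \<in> carrier G \<Longrightarrow> (c :: 'a \<Rightarrow> real) (x \<otimes> y) = c x + c y" "x \<in> carrier G"
  shows "c (x [^] (k::nat)) = real k * c x"
  by (induction k) (use assms additive_one[of c, OF assms(1)] in \<open>auto simp: algebra_simps\<close>)

text \<open>On the open set of \<open>u\<close> with \<open>u^m\<close> in \<open>W\<close>, the
  absolute value of \<open>c\<close> is at most \<open>M / m\<close>. This gives continuity at the
  identity and, by translation, everywhere.\<close>

lemma bounded_additive_continuous:
  assumes add: "\<And>x y. x \<in> carrier G \<Longrightarrow> y \<in> carrier G \<Longrightarrow> (c :: 'a \<Rightarrow> real) (x \<otimes> y) = c x + c y"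
    and W: "openin T W" "\<one> \<in> W" "\<And>x. x \<in> W \<Longrightarrow> \<bar>c x\<bar> \<le> M"
  shows "continuous_map T euclideanreal c"
proof -
  have pow: "continuous_map T T (\<lambda>x. x [^] (m::nat))" for m
  proof (induction m)
    case 0 then show ?case by (simp add: topspace)
  next
    case (Suc m)
    have "continuous_map T T (\<lambda>x. x)" using continuous_map_id by (simp add: id_def)
    then show ?case using cont_mult[OF Suc] by simp
  qed
  have M0: "0 \<le> M" using W(3)[OF W(2)] by linarith
  have "openin T {x \<in> topspace T. c x \<in> U}" if U: "open U" for U
  proof (subst openin_subopen, intro ballI)
    fix x assume x: "x \<in> {x \<in> topspace T. c x \<in> U}"
    then have xc: "x \<in> carrier G" "c x \<in> U" by (auto simp: topspace)
    obtain e where e: "e > 0" "\<And>y. dist y (c x) < e \<Longrightarrow> y \<in> U" using U xc(2) unfolding open_dist by blast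
    obtain m :: nat where m: "M / e < real m" using reals_Archimedean2 by blast
    have m0: "real m > 0" using m M0 e(1) by (smt (verit) divide_nonneg_pos)
    let ?O = "{u \<in> topspace T. u [^] m \<in> W}"
    have O: "openin T ?O" using pow W(1) by (rule openin_continuous_map_preimage)
    have small: "\<bar>c u\<bar> < e" if "u \<in> ?O" for u
    proof -
      have "u \<in> carrier G" using that by (simp add: topspace)
      then have "real m * \<bar>c u\<bar> \<le> M" using W(3)[of "u [^] m"] that additive_pow[of c u m, OF add] by (simp add: abs_mult)
      then have "\<bar>c u\<bar> \<le> M / real m" using m0 by (simp add: field_simps)
      also have "\<dots> < e" using m m0 e(1) by (simp add: field_simps)
      finally show ?thesis .
    qed
    show "\<exists>Ta. openin T Ta \<and> x \<in> Ta \<and> Ta \<subseteq> {x \<in> topspace T. c x \<in> U}"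
    proof (intro exI conjI)
      show "openin T (x <# ?O)" using open_translate O xc by blast
      have "x = x \<otimes> \<one>" using xc by simp
      moreover have "\<one> \<in> ?O" using W(2) by (simp add: topspace)
      ultimately show "x \<in> x <# ?O" unfolding l_coset_def by blast
      show "x <# ?O \<subseteq> {x \<in> topspace T. c x \<in> U}"
      proof
        fix y assume "y \<in> x <# ?O"
        then obtain u where u: "u \<in> ?O" "y = x \<otimes> u" by (auto simp: l_coset_def)
        then have uc: "u \<in> carrier G" by (simp add: topspace)
        have "dist (c y) (c x) < e" using small[OF u(1)] u add[OF xc(1) uc] by (simp add: dist_real_def)
        then show "y \<in> {x \<in> topspace T. c x \<in> U}" using e u xc uc by (simp add: topspace)
      qed
    qed
  qed
  then show ?thesis by (auto simp: continuous_map_def)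
qed

text \<open>Upgrades generation to generation with bounded length. \<open>N\<close> is a countable
  union of compact sets of products, so one of them has interior in \<open>N\<close> by the Baire
  category theorem, and finitely many translates of this interior cover \<open>L\<close>.\<close>

theorem compact_subset_prodn:
  assumes N: "subgroup N G" "closedin T N" and L: "compactin T L" "L \<subseteq> N"
    and Y: "\<And>j. compactin T (Y j)" "\<And>j. Y j \<subseteq> N" "\<And>j. \<one> \<in> Y j" "\<And>j y. y \<in> Y j \<Longrightarrow> inv y \<in> Y j"
    "\<And>i j. i \<le> j \<Longrightarrow> Y i \<subseteq> Y j"
    and gen: "N \<subseteq> generate G (\<Union>j. Y j)"
  shows "\<exists>j. L \<subseteq> prodn G (Y j) j"
proof -
  define X where "X j = prodn G (Y j) j" for j
  have Nc: "N \<subseteq> carrier G" using N subgroup.subset by blast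
  have Yc: "Y j \<subseteq> carrier G" for j using Y(2) Nc by blast
  have Xmono: "prodn G (Y i) k \<subseteq> X j" if "i \<le> j" "k \<le> j" for i j k
    unfolding X_def using prodn_mono[OF Y(5)[OF that(1)], of k] prodn_le[OF Yc Y(3) that(2), of j] by blast
  have XN: "X j \<subseteq> N" for j
  proof -
    have "generate G (Y j) \<subseteq> N" using generate_subgroup_incl[OF Y(2) N(1)] .
    then show ?thesis unfolding X_def using prodn_subset_generate[OF Yc] by blast
  qed
  have Xmul: "x \<otimes> y \<in> X (i + j)" if "x \<in> X i" "y \<in> X j" for x y i j
  proof -
    have "x \<in> prodn G (Y (i + j)) i" "y \<in> prodn G (Y (i + j)) j"
      using that prodn_mono[OF Y(5)] unfolding X_def by (meson le_add1 le_add2 subsetD)+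
    then show ?thesis unfolding X_def using prodn_add[OF Yc] by blast
  qed
  have Xinv: "inv x \<in> X j" if "x \<in> X j" for x j using prodn_inv[OF Yc Y(4)] that unfolding X_def by blast
  have XU: "N = (\<Union>j. X j)"
  proof
    show "N \<subseteq> (\<Union>j. X j)"
    proof
      fix x assume "x \<in> N"
      then have "x \<in> generate G (\<Union>j. Y j)" using gen by blast
      then show "x \<in> (\<Union>j. X j)"
      proof induction
        case one
        have "\<one> \<in> X 0" by (simp add: X_def)
        then show ?case by blast
      next
        case (incl h)
        then obtain j where "h \<in> Y j" by blast
        then have "h \<in> X (Suc j)" using Xmono[of j "Suc j" 1] prodn_1[OF Yc] by auto
        then show ?case by blast
      next
        case (inv h)
        then obtain j where "inv h \<in> Y j" using Y(4) by blast
        then have "inv h \<in> X (Suc j)" using Xmono[of j "Suc j" 1] prodn_1[OF Yc] by auto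
        then show ?case by blast
      next
        case (eng h1 h2) then show ?case using Xmul by blast
      qed
    qed
  qed (use XN in blast)
  have Xcomp: "compactin T (X j)" for j unfolding X_def using compact_prodn Y(1) by blast
  let ?T = "subtopology T N"
  have topN: "topspace ?T = N" using Nc topspace by auto
  have "\<exists>j. ?T interior_of X j \<noteq> {}"
  proof (rule ccontr)
    assume "\<nexists>j. ?T interior_of X j \<noteq> {}"
    then have e: "?T interior_of X j = {}" for j by blast
    have H: "Hausdorff_space ?T" using Haus Hausdorff_space_subtopology by blast
    have lcs: "locally_compact_space ?T" using loc_compact N(2) locally_compact_space_closed_subset by blast
    have "?T interior_of (\<Union>(range X)) = {}"
    proof (rule Baire_category_alt)
      show "completely_metrizable_space ?T \<or> locally_compact_space ?T \<and> regular_space ?T"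
        using lcs H locally_compact_Hausdorff_imp_regular_space by blast
      fix S assume "S \<in> range X"
      then obtain j where "S = X j" by blast
      then show "closedin ?T S \<and> ?T interior_of S = {}"
        using e closedin_subset_topspace[OF compact_closed[OF Xcomp] XN] by blast
    qed simp
    moreover have "\<Union>(range X) = topspace ?T" using XU topN by simp
    ultimately have "N = {}" using topN by (metis interior_of_topspace)
    then show False using subgroup.one_closed[OF N(1)] by blast
  qed
  then obtain j where "?T interior_of X j \<noteq> {}" by blast
  then obtain U o' where U: "openin T U" "o' \<in> N \<inter> U" "N \<inter> U \<subseteq> X j"
    unfolding interior_of_def openin_subtopology by auto
  have oc: "o' \<in> carrier G" using U Nc by blast
  \<comment> \<open>Moving the interior point \<open>o'\<close> to the identity costs the two
    factors \<open>inv o'\<close> and \<open>u\<close>, both in \<open>X j\<close>; hence the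
    summand \<open>j + j\<close> in \<open>J\<close>.\<close>
  let ?O = "inv o' <# U"
  have O: "openin T ?O" "\<one> \<in> ?O" using open_translate U oc by (auto simp: l_coset_def intro!: bexI[of _ o'])
  obtain F where F: "finite F" "F \<subseteq> L" "L \<subseteq> (\<Union>x\<in>F. x <# ?O)" using compact_cover[OF L(1) O] by blast
  have "\<forall>x\<in>F. \<exists>i. x \<in> X i" using F(2) L(2) XU by blast
  then obtain ix where ix: "\<And>x. x \<in> F \<Longrightarrow> x \<in> X (ix x)" by metis
  define J where "J = Max (insert 0 (ix ` F)) + (j + j)"
  have "L \<subseteq> X J"
  proof
    fix l assume l: "l \<in> L"
    then obtain x where x: "x \<in> F" "l \<in> x <# ?O" using F(3) by blast
    then obtain u where u: "u \<in> U" "l = x \<otimes> (inv o' \<otimes> u)" by (auto simp: l_coset_def)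
    have xN: "x \<in> N" "l \<in> N" "o' \<in> N" using x F(2) L(2) l U by auto
    have uc: "u \<in> carrier G" using u openin_subset[OF U(1)] topspace by auto
    have "u = o' \<otimes> (inv x \<otimes> l)" using u xN Nc uc by (auto simp: m_assoc subset_iff)
    then have "u \<in> N" using xN N(1) by (simp add: subgroup.m_closed subgroup.m_inv_closed)
    then have uX: "u \<in> X j" using u U by blast
    have "inv o' \<in> X j" using U Xinv by blast
    then have "l \<in> X (ix x + (j + j))" using u ix[OF x(1)] Xmul uX by metis
    moreover have "ix x + (j + j) \<le> J" unfolding J_def using F(1) x(1) by simp
    ultimately show "l \<in> X J" using Xmono[of "ix x + (j + j)" J "ix x + (j + j)"] unfolding X_def[of "ix x + (j + j)"] by blast
  qed
  then show ?thesis unfolding X_def by blast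
qed

end

context lc_ab
begin

text \<open>Compact presentability of \<open>Q\<close> in functional form. \<open>D\<close> is
  chosen before the target \<open>A\<close>, so that it serves for groups constructed later. The
  extension splits an element into a transversal part and a lattice point, then applies
  \<open>f\<close> to the former and to the generators of the latter.\<close>

theorem extend_partial_hom:
  assumes cg: "compactly_generated G T" and L: "compactin T L"
  shows "\<exists>D. compactin T D \<and> L \<subseteq> D \<and> (\<forall>(A::('e,'f) monoid_scheme) f. comm_group A \<longrightarrow> f ` D \<subseteq> carrier A \<longrightarrow>
    (\<forall>x\<in>D. \<forall>y\<in>D. \<forall>z\<in>D. q x \<otimes>\<^bsub>Q\<^esub> q y = q z \<longrightarrow> f x \<otimes>\<^bsub>A\<^esub> f y = f z) \<longrightarrow>
    (\<exists>F\<in>hom G A. (\<forall>g\<in>carrier G. q g = \<one>\<^bsub>Q\<^esub> \<longrightarrow> F g = \<one>\<^bsub>A\<^esub>) \<and> (\<forall>x\<in>L. F x = f x)))"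
proof -
  obtain n t C where t: "\<And>i. i < n \<Longrightarrow> t i \<in> carrier G" and pr: "proper n t" and C: "compactin T C"
    and dec: "\<And>g. g \<in> carrier G \<Longrightarrow> \<exists>c\<in>C. \<exists>a\<in>Zn n. q g = q c \<otimes>\<^bsub>Q\<^esub> tp n t a"
    using lattice_exists[OF cg] by blast
  have tc: "\<And>i. i < n \<Longrightarrow> q (t i) \<in> carrier Q" using t by simp
  have tpc [simp]: "tp n t a \<in> carrier Q" for a using Q.tpow_closed[OF tc] by simp
  have "compactin T (t ` {..<n})" using t by (intro compact_finite) auto
  then obtain B where B: "compactin T B" "C \<union> L \<union> t ` {..<n} \<subseteq> B" "\<one> \<in> B" "\<And>v. v \<in> B \<Longrightarrow> inv v \<in> B"
    using compact_symmetric[OF compactin_Un[OF compactin_Un[OF C L]]] by metis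
  have Bc: "B \<subseteq> carrier G" using B compact_carrier by blast
  \<comment> \<open>The lattice points by which two decompositions of one element can differ: the
    transversal parts lie in twofold products, so their quotient lies in a fourfold one.\<close>
  define A1 where "A1 = {a \<in> Zn n. tp n t a \<in> q ` prodn G B 4}"
  have fA1: "finite A1" unfolding A1_def using pr compact_prodn[OF B(1)] unfolding proper_def by blast
  define M where "M = (\<Sum>a\<in>A1. \<Sum>i<n. \<bar>a i\<bar>)"
  have M: "\<bar>a i\<bar> \<le> M" if "a \<in> A1" "i < n" for a i
  proof -
    have "\<bar>a i\<bar> \<le> (\<Sum>i<n. \<bar>a i\<bar>)" using that by (intro member_le_sum) auto
    also have "\<dots> \<le> M" unfolding M_def using that fA1 by (intro member_le_sum) (auto simp: sum_nonneg)
    finally show ?thesis .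
  qed
  have M0: "0 \<le> M" unfolding M_def by (intro sum_nonneg) auto
  \<comment> \<open>\<open>P1\<close> and \<open>P2\<close> hold the partial products and the powers
    met in spelling a lattice point of \<open>A1\<close>, so that \<open>f\<close> can be evaluated
    along the way.\<close>
  define P1 where "P1 = (\<lambda>(j, a). tpow G t j a) ` ({..n} \<times> A1)"
  define P2 where "P2 = (\<lambda>(j, k). t j [^] (k::int)) ` ({..<n} \<times> {-M..M})"
  define D where "D = prodn G B 2 \<union> P1 \<union> P2"
  have "finite P1" "finite P2" unfolding P1_def P2_def using fA1 by auto
  moreover have "P1 \<subseteq> carrier G" "P2 \<subseteq> carrier G" unfolding P1_def P2_def using t by (auto intro!: tpow_closed)
  ultimately have Dcomp: "compactin T D" unfolding D_def
    using compact_prodn[OF B(1)] compact_finite by (simp add: compactin_Un)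
  have Dc: "D \<subseteq> carrier G" using Dcomp compact_carrier by blast
  have BD: "prodn G B 2 \<subseteq> D" unfolding D_def by blast
  have B2: "B \<subseteq> prodn G B 2" using prodn_le[OF Bc B(3), of 1 2] prodn_1[OF Bc] by simp
  have LD: "L \<subseteq> D" using B(2) B2 BD by blast
  have main: "\<exists>F\<in>hom G A. (\<forall>g\<in>carrier G. q g = \<one>\<^bsub>Q\<^esub> \<longrightarrow> F g = \<one>\<^bsub>A\<^esub>) \<and> (\<forall>x\<in>L. F x = f x)"
    if "comm_group A" and fD: "f ` D \<subseteq> carrier A"
      and part: "\<And>x y z. x \<in> D \<Longrightarrow> y \<in> D \<Longrightarrow> z \<in> D \<Longrightarrow> q x \<otimes>\<^bsub>Q\<^esub> q y = q z \<Longrightarrow> f x \<otimes>\<^bsub>A\<^esub> f y = f z"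
    for A :: "('e,'f) monoid_scheme" and f
  proof -
    interpret A: comm_group A by fact
    have fc: "x \<in> D \<Longrightarrow> f x \<in> carrier A" for x using fD by blast
    have one_D: "\<one> \<in> D" using B(3) B2 BD by blast
    have f1: "f \<one> = \<one>\<^bsub>A\<^esub>" using part[OF one_D one_D one_D] fc[OF one_D] by (simp add: A.l_cancel_one')
    have ftc: "\<And>i. i < n \<Longrightarrow> f (t i) \<in> carrier A" using fc B(2) B2 BD by blast
    have P2D: "t j [^] k \<in> D" if "j < n" "\<bar>k\<bar> \<le> M" for j k
      using imageI[of "(j, k)" "{..<n} \<times> {-M..M}" "\<lambda>(j, k). t j [^] k"] that by (auto simp: D_def P2_def abs_le_iff)
    have fpow_nat: "f (t j [^] int k) = f (t j) [^]\<^bsub>A\<^esub> int k" if "j < n" "int k \<le> M" for j k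
      using that(2)
    proof (induction k)
      case 0 then show ?case using f1 by simp
    next
      case (Suc k)
      have "t j \<in> B" using that(1) B(2) by blast
      then have "t j \<in> D" using B2 BD by blast
      then have d: "t j [^] int k \<in> D" "t j [^] int (Suc k) \<in> D" "t j \<in> D"
        using Suc.prems that(1) P2D[of j "int k"] P2D[of j "int (Suc k)"] by auto
      have e: "t j [^] int (Suc k) = t j [^] int k \<otimes> t j"
        using t[OF that(1)] int_pow_mult[of "t j" "int k" 1] by (simp add: add.commute)
      have "f (t j [^] int (Suc k)) = f (t j [^] int k) \<otimes>\<^bsub>A\<^esub> f (t j)"
        using part[OF d(1,3,2)] e t[OF that(1)] by (metis int_pow_closed q_mult)
      also have "\<dots> = f (t j) [^]\<^bsub>A\<^esub> int (Suc k)"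
        using Suc ftc[OF that(1)] A.int_pow_mult[of "f (t j)" "int k" 1] by (simp add: add.commute)
      finally show ?case .
    qed
    have fpow: "f (t j [^] k) = f (t j) [^]\<^bsub>A\<^esub> k" if "j < n" "\<bar>k\<bar> \<le> M" for j k
    proof (cases "k \<ge> 0")
      case True then show ?thesis using fpow_nat[OF that(1), of "nat k"] that by simp
    next
      case False
      have d: "t j [^] (- k) \<in> D" "t j [^] k \<in> D" using P2D[OF that] P2D[of j "- k"] that by auto
      have "f (t j [^] k) \<otimes>\<^bsub>A\<^esub> f (t j [^] (- k)) = f \<one>"
        by (rule part[OF d(2,1) one_D]) (use t[OF that(1)] in \<open>simp flip: Q.int_pow_mult\<close>)
      then have "f (t j [^] k) = inv\<^bsub>A\<^esub> (f (t j [^] (- k)))" using f1 fc d by (metis A.inv_equality)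
      also have "f (t j [^] (- k)) = f (t j) [^]\<^bsub>A\<^esub> (- k)" using fpow_nat[OF that(1), of "nat (- k)"] that False by simp
      finally show ?thesis using ftc[OF that(1)] by (simp add: A.int_pow_neg)
    qed
    define tA where "tA a = tpow A (\<lambda>i. f (t i)) n a" for a
    have tAc [simp]: "tA a \<in> carrier A" for a unfolding tA_def using A.tpow_closed[OF ftc] by simp
    have tA_add: "tA (\<lambda>i. a i + b i) = tA a \<otimes>\<^bsub>A\<^esub> tA b" for a b
      unfolding tA_def using A.tpow_add[of n "\<lambda>i. f (t i)" a b, OF ftc] by simp
    have tA0: "tA (\<lambda>_. 0) = \<one>\<^bsub>A\<^esub>" unfolding tA_def using A.tpow_0[OF ftc] by simp
    have ft: "f (tpow G t n a) = tA a" if a: "a \<in> A1" for a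
    proof -
      have "f (tpow G t j a) = tpow A (\<lambda>i. f (t i)) j a" if "j \<le> n" for j
        using that
      proof (induction j)
        case 0 then show ?case using f1 by simp
      next
        case (Suc j)
        have P1: "tpow G t i a \<in> D" if "i \<le> n" for i unfolding D_def P1_def using a that by force
        have d: "tpow G t j a \<in> D" "tpow G t (Suc j) a \<in> D" "t j [^] a j \<in> D"
          using P1[of j] P1[of "Suc j"] Suc.prems P2D[of j "a j"] M[OF a, of j] by auto
        have cl: "tpow G t j a \<in> carrier G" "t j \<in> carrier G" using t Suc.prems by (auto intro: tpow_closed)
        have "f (tpow G t (Suc j) a) = f (tpow G t j a) \<otimes>\<^bsub>A\<^esub> f (t j [^] a j)"
          by (rule part[OF d(1,3,2), symmetric]) (use cl in simp)
        then show ?case using Suc fpow[of j "a j"] M[OF a, of j] by simp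
      qed
      then show ?thesis unfolding tA_def by simp
    qed
    \<comment> \<open>Independence of the decomposition: two lattice parts differ by an element of
      \<open>A1\<close>, where \<open>f\<close> and \<open>tA\<close> agree.\<close>
    have key: "f c \<otimes>\<^bsub>A\<^esub> tA a = f c' \<otimes>\<^bsub>A\<^esub> tA a'"
      if c: "c \<in> prodn G B 2" "c' \<in> prodn G B 2" and a: "a \<in> Zn n" "a' \<in> Zn n"
        and e: "q c \<otimes>\<^bsub>Q\<^esub> tp n t a = q c' \<otimes>\<^bsub>Q\<^esub> tp n t a'" for c c' a a'
    proof -
      let ?b = "\<lambda>i. a' i - a i"
      have cc: "c \<in> carrier G" "c' \<in> carrier G" using c prodn_carrier[OF Bc] by blast+
      have tb: "tp n t ?b = inv\<^bsub>Q\<^esub> (q c') \<otimes>\<^bsub>Q\<^esub> q c"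
      proof -
        have "inv\<^bsub>Q\<^esub> (q c') \<otimes>\<^bsub>Q\<^esub> q c = inv\<^bsub>Q\<^esub> (q c') \<otimes>\<^bsub>Q\<^esub> (q c \<otimes>\<^bsub>Q\<^esub> tp n t a) \<otimes>\<^bsub>Q\<^esub> inv\<^bsub>Q\<^esub> (tp n t a)"
          using cc by (simp add: Q.m_assoc)
        also have "\<dots> = tp n t a' \<otimes>\<^bsub>Q\<^esub> inv\<^bsub>Q\<^esub> (tp n t a)" unfolding e using cc by (simp flip: Q.m_assoc)
        also have "\<dots> = tp n t ?b" using Q.tpow_diff[of n "\<lambda>i. q (t i)" a' a, OF tc] by simp
        finally show ?thesis by simp
      qed
      have "inv c' \<otimes> c \<in> prodn G B (2 + 2)" using c prodn_inv[OF Bc B(4)] by (intro prodn_add[OF Bc]) auto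
      then have "tp n t ?b \<in> q ` prodn G B 4" using tb cc by (intro image_eqI[of _ _ "inv c' \<otimes> c"]) auto
      then have bA: "?b \<in> A1" unfolding A1_def using a by auto
      let ?d = "tpow G t n ?b"
      have dD: "?d \<in> D" unfolding D_def P1_def using bA by force
      have "f c' \<otimes>\<^bsub>A\<^esub> f ?d = f c"
      proof (rule part)
        show "q c' \<otimes>\<^bsub>Q\<^esub> q ?d = q c" using q_tpow[of n t ?b, OF t] tb cc by simp
      qed (use c BD dD in auto)
      then have "f c \<otimes>\<^bsub>A\<^esub> tA a = f c' \<otimes>\<^bsub>A\<^esub> tA ?b \<otimes>\<^bsub>A\<^esub> tA a" using ft[OF bA] by simp
      also have "\<dots> = f c' \<otimes>\<^bsub>A\<^esub> (tA ?b \<otimes>\<^bsub>A\<^esub> tA a)" using fc[OF subsetD[OF BD c(2)]] by (simp add: A.m_assoc)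
      also have "tA ?b \<otimes>\<^bsub>A\<^esub> tA a = tA a'" using tA_add[of ?b a] by simp
      finally show ?thesis .
    qed
    have "\<forall>g. \<exists>c a. g \<in> carrier G \<longrightarrow> c \<in> C \<and> a \<in> Zn n \<and> q g = q c \<otimes>\<^bsub>Q\<^esub> tp n t a" using dec by blast
    then obtain cg ag where ca: "\<And>g. g \<in> carrier G \<Longrightarrow> cg g \<in> C \<and> ag g \<in> Zn n \<and> q g = q (cg g) \<otimes>\<^bsub>Q\<^esub> tp n t (ag g)"
      by metis
    have cg2: "cg g \<in> prodn G B 2" "cg g \<in> B" if "g \<in> carrier G" for g using ca[OF that] B(2) B2 by auto
    define F where "F g = f (cg g) \<otimes>\<^bsub>A\<^esub> tA (ag g)" for g
    have Fkey: "F g = f c \<otimes>\<^bsub>A\<^esub> tA a" if "g \<in> carrier G" "c \<in> prodn G B 2" "a \<in> Zn n" "q g = q c \<otimes>\<^bsub>Q\<^esub> tp n t a" for g c a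
      unfolding F_def using ca[OF that(1)] that by (intro key) (auto simp: cg2)
    have "F \<in> hom G A"
    proof (rule homI)
      fix g assume "g \<in> carrier G"
      then have "f (cg g) \<in> carrier A" using fc[OF subsetD[OF BD cg2(1)]] by blast
      then show "F g \<in> carrier A" unfolding F_def by simp
    next
      fix g h assume gh: "g \<in> carrier G" "h \<in> carrier G"
      have cc: "cg g \<in> carrier G" "cg h \<in> carrier G" using cg2 gh Bc by blast+
      have c2: "cg g \<otimes> cg h \<in> prodn G B 2"
        using prodn_add[OF Bc, of "cg g" 1 "cg h" 1] cg2 gh prodn_1[OF Bc] by (simp add: numeral_2_eq_2)
      have "q (g \<otimes> h) = q (cg g \<otimes> cg h) \<otimes>\<^bsub>Q\<^esub> tp n t (\<lambda>i. ag g i + ag h i)"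
        using ca[OF gh(1)] ca[OF gh(2)] gh cc Q.tpow_add[of n "\<lambda>i. q (t i)" "ag g" "ag h", OF tc] by (simp add: Q.m_ac)
      then have "F (g \<otimes> h) = f (cg g \<otimes> cg h) \<otimes>\<^bsub>A\<^esub> tA (\<lambda>i. ag g i + ag h i)"
        using gh ca by (intro Fkey c2) auto
      also have "f (cg g \<otimes> cg h) = f (cg g) \<otimes>\<^bsub>A\<^esub> f (cg h)"
        by (rule part[symmetric]) (use cg2 gh BD c2 cc in auto)
      finally show "F (g \<otimes> h) = F g \<otimes>\<^bsub>A\<^esub> F h"
        unfolding F_def tA_add using fc cg2(1)[OF gh(1)] cg2(1)[OF gh(2)] BD by (auto simp: A.m_ac subset_iff)
    qed
    moreover have "F g = \<one>\<^bsub>A\<^esub>" if g: "g \<in> carrier G" "q g = \<one>\<^bsub>Q\<^esub>" for g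
    proof -
      have "q g = q \<one> \<otimes>\<^bsub>Q\<^esub> tp n t (\<lambda>_. 0)" using g Q.tpow_0[of n "\<lambda>i. q (t i)", OF tc] by simp
      then have "F g = f \<one> \<otimes>\<^bsub>A\<^esub> tA (\<lambda>_. 0)" using g B(3) B2 by (intro Fkey) auto
      then show ?thesis using f1 tA0 by simp
    qed
    moreover have "F x = f x" if x: "x \<in> L" for x
    proof -
      have xc: "x \<in> carrier G" "x \<in> prodn G B 2" using x LD Dc B(2) B2 by blast+
      have "q x = q x \<otimes>\<^bsub>Q\<^esub> tp n t (\<lambda>_. 0)" using xc Q.tpow_0[of n "\<lambda>i. q (t i)", OF tc] by simp
      then have "F x = f x \<otimes>\<^bsub>A\<^esub> tA (\<lambda>_. 0)" using xc by (intro Fkey) auto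
      then show ?thesis using tA0 fc x LD by auto
    qed
    ultimately show ?thesis by blast
  qed
  show ?thesis
  proof (intro exI[of _ D] conjI allI impI Dcomp LD)
    fix A :: "('e,'f) monoid_scheme" and f
    assume a: "comm_group A" "f ` D \<subseteq> carrier A"
      and p: "\<forall>x\<in>D. \<forall>y\<in>D. \<forall>z\<in>D. q x \<otimes>\<^bsub>Q\<^esub> q y = q z \<longrightarrow> f x \<otimes>\<^bsub>A\<^esub> f y = f z"
    show "\<exists>F\<in>hom G A. (\<forall>g\<in>carrier G. q g = \<one>\<^bsub>Q\<^esub> \<longrightarrow> F g = \<one>\<^bsub>A\<^esub>) \<and> (\<forall>x\<in>L. F x = f x)"
      by (rule main[OF a]) (rule p[rule_format])
  qed
qed

text \<open>The \<open>i\<close>-th lattice coordinate of a chosen decomposition is additive up to a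
  bounded error, hence close to a homomorphism. On the lattice the deviation is both additive and
  bounded, so it vanishes there.\<close>

theorem coordinate_characters:
  assumes t: "\<And>i. i < n \<Longrightarrow> t i \<in> carrier G" and pr: "proper n t" and C: "compactin T C"
    and dec: "\<And>g. g \<in> carrier G \<Longrightarrow> \<exists>c\<in>C. \<exists>a\<in>Zn n. q g = q c \<otimes>\<^bsub>Q\<^esub> tp n t a"
    and i: "i < n"
  shows "\<exists>\<phi> :: 'a \<Rightarrow> real. (\<forall>x\<in>carrier G. \<forall>y\<in>carrier G. \<phi> (x \<otimes> y) = \<phi> x + \<phi> y) \<and> continuous_map T euclideanreal \<phi> \<and>
    (\<forall>b\<in>Zn n. \<phi> (tpow G t n b) = real_of_int (b i))"
proof -
  have tc: "\<And>i. i < n \<Longrightarrow> q (t i) \<in> carrier Q" using t by simp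
  have tpc [simp]: "tp n t a \<in> carrier Q" for a using Q.tpow_closed[OF tc] by simp
  note tpd = Q.tpow_diff[of n "\<lambda>i. q (t i)", OF tc] and tpa = Q.tpow_add[of n "\<lambda>i. q (t i)", OF tc]
  obtain W0 V0 where W0: "openin T W0" "\<one> \<in> W0" "W0 \<subseteq> V0" "compactin T V0" using compact_nbhd_one by blast
  obtain B where B: "compactin T B" "V0 \<union> C \<subseteq> B" "\<one> \<in> B" "\<And>v. v \<in> B \<Longrightarrow> inv v \<in> B"
    using compact_symmetric[OF compactin_Un[OF W0(4) C]] by blast
  have Bc: "B \<subseteq> carrier G" using B compact_carrier by blast
  define A1 where "A1 = {a \<in> Zn n. tp n t a \<in> q ` prodn G B 3}"
  have fA1: "finite A1" unfolding A1_def using pr compact_prodn[OF B(1)] unfolding proper_def by blast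
  define M where "M = (\<Sum>a\<in>A1. \<bar>a i\<bar>)"
  have M: "\<bar>real_of_int (a i)\<bar> \<le> real_of_int M" if "a \<in> A1" for a
  proof -
    have "\<bar>a i\<bar> \<le> M" unfolding M_def using that fA1 by (intro member_le_sum) auto
    then show ?thesis by linarith
  qed
  have B3: "x \<otimes> y \<otimes> z \<in> prodn G B 3" if "x \<in> B" "y \<in> B" "z \<in> B" for x y z
    using prodn_add[OF Bc prodn_add[OF Bc, of x 1 y 1], of z 1] prodn_1[OF Bc] that by (simp add: numeral_3_eq_3)
  have B32: "x \<otimes> y \<in> prodn G B 3" if "x \<in> B" "y \<in> B" for x y
    using B3[OF that B(3)] that Bc by (metis r_one subsetD m_closed)
  have "\<exists>c a. x \<in> carrier Q \<longrightarrow> c \<in> C \<and> a \<in> Zn n \<and> x = q c \<otimes>\<^bsub>Q\<^esub> tp n t a" for x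
  proof (cases "x \<in> carrier Q")
    case True
    then obtain g where "g \<in> carrier G" "x = q g" using q_surj by blast
    then show ?thesis using dec[of g] by blast
  qed simp
  then obtain cq aq where ca: "\<And>x. x \<in> carrier Q \<Longrightarrow> cq x \<in> C \<and> aq x \<in> Zn n \<and> x = q (cq x) \<otimes>\<^bsub>Q\<^esub> tp n t (aq x)" by metis
  have cB: "cq x \<in> B" "cq x \<in> carrier G" if "x \<in> carrier Q" for x using ca[OF that] B(2) Bc by blast+
  have tq: "tp n t (aq x) = inv\<^bsub>Q\<^esub> (q (cq x)) \<otimes>\<^bsub>Q\<^esub> x" if x: "x \<in> carrier Q" for x
  proof -
    have "inv\<^bsub>Q\<^esub> (q (cq x)) \<otimes>\<^bsub>Q\<^esub> (q (cq x) \<otimes>\<^bsub>Q\<^esub> tp n t (aq x)) = tp n t (aq x)" using cB[OF x] by simp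
    then show ?thesis using ca[OF x] by simp
  qed
  \<comment> \<open>The error vector is a lattice point in a threefold product of \<open>B\<close>,
    with one factor for each of the three transversal elements involved.\<close>
  have defect: "\<bar>real_of_int (aq (x \<otimes>\<^bsub>Q\<^esub> y) i) - real_of_int (aq x i) - real_of_int (aq y i)\<bar> \<le> real_of_int M"
    if x: "x \<in> carrier Q" and y: "y \<in> carrier Q" for x y
  proof -
    let ?b = "\<lambda>i. aq (x \<otimes>\<^bsub>Q\<^esub> y) i - aq x i - aq y i"
    have xy: "x \<otimes>\<^bsub>Q\<^esub> y \<in> carrier Q" using x y by simp
    have "tp n t ?b = tp n t (aq (x \<otimes>\<^bsub>Q\<^esub> y)) \<otimes>\<^bsub>Q\<^esub> inv\<^bsub>Q\<^esub> (tp n t (aq x)) \<otimes>\<^bsub>Q\<^esub> inv\<^bsub>Q\<^esub> (tp n t (aq y))"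
      by (simp add: tpd)
    also have "\<dots> = q (inv (cq (x \<otimes>\<^bsub>Q\<^esub> y)) \<otimes> cq x \<otimes> cq y)"
    proof -
      have c4: "x \<otimes>\<^bsub>Q\<^esub> (y \<otimes>\<^bsub>Q\<^esub> (inv\<^bsub>Q\<^esub> x \<otimes>\<^bsub>Q\<^esub> (inv\<^bsub>Q\<^esub> y \<otimes>\<^bsub>Q\<^esub> z))) = z" if "z \<in> carrier Q" for z
        using x y that Q.m_lcomm[of y "inv\<^bsub>Q\<^esub> x" "inv\<^bsub>Q\<^esub> y \<otimes>\<^bsub>Q\<^esub> z"] by simp
      show ?thesis
        unfolding tq[OF xy] tq[OF x] tq[OF y] using cB[OF xy] cB[OF x] cB[OF y] x y
        by (simp add: Q.inv_mult Q.m_ac c4)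
    qed
    finally have "tp n t ?b \<in> q ` prodn G B 3"
      using B3[OF B(4)[OF cB(1)[OF xy]] cB(1)[OF x] cB(1)[OF y]] by blast
    then have "?b \<in> A1" unfolding A1_def using ca[OF xy] ca[OF x] ca[OF y] by auto
    then show ?thesis using M by fastforce
  qed
  obtain \<psi> where \<psi>: "\<And>x y. x \<in> carrier Q \<Longrightarrow> y \<in> carrier Q \<Longrightarrow> \<psi> (x \<otimes>\<^bsub>Q\<^esub> y) = \<psi> x + \<psi> y"
    and close: "\<And>x. x \<in> carrier Q \<Longrightarrow> \<bar>\<psi> x - real_of_int (aq x i)\<bar> \<le> real_of_int M"
    using Q.quasi_hom_close_to_hom[of "\<lambda>x. real_of_int (aq x i)" "real_of_int M"] defect by blast
  define \<phi> where "\<phi> g = \<psi> (q g)" for g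
  have add: "\<phi> (x \<otimes> y) = \<phi> x + \<phi> y" if "x \<in> carrier G" "y \<in> carrier G" for x y using \<psi> that by (simp add: \<phi>_def)
  have "continuous_map T euclideanreal \<phi>"
  proof (rule bounded_additive_continuous[OF add W0(1,2)])
    fix x assume x: "x \<in> W0"
    then have xB: "x \<in> B" "x \<in> carrier G" using W0 B Bc by blast+
    have qx: "q x \<in> carrier Q" using xB by simp
    have "tp n t (aq (q x)) = q (inv (cq (q x)) \<otimes> x)" unfolding tq[OF qx] using xB cB[OF qx] by simp
    then have "tp n t (aq (q x)) \<in> q ` prodn G B 3" using B32[OF B(4)[OF cB(1)[OF qx]] xB(1)] by blast
    then have "aq (q x) \<in> A1" unfolding A1_def using ca[OF qx] by auto
    then show "\<bar>\<phi> x\<bar> \<le> 2 * real_of_int M" using M close[OF qx] unfolding \<phi>_def by fastforce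
  qed auto
  moreover have "\<phi> (tpow G t n b) = real_of_int (b i)" if b: "b \<in> Zn n" for b
  proof -
    have near: "\<bar>\<psi> (tp n t b) - real_of_int (b i)\<bar> \<le> 2 * real_of_int M" if b: "b \<in> Zn n" for b
    proof -
      let ?x = "tp n t b"
      have x: "?x \<in> carrier Q" by simp
      let ?d = "\<lambda>i. aq ?x i - b i"
      have "tp n t ?d = tp n t (aq ?x) \<otimes>\<^bsub>Q\<^esub> inv\<^bsub>Q\<^esub> (tp n t b)" by (simp add: tpd)
      also have "\<dots> = q (inv (cq ?x) \<otimes> \<one>)" unfolding tq[OF x] using cB[OF x] by (simp add: Q.m_assoc)
      finally have "tp n t ?d = q (inv (cq ?x) \<otimes> \<one>)" .
      then have "tp n t ?d \<in> q ` prodn G B 3" using B32[OF B(4)[OF cB(1)[OF x]] B(3)] by blast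
      then have "?d \<in> A1" unfolding A1_def using ca[OF x] b by auto
      then show ?thesis using M[of ?d] close[OF x] by fastforce
    qed
    have mult: "\<psi> (tp n t (\<lambda>i. int k * b i)) = real k * \<psi> (tp n t b)" for k
    proof (induction k)
      case 0
      have "\<psi> \<one>\<^bsub>Q\<^esub> = 0" using \<psi>[OF Q.one_closed Q.one_closed] by simp
      then show ?case using Q.tpow_0[of n "\<lambda>i. q (t i)", OF tc] by simp
    next
      case (Suc k)
      have "tp n t (\<lambda>i. int (Suc k) * b i) = tp n t (\<lambda>i. int k * b i + b i)" by (simp add: algebra_simps)
      then show ?case using Suc \<psi> by (simp add: tpa algebra_simps)
    qed
    have "\<psi> (tp n t b) = real_of_int (b i)"
    proof (rule ccontr)
      assume "\<psi> (tp n t b) \<noteq> real_of_int (b i)"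
      then have p: "0 < \<bar>\<psi> (tp n t b) - real_of_int (b i)\<bar>" by simp
      obtain k :: nat where k: "2 * real_of_int M / \<bar>\<psi> (tp n t b) - real_of_int (b i)\<bar> < real k" using reals_Archimedean2 by blast
      have "(\<lambda>i. int k * b i) \<in> Zn n" using b by (auto simp: Zn_def)
      from near[OF this] have "\<bar>real k * (\<psi> (tp n t b) - real_of_int (b i))\<bar> \<le> 2 * real_of_int M" unfolding mult by (simp add: algebra_simps)
      then have "real k * \<bar>\<psi> (tp n t b) - real_of_int (b i)\<bar> \<le> 2 * real_of_int M" by (simp add: abs_mult)
      then show False using k p by (simp add: field_simps)
    qed
    then show ?thesis unfolding \<phi>_def using q_tpow[of n t b, OF t] by simp
  qed
  ultimately show ?thesis using add by blast
qed

end

section \<open>Metabelian groups\<close>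

lemma (in group) comm_group_if_generators_commute:
  assumes "S \<subseteq> carrier G" "generate G S = carrier G" "\<And>x y. x \<in> S \<Longrightarrow> y \<in> S \<Longrightarrow> x \<otimes> y = y \<otimes> x"
  shows "comm_group G"
proof (rule group_comm_groupI)
  fix x y assume x: "x \<in> carrier G" and y: "y \<in> carrier G"
  have 1: "g \<otimes> s = s \<otimes> g" if "s \<in> S" "g \<in> carrier G" for s g
    by (rule generate_centralizes[OF assms(1)]) (use that assms in auto)
  show "x \<otimes> y = y \<otimes> x"
    by (rule generate_centralizes[OF assms(1) y]) (use 1 x y assms in auto)
qed

lemma hom_eq_on_generate:
  assumes "group G" "group A" "F \<in> hom G A" "F' \<in> hom G A" "S \<subseteq> carrier G" "\<And>x. x \<in> S \<Longrightarrow> F x = F' x" "g \<in> generate G S"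
  shows "F g = F' g"
  using assms(7)
proof induction
  interpret G: group G by fact
  interpret A: group A by fact
  interpret F: group_hom G A F using assms by unfold_locales
  interpret F': group_hom G A F' using assms by unfold_locales
  case one show ?case by simp
next
  interpret G: group G by fact
  interpret A: group A by fact
  interpret F: group_hom G A F using assms by unfold_locales
  interpret F': group_hom G A F' using assms by unfold_locales
  case (inv h) then show ?case using assms by auto
next
  interpret G: group G by fact
  interpret A: group A by fact
  interpret F: group_hom G A F using assms by unfold_locales
  interpret F': group_hom G A F' using assms by unfold_locales
  case (eng h1 h2)
  then show ?case using G.generate_in_carrier[OF assms(5)] by simp
qed (use assms in auto)

context group
begin

lemma quotient_eq_iff:
  assumes "N \<lhd> G" "x \<in> carrier G" "y \<in> carrier G"
  shows "N #> x = N #> y \<longleftrightarrow> x \<otimes> inv y \<in> N"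
proof -
  interpret normal N G by fact
  show ?thesis
  proof
    assume "N #> x = N #> y"
    then have "x \<in> N #> y" using rcos_self[OF assms(2) is_subgroup] by simp
    then obtain k where "k \<in> N" "x = k \<otimes> y" by (auto simp: r_coset_def)
    then show "x \<otimes> inv y \<in> N" using assms(3) subset by (auto simp: m_assoc subset_iff)
  next
    assume k: "x \<otimes> inv y \<in> N"
    have "N #> x = N #> ((x \<otimes> inv y) \<otimes> y)" using assms by (simp add: m_assoc)
    also have "\<dots> = N #> (x \<otimes> inv y) #> y" using assms subset by (simp add: coset_mult_assoc)
    also have "N #> (x \<otimes> inv y) = N" using k assms by (intro coset_join2 is_subgroup) auto
    finally show "N #> x = N #> y" .
  qed
qed

lemma quotient_one_iff:
  assumes "N \<lhd> G" "x \<in> carrier G"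
  shows "N #> x = \<one>\<^bsub>G Mod N\<^esub> \<longleftrightarrow> x \<in> N"
proof -
  interpret normal N G by fact
  show ?thesis unfolding one_FactGroup using assms(2) by (metis coset_join1 coset_join2 is_subgroup)
qed

lemma quotient_comm:
  assumes N: "N \<lhd> G" and S: "S \<subseteq> carrier G" "generate G S = carrier G"
    and c: "\<And>x y. x \<in> S \<Longrightarrow> y \<in> S \<Longrightarrow> x \<otimes> y \<otimes> inv x \<otimes> inv y \<in> N"
  shows "comm_group (G Mod N)"
proof -
  interpret normal N G by fact
  interpret Q: group "G Mod N" by (rule factorgroup_is_group)
  have hom: "(\<lambda>x. N #> x) \<in> hom G (G Mod N)" by (rule r_coset_hom_Mod)
  interpret h: group_hom G "G Mod N" "\<lambda>x. N #> x" using hom by unfold_locales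
  show ?thesis
  proof (rule Q.comm_group_if_generators_commute[of "(\<lambda>x. N #> x) ` S"])
    show "(\<lambda>x. N #> x) ` S \<subseteq> carrier (G Mod N)" using S by (auto simp: carrier_FactGroup)
    have "generate (G Mod N) ((\<lambda>x. N #> x) ` S) = (\<lambda>x. N #> x) ` generate G S" using h.generate_img[OF S(1)] by simp
    then show "generate (G Mod N) ((\<lambda>x. N #> x) ` S) = carrier (G Mod N)" using S(2) by (simp add: carrier_FactGroup)
    fix x y assume "x \<in> (\<lambda>x. N #> x) ` S" "y \<in> (\<lambda>x. N #> x) ` S"
    then obtain a b where ab: "a \<in> S" "b \<in> S" "x = N #> a" "y = N #> b" by blast
    have abc: "a \<in> carrier G" "b \<in> carrier G" using ab S by auto
    have "N #> (a \<otimes> b) = N #> (b \<otimes> a)"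
      using quotient_eq_iff[OF N, of "a \<otimes> b" "b \<otimes> a"] c[OF ab(1,2)] abc by (simp add: group_normalize)
    then show "x \<otimes>\<^bsub>G Mod N\<^esub> y = y \<otimes>\<^bsub>G Mod N\<^esub> x" using ab abc h.hom_mult by metis
  qed
qed

lemma generate_conjs_normal:
  assumes "K \<subseteq> carrier G"
  shows "generate G (conjs G (carrier G) K) \<lhd> G"
proof -
  have c: "conjs G (carrier G) K \<subseteq> carrier G" using assms by (intro conjs_carrier) auto
  have sg: "subgroup (generate G (conjs G (carrier G) K)) G" using generate_is_subgroup[OF c] .
  moreover have "x \<otimes> g \<otimes> inv x \<in> generate G (conjs G (carrier G) K)" if x: "x \<in> carrier G" and g: "g \<in> generate G (conjs G (carrier G) K)" for x g
  proof (rule generate_conj_closed[OF c x sg _ g])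
    fix s assume "s \<in> conjs G (carrier G) K"
    then obtain a k where ak: "a \<in> carrier G" "k \<in> K" "s = a \<otimes> k \<otimes> inv a" by (rule conjsE)
    then have kc: "k \<in> carrier G" using assms by auto
    have "x \<otimes> s \<otimes> inv x = (x \<otimes> a) \<otimes> k \<otimes> inv (x \<otimes> a)" using ak x kc by (simp add: group_normalize)
    then show "x \<otimes> s \<otimes> inv x \<in> generate G (conjs G (carrier G) K)" using ak x by (auto intro!: generate.incl conjsI)
  qed
  ultimately show ?thesis by (simp add: normal_inv_iff)
qed

end

section \<open>The closed commutator subgroup and its quotient\<close>

locale metab = lc_grp +
  assumes metabelian: "metabelian G" and cg: "compactly_generated G T"
begin

definition N where "N = T closure_of derived G (carrier G)"

lemma der_sub: "subgroup (derived G (carrier G)) G" using derived_is_subgroup[of "carrier G"] by simp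

lemma der_carrier: "derived G (carrier G) \<subseteq> carrier G" using der_sub subgroup.subset by blast

lemma N_closed: "closedin T N" unfolding N_def by simp

lemma N_carrier: "N \<subseteq> carrier G" unfolding N_def using closure_of_subset_topspace topspace by metis

lemma der_N: "derived G (carrier G) \<subseteq> N" unfolding N_def using closure_of_subset der_carrier topspace by metis

lemma comm_N: "x \<in> carrier G \<Longrightarrow> y \<in> carrier G \<Longrightarrow> x \<otimes> y \<otimes> inv x \<otimes> inv y \<in> N"
  using der_N unfolding derived_def by (blast intro: generate.incl)

lemma N_mult: "x \<in> N \<Longrightarrow> y \<in> N \<Longrightarrow> x \<otimes> y \<in> N"
proof -
  let ?D = "derived G (carrier G)"
  assume "x \<in> N" "y \<in> N"
  then have "(x, y) \<in> prod_topology T T closure_of (?D \<times> ?D)" by (simp add: closure_of_Times N_def)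
  moreover have "continuous_map (prod_topology T T) T (\<lambda>p. fst p \<otimes> snd p)" by (intro cont_intros)
  ultimately have "x \<otimes> y \<in> T closure_of ((\<lambda>p. fst p \<otimes> snd p) ` (?D \<times> ?D))"
    using continuous_map_image_closure_subset by fastforce
  moreover have "(\<lambda>p. fst p \<otimes> snd p) ` (?D \<times> ?D) \<subseteq> ?D" using subgroup.m_closed[OF der_sub] by auto
  ultimately show "x \<otimes> y \<in> N" unfolding N_def using closure_of_mono by blast
qed

lemma N_inv: "x \<in> N \<Longrightarrow> inv x \<in> N"
proof -
  let ?D = "derived G (carrier G)"
  assume "x \<in> N"
  moreover have "continuous_map T T (\<lambda>p. inv p)" using cont_inv[OF continuous_map_id] by (simp add: id_def)
  ultimately have "inv x \<in> T closure_of ((\<lambda>p. inv p) ` ?D)" unfolding N_def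
    using continuous_map_image_closure_subset by fastforce
  moreover have "(\<lambda>p. inv p) ` ?D \<subseteq> ?D" using subgroup.m_inv_closed[OF der_sub] by auto
  ultimately show "inv x \<in> N" unfolding N_def using closure_of_mono by blast
qed

lemma N_conj: "g \<in> carrier G \<Longrightarrow> x \<in> N \<Longrightarrow> g \<otimes> x \<otimes> inv g \<in> N"
proof -
  let ?D = "derived G (carrier G)"
  assume g: "g \<in> carrier G" and "x \<in> N"
  moreover have "continuous_map T T (\<lambda>p. g \<otimes> p \<otimes> inv g)" using g continuous_map_id by (intro cont_intros) (auto simp: id_def)
  ultimately have "g \<otimes> x \<otimes> inv g \<in> T closure_of ((\<lambda>p. g \<otimes> p \<otimes> inv g) ` ?D)" unfolding N_def
    using continuous_map_image_closure_subset by fastforce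
  moreover have "?D \<lhd> G" using derived_self_is_normal by simp
  then have "(\<lambda>p. g \<otimes> p \<otimes> inv g) ` ?D \<subseteq> ?D" using g by (auto simp: normal_inv_iff)
  ultimately show ?thesis unfolding N_def using closure_of_mono by blast
qed

lemma N_subgroup: "subgroup N G"
proof (rule subgroupI)
  show "N \<noteq> {}" using der_N subgroup.one_closed[OF der_sub] by blast
qed (use N_carrier N_inv N_mult in auto)

lemma N_normal: "N \<lhd> G" using N_subgroup N_conj by (simp add: normal_inv_iff)

text \<open>In a Hausdorff group, commuting is a closed condition on pairs, so it passes from the
  commutator subgroup to its closure.\<close>

lemma N_comm: "x \<in> N \<Longrightarrow> y \<in> N \<Longrightarrow> x \<otimes> y = y \<otimes> x"
proof -
  let ?D = "derived G (carrier G)"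
  let ?X = "{p \<in> topspace (prod_topology T T). fst p \<otimes> snd p = snd p \<otimes> fst p}"
  assume "x \<in> N" "y \<in> N"
  then have xy: "(x, y) \<in> prod_topology T T closure_of (?D \<times> ?D)" by (simp add: closure_of_Times N_def)
  have "closedin (prod_topology T T) ?X"
    by (rule closedin_continuous_maps_eq[OF Haus]) (intro cont_intros)+
  moreover have "?D \<times> ?D \<subseteq> ?X" using metabelian der_carrier by (auto simp: metabelian_def topspace)
  ultimately have "prod_topology T T closure_of (?D \<times> ?D) \<subseteq> ?X" using closure_of_minimal by blast
  then show ?thesis using xy by auto
qed

text \<open>The two conjugators differ by a commutator, which lies in the abelian group
  \<open>N\<close> and therefore acts trivially on it.\<close>

lemma conj_swap:
  assumes "x \<in> carrier G" "y \<in> carrier G" "k \<in> N"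
  shows "x \<otimes> y \<otimes> k \<otimes> inv (x \<otimes> y) = y \<otimes> x \<otimes> k \<otimes> inv (y \<otimes> x)"
proof -
  let ?c = "x \<otimes> y \<otimes> inv x \<otimes> inv y" and ?X = "y \<otimes> x \<otimes> k \<otimes> inv (y \<otimes> x)"
  have k: "k \<in> carrier G" using assms N_carrier by auto
  have c: "?c \<in> N" "?X \<in> N" using comm_N assms N_conj[of "y \<otimes> x" k] by auto
  have cc: "?c \<in> carrier G" "?X \<in> carrier G" using c N_carrier by auto
  have "x \<otimes> y \<otimes> k \<otimes> inv (x \<otimes> y) = ?c \<otimes> ?X \<otimes> inv ?c" using assms k by (simp add: group_normalize)
  also have "\<dots> = ?X \<otimes> ?c \<otimes> inv ?c" using N_comm[OF c] by simp
  also have "\<dots> = ?X" using cc by (simp add: m_assoc)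
  finally show ?thesis .
qed

definition Q where "Q = G Mod N"
definition q where "q x = N #> x"

lemma gens: "\<exists>S. compactin T S \<and> generate G S = carrier G \<and> \<one> \<in> S \<and> (\<forall>s\<in>S. inv s \<in> S)"
proof -
  obtain S0 where S0: "compactin T S0" "generate G S0 = carrier G" using cg unfolding compactly_generated_def by blast
  obtain S where S: "compactin T S" "S0 \<subseteq> S" "\<one> \<in> S" "\<forall>v\<in>S. inv v \<in> S" using compact_symmetric[OF S0(1)] by blast
  have "generate G S = carrier G" using S0(2) mono_generate[OF S(2)] generate_incl[OF compact_carrier[OF S(1)]] by auto
  then show ?thesis using S by blast
qed

lemma Q_comm_group: "comm_group Q"
  unfolding Q_def by (rule quotient_comm[OF N_normal, of "carrier G"]) (use comm_N generate_incl[of "carrier G"] in \<open>auto intro: generate.incl\<close>)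

lemma q_eq_iff: "x \<in> carrier G \<Longrightarrow> y \<in> carrier G \<Longrightarrow> q x = q y \<longleftrightarrow> x \<otimes> inv y \<in> N"
  unfolding q_def by (rule quotient_eq_iff[OF N_normal])

lemma q_one_iff: "x \<in> carrier G \<Longrightarrow> q x = \<one>\<^bsub>Q\<^esub> \<longleftrightarrow> x \<in> N"
  unfolding q_def Q_def by (rule quotient_one_iff[OF N_normal])

sublocale qt: lc_ab G T Q q
proof -
  interpret normal N G by (rule N_normal)
  interpret Q: comm_group Q by (rule Q_comm_group)
  show "lc_ab G T Q q"
    by unfold_locales (use r_coset_hom_Mod in \<open>auto simp: q_def[abs_def] Q_def carrier_FactGroup\<close>)
qed

text \<open>Modulo the normal closure \<open>N0\<close> of a compact part of \<open>N\<close>, the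
  group is abelian and satisfies the products visible in \<open>D\<close>. So
  \<open>extend_partial_hom\<close> yields a homomorphism that kills \<open>N\<close> and agrees
  with the projection on generators, which puts \<open>N\<close> inside \<open>N0\<close>.\<close>

theorem N_normally_compactly_generated:
  "\<exists>K. compactin T K \<and> K \<subseteq> N \<and> N = generate G (conjs G (carrier G) K)"
proof -
  obtain S where S: "compactin T S" "generate G S = carrier G" "\<one> \<in> S" "\<And>s. s \<in> S \<Longrightarrow> inv s \<in> S" using gens by blast
  have Sc: "S \<subseteq> carrier G" using S compact_carrier by blast
  obtain D where D: "compactin T D" "S \<subseteq> D" and ext: "\<forall>(A::'a set monoid) f. comm_group A \<longrightarrow> f ` D \<subseteq> carrier A \<longrightarrow>
    (\<forall>x\<in>D. \<forall>y\<in>D. \<forall>z\<in>D. q x \<otimes>\<^bsub>Q\<^esub> q y = q z \<longrightarrow> f x \<otimes>\<^bsub>A\<^esub> f y = f z) \<longrightarrow>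
    (\<exists>F\<in>hom G A. (\<forall>g\<in>carrier G. q g = \<one>\<^bsub>Q\<^esub> \<longrightarrow> F g = \<one>\<^bsub>A\<^esub>) \<and> (\<forall>x\<in>S. F x = f x))"
    using qt.extend_partial_hom[OF cg S(1), where ?'e = "'a set" and ?'f = unit] by (elim exE conjE)
  obtain B where B: "compactin T B" "D \<subseteq> B" "\<one> \<in> B" "\<And>v. v \<in> B \<Longrightarrow> inv v \<in> B" using compact_symmetric[OF D(1)] by blast
  have Bc: "B \<subseteq> carrier G" using B compact_carrier by blast
  \<comment> \<open>Four factors are needed for commutators of generators, three for the quotients
    \<open>x y inv z\<close> that test multiplicativity on \<open>D\<close>.\<close>
  define K where "K = N \<inter> prodn G B 4"
  have K: "compactin T K" unfolding K_def using closed_Int_compactin[OF N_closed compact_prodn[OF B(1)]] .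
  have KN: "K \<subseteq> N" unfolding K_def by blast
  have Kc: "K \<subseteq> carrier G" using KN N_carrier by blast
  define N0 where "N0 = generate G (conjs G (carrier G) K)"
  have N0: "N0 \<lhd> G" unfolding N0_def using generate_conjs_normal[OF Kc] .
  have KN0: "K \<subseteq> N0"
  proof
    fix k assume k: "k \<in> K"
    have "\<one> \<otimes> k \<otimes> inv \<one> \<in> conjs G (carrier G) K" using k by (intro conjsI) auto
    moreover have "\<one> \<otimes> k \<otimes> inv \<one> = k" using k Kc by auto
    ultimately show "k \<in> N0" unfolding N0_def by (metis generate.incl)
  qed
  have m1: "x \<in> prodn G B 1" if "x \<in> B" for x using that prodn_1[OF Bc] by simp
  have m3: "x \<otimes> y \<otimes> z \<in> prodn G B 3" if "x \<in> B" "y \<in> B" "z \<in> B" for x y z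
    using prodn_add[OF Bc prodn_add[OF Bc m1 m1] m1, OF that] by (simp add: numeral_3_eq_3)
  have m4: "x \<otimes> y \<otimes> z \<otimes> w \<in> prodn G B 4" if "x \<in> B" "y \<in> B" "z \<in> B" "w \<in> B" for x y z w
    using prodn_add[OF Bc m3[OF that(1-3)] m1[OF that(4)]] by simp
  let ?A = "G Mod N0" and ?f = "\<lambda>x. N0 #> x"
  interpret N0: normal N0 G by (rule N0)
  have A: "comm_group ?A"
  proof (rule quotient_comm[OF N0 Sc S(2)])
    fix x y assume xy: "x \<in> S" "y \<in> S"
    then have "x \<otimes> y \<otimes> inv x \<otimes> inv y \<in> prodn G B 4" using D B S(4) by (intro m4) auto
    then show "x \<otimes> y \<otimes> inv x \<otimes> inv y \<in> N0" using comm_N xy Sc KN0 unfolding K_def by blast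
  qed
  have fhom: "?f \<in> hom G ?A" by (rule N0.r_coset_hom_Mod)
  have part: "\<forall>x\<in>D. \<forall>y\<in>D. \<forall>z\<in>D. q x \<otimes>\<^bsub>Q\<^esub> q y = q z \<longrightarrow> ?f x \<otimes>\<^bsub>?A\<^esub> ?f y = ?f z"
  proof (intro ballI impI)
    fix x y z assume xyz: "x \<in> D" "y \<in> D" "z \<in> D" and e: "q x \<otimes>\<^bsub>Q\<^esub> q y = q z"
    have c: "x \<in> carrier G" "y \<in> carrier G" "z \<in> carrier G" using xyz B(2) Bc by auto
    have "q (x \<otimes> y) = q z" using e c by simp
    then have "x \<otimes> y \<otimes> inv z \<in> N" using q_eq_iff[of "x \<otimes> y" z] c by blast
    moreover have "x \<otimes> y \<otimes> inv z \<in> prodn G B 3" using xyz B by (intro m3) auto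
    then have "x \<otimes> y \<otimes> inv z \<in> prodn G B 4" using prodn_le[OF Bc B(3), of 3 4] by auto
    ultimately have "x \<otimes> y \<otimes> inv z \<in> N0" using KN0 unfolding K_def by blast
    then have "?f (x \<otimes> y) = ?f z" using quotient_eq_iff[OF N0] c by simp
    then show "?f x \<otimes>\<^bsub>?A\<^esub> ?f y = ?f z" using hom_mult[OF fhom c(1,2)] by simp
  qed
  have fD: "?f ` D \<subseteq> carrier ?A" using B(2) Bc by (auto simp: carrier_FactGroup)
  obtain F where F: "F \<in> hom G ?A" "\<And>g. g \<in> carrier G \<Longrightarrow> q g = \<one>\<^bsub>Q\<^esub> \<Longrightarrow> F g = \<one>\<^bsub>?A\<^esub>" "\<And>x. x \<in> S \<Longrightarrow> F x = ?f x"
    using ext[rule_format, OF A fD part[rule_format]] by blast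
  have "N \<subseteq> N0"
  proof
    fix x assume x: "x \<in> N"
    then have xc: "x \<in> carrier G" using N_carrier by blast
    have "F x = ?f x" using hom_eq_on_generate[OF is_group comm_group.axioms(2)[OF A] F(1) fhom Sc F(3)] S(2) xc by blast
    moreover have "F x = \<one>\<^bsub>?A\<^esub>" using F(2) xc q_one_iff x by blast
    ultimately show "x \<in> N0" using quotient_one_iff[OF N0 xc] by simp
  qed
  moreover have "N0 \<subseteq> N" unfolding N0_def
  proof (rule generate_subgroup_incl[OF _ N_subgroup])
    show "conjs G (carrier G) K \<subseteq> N" using N_conj KN by (auto elim!: conjsE)
  qed
  ultimately show ?thesis using K KN unfolding N0_def by blast
qed

end

section \<open>Compactly presentable groups have no line in Gamma\<close>

lemma monoid_gen_mult:
  assumes "group G" "P \<subseteq> carrier G" "x \<in> monoid_gen G P" "y \<in> monoid_gen G P"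
  shows "x \<otimes>\<^bsub>G\<^esub> y \<in> monoid_gen G P \<and> x \<in> carrier G"
proof -
  interpret group G by fact
  have c: "z \<in> carrier G" if "z \<in> monoid_gen G P" for z using that by induction (use assms(2) in auto)
  from assms(3) show ?thesis
  proof induction
    case one then show ?case using assms(4) c by simp
  next
    case (mult k m)
    then have "k \<otimes>\<^bsub>G\<^esub> (m \<otimes>\<^bsub>G\<^esub> y) \<in> monoid_gen G P" by (intro monoid_gen.mult[where k = k and m = "m \<otimes>\<^bsub>G\<^esub> y"]) auto
    then show ?case using mult c assms(2,4) by (auto simp: m_assoc subset_iff)
  qed
qed

lemma monoid_gen_incl: "group G \<Longrightarrow> P \<subseteq> carrier G \<Longrightarrow> x \<in> P \<Longrightarrow> x \<in> monoid_gen G P"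
  using monoid_gen.mult[OF _ monoid_gen.one, of x P G] by (simp add: group.is_monoid monoid.r_one subsetD)

lemma (in group) pow_conj_closed:
  assumes "z \<in> carrier G" "\<And>x. x \<in> X \<Longrightarrow> z \<otimes> x \<otimes> inv z \<in> X" "X \<subseteq> carrier G" "x \<in> X"
  shows "z [^] (m::nat) \<otimes> x \<otimes> inv (z [^] m) \<in> X"
  using assms(4)
proof (induction m arbitrary: x)
  case 0 then show ?case using assms(3) by auto
next
  case (Suc m)
  have xc: "x \<in> carrier G" using Suc assms(3) by auto
  have "z [^] m \<otimes> (z \<otimes> x \<otimes> inv z) \<otimes> inv (z [^] m) \<in> X" using Suc assms(2) by blast
  moreover have "z [^] Suc m \<otimes> x \<otimes> inv (z [^] Suc m) = z [^] m \<otimes> (z \<otimes> x \<otimes> inv z) \<otimes> inv (z [^] m)"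
    using assms(1) xc by (simp add: group_normalize)
  ultimately show ?case by simp
qed

context lc_grp
begin

lemma GstarD:
  assumes "c \<in> Gstar G T"
  shows "\<And>x y. x \<in> carrier G \<Longrightarrow> y \<in> carrier G \<Longrightarrow> c (x \<otimes> y) = c x + c y" "continuous_map T euclideanreal c"
  using assms by (auto simp: Gstar_def)

lemma Gstar_bounded:
  assumes "c \<in> Gstar G T" "compactin T S"
  shows "\<exists>B. B > 0 \<and> (\<forall>s\<in>S. \<bar>c s\<bar> \<le> B)"
proof -
  have "compactin euclideanreal (c ` S)" using image_compactin assms GstarD(2) by blast
  then have "bounded (c ` S)" by (simp add: compact_imp_bounded)
  then obtain B where "\<And>s. s \<in> S \<Longrightarrow> \<bar>c s\<bar> \<le> B" unfolding bounded_iff by auto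
  then have "\<forall>s\<in>S. \<bar>c s\<bar> \<le> max B 1" by (meson max.coboundedI1)
  then show ?thesis by (intro exI[of _ "max B 1"]) auto
qed

lemma Gstar_uminus: "c \<in> Gstar G T \<Longrightarrow> (\<lambda>x. - c x) \<in> Gstar G T"
  by (auto simp: Gstar_def intro!: continuous_map_minus)

end

text \<open>\<open>heights \<xi> c w\<close> collects the heights reached, after at least one letter, by the path
  that starts at height \<open>c\<close> and follows the word \<open>w\<close>.\<close>

fun heights :: "('a \<Rightarrow> real) \<Rightarrow> real \<Rightarrow> 'a word \<Rightarrow> real set" where
  "heights \<xi> c [] = {}"
| "heights \<xi> c ((x, b) # w) = insert (c + (if b then \<xi> x else - \<xi> x)) (heights \<xi> (c + (if b then \<xi> x else - \<xi> x)) w)"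

lemma heights_uminus: "heights (\<lambda>x. - \<xi> x) (- c) w = uminus ` heights \<xi> c w"
proof (induction \<xi> c w rule: heights.induct)
  case (2 \<xi> c x b w)
  have "- c + (if b then - \<xi> x else - (- \<xi> x)) = - (c + (if b then \<xi> x else - \<xi> x))" by simp
  then show ?case using 2 by (cases b) (simp_all add: algebra_simps)
qed simp

lemma heights_shift: "heights \<xi> (c + d) w = (\<lambda>r. r + d) ` heights \<xi> c w"
proof (induction \<xi> c w rule: heights.induct)
  case (2 \<xi> c x b w)
  have "c + d + (if b then \<xi> x else - \<xi> x) = (c + (if b then \<xi> x else - \<xi> x)) + d" by simp
  then show ?case using 2 by (cases b) (simp_all add: algebra_simps)
qed simp

lemma finite_heights: "finite (heights \<xi> c w)"
  by (induction \<xi> c w rule: heights.induct) auto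

lemma heights_replicate:
  "heights \<xi> c (replicate k (x, b)) \<subseteq> {c + real i * (if b then \<xi> x else - \<xi> x) |i. i \<le> k}"
proof (induction k arbitrary: c)
  case (Suc k)
  let ?s = "if b then \<xi> x else - \<xi> x"
  have "heights \<xi> (c + ?s) (replicate k (x, b)) \<subseteq> {c + real i * ?s |i. i \<le> Suc k}"
  proof
    fix r assume "r \<in> heights \<xi> (c + ?s) (replicate k (x, b))"
    then obtain i where "i \<le> k" "r = c + ?s + real i * ?s" using Suc[of "c + ?s"] by blast
    then show "r \<in> {c + real i * ?s |i. i \<le> Suc k}" by (intro CollectI exI[of _ "Suc i"]) (simp add: algebra_simps)
  qed
  moreover have "c + ?s \<in> {c + real i * ?s |i. i \<le> Suc k}" by (intro CollectI exI[of _ 1]) simp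
  ultimately show ?case by simp
qed simp

locale height_group = lc_grp +
  fixes \<xi> :: "'a \<Rightarrow> real" and S :: "'a set"
  assumes \<xi>: "\<xi> \<in> Gstar G T" and S: "S \<subseteq> carrier G"
begin

lemma \<xi>_mult: "x \<in> carrier G \<Longrightarrow> y \<in> carrier G \<Longrightarrow> \<xi> (x \<otimes> y) = \<xi> x + \<xi> y" using GstarD(1)[OF \<xi>] .
lemma \<xi>_one: "\<xi> \<one> = 0" using additive_one[of \<xi>, OF \<xi>_mult] by simp
lemma \<xi>_inv: "x \<in> carrier G \<Longrightarrow> \<xi> (inv x) = - \<xi> x" using additive_inv[of \<xi>, OF \<xi>_mult] by simp
lemma \<xi>_pow: "x \<in> carrier G \<Longrightarrow> \<xi> (x [^] (k::nat)) = real k * \<xi> x" using additive_pow[of \<xi>, OF \<xi>_mult] by simp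

lemma heights_append:
  "word_over S u \<Longrightarrow> heights \<xi> c (u @ w) = heights \<xi> c u \<union> heights \<xi> (c + \<xi> (eval_word G u)) w"
proof (induction u arbitrary: c)
  case Nil then show ?case using \<xi>_one by simp
next
  case (Cons y u)
  obtain x b where y: "y = (x, b)" by (cases y)
  have xc: "x \<in> carrier G" and uc: "eval_word G u \<in> carrier G" using Cons y S eval_word_closed[of S u] by auto
  let ?s = "if b then \<xi> x else - \<xi> x"
  have "\<xi> (eval_word G (y # u)) = ?s + \<xi> (eval_word G u)" using xc uc by (simp add: y \<xi>_mult \<xi>_inv)
  then show ?case using Cons y by (simp add: algebra_simps)
qed

end

section \<open>From paths above a fixed height to generation over a half space\<close>

context metab
begin

lemma conjs_N: "A \<subseteq> carrier G \<Longrightarrow> K \<subseteq> N \<Longrightarrow> conjs G A K \<subseteq> N"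
  using N_conj by (auto elim!: conjsE)

text \<open>A path above height \<open>-L\<close> writes the commutator of its endpoint with
  \<open>z\<close> as a product of conjugates of \<open>K\<close> from above that height. For
  \<open>x\<close> in \<open>N\<close>, the identity \<open>x = [x, z] (z x inv z)\<close> then
  undoes a lift by \<open>z\<close>, and sufficiently high lifts of \<open>x\<close> are generated
  from above anyway. Finally Baire category replaces the half space by a compactly generated
  monoid.\<close>

theorem cg_over_if_connected_half_space:
  assumes \<xi>: "\<xi> \<in> Gstar G T" and cS: "compactin T S" "generate G S = carrier G"
    and z: "z \<in> carrier G" "\<xi> z > 0"
    and H: "\<And>x. x \<in> N \<Longrightarrow> \<exists>w. word_over S w \<and> eval_word G w = x \<and> (\<forall>r\<in>heights \<xi> 0 w. r \<ge> - L)" and L: "L \<ge> 0"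
  shows "\<exists>M. cg_submonoid G T M \<and> M \<subseteq> Gchi G \<xi> \<and> cg_over G T N M"
proof -
  interpret height_group G T \<xi> S by unfold_locales (use \<xi> cS compact_carrier in auto)
  obtain S1 where S1: "compactin T S1" "S \<subseteq> S1" "\<one> \<in> S1" "\<And>s. s \<in> S1 \<Longrightarrow> inv s \<in> S1" using compact_symmetric[OF cS(1)] by blast
  have S1c: "S1 \<subseteq> carrier G" using S1 compact_carrier by blast
  obtain K0 where K0: "compactin T K0" "K0 \<subseteq> N" "N = generate G (conjs G (carrier G) K0)"
    using N_normally_compactly_generated by blast
  \<comment> \<open>With these commutators in \<open>K\<close>, one letter of a path changes the
    commutator with \<open>z\<close> by a single conjugate of an element of
    \<open>K\<close>.\<close>
  define K1 where "K1 = {s \<otimes> z \<otimes> inv s \<otimes> inv z' |s z'. s \<in> S1 \<and> z' \<in> {z}}"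
  have "compactin T {(\<lambda>a b. a \<otimes> z \<otimes> inv a \<otimes> inv b) s z' |s z'. s \<in> S1 \<and> z' \<in> {z}}"
    by (rule compact_image2) (use S1 z in \<open>auto intro!: cont_intros compact_finite simp: topspace\<close>)
  then have K1: "compactin T K1" by (simp add: K1_def)
  have K1N: "K1 \<subseteq> N" using comm_N S1c z by (auto simp: K1_def)
  obtain K where K: "compactin T K" "K0 \<union> K1 \<subseteq> K" "\<one> \<in> K" "\<And>k. k \<in> K \<Longrightarrow> inv k \<in> K" "K \<subseteq> N"
  proof
    let ?K = "(K0 \<union> K1) \<union> m_inv G ` (K0 \<union> K1) \<union> {\<one>}"
    have c: "compactin T (K0 \<union> K1)" using K0 K1 by (intro compactin_Un) auto
    show "compactin T ?K" using compactin_Un[OF compactin_Un[OF c compact_inv[OF c]] compact_finite[of "{\<one>}"]] by simp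
    show "\<And>k. k \<in> ?K \<Longrightarrow> inv k \<in> ?K" using compact_carrier[OF c] by auto
    show "?K \<subseteq> N" using K0(2) K1N N_inv subgroup.one_closed[OF N_subgroup] by auto
  qed auto
  have Kc: "K \<subseteq> carrier G" using K N_carrier by blast
  have Ngen: "N \<subseteq> generate G (conjs G (carrier G) K)"
    unfolding K0(3) by (intro mono_generate conjs_mono) (use K in auto)
  define HS where "HS l = {g \<in> carrier G. \<xi> g \<ge> l}" for l
  define NH where "NH l = generate G (conjs G (HS l) K)" for l
  have HSc: "HS l \<subseteq> carrier G" for l by (auto simp: HS_def)
  have cc: "conjs G (HS l) K \<subseteq> carrier G" for l by (rule conjs_carrier[OF HSc Kc])
  have NHsub: "subgroup (NH l) G" for l unfolding NH_def using generate_is_subgroup[OF cc] .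
  have NHN: "NH l \<subseteq> N" for l unfolding NH_def
    by (rule generate_subgroup_incl[OF conjs_N[OF HSc K(5)] N_subgroup])
  \<comment> \<open>Uses \<open>[g s, z] = (g [s, z] inv g) [g, z]\<close> for each letter
    \<open>s\<close>.\<close>
  have path: "\<xi> g + 0 \<ge> - L \<Longrightarrow> g \<in> carrier G \<Longrightarrow> word_over S w \<Longrightarrow> (\<forall>r\<in>heights \<xi> (\<xi> g) w. r \<ge> - L) \<Longrightarrow>
     g \<otimes> z \<otimes> inv g \<otimes> inv z \<in> NH (- L) \<Longrightarrow>
     (g \<otimes> eval_word G w) \<otimes> z \<otimes> inv (g \<otimes> eval_word G w) \<otimes> inv z \<in> NH (- L)" for g w
  proof (induction w arbitrary: g)
    case Nil then show ?case by simp
  next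
    case (Cons y w)
    obtain x b where y: "y = (x, b)" by (cases y)
    define s where "s = (if b then x else inv x)"
    have xS: "x \<in> S" "x \<in> carrier G" using Cons y S compact_carrier by auto
    have sS: "s \<in> S1" "s \<in> carrier G" using xS S1 by (auto simp: s_def)
    have \<xi>s: "\<xi> (g \<otimes> s) = \<xi> g + (if b then \<xi> x else - \<xi> x)" using Cons.prems sS xS by (simp add: \<xi>_mult \<xi>_inv s_def)
    have "s \<otimes> z \<otimes> inv s \<otimes> inv z \<in> K" using K(2) sS by (auto simp: K1_def)
    moreover have "g \<in> HS (- L)" using Cons.prems by (simp add: HS_def)
    ultimately have "g \<otimes> (s \<otimes> z \<otimes> inv s \<otimes> inv z) \<otimes> inv g \<in> NH (- L)"
      unfolding NH_def by (intro generate.incl conjsI)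
    then have "(g \<otimes> (s \<otimes> z \<otimes> inv s \<otimes> inv z) \<otimes> inv g) \<otimes> (g \<otimes> z \<otimes> inv g \<otimes> inv z) \<in> NH (- L)"
      using Cons.prems(5) subgroup.m_closed[OF NHsub] by blast
    moreover have "(g \<otimes> (s \<otimes> z \<otimes> inv s \<otimes> inv z) \<otimes> inv g) \<otimes> (g \<otimes> z \<otimes> inv g \<otimes> inv z) = (g \<otimes> s) \<otimes> z \<otimes> inv (g \<otimes> s) \<otimes> inv z"
      using Cons.prems(2) sS z by (simp add: group_normalize)
    ultimately have g_s: "(g \<otimes> s) \<otimes> z \<otimes> inv (g \<otimes> s) \<otimes> inv z \<in> NH (- L)" by simp
    have "(g \<otimes> s \<otimes> eval_word G w) \<otimes> z \<otimes> inv (g \<otimes> s \<otimes> eval_word G w) \<otimes> inv z \<in> NH (- L)"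
    proof (rule Cons.IH)
      show "(g \<otimes> s) \<otimes> z \<otimes> inv (g \<otimes> s) \<otimes> inv z \<in> NH (- L)" by (rule g_s)
    qed (use Cons.prems y \<xi>s sS in auto)
    moreover have "eval_word G w \<in> carrier G" using Cons.prems S by auto
    ultimately show ?case using Cons.prems(2) sS y by (simp add: s_def m_assoc)
  qed
  have one_step: "x \<in> NH (- L)" if x: "x \<in> N" and zx: "z \<otimes> x \<otimes> inv z \<in> NH (- L)" for x
  proof -
    obtain w where w: "word_over S w" "eval_word G w = x" "\<forall>r\<in>heights \<xi> 0 w. r \<ge> - L" using H[OF x] by blast
    have xc: "x \<in> carrier G" using x N_carrier by blast
    have "\<one> \<otimes> z \<otimes> inv \<one> \<otimes> inv z \<in> NH (- L)" using z subgroup.one_closed[OF NHsub] by simp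
    then have "x \<otimes> z \<otimes> inv x \<otimes> inv z \<in> NH (- L)" using path[of \<one> w] w \<xi>_one L xc by simp
    then have "(x \<otimes> z \<otimes> inv x \<otimes> inv z) \<otimes> (z \<otimes> x \<otimes> inv z) \<in> NH (- L)" using zx subgroup.m_closed[OF NHsub] by blast
    then show ?thesis using xc z by (simp add: group_normalize)
  qed
  have steps: "x \<in> NH (- L)" if "x \<in> N" "z [^] m \<otimes> x \<otimes> inv (z [^] m) \<in> NH (- L)" for x and m :: nat
    using that
  proof (induction m arbitrary: x)
    case 0 then show ?case using N_carrier by auto
  next
    case (Suc m)
    have xc: "x \<in> carrier G" using Suc N_carrier by blast
    have "z [^] Suc m \<otimes> x \<otimes> inv (z [^] Suc m) = z [^] m \<otimes> (z \<otimes> x \<otimes> inv z) \<otimes> inv (z [^] m)"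
      using z xc by (simp add: group_normalize)
    then have "z \<otimes> x \<otimes> inv z \<in> NH (- L)" using Suc.IH[of "z \<otimes> x \<otimes> inv z"] Suc.prems N_conj z by simp
    then show ?case using one_step Suc.prems by blast
  qed
  \<comment> \<open>A high power of \<open>z\<close> raises the finitely many conjugators occurring
    in \<open>x\<close> above height \<open>-L\<close>.\<close>
  have ex: "\<exists>m0::nat. \<forall>m\<ge>m0. z [^] m \<otimes> x \<otimes> inv (z [^] m) \<in> NH (- L)" if "x \<in> generate G (conjs G (carrier G) K)" for x
    using that
  proof induction
    case one then show ?case using z subgroup.one_closed[OF NHsub] by simp
  next
    case (incl h)
    then obtain g k where gk: "g \<in> carrier G" "k \<in> K" "h = g \<otimes> k \<otimes> inv g" by (rule conjsE)
    obtain m0 :: nat where m0: "- \<xi> g / \<xi> z < real m0" using reals_Archimedean2 by blast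
    have kc: "k \<in> carrier G" using gk Kc by blast
    have "z [^] m \<otimes> h \<otimes> inv (z [^] m) \<in> NH (- L)" if m: "m \<ge> m0" for m
    proof -
      have "- \<xi> g / \<xi> z < real m" using m m0 by linarith
      then have "- \<xi> g < real m * \<xi> z" using z(2) by (simp only: pos_divide_less_eq)
      then have "z [^] m \<otimes> g \<in> HS (- L)" using gk z L by (simp add: HS_def \<xi>_mult \<xi>_pow)
      then have "(z [^] m \<otimes> g) \<otimes> k \<otimes> inv (z [^] m \<otimes> g) \<in> NH (- L)" unfolding NH_def using gk by (intro generate.incl conjsI)
      then show ?thesis using gk kc z by (simp add: group_normalize)
    qed
    then show ?case by blast
  next
    case (inv h)
    then obtain g k where gk: "g \<in> carrier G" "k \<in> K" "h = g \<otimes> k \<otimes> inv g" by (metis conjsE)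
    obtain m0 :: nat where m0: "- \<xi> g / \<xi> z < real m0" using reals_Archimedean2 by blast
    have kc: "k \<in> carrier G" using gk Kc by blast
    have "z [^] m \<otimes> inv h \<otimes> inv (z [^] m) \<in> NH (- L)" if m: "m \<ge> m0" for m
    proof -
      have "- \<xi> g / \<xi> z < real m" using m m0 by linarith
      then have "- \<xi> g < real m * \<xi> z" using z(2) by (simp only: pos_divide_less_eq)
      then have "z [^] m \<otimes> g \<in> HS (- L)" using gk z L by (simp add: HS_def \<xi>_mult \<xi>_pow)
      then have "(z [^] m \<otimes> g) \<otimes> inv k \<otimes> inv (z [^] m \<otimes> g) \<in> NH (- L)" unfolding NH_def using gk K(4) by (intro generate.incl conjsI) auto
      then show ?thesis using gk kc z by (simp add: group_normalize)
    qed
    then show ?case by blast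
  next
    case (eng h1 h2)
    then obtain m1 m2 :: nat where m: "\<And>m. m \<ge> m1 \<Longrightarrow> z [^] m \<otimes> h1 \<otimes> inv (z [^] m) \<in> NH (- L)"
      "\<And>m. m \<ge> m2 \<Longrightarrow> z [^] m \<otimes> h2 \<otimes> inv (z [^] m) \<in> NH (- L)" by blast
    have c: "h1 \<in> carrier G" "h2 \<in> carrier G"
      using eng generate_in_carrier[of "conjs G (carrier G) K"] conjs_carrier[of "carrier G" K] Kc by auto
    have "z [^] m \<otimes> (h1 \<otimes> h2) \<otimes> inv (z [^] m) \<in> NH (- L)" if "m \<ge> max m1 m2" for m
    proof -
      have "(z [^] m \<otimes> h1 \<otimes> inv (z [^] m)) \<otimes> (z [^] m \<otimes> h2 \<otimes> inv (z [^] m)) \<in> NH (- L)"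
        using m that subgroup.m_closed[OF NHsub] by auto
      then show ?thesis using c z by (simp add: group_normalize)
    qed
    then show ?case by blast
  qed
  have N1: "N \<subseteq> NH (- L)"
  proof
    fix x assume x: "x \<in> N"
    then obtain m0 :: nat where "\<And>m. m \<ge> m0 \<Longrightarrow> z [^] m \<otimes> x \<otimes> inv (z [^] m) \<in> NH (- L)"
      using ex[OF subsetD[OF Ngen]] by blast
    then show "x \<in> NH (- L)" using steps[OF x, of m0] by blast
  qed
  \<comment> \<open>Conjugation by \<open>z^r\<close> maps \<open>N\<close> onto itself and raises
    height \<open>-L\<close> above 0.\<close>
  have N2: "N \<subseteq> NH 0"
  proof
    fix x assume x: "x \<in> N"
    then have xc: "x \<in> carrier G" using N_carrier by blast
    obtain r :: nat where r: "L / \<xi> z < real r" using reals_Archimedean2 by blast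
    have rz: "L < real r * \<xi> z" using r z(2) by (simp only: pos_divide_less_eq)
    let ?zr = "z [^] r"
    have zr: "?zr \<in> carrier G" using z by simp
    have "inv ?zr \<otimes> x \<otimes> inv (inv ?zr) \<in> N" using N_conj x zr by blast
    then have y: "inv ?zr \<otimes> x \<otimes> ?zr \<in> generate G (conjs G (HS (- L)) K)" using N1 zr unfolding NH_def by auto
    have "?zr \<otimes> (inv ?zr \<otimes> x \<otimes> ?zr) \<otimes> inv ?zr \<in> NH 0"
    proof (rule generate_conj_closed[OF cc zr NHsub _ y])
      fix s assume "s \<in> conjs G (HS (- L)) K"
      then obtain g k where gk: "g \<in> HS (- L)" "k \<in> K" "s = g \<otimes> k \<otimes> inv g" by (rule conjsE)
      have c: "g \<in> carrier G" "k \<in> carrier G" using gk HSc Kc by auto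
      have "?zr \<otimes> g \<in> HS 0" using gk c z rz by (simp add: HS_def \<xi>_mult \<xi>_pow)
      then have "(?zr \<otimes> g) \<otimes> k \<otimes> inv (?zr \<otimes> g) \<in> NH 0" unfolding NH_def using gk by (intro generate.incl conjsI)
      then show "?zr \<otimes> s \<otimes> inv ?zr \<in> NH 0" using gk c zr by (simp add: group_normalize)
    qed
    then show "x \<in> NH 0" using xc zr by (simp add: group_normalize)
  qed
  define P0 where "P0 j = {g \<in> prodn G S1 j. \<xi> g \<ge> 0}" for j
  have "closedin T {x \<in> topspace T. \<xi> x \<in> {0..}}"
    by (rule closedin_continuous_map_preimage[OF GstarD(2)[OF \<xi>]]) simp
  then have P0comp: "compactin T (P0 j)" for j
  proof -
    have "P0 j = {x \<in> topspace T. \<xi> x \<in> {0..}} \<inter> prodn G S1 j" unfolding P0_def using prodn_carrier[OF S1c] topspace by auto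
    then show ?thesis using closed_Int_compactin[OF \<open>closedin T _\<close> compact_prodn[OF S1(1)]] by simp
  qed
  have P0c: "P0 j \<subseteq> carrier G" for j using P0comp compact_carrier by blast
  have S1gen: "generate G S1 = carrier G"
    using cS(2) mono_generate[OF S1(2)] generate_incl[OF S1c] by auto
  have S1U: "carrier G = (\<Union>j. prodn G S1 j)" using generate_prodn[OF S1c S1(3,4)] S1gen by simp
  define Y where "Y j = conjs G (P0 j) K" for j
  have one_P0: "\<one> \<in> P0 j" for j using prodn_le[OF S1c S1(3), of 0 j] \<xi>_one by (auto simp: P0_def)
  have zc: "conjs G {inv z} K \<subseteq> N" using conjs_N[of "{inv z}"] K(5) z by auto
  \<comment> \<open>The elements of nonnegative height need not form a compactly generated monoid.
    It is enough to write the single compact set \<open>inv z K z\<close> as bounded products over a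
    bounded part \<open>P0 j\<close>.\<close>
  have "\<exists>j. conjs G {inv z} K \<subseteq> prodn G (Y j) j"
  proof (rule compact_subset_prodn[OF N_subgroup N_closed])
    show "compactin T (conjs G {inv z} K)" using z by (intro compact_conjs[OF compact_finite K(1)]) auto
    show "compactin T (Y j)" for j unfolding Y_def using P0comp K by (intro compact_conjs)
    show "Y j \<subseteq> N" for j unfolding Y_def by (rule conjs_N[OF P0c K(5)])
    show "\<one> \<in> Y j" for j unfolding Y_def using conjsI[OF one_P0[of j] K(3), of G] by simp
    show "inv y \<in> Y j" if "y \<in> Y j" for y j
    proof -
      from that obtain g k where gk: "g \<in> P0 j" "k \<in> K" "y = g \<otimes> k \<otimes> inv g" unfolding Y_def by (rule conjsE)
      have "g \<in> carrier G" "k \<in> carrier G" using gk P0c Kc by auto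
      then have "inv y = g \<otimes> inv k \<otimes> inv g" using gk by (simp add: group_normalize)
      then show ?thesis unfolding Y_def using gk K(4) conjsI by metis
    qed
    show "Y i \<subseteq> Y j" if "i \<le> j" for i j unfolding Y_def
      by (rule conjs_mono) (use prodn_le[OF S1c S1(3) that] in \<open>auto simp: P0_def\<close>)
    have "conjs G (HS 0) K \<subseteq> (\<Union>j. Y j)"
    proof
      fix y assume "y \<in> conjs G (HS 0) K"
      then obtain g k where gk: "g \<in> HS 0" "k \<in> K" "y = g \<otimes> k \<otimes> inv g" by (rule conjsE)
      then obtain j where "g \<in> P0 j" using S1U by (auto simp: HS_def P0_def)
      then have "y \<in> Y j" unfolding Y_def gk(3) using gk(2) by (rule conjsI)
      then show "y \<in> (\<Union>j. Y j)" by blast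
    qed
    from mono_generate[OF this] show "N \<subseteq> generate G (\<Union>j. Y j)" using N2 unfolding NH_def by (rule order_trans[rotated])
  qed (rule zc)
  then obtain j where j: "conjs G {inv z} K \<subseteq> prodn G (Y j) j" by blast
  obtain c where c: "c > 0" "\<And>s. s \<in> S1 \<Longrightarrow> \<bar>\<xi> s\<bar> \<le> c" using Gstar_bounded[OF \<xi> S1(1)] by blast
  obtain r :: nat where "c / \<xi> z < real r" using reals_Archimedean2 by blast
  then have rz: "c < real r * \<xi> z" using z(2) by (simp only: pos_divide_less_eq)
  \<comment> \<open>The power \<open>z^r\<close> lifts every generator \<open>s\<close> to
    nonnegative height. Afterwards \<open>s\<close> is recovered as
    \<open>(s z^r) inv (z^r)\<close>, because \<open>inv z\<close> preserves \<open>NM\<close> as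
    well.\<close>
  define P where "P = P0 j \<union> {z} \<union> (S1 <#> {z [^] r})"
  have Pcomp: "compactin T P" unfolding P_def
    using P0comp compact_finite[of "{z}"] compact_mult[OF S1(1) compact_finite[of "{z [^] r}"]] z by (intro compactin_Un) auto
  have Pc: "P \<subseteq> carrier G" using Pcomp compact_carrier by blast
  define M where "M = monoid_gen G P"
  have P\<xi>: "\<xi> p \<ge> 0" if p: "p \<in> P" for p
  proof -
    consider "p \<in> P0 j" | "p = z" | s where "s \<in> S1" "p = s \<otimes> z [^] r" using p by (auto simp: P_def set_mult_def)
    then show ?thesis
    proof cases
      case 3
      then show ?thesis using c(2)[of s] rz S1c z by (auto simp: \<xi>_mult \<xi>_pow subset_iff)
    qed (use z in \<open>auto simp: P0_def\<close>)
  qed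
  have MG: "m \<in> carrier G \<and> \<xi> m \<ge> 0" if "m \<in> M" for m
    using that unfolding M_def by induction (use Pc P\<xi> \<xi>_one in \<open>auto simp: \<xi>_mult subset_iff\<close>)
  have Mc: "M \<subseteq> carrier G" using MG by blast
  define NM where "NM = generate G (conjs G M K)"
  have cM: "conjs G M K \<subseteq> carrier G" by (rule conjs_carrier[OF Mc Kc])
  have NMsub: "subgroup NM G" unfolding NM_def using generate_is_subgroup[OF cM] .
  have NMN: "NM \<subseteq> N" unfolding NM_def
    by (rule generate_subgroup_incl[OF conjs_N[OF Mc K(5)] N_subgroup])
  have NMc: "NM \<subseteq> carrier G" using NMN N_carrier by blast
  have PM: "P \<subseteq> M" unfolding M_def using monoid_gen_incl[OF is_group Pc] by blast
  have Mconj: "m \<otimes> x \<otimes> inv m \<in> NM" if m: "m \<in> M" and x: "x \<in> NM" for m x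
  proof (rule generate_conj_closed[OF cM _ NMsub _ x[unfolded NM_def]])
    show "m \<in> carrier G" using m Mc by blast
    fix s assume "s \<in> conjs G M K"
    then obtain g k where gk: "g \<in> M" "k \<in> K" "s = g \<otimes> k \<otimes> inv g" by (rule conjsE)
    have cl: "g \<in> carrier G" "k \<in> carrier G" "m \<in> carrier G" using gk Mc Kc m by auto
    have "m \<otimes> g \<in> M" using monoid_gen_mult[OF is_group Pc] m gk unfolding M_def by blast
    then have "(m \<otimes> g) \<otimes> k \<otimes> inv (m \<otimes> g) \<in> NM" unfolding NM_def using gk by (intro generate.incl conjsI)
    then show "m \<otimes> s \<otimes> inv m \<in> NM" using gk cl by (simp add: group_normalize)
  qed
  have zinvK: "inv z \<otimes> k \<otimes> z \<in> NM" if k: "k \<in> K" for k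
  proof -
    have "inv z \<otimes> k \<otimes> inv (inv z) \<in> conjs G {inv z} K" using k by (intro conjsI) auto
    then have "inv z \<otimes> k \<otimes> z \<in> prodn G (Y j) j" using j z by auto
    moreover have YM: "Y j \<subseteq> conjs G M K" unfolding Y_def by (rule conjs_mono) (use PM in \<open>auto simp: P_def\<close>)
    ultimately show ?thesis using prodn_subset_generate[of "Y j" j] mono_generate[OF YM] YM cM unfolding NM_def by blast
  qed
  \<comment> \<open>By \<open>conj_swap\<close>, \<open>inv z\<close> can be moved past the
    conjugator from \<open>M\<close>; it then meets \<open>K\<close>, where \<open>zinvK\<close>
    applies.\<close>
  have zinv: "inv z \<otimes> x \<otimes> inv (inv z) \<in> NM" if x: "x \<in> NM" for x
  proof (rule generate_conj_closed[OF cM _ NMsub _ x[unfolded NM_def]])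
    show "inv z \<in> carrier G" using z by simp
    fix s assume "s \<in> conjs G M K"
    then obtain g k where gk: "g \<in> M" "k \<in> K" "s = g \<otimes> k \<otimes> inv g" by (rule conjsE)
    have cl: "g \<in> carrier G" "k \<in> carrier G" "k \<in> N" using gk Mc Kc K(5) by auto
    have "inv z \<otimes> s \<otimes> inv (inv z) = (inv z \<otimes> g) \<otimes> k \<otimes> inv (inv z \<otimes> g)" using gk cl z by (simp add: group_normalize)
    also have "\<dots> = (g \<otimes> inv z) \<otimes> k \<otimes> inv (g \<otimes> inv z)" using cl z by (intro conj_swap) auto
    also have "\<dots> = g \<otimes> (inv z \<otimes> k \<otimes> z) \<otimes> inv g" using cl z by (simp add: group_normalize)
    also have "\<dots> \<in> NM" using Mconj[OF gk(1) zinvK[OF gk(2)]] .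
    finally show "inv z \<otimes> s \<otimes> inv (inv z) \<in> NM" .
  qed
  have s_conj: "s \<otimes> x \<otimes> inv s \<in> NM" if s: "s \<in> S1" and x: "x \<in> NM" for s x
  proof -
    have sc: "s \<in> carrier G" using s S1c by blast
    have xc: "x \<in> carrier G" using x NMc by blast
    have 1: "inv z [^] r \<otimes> x \<otimes> inv (inv z [^] r) \<in> NM" by (rule pow_conj_closed[OF _ zinv NMc x]) (use z in auto)
    have e: "inv z [^] r = inv (z [^] r)" using z by (simp add: nat_pow_inv)
    have "s \<otimes> z [^] r \<in> M" using PM s by (auto simp: P_def set_mult_def)
    then have "(s \<otimes> z [^] r) \<otimes> (inv (z [^] r) \<otimes> x \<otimes> inv (inv (z [^] r))) \<otimes> inv (s \<otimes> z [^] r) \<in> NM"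
      using Mconj 1 unfolding e by blast
    then show ?thesis using sc xc z by (simp add: group_normalize)
  qed
  have all_conj: "g \<otimes> x \<otimes> inv g \<in> NM" if g: "g \<in> generate G S1" and "x \<in> NM" for g x
    using g \<open>x \<in> NM\<close>
  proof (induction arbitrary: x)
    case one then show ?case using NMc by auto
  next
    case (incl h) then show ?case using s_conj by blast
  next
    case (inv h) then show ?case using s_conj S1(4) by blast
  next
    case (eng h1 h2)
    have cl: "h1 \<in> carrier G" "h2 \<in> carrier G" "x \<in> carrier G" using eng generate_in_carrier[OF S1c] NMc by auto
    have "h1 \<otimes> (h2 \<otimes> x \<otimes> inv h2) \<otimes> inv h1 \<in> NM" using eng by blast
    then show ?case using cl by (simp add: group_normalize)
  qed
  have KNM: "K \<subseteq> NM"
  proof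
    fix k assume k: "k \<in> K"
    have "\<one> \<otimes> k \<otimes> inv \<one> \<in> conjs G M K" using k unfolding M_def by (intro conjsI) (auto intro: monoid_gen.one)
    moreover have "\<one> \<otimes> k \<otimes> inv \<one> = k" using k Kc by auto
    ultimately show "k \<in> NM" unfolding NM_def by (metis generate.incl)
  qed
  have "conjs G (carrier G) K \<subseteq> NM" using all_conj KNM S1gen by (auto elim!: conjsE)
  then have "N \<subseteq> NM" using Ngen generate_subgroup_incl[OF _ NMsub] by blast
  then have NM_eq: "NM = N" using NMN by blast
  have "cg_over G T N M" unfolding cg_over_def
  proof (intro exI[of _ K] conjI)
    show "generate G {g \<otimes> k \<otimes> inv g |g k. g \<in> M \<and> k \<in> K} = N" using NM_eq unfolding NM_def conjs_def .
  qed (use K in auto)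
  moreover have "cg_submonoid G T M" unfolding cg_submonoid_def using Pc Pcomp M_def by blast
  moreover have "M \<subseteq> Gchi G \<xi>" using MG by (auto simp: Gchi_def)
  ultimately show ?thesis by blast
qed

end

text \<open>\<open>cr g w\<close> is the signed number of crossings of height \<open>0\<close>, counted only at points of \<open>E\<close>, along the path that starts
  at \<open>g\<close> and follows \<open>w\<close>. The strip is so thick that a relator of length at most \<open>n0\<close> crossing height \<open>0\<close>
  stays either inside or outside \<open>E\<close>.\<close>

locale crossing = height_group +
  fixes c0 L :: real and n0 :: nat
  assumes c0: "\<And>s. s \<in> S \<Longrightarrow> \<bar>\<xi> s\<bar> \<le> c0" and c0_pos: "c0 > 0" and L: "2 * real (Suc n0) * c0 \<le> L"
begin

definition E where "E = {g \<in> carrier G. \<exists>w. word_over S w \<and> eval_word G w = g \<and> (\<forall>r\<in>heights \<xi> 0 w. \<bar>r\<bar> \<le> L)}"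
definition h :: "'a \<Rightarrow> int" where "h g = (if \<xi> g \<ge> 0 then 1 else 0)"
definition step :: "'a \<Rightarrow> 'a \<Rightarrow> int" where "step g g' = (if g \<in> E then h g' - h g else 0)"
definition ev :: "'a \<times> bool \<Rightarrow> 'a" where "ev y = (if snd y then fst y else inv (fst y))"

primrec cr :: "'a \<Rightarrow> 'a word \<Rightarrow> int" where
  "cr g [] = 0"
| "cr g (y # w) = step g (g \<otimes> ev y) + cr (g \<otimes> ev y) w"

lemma ev_closed: "fst y \<in> S \<Longrightarrow> ev y \<in> carrier G" using S by (auto simp: ev_def)

lemma ev_Cons: "eval_word G (y # w) = ev y \<otimes> eval_word G w" by (cases y) (simp add: ev_def)

lemma xi_ev: "fst y \<in> S \<Longrightarrow> \<bar>\<xi> (ev y)\<bar> \<le> c0" using c0 S \<xi>_inv by (auto simp: ev_def)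

lemma heights_Cons: "fst y \<in> S \<Longrightarrow> heights \<xi> d (y # w) = insert (d + \<xi> (ev y)) (heights \<xi> (d + \<xi> (ev y)) w)"
  using \<xi>_inv S by (cases y) (auto simp: ev_def)

lemma evw [simp]: "word_over S w \<Longrightarrow> eval_word G w \<in> carrier G" using S eval_word_closed by blast

lemma one_E: "\<one> \<in> E" unfolding E_def by (auto intro!: exI[of _ "[]"])

lemma c0_L: "c0 \<le> L" "0 \<le> L"
proof -
  have "1 * c0 \<le> 2 * real (Suc n0) * c0" using c0_pos by (intro mult_right_mono) auto
  then show "c0 \<le> L" using L by simp
  then show "0 \<le> L" using c0_pos by simp
qed

lemma E_step_aux:
  assumes "g \<in> E" "fst y \<in> S" "\<bar>\<xi> (g \<otimes> ev y)\<bar> \<le> L"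
  shows "g \<otimes> ev y \<in> E"
proof -
  obtain w where w: "word_over S w" "eval_word G w = g" "\<forall>r\<in>heights \<xi> 0 w. \<bar>r\<bar> \<le> L" and g: "g \<in> carrier G"
    using assms(1) unfolding E_def by blast
  have "eval_word G (w @ [y]) = g \<otimes> ev y"
    using w assms(2) ev_closed[OF assms(2)] eval_word_append[of S w "[y]"] S by (simp add: ev_Cons)
  moreover have "heights \<xi> 0 (w @ [y]) = heights \<xi> 0 w \<union> {\<xi> g + \<xi> (ev y)}"
    using w heights_append[OF w(1)] heights_Cons[OF assms(2), of _ "[]"] by simp
  ultimately show ?thesis unfolding E_def using w assms(2,3) g ev_closed[OF assms(2)]
    by (auto intro!: exI[of _ "w @ [y]"] simp: \<xi>_mult)
qed

lemma ev_inv: "fst y \<in> S \<Longrightarrow> ev (fst y, \<not> snd y) = inv (ev y)" using S by (auto simp: ev_def)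

text \<open>A path in the strip can be prolonged by \<open>y\<close> and, for the converse, by the
  inverse letter.\<close>

lemma E_step:
  assumes "g \<in> carrier G" "fst y \<in> S" "\<bar>\<xi> g\<bar> \<le> L" "\<bar>\<xi> (g \<otimes> ev y)\<bar> \<le> L"
  shows "g \<otimes> ev y \<in> E \<longleftrightarrow> g \<in> E"
proof
  assume e: "g \<otimes> ev y \<in> E"
  have yc: "ev y \<in> carrier G" using ev_closed assms by blast
  have "g \<otimes> ev y \<otimes> ev (fst y, \<not> snd y) = g" using ev_inv[OF assms(2)] assms yc by (simp add: m_assoc)
  then show "g \<in> E" using E_step_aux[OF e, of "(fst y, \<not> snd y)"] assms by simp
qed (use E_step_aux assms in blast)

lemma crossing_small:
  assumes "g \<in> carrier G" "fst y \<in> S" "h (g \<otimes> ev y) \<noteq> h g"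
  shows "\<bar>\<xi> g\<bar> \<le> c0" "\<bar>\<xi> (g \<otimes> ev y)\<bar> \<le> c0"
proof -
  have e: "\<xi> (g \<otimes> ev y) = \<xi> g + \<xi> (ev y)" using \<xi>_mult assms ev_closed by blast
  show "\<bar>\<xi> g\<bar> \<le> c0" "\<bar>\<xi> (g \<otimes> ev y)\<bar> \<le> c0"
    using assms(3) xi_ev[OF assms(2)] unfolding h_def e by (auto split: if_splits)
qed

text \<open>A letter that changes \<open>h\<close> has both ends within \<open>c0\<close> of height
  0, hence in the strip. So both ends or neither lie in \<open>E\<close>, and testing only the
  starting point is symmetric.\<close>

lemma step_anti:
  assumes "g \<in> carrier G" "fst y \<in> S"
  shows "step (g \<otimes> ev y) g = - step g (g \<otimes> ev y)"
proof (cases "h (g \<otimes> ev y) = h g")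
  case True then show ?thesis by (simp add: step_def)
next
  case False
  then have "g \<otimes> ev y \<in> E \<longleftrightarrow> g \<in> E" using crossing_small[OF assms False] c0_L by (intro E_step assms) auto
  then show ?thesis by (simp add: step_def)
qed

lemma cr_append: "g \<in> carrier G \<Longrightarrow> word_over S u \<Longrightarrow> cr g (u @ w) = cr g u + cr (g \<otimes> eval_word G u) w"
proof (induction u arbitrary: g)
  case (Cons y u)
  then have "ev y \<in> carrier G" using ev_closed by simp
  then show ?case using Cons by (simp add: ev_Cons m_assoc)
qed simp

lemma cr_inv: "g \<in> carrier G \<Longrightarrow> word_over S w \<Longrightarrow> cr (g \<otimes> eval_word G w) (inv_word w) = - cr g w"
proof (induction w arbitrary: g)
  case (Cons y w)
  obtain x b where y: "y = (x, b)" by (cases y)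
  have yc: "ev y \<in> carrier G" "fst y \<in> S" "word_over S w" using Cons ev_closed by auto
  have gy: "g \<otimes> ev y \<in> carrier G" using Cons yc by simp
  have e: "g \<otimes> eval_word G (y # w) = (g \<otimes> ev y) \<otimes> eval_word G w" using Cons yc by (simp add: ev_Cons m_assoc)
  have iw: "inv_word (y # w) = inv_word w @ [(fst y, \<not> snd y)]" by (simp add: y)
  have ret: "(g \<otimes> ev y) \<otimes> eval_word G w \<otimes> eval_word G (inv_word w) = g \<otimes> ev y"
    using gy yc eval_word_inv[of S w] S by (simp add: m_assoc)
  have "cr (g \<otimes> eval_word G (y # w)) (inv_word (y # w))
      = cr ((g \<otimes> ev y) \<otimes> eval_word G w) (inv_word w) + cr (g \<otimes> ev y) [(fst y, \<not> snd y)]"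
    unfolding e iw using gy yc ret by (subst cr_append) auto
  also have "cr (g \<otimes> ev y) [(fst y, \<not> snd y)] = step (g \<otimes> ev y) g"
    using ev_inv[OF yc(2)] yc Cons.prems by (simp add: m_assoc)
  also have "\<dots> = - step g (g \<otimes> ev y)" using step_anti Cons.prems yc by blast
  finally show ?case using Cons.IH[OF gy yc(3)] by simp
qed simp

lemma cr_const:
  assumes "g \<in> carrier G" "word_over S w"
    and "(\<xi> g \<ge> 0 \<and> (\<forall>r\<in>heights \<xi> (\<xi> g) w. r \<ge> 0)) \<or> (\<xi> g < 0 \<and> (\<forall>r\<in>heights \<xi> (\<xi> g) w. r < 0))"
  shows "cr g w = 0"
  using assms
proof (induction w arbitrary: g)
  case (Cons y w)
  have yc: "ev y \<in> carrier G" "fst y \<in> S" "word_over S w" using Cons.prems ev_closed by auto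
  have e: "\<xi> (g \<otimes> ev y) = \<xi> g + \<xi> (ev y)" using \<xi>_mult Cons.prems yc by blast
  have "cr (g \<otimes> ev y) w = 0" using Cons.prems yc heights_Cons[OF yc(2)] e by (intro Cons.IH) auto
  moreover have "step g (g \<otimes> ev y) = 0" using Cons.prems heights_Cons[OF yc(2)] e by (auto simp: step_def h_def)
  ultimately show ?case by simp
qed simp

text \<open>Membership in \<open>E\<close> is constant along a path in the strip, so the crossing
  numbers telescope.\<close>

lemma cr_strip:
  assumes "g \<in> carrier G" "word_over S w" "\<bar>\<xi> g\<bar> \<le> L" "\<forall>r\<in>heights \<xi> (\<xi> g) w. \<bar>r\<bar> \<le> L"
  shows "cr g w = (if g \<in> E then h (g \<otimes> eval_word G w) - h g else 0)"
  using assms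
proof (induction w arbitrary: g)
  case (Cons y w)
  have yc: "ev y \<in> carrier G" "fst y \<in> S" "word_over S w" using Cons.prems ev_closed by auto
  have e: "\<xi> (g \<otimes> ev y) = \<xi> g + \<xi> (ev y)" using \<xi>_mult Cons.prems yc by blast
  have l: "\<bar>\<xi> (g \<otimes> ev y)\<bar> \<le> L" using Cons.prems(4) heights_Cons[OF yc(2)] e by auto
  have "cr (g \<otimes> ev y) w = (if g \<otimes> ev y \<in> E then h (g \<otimes> ev y \<otimes> eval_word G w) - h (g \<otimes> ev y) else 0)"
    using Cons.prems yc heights_Cons[OF yc(2)] e l by (intro Cons.IH) auto
  moreover have "g \<otimes> ev y \<in> E \<longleftrightarrow> g \<in> E" using E_step Cons.prems yc l by blast
  ultimately show ?case using Cons.prems yc by (simp add: step_def ev_Cons m_assoc)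
qed simp

lemma heights_near: "word_over S w \<Longrightarrow> r \<in> heights \<xi> d w \<Longrightarrow> \<bar>r - d\<bar> \<le> real (length w) * c0"
proof (induction w arbitrary: d)
  case (Cons y w)
  have yS: "fst y \<in> S" "word_over S w" using Cons.prems by auto
  have c: "\<bar>\<xi> (ev y)\<bar> \<le> c0" using xi_ev yS by blast
  have "r = d + \<xi> (ev y) \<or> r \<in> heights \<xi> (d + \<xi> (ev y)) w" using Cons.prems heights_Cons[OF yS(1)] by auto
  then show ?case
  proof
    assume "r = d + \<xi> (ev y)"
    then have "\<bar>r - d\<bar> \<le> c0" using c by simp
    also have "\<dots> \<le> real (length (y # w)) * c0" using c0_pos by simp
    finally show ?thesis .
  next
    assume "r \<in> heights \<xi> (d + \<xi> (ev y)) w"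
    then have "\<bar>r - (d + \<xi> (ev y))\<bar> \<le> real (length w) * c0" using Cons.IH yS by blast
    then have "\<bar>r - d\<bar> \<le> real (length w) * c0 + c0" using c by linarith
    then show ?thesis by (simp add: algebra_simps)
  qed
qed simp

text \<open>A short relator that starts within \<open>n0 * c0\<close> of height 0 stays in the
  strip, where the count telescopes to zero because the path is closed. One that starts farther away
  never changes sign.\<close>

lemma cr_relator:
  assumes "g \<in> carrier G" "word_over S r" "length r \<le> n0" "eval_word G r = \<one>"
  shows "cr g r = 0"
proof -
  have near: "\<bar>t - \<xi> g\<bar> \<le> real n0 * c0" if "t \<in> heights \<xi> (\<xi> g) r" for t
  proof -
    have "\<bar>t - \<xi> g\<bar> \<le> real (length r) * c0" using heights_near assms that by blast
    also have "\<dots> \<le> real n0 * c0" using assms c0_pos by (intro mult_right_mono) auto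
    finally show ?thesis .
  qed
  have L2: "2 * (real n0 * c0) \<le> L" using L c0_pos by (simp add: algebra_simps)
  show ?thesis
  proof (cases "\<bar>\<xi> g\<bar> \<le> real n0 * c0")
    case True
    have "\<bar>t\<bar> \<le> L" if "t \<in> heights \<xi> (\<xi> g) r" for t using near[OF that] True L2 by linarith
    moreover have "\<bar>\<xi> g\<bar> \<le> L" using True L2 c0_pos by (smt (verit) mult_nonneg_nonneg of_nat_0_le_iff)
    ultimately show ?thesis using cr_strip[of g r] assms by simp
  next
    case False
    show ?thesis
    proof (cases "\<xi> g \<ge> 0")
      case True
      have "t \<ge> 0" if "t \<in> heights \<xi> (\<xi> g) r" for t using near[OF that] True False by linarith
      then show ?thesis using True cr_const assms by blast
    next
      case neg: False
      have "t < 0" if "t \<in> heights \<xi> (\<xi> g) r" for t using near[OF that] neg False by linarith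
      then show ?thesis using neg cr_const assms by (meson not_le)
    qed
  qed
qed

lemma cr_NC:
  assumes "w \<in> normal_closure_words S {r. word_over S r \<and> length r \<le> n0 \<and> eval_word G r = \<one>}"
  shows "\<forall>g\<in>carrier G. cr g w = 0"
proof -
  let ?R = "{r. word_over S r \<and> length r \<le> n0 \<and> eval_word G r = \<one>}"
  have nc: "word_over S v \<and> eval_word G v = \<one>" if "v \<in> normal_closure_words S ?R" for v
    using NC_eval[OF S _ that] by blast
  have pair: "cr g (u @ [(x, b), (x, \<not> b)] @ v) = cr g (u @ v)" if "word_over S u" "x \<in> S" "g \<in> carrier G" for g u x b v
  proof -
    let ?g = "g \<otimes> eval_word G u"
    have gc: "?g \<in> carrier G" "ev (x, b) \<in> carrier G" using that ev_closed by auto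
    have b: "?g \<otimes> ev (x, b) \<otimes> ev (x, \<not> b) = ?g" using ev_inv[of "(x, b)"] that gc by (simp add: m_assoc)
    have "step (?g \<otimes> ev (x, b)) ?g = - step ?g (?g \<otimes> ev (x, b))" using step_anti[OF gc(1), of "(x, b)"] that by simp
    then show ?thesis using that b by (simp add: cr_append)
  qed
  from assms show ?thesis
  proof (induction rule: normal_closure_words.induct)
    case nil then show ?case by simp
  next
    case (conj w r u)
    show ?case
    proof
      fix g assume g: "g \<in> carrier G"
      have w: "word_over S w" "eval_word G w = \<one>" using nc[OF conj.hyps(1)] by blast+
      have r: "word_over S r" "length r \<le> n0" "eval_word G r = \<one>" using conj.hyps by auto
      have "cr g (w @ u @ r @ inv_word u) = cr g u + cr (g \<otimes> eval_word G u) r + cr (g \<otimes> eval_word G u) (inv_word u)"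
        using g w r conj by (simp add: cr_append)
      then show "cr g (w @ u @ r @ inv_word u) = 0" using cr_relator[of "g \<otimes> eval_word G u" r] r conj g cr_inv[of g u] by simp
    qed
  next
    case (conj_inv w r u)
    show ?case
    proof
      fix g assume g: "g \<in> carrier G"
      have w: "word_over S w" "eval_word G w = \<one>" using nc[OF conj_inv.hyps(1)] by blast+
      have r: "word_over S r" "length r \<le> n0" "eval_word G r = \<one>" "eval_word G (inv_word r) = \<one>"
        using conj_inv.hyps eval_word_inv[of S r] S by auto
      let ?g = "g \<otimes> eval_word G u"
      have gc: "?g \<in> carrier G" using g conj_inv by simp
      have "cr g (w @ u @ inv_word r @ inv_word u) = cr g u + cr ?g (inv_word r) + cr ?g (inv_word u)"
        using g w r conj_inv by (simp add: cr_append)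
      moreover have "cr ?g (inv_word r) = 0" using cr_inv[OF gc r(1)] cr_relator[OF gc r(1,2,3)] r(3) gc by simp
      ultimately show "cr g (w @ u @ inv_word r @ inv_word u) = 0" using conj_inv g cr_inv[of g u] by simp
    qed
  next
    case (ins u v x b)
    have "word_over S u" using nc[OF ins.hyps(1)] by simp
    then show ?case using pair ins by simp
  next
    case (del u x b v)
    have "word_over S u" "x \<in> S" using nc[OF del.hyps] by simp_all
    then show ?case using pair[of u x _ b v] del.IH by simp
  qed
qed

text \<open>The commutator of the upper path \<open>wp\<close> and the lower path \<open>wm\<close>
  is a loop. The upper path never crosses. If neither endpoint lies in \<open>E\<close>, traversing
  \<open>wm\<close> backwards contributes 1 at its arrival at the identity, and the other traversal
  contributes 0 or 1, so the count cannot vanish. The letter \<open>y\<close> pushes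
  \<open>u\<close> strictly below 0, since height 0 itself counts as nonnegative.\<close>

lemma dichotomy_E:
  assumes loops: "\<And>w. word_over S w \<Longrightarrow> eval_word G w = \<one> \<Longrightarrow> cr \<one> w = 0"
    and wp: "word_over S wp" "\<forall>r\<in>heights \<xi> 0 wp. r \<ge> 0" "\<xi> (eval_word G wp) = 0"
    and y: "fst y \<in> S" "\<xi> (ev y) < 0"
    and u: "word_over S u" "\<forall>r\<in>heights \<xi> 0 u. r \<le> 0" "\<xi> (eval_word G u) = 0"
    and comm: "eval_word G wp \<otimes> (ev y \<otimes> eval_word G u \<otimes> inv (ev y)) = (ev y \<otimes> eval_word G u \<otimes> inv (ev y)) \<otimes> eval_word G wp"
  shows "eval_word G wp \<in> E \<or> ev y \<otimes> eval_word G u \<otimes> inv (ev y) \<in> E"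
proof (rule ccontr)
  let ?np = "eval_word G wp" and ?nm = "ev y \<otimes> eval_word G u \<otimes> inv (ev y)"
  assume notin: "\<not> (?np \<in> E \<or> ?nm \<in> E)"
  let ?y' = "(fst y, \<not> snd y)"
  define wm where "wm = [y] @ u @ [?y']"
  have yc: "ev y \<in> carrier G" and y': "ev ?y' = inv (ev y)" using ev_closed ev_inv y by auto
  have uc: "eval_word G u \<in> carrier G" and npc: "?np \<in> carrier G" using u wp by auto
  have nmc: "?nm \<in> carrier G" using yc uc by simp
  have wm_over: "word_over S wm" using y u by (simp add: wm_def)
  have wm_ev: "eval_word G wm = ?nm"
    using y u yc uc y' eval_word_append[of S u "[?y']"] S by (simp add: wm_def ev_Cons m_assoc del: eval_word_simps(2))
  have xy: "\<bar>\<xi> (ev y)\<bar> \<le> c0" using xi_ev y by blast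
  have cr_wp: "cr g wp = 0" if "g \<in> carrier G" "\<xi> g = 0" for g using cr_const[of g wp] that wp by simp
  \<comment> \<open>\<open>wm\<close> goes down with its first letter and up with its last; these
    crossings are counted exactly when the start, respectively the end, lies in
    \<open>E\<close>.\<close>
  have cr_wm: "cr g wm = (if g \<otimes> ?nm \<in> E then 1 else 0) - (if g \<in> E then 1 else 0)" if g: "g \<in> carrier G" "\<xi> g = 0" for g
  proof -
    let ?g1 = "g \<otimes> ev y" and ?g2 = "g \<otimes> ev y \<otimes> eval_word G u" and ?g3 = "g \<otimes> ev y \<otimes> eval_word G u \<otimes> inv (ev y)"
    have c: "?g1 \<in> carrier G" "?g2 \<in> carrier G" "?g3 \<in> carrier G" using g yc uc by auto
    have x1: "\<xi> ?g1 = \<xi> (ev y)" "\<xi> ?g2 = \<xi> (ev y)" "\<xi> ?g3 = 0" using g yc uc u(3) by (simp_all add: \<xi>_mult \<xi>_inv)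
    have "heights \<xi> (0 + \<xi> (ev y)) u = (\<lambda>r. r + \<xi> (ev y)) ` heights \<xi> 0 u" by (rule heights_shift)
    then have "\<forall>r\<in>heights \<xi> (\<xi> ?g1) u. r < 0" unfolding x1(1) using u(2) y(2) by force
    then have mid: "cr ?g1 u = 0" using cr_const[of ?g1 u] c u y x1 by simp
    have "cr g wm = step g ?g1 + (cr ?g1 u + cr ?g2 [?y'])" using c u by (simp add: wm_def cr_append)
    also have "cr ?g2 [?y'] = step ?g2 ?g3" using y' by simp
    finally have "cr g wm = step g ?g1 + step ?g2 ?g3" using mid by simp
    moreover have "step g ?g1 = - (if g \<in> E then 1 else 0)" using g x1 y(2) by (simp add: step_def h_def)
    moreover have "step ?g2 ?g3 = (if ?g2 \<in> E then 1 else 0)" using x1 y(2) by (simp add: step_def h_def)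
    moreover have "?g3 \<in> E \<longleftrightarrow> ?g2 \<in> E" using E_step[OF c(2), of ?y'] x1 y y' xy c0_L by simp
    moreover have "?g3 = g \<otimes> ?nm" using g yc uc by (simp add: m_assoc)
    ultimately show ?thesis by simp
  qed
  let ?W = "wp @ wm @ inv_word wp @ inv_word wm"
  have over: "word_over S ?W" using wp wm_over by simp
  have ivp: "eval_word G (inv_word wp) = inv ?np" and ivm: "eval_word G (inv_word wm) = inv ?nm"
    using eval_word_inv[of S] S wp wm_over wm_ev by auto
  have "eval_word G ?W = ?np \<otimes> (?nm \<otimes> (inv ?np \<otimes> inv ?nm))"
    using S wp wm_over wm_ev ivp ivm by (simp add: eval_word_append[of S])
  also have "\<dots> = (?np \<otimes> ?nm) \<otimes> (inv ?np \<otimes> inv ?nm)" using npc nmc by (metis inv_closed m_assoc m_closed)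
  also have "\<dots> = (?nm \<otimes> ?np) \<otimes> (inv ?np \<otimes> inv ?nm)" unfolding comm ..
  also have "\<dots> = \<one>" using npc nmc by (simp add: m_assoc del: inv_mult_group)
  finally have "cr \<one> ?W = 0" using loops over by blast
  moreover have "cr \<one> ?W = cr \<one> wp + (cr ?np wm + (cr (?np \<otimes> ?nm) (inv_word wp) + cr (?np \<otimes> ?nm \<otimes> inv ?np) (inv_word wm)))"
    using wp wm_over wm_ev ivp npc nmc by (simp add: cr_append)
  moreover have "cr \<one> wp = 0" using cr_wp \<xi>_one by simp
  moreover have "cr ?np wm = (if ?np \<otimes> ?nm \<in> E then 1 else 0)" using cr_wm[OF npc wp(3)] notin by simp
  moreover have "\<xi> ?nm = 0" using yc uc u(3) by (simp add: \<xi>_mult \<xi>_inv)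
  then have "cr (?nm \<otimes> ?np) (inv_word wp) = 0" using cr_inv[OF nmc wp(1)] cr_wp[OF nmc] by simp
  then have "cr (?np \<otimes> ?nm) (inv_word wp) = 0" unfolding comm .
  moreover have "?np \<otimes> ?nm \<otimes> inv ?np = ?nm" unfolding comm using npc nmc by (simp add: m_assoc)
  moreover have "cr ?nm (inv_word wm) = 1" using cr_inv[OF one_closed wm_over] cr_wm[OF one_closed \<xi>_one] wm_ev nmc notin one_E by simp
  ultimately show False by (simp split: if_splits)
qed

end

context metab
begin

lemma Gstar_N:
  assumes cG: "c \<in> Gstar G T" and k: "k \<in> N"
  shows "c k = 0"
proof -
  interpret height_group G T c "{}" by unfold_locales (use cG in auto)
  have "closedin T {x \<in> topspace T. c x \<in> {0}}" by (rule closedin_continuous_map_preimage[OF GstarD(2)[OF cG]]) simp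
  moreover have "derived G (carrier G) \<subseteq> {x \<in> topspace T. c x \<in> {0}}"
  proof
    fix d assume d: "d \<in> derived G (carrier G)"
    have "d \<in> carrier G" using d der_carrier by blast
    moreover have "c d = 0" using d unfolding derived_def
    proof induction
      case one show ?case by (rule \<xi>_one)
    next
      case (incl h) then show ?case by (auto simp: \<xi>_mult \<xi>_inv)
    next
      case (inv h) then show ?case by (auto simp: \<xi>_mult \<xi>_inv)
    next
      case (eng h1 h2)
      then have "h1 \<in> carrier G" "h2 \<in> carrier G" using der_carrier unfolding derived_def by auto
      then show ?case using eng \<xi>_mult by simp
    qed
    ultimately show "d \<in> {x \<in> topspace T. c x \<in> {0}}" using topspace by simp
  qed
  ultimately have "N \<subseteq> {x \<in> topspace T. c x \<in> {0}}" unfolding N_def by (intro closure_of_minimal)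
  then show ?thesis using k by blast
qed

text \<open>A power of \<open>y\<close> conjugates each element of \<open>N\<close> to one that is
  reached on a prescribed side of height 0. If all upper elements lie in \<open>E\<close>,
  conjugating back gives paths below \<open>L\<close> and generation over the half space of
  \<open>- c\<close>. Otherwise one upper element outside \<open>E\<close> forces, by
  \<open>dichotomy_E\<close>, conjugates of the lower ones into \<open>E\<close>, and the half space
  of \<open>c\<close> is obtained.\<close>

theorem Gamma_no_line_if_compactly_presentable:
  assumes cp: "compactly_presentable G T" and c: "c \<in> GammaG G T" "(\<lambda>x. - c x) \<in> GammaG G T" and x: "x \<in> carrier G"
  shows "c x = 0"
proof (rule ccontr)
  assume "c x \<noteq> 0"
  then have nz: "\<not> (\<forall>x\<in>carrier G. c x = 0)" "\<not> (\<forall>x\<in>carrier G. - c x = 0)" using x by auto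
  have cG: "c \<in> Gstar G T" and no1: "\<nexists>M. cg_submonoid G T M \<and> M \<subseteq> Gchi G c \<and> cg_over G T N M"
    and no2: "\<nexists>M. cg_submonoid G T M \<and> M \<subseteq> Gchi G (\<lambda>x. - c x) \<and> cg_over G T N M"
    using c nz unfolding GammaG_def N_def by auto
  obtain S n0 where cS: "S \<subseteq> carrier G" "compactin T S" "generate G S = carrier G"
    and pres: "\<forall>w. word_over S w \<and> eval_word G w = \<one> \<longrightarrow>
           w \<in> normal_closure_words S {r. word_over S r \<and> length r \<le> n0 \<and> eval_word G r = \<one>}"
    using cp unfolding compactly_presentable_def by (elim exE conjE)
  obtain c0 where c0: "c0 > 0" "\<And>s. s \<in> S \<Longrightarrow> \<bar>c s\<bar> \<le> c0" using Gstar_bounded[OF cG cS(2)] by blast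
  define L where "L = 2 * real (Suc n0) * c0"
  interpret crossing G T c S c0 L n0 by unfold_locales (use cG cS c0 L_def in auto)
  have loops: "\<And>w. word_over S w \<Longrightarrow> eval_word G w = \<one> \<Longrightarrow> cr \<one> w = 0" using pres cr_NC by blast
  have Nz: "c k = 0" if "k \<in> N" for k using Gstar_N[OF cG that] .
  have "\<exists>y. fst y \<in> S \<and> c (ev y) < 0"
  proof (rule ccontr)
    assume no: "\<not> (\<exists>y. fst y \<in> S \<and> c (ev y) < 0)"
    have c_S: "c s = 0" if s: "s \<in> S" for s
    proof -
      have "\<not> c (ev (s, True)) < 0" "\<not> c (ev (s, False)) < 0" using no s by (metis fst_conv)+
      then show ?thesis using s S \<xi>_inv by (auto simp: ev_def)
    qed
    have "c g = 0" if "g \<in> generate G S" for g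
      using that
    proof induction
      case one show ?case by (rule \<xi>_one)
    next
      case (eng h1 h2)
      then show ?case using generate_in_carrier[OF cS(1)] \<xi>_mult by simp
    qed (use S \<xi>_inv c_S in auto)
    then show False using nz(1) cS(3) by blast
  qed
  then obtain y where y: "fst y \<in> S" "c (ev y) < 0" by blast
  let ?y' = "(fst y, \<not> snd y)"
  have yc: "ev y \<in> carrier G" and y': "ev ?y' = inv (ev y)" "fst ?y' \<in> S" using ev_closed ev_inv y by auto
  have words: "\<exists>w. word_over S w \<and> eval_word G w = g" if "g \<in> carrier G" for g
  proof -
    have "generate G S \<subseteq> {eval_word G w |w. word_over S w}"
    proof (rule generate_subset_right_closed[OF cS(1)])
      show "\<one> \<in> {eval_word G w |w. word_over S w}" by (auto intro!: exI[of _ "[]"])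
      fix g s assume "g \<in> {eval_word G w |w. word_over S w}" "s \<in> S"
      then obtain w where w: "word_over S w" "g = eval_word G w" "s \<in> S" by blast
      have e: "g \<otimes> s = eval_word G (w @ [(s, True)])" "g \<otimes> inv s = eval_word G (w @ [(s, False)])"
        using w cS(1) by (auto simp: eval_word_append[of S])
      moreover have "word_over S (w @ [(s, True)])" "word_over S (w @ [(s, False)])" using w by auto
      ultimately show "g \<otimes> s \<in> {eval_word G w |w. word_over S w}" "g \<otimes> inv s \<in> {eval_word G w |w. word_over S w}" by blast+
    qed auto
    then show ?thesis using that cS(3) by blast
  qed
  define Y where "Y k = replicate k y" for k
  define Y' where "Y' k = replicate k ?y'" for k
  have Yo: "word_over S (Y k)" "word_over S (Y' k)" for k using y by (auto simp: Y_def Y'_def word_over_def)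
  have Ye: "eval_word G (Y k) = ev y [^] k" "eval_word G (Y' k) = inv (ev y [^] k)" for k
  proof -
    show "eval_word G (Y k) = ev y [^] k" unfolding Y_def
    proof (induction k)
      case (Suc k)
      have "eval_word G (replicate (Suc k) y) = ev y \<otimes> ev y [^] k" using Suc by (simp add: ev_Cons)
      then show ?case using nat_pow_Suc2[OF yc, of k] by simp
    qed simp
    show "eval_word G (Y' k) = inv (ev y [^] k)" unfolding Y'_def
    proof (induction k)
      case (Suc k)
      have "eval_word G (replicate (Suc k) ?y') = inv (ev y) \<otimes> inv (ev y [^] k)" using Suc y'(1) by (simp add: ev_Cons del: eval_word_simps(2))
      also have "\<dots> = inv (ev y [^] Suc k)" using yc by (simp add: inv_mult_group)
      finally show ?case .
    qed simp
  qed
  let ?e = "- c (ev y)"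
  have sgn: "(if snd y then c (fst y) else - c (fst y)) = c (ev y)" using y cS(1) \<xi>_inv by (auto simp: ev_def)
  have hY: "\<exists>i\<le>k. r = d + real i * c (ev y)" if "r \<in> heights c d (Y k)" for r d k
    using heights_replicate[of c d k "fst y" "snd y"] that sgn unfolding Y_def by auto
  have hY': "\<exists>i\<le>k. r = d - real i * c (ev y)" if "r \<in> heights c d (Y' k)" for r d k
  proof -
    have sg: "(if \<not> snd y then c (fst y) else - c (fst y)) = - c (ev y)" using sgn by (cases "snd y") auto
    have "r \<in> {d + real i * (if \<not> snd y then c (fst y) else - c (fst y)) |i. i \<le> k}"
      using heights_replicate[of c d k "fst y" "\<not> snd y"] that unfolding Y'_def by (rule subsetD)
    then show ?thesis unfolding sg by auto
  qed
  have bound: "\<exists>k. \<forall>r\<in>heights c 0 w. \<bar>r\<bar> \<le> real k * ?e" for w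
  proof -
    have "\<exists>B. \<forall>r\<in>heights c 0 w. \<bar>r\<bar> \<le> B" using finite_heights[of c 0 w] by (metis bounded_iff finite_imp_bounded real_norm_def)
    then obtain B where B: "\<And>r. r \<in> heights c 0 w \<Longrightarrow> \<bar>r\<bar> \<le> B" by blast
    obtain k :: nat where "B / ?e < real k" using reals_Archimedean2 by blast
    moreover have "0 < ?e" using y(2) by simp
    ultimately have "B < real k * ?e" by (simp only: pos_divide_less_eq)
    then show ?thesis using B by (intro exI[of _ k]) force
  qed
  have hsh: "heights c d w = (\<lambda>r. r + d) ` heights c 0 w" for d w using heights_shift[of c 0 d w] by simp
  have neg_le: "real i * c (ev y) \<le> 0" for i using y(2) by (simp add: mult_le_0_iff)
  have mono_i: "real k * c (ev y) \<le> real i * c (ev y)" if "i \<le> k" for i k using that y(2) by (simp add: mult_right_mono_neg)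
  \<comment> \<open>The inverse of \<open>y\<close> climbs, so enough copies of it lift the whole
    path \<open>w0\<close> to nonnegative heights.\<close>
  have up: "\<exists>w. word_over S w \<and> eval_word G w = inv (ev y [^] k) \<otimes> v \<otimes> ev y [^] k \<and> (\<forall>r\<in>heights c 0 w. r \<ge> 0)"
    if w: "word_over S w0" "eval_word G w0 = v" "\<forall>r\<in>heights c 0 w0. \<bar>r\<bar> \<le> real k * ?e" and v: "v \<in> N" for v w0 k
  proof (intro exI conjI)
    let ?w = "Y' k @ w0 @ Y k"
    have vc: "v \<in> carrier G" using v N_carrier by blast
    have pc: "ev y [^] k \<in> carrier G" using yc by simp
    show "word_over S ?w" using Yo w by simp
    show "eval_word G ?w = inv (ev y [^] k) \<otimes> v \<otimes> ev y [^] k"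
      using Yo w Ye vc pc cS(1) by (simp add: eval_word_append[of S] m_assoc)
    have h: "heights c 0 ?w = heights c 0 (Y' k) \<union> heights c (real k * ?e) w0 \<union> heights c (real k * ?e) (Y k)"
      using heights_append Yo w Ye yc Nz[OF v] by (simp add: \<xi>_inv \<xi>_pow Un_assoc)
    show "\<forall>r\<in>heights c 0 ?w. r \<ge> 0"
    proof
      fix r assume "r \<in> heights c 0 ?w"
      then consider "r \<in> heights c 0 (Y' k)" | "r \<in> heights c (real k * ?e) w0" | "r \<in> heights c (real k * ?e) (Y k)" using h by blast
      then show "r \<ge> 0"
      proof cases
        case 1 then show ?thesis using hY' neg_le by fastforce
      next
        case 2
        then obtain r' where "r' \<in> heights c 0 w0" "r = r' + real k * ?e" unfolding hsh[of "real k * ?e"] by blast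
        then show ?thesis using w(3) by force
      next
        case 3
        then obtain i where "i \<le> k" "r = real k * ?e + real i * c (ev y)" using hY by blast
        then show ?thesis using mono_i[of i k] by simp
      qed
    qed
  qed
  have down: "\<exists>w. word_over S w \<and> eval_word G w = ev y [^] k \<otimes> v \<otimes> inv (ev y [^] k) \<and> (\<forall>r\<in>heights c 0 w. r \<le> 0)"
    if w: "word_over S w0" "eval_word G w0 = v" "\<forall>r\<in>heights c 0 w0. \<bar>r\<bar> \<le> real k * ?e" and v: "v \<in> N" for v w0 k
  proof (intro exI conjI)
    let ?w = "Y k @ w0 @ Y' k"
    have vc: "v \<in> carrier G" using v N_carrier by blast
    have pc: "ev y [^] k \<in> carrier G" using yc by simp
    show "word_over S ?w" using Yo w by simp
    show "eval_word G ?w = ev y [^] k \<otimes> v \<otimes> inv (ev y [^] k)"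
      using Yo w Ye vc pc cS(1) by (simp add: eval_word_append[of S] m_assoc)
    have h: "heights c 0 ?w = heights c 0 (Y k) \<union> heights c (- (real k * ?e)) w0 \<union> heights c (- (real k * ?e)) (Y' k)"
      using heights_append Yo w Ye yc Nz[OF v] by (simp add: \<xi>_inv \<xi>_pow Un_assoc)
    show "\<forall>r\<in>heights c 0 ?w. r \<le> 0"
    proof
      fix r assume "r \<in> heights c 0 ?w"
      then consider "r \<in> heights c 0 (Y k)" | "r \<in> heights c (- (real k * ?e)) w0" | "r \<in> heights c (- (real k * ?e)) (Y' k)" using h by blast
      then show "r \<le> 0"
      proof cases
        case 1 then show ?thesis using hY neg_le by fastforce
      next
        case 2
        then obtain r' where "r' \<in> heights c 0 w0" "r = r' + - (real k * ?e)" unfolding hsh[of "- (real k * ?e)"] by blast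
        then show ?thesis using w(3) by force
      next
        case 3
        then obtain i where "i \<le> k" "r = - (real k * ?e) - real i * c (ev y)" using hY' by blast
        then show ?thesis using mono_i[of i k] by simp
      qed
    qed
  qed
  have pos: "c (inv (ev y)) > 0" "- c (ev y) > 0" using y yc \<xi>_inv by auto
  have pN: "ev y [^] k \<otimes> v \<otimes> inv (ev y [^] k) \<in> N" "inv (ev y [^] k) \<otimes> v \<otimes> ev y [^] k \<in> N" if "v \<in> N" for v and k :: nat
    using N_conj[of "ev y [^] k" v] N_conj[of "inv (ev y [^] k)" v] that yc by auto
  show False
  proof (cases "\<forall>w. word_over S w \<longrightarrow> eval_word G w \<in> N \<longrightarrow> (\<forall>r\<in>heights c 0 w. r \<ge> 0) \<longrightarrow> eval_word G w \<in> E")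
    case True
    have "\<exists>M. cg_submonoid G T M \<and> M \<subseteq> Gchi G (\<lambda>x. - c x) \<and> cg_over G T N M"
    proof (rule cg_over_if_connected_half_space[OF Gstar_uminus[OF cG] cS(2,3) yc pos(2) _ c0_L(2)])
      fix v assume v: "v \<in> N"
      have vc: "v \<in> carrier G" using v N_carrier by blast
      obtain w0 where w0: "word_over S w0" "eval_word G w0 = v" using words[OF vc] by blast
      obtain k where k: "\<forall>r\<in>heights c 0 w0. \<bar>r\<bar> \<le> real k * ?e" using bound by blast
      let ?v = "inv (ev y [^] k) \<otimes> v \<otimes> ev y [^] k"
      obtain w1 where w1: "word_over S w1" "eval_word G w1 = ?v" "\<forall>r\<in>heights c 0 w1. r \<ge> 0" using up[OF w0 k v] by blast
      have "?v \<in> E" using True w1 pN[OF v] by metis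
      then obtain w2 where w2: "word_over S w2" "eval_word G w2 = ?v" "\<forall>r\<in>heights c 0 w2. \<bar>r\<bar> \<le> L" unfolding E_def by blast
      \<comment> \<open>Down along \<open>Y k\<close>, then through the shifted strip, then up to
        height 0: no point of this path is higher than \<open>L\<close>.\<close>
      let ?w = "Y k @ w2 @ Y' k"
      have pc: "ev y [^] k \<in> carrier G" using yc by simp
      have ev: "eval_word G ?w = v" using Yo w2 Ye vc pc cS(1) by (simp add: eval_word_append[of S] m_assoc)
      have h: "heights c 0 ?w = heights c 0 (Y k) \<union> heights c (- (real k * ?e)) w2 \<union> heights c (- (real k * ?e)) (Y' k)"
        using heights_append Yo w2 Ye yc Nz[OF pN(2)[OF v]] by (simp add: \<xi>_inv \<xi>_pow Un_assoc)
      have "r \<le> L" if r: "r \<in> heights c 0 ?w" for r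
      proof -
        consider "r \<in> heights c 0 (Y k)" | "r \<in> heights c (- (real k * ?e)) w2" | "r \<in> heights c (- (real k * ?e)) (Y' k)" using h r by blast
        then show ?thesis
        proof cases
          case 1
          then obtain i where "r = 0 + real i * c (ev y)" using hY by blast
          then show ?thesis using neg_le[of i] c0_L by linarith
        next
          case 2
          then obtain r' where r': "r' \<in> heights c 0 w2" "r = r' + - (real k * ?e)" unfolding hsh[of "- (real k * ?e)"] by blast
          have "r' \<le> L" using w2(3) r'(1) by force
          then show ?thesis using r'(2) neg_le[of k] by simp
        next
          case 3
          then obtain i where "i \<le> k" "r = - (real k * ?e) - real i * c (ev y)" using hY' by blast
          then show ?thesis using mono_i[of i k] c0_L by simp
        qed
      qed
      moreover have "heights (\<lambda>x. - c x) 0 ?w = uminus ` heights c 0 ?w" using heights_uminus[of c 0 ?w] by simp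
      ultimately show "\<exists>w. word_over S w \<and> eval_word G w = v \<and> (\<forall>r\<in>heights (\<lambda>x. - c x) 0 w. - L \<le> r)"
        using ev Yo w2 by (intro exI[of _ ?w]) auto
    qed
    then show False using no2 by blast
  next
    case False
    then obtain wp where wp: "word_over S wp" "eval_word G wp \<in> N" "\<forall>r\<in>heights c 0 wp. r \<ge> 0" "eval_word G wp \<notin> E" by blast
    \<comment> \<open>\<open>dichotomy_E\<close> speaks about the conjugate by \<open>y\<close>;
      this additional letter is the reason for \<open>Suc k\<close> instead of \<open>k\<close>
      below.\<close>
    have allE: "ev y \<otimes> v \<otimes> inv (ev y) \<in> E" if u: "word_over S u" "eval_word G u = v" "v \<in> N" "\<forall>r\<in>heights c 0 u. r \<le> 0" for u v
      using dichotomy_E[OF loops wp(1,3) Nz[OF wp(2)] y u(1,4)] Nz[OF u(3)] u(2) N_comm[OF wp(2) N_conj[OF yc u(3)]] wp(4) by auto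
    have "\<exists>M. cg_submonoid G T M \<and> M \<subseteq> Gchi G c \<and> cg_over G T N M"
    proof (rule cg_over_if_connected_half_space[OF cG cS(2,3) _ pos(1) _ c0_L(2)])
      show "inv (ev y) \<in> carrier G" using yc by simp
      fix v assume v: "v \<in> N"
      have vc: "v \<in> carrier G" using v N_carrier by blast
      obtain w0 where w0: "word_over S w0" "eval_word G w0 = v" using words[OF vc] by blast
      obtain k where k: "\<forall>r\<in>heights c 0 w0. \<bar>r\<bar> \<le> real k * ?e" using bound by blast
      let ?v = "ev y [^] k \<otimes> v \<otimes> inv (ev y [^] k)"
      obtain u where u: "word_over S u" "eval_word G u = ?v" "\<forall>r\<in>heights c 0 u. r \<le> 0" using down[OF w0 k v] by blast
      have pc: "ev y [^] k \<in> carrier G" using yc by simp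
      have "ev y \<otimes> ?v \<otimes> inv (ev y) \<in> E" using allE[OF u(1,2) pN(1)[OF v] u(3)] .
      moreover have e1: "ev y \<otimes> ?v \<otimes> inv (ev y) = ev y [^] Suc k \<otimes> v \<otimes> inv (ev y [^] Suc k)"
        unfolding nat_pow_Suc2[OF yc] using yc pc vc by (simp add: group_normalize del: nat_pow_Suc)
      ultimately obtain w2 where w2: "word_over S w2" "eval_word G w2 = ev y [^] Suc k \<otimes> v \<otimes> inv (ev y [^] Suc k)" "\<forall>r\<in>heights c 0 w2. \<bar>r\<bar> \<le> L"
        unfolding E_def by auto
      let ?K = "Suc k"
      have pK: "ev y [^] ?K \<in> carrier G" using yc by (rule nat_pow_closed)
      let ?w = "Y' ?K @ w2 @ Y ?K"
      have ev: "eval_word G ?w = v" using Yo w2(1,2) Ye vc pK cS(1) by (simp add: eval_word_append[of S] m_assoc del: nat_pow_Suc)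
      have x2: "c (eval_word G w2) = 0" using w2(2) Nz[OF pN(1)[OF v, of ?K]] by simp
      have h: "heights c 0 ?w = heights c 0 (Y' ?K) \<union> heights c (real ?K * ?e) w2 \<union> heights c (real ?K * ?e) (Y ?K)"
        using heights_append Yo w2(1) Ye yc pK x2 \<xi>_pow[OF yc, of ?K] \<xi>_inv[OF pK] by (simp add: Un_assoc del: nat_pow_Suc of_nat_Suc)
      have "r \<ge> - L" if r: "r \<in> heights c 0 ?w" for r
      proof -
        consider "r \<in> heights c 0 (Y' ?K)" | "r \<in> heights c (real ?K * ?e) w2" | "r \<in> heights c (real ?K * ?e) (Y ?K)" using h r by blast
        then show ?thesis
        proof cases
          case 1
          then obtain i where "r = 0 - real i * c (ev y)" using hY' by blast
          then show ?thesis using neg_le[of i] c0_L by linarith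
        next
          case 2
          then obtain r' where r': "r' \<in> heights c 0 w2" "r = r' + real ?K * ?e" unfolding hsh[of "real ?K * ?e"] by blast
          have "r' \<ge> - L" using w2(3) r'(1) by force
          then show ?thesis using r'(2) neg_le[of ?K] by simp
        next
          case 3
          then obtain i where "i \<le> ?K" "r = real ?K * ?e + real i * c (ev y)" using hY by blast
          then show ?thesis using mono_i[of i ?K] c0_L by simp
        qed
      qed
      then show "\<exists>w. word_over S w \<and> eval_word G w = v \<and> (\<forall>r\<in>heights c 0 w. - L \<le> r)"
        using ev Yo w2 by (intro exI[of _ ?w]) auto
    qed
    then show False using no1 by blast
  qed
qed

end

section \<open>Contracting directions\<close>

lemma finite_box: "finite {a \<in> Zn n. \<forall>i. \<bar>a i\<bar> \<le> int j}"
proof (induction n)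
  case 0
  have "{a \<in> Zn 0. \<forall>i. \<bar>a i\<bar> \<le> int j} \<subseteq> {\<lambda>_. 0}" by (auto simp: Zn_def)
  then show ?case using finite_subset by blast
next
  case (Suc n)
  have "{a \<in> Zn (Suc n). \<forall>i. \<bar>a i\<bar> \<le> int j} \<subseteq> (\<Union>k\<in>{-int j..int j}. (\<lambda>a. a(n := k)) ` {a \<in> Zn n. \<forall>i. \<bar>a i\<bar> \<le> int j})"
  proof
    fix a assume a: "a \<in> {a \<in> Zn (Suc n). \<forall>i. \<bar>a i\<bar> \<le> int j}"
    then have "a(n := 0) \<in> {a \<in> Zn n. \<forall>i. \<bar>a i\<bar> \<le> int j}" by (auto simp: Zn_def)
    moreover have "a = (a(n := 0))(n := a n)" by auto
    moreover have "a n \<in> {-int j..int j}" using a by (auto simp: abs_le_iff minus_le_iff)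
    ultimately show "a \<in> (\<Union>k\<in>{-int j..int j}. (\<lambda>a. a(n := k)) ` {a \<in> Zn n. \<forall>i. \<bar>a i\<bar> \<le> int j})" by blast
  qed
  then show ?case using Suc finite_subset by (metis (no_types, lifting) finite_UN_I finite_atLeastAtMost_int finite_imageI)
qed

lemma Zn_in_box: "a \<in> Zn n \<Longrightarrow> \<exists>j. \<forall>i. \<bar>a i\<bar> \<le> int j"
proof -
  assume a: "a \<in> Zn n"
  have "\<bar>a i\<bar> \<le> int (nat (\<Sum>i<n. \<bar>a i\<bar>))" for i
  proof (cases "i < n")
    case True
    then have "\<bar>a i\<bar> \<le> (\<Sum>i<n. \<bar>a i\<bar>)" by (intro member_le_sum) auto
    then show ?thesis by simp
  next
    case False then show ?thesis using a by (simp add: Zn_def)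
  qed
  then show ?thesis by blast
qed

lemma (in group) prodn_conj:
  assumes "x \<in> carrier G" "A \<subseteq> carrier G" "\<And>a. a \<in> A \<Longrightarrow> x \<otimes> a \<otimes> inv x \<in> B" "y \<in> prodn G A j"
  shows "x \<otimes> y \<otimes> inv x \<in> prodn G B j"
  using assms(4)
proof (induction j arbitrary: y)
  case 0 then show ?case using assms(1) by simp
next
  case (Suc j)
  then obtain a z where az: "a \<in> A" "z \<in> prodn G A j" "y = a \<otimes> z" by (auto simp: set_mult_def)
  have c: "a \<in> carrier G" "z \<in> carrier G" using az assms(2) prodn_carrier by blast+
  have "(x \<otimes> a \<otimes> inv x) \<otimes> (x \<otimes> z \<otimes> inv x) \<in> B <#> prodn G B j" using az Suc assms(3) by (intro set_mult_memI) auto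
  then show ?case using az c assms(1) by (simp add: group_normalize)
qed

lemma (in group) prodn_prodn:
  assumes "A \<subseteq> prodn G B j" "B \<subseteq> carrier G" "y \<in> prodn G A i"
  shows "y \<in> prodn G B (i * j)"
  using assms(3)
proof (induction i arbitrary: y)
  case 0 then show ?case by simp
next
  case (Suc i)
  then obtain a z where az: "a \<in> A" "z \<in> prodn G A i" "y = a \<otimes> z" by (auto simp: set_mult_def)
  then show ?case using prodn_add[OF assms(2), of a j z "i * j"] Suc assms(1) by auto
qed

context metab
begin

lemma conj_q:
  assumes "x \<in> carrier G" "y \<in> carrier G" "q x = q y" "k \<in> N"
  shows "x \<otimes> k \<otimes> inv x = y \<otimes> k \<otimes> inv y"
proof -
  let ?c = "x \<otimes> inv y" and ?Y = "y \<otimes> k \<otimes> inv y"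
  have k: "k \<in> carrier G" using assms N_carrier by auto
  have c: "?c \<in> N" "?Y \<in> N" using q_eq_iff assms N_conj by auto
  have cc: "?c \<in> carrier G" "?Y \<in> carrier G" using c N_carrier by auto
  have "x \<otimes> k \<otimes> inv x = ?c \<otimes> ?Y \<otimes> inv ?c" using assms k by (simp add: group_normalize)
  also have "\<dots> = ?Y \<otimes> ?c \<otimes> inv ?c" using N_comm[OF c] by simp
  also have "\<dots> = ?Y" using cc by (simp add: m_assoc)
  finally show ?thesis .
qed

end

locale lattice_metab = metab +
  fixes n :: nat and t :: "nat \<Rightarrow> 'a" and C :: "'a set"
  assumes t: "\<And>i. i < n \<Longrightarrow> t i \<in> carrier G" and C: "compactin T C"
    and dec: "\<And>g. g \<in> carrier G \<Longrightarrow> \<exists>c\<in>C. \<exists>a\<in>Zn n. q g = q c \<otimes>\<^bsub>Q\<^esub> tpow Q (\<lambda>i. q (t i)) n a"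
begin

abbreviation tt where "tt a \<equiv> tpow G t n a"

lemma tt_closed [simp]: "tt a \<in> carrier G" using t by simp

lemma q_tt_add: "q (tt a \<otimes> tt b) = q (tt (\<lambda>i. a i + b i))"
proof -
  have tc: "\<And>i. i < n \<Longrightarrow> q (t i) \<in> carrier Q" using t by simp
  have qt: "q (tt a) = tpow Q (\<lambda>i. q (t i)) n a" for a using qt.q_tpow[of n t a] t by simp
  show ?thesis using qt.Q.tpow_add[of n "\<lambda>i. q (t i)" a b] tc by (simp add: qt)
qed

text \<open>Bounded generation instead of generation: only an expression with a fixed number
  \<open>j\<close> of factors can later be transported to a presented group.\<close>

definition reach :: "'a set \<Rightarrow> (nat \<Rightarrow> int) set \<Rightarrow> 'a set \<Rightarrow> bool" where
  "reach X E K \<longleftrightarrow> (\<exists>j. X \<subseteq> prodn G (conjs G (tt ` E) K) j)"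

definition vsum :: "(nat \<Rightarrow> int) set \<Rightarrow> (nat \<Rightarrow> int) set \<Rightarrow> (nat \<Rightarrow> int) set" where
  "vsum E E' = {\<lambda>i. a i + b i |a b. a \<in> E \<and> b \<in> E'}"

lemma finite_vsum: "finite E \<Longrightarrow> finite E' \<Longrightarrow> finite (vsum E E')"
proof -
  assume "finite E" "finite E'"
  then have "finite ((\<lambda>(a, b). \<lambda>i. a i + b i) ` (E \<times> E'))" by simp
  moreover have "vsum E E' \<subseteq> (\<lambda>(a, b). \<lambda>i. a i + b i) ` (E \<times> E')" by (auto simp: vsum_def)
  ultimately show ?thesis using finite_subset by blast
qed

lemma vsum_Zn: "E \<subseteq> Zn n \<Longrightarrow> E' \<subseteq> Zn n \<Longrightarrow> vsum E E' \<subseteq> Zn n"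
  unfolding vsum_def using Zn_add by blast

lemma tt_conj_carrier: "K \<subseteq> N \<Longrightarrow> conjs G (tt ` E) K \<subseteq> N" by (rule conjs_N) auto

text \<open>Conjugation on \<open>N\<close> depends only on the image of the conjugator in
  \<open>Q\<close>, where lattice vectors add up. The numbers of factors multiply.\<close>

lemma reach_trans:
  assumes "reach X E A" "reach A E' B" "A \<subseteq> N" "B \<subseteq> N"
  shows "reach X (vsum E E') B"
proof -
  obtain i j where i: "X \<subseteq> prodn G (conjs G (tt ` E) A) i" and j: "A \<subseteq> prodn G (conjs G (tt ` E') B) j"
    using assms unfolding reach_def by blast
  let ?V = "conjs G (tt ` vsum E E') B"
  have Bc: "B \<subseteq> carrier G" using assms N_carrier by blast
  have Vc: "?V \<subseteq> carrier G" by (rule conjs_carrier[OF _ Bc]) auto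
  have Ec: "conjs G (tt ` E') B \<subseteq> carrier G" by (rule conjs_carrier[OF _ Bc]) auto
  have "conjs G (tt ` E) A \<subseteq> prodn G ?V j"
  proof
    fix x assume "x \<in> conjs G (tt ` E) A"
    then obtain g k where gk: "g \<in> tt ` E" "k \<in> A" "x = g \<otimes> k \<otimes> inv g" by (rule conjsE)
    obtain a where a: "a \<in> E" "g = tt a" using gk by blast
    show "x \<in> prodn G ?V j" unfolding gk(3)
    proof (rule prodn_conj[OF _ Ec])
      show "g \<in> carrier G" using a by simp
      show "k \<in> prodn G (conjs G (tt ` E') B) j" using j gk by blast
      fix y assume "y \<in> conjs G (tt ` E') B"
      then obtain g' k' where gk': "g' \<in> tt ` E'" "k' \<in> B" "y = g' \<otimes> k' \<otimes> inv g'" by (rule conjsE)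
      obtain b where b: "b \<in> E'" "g' = tt b" using gk' by blast
      have kN: "k' \<in> N" "k' \<in> carrier G" using gk' assms N_carrier by auto
      have "g \<otimes> y \<otimes> inv g = (tt a \<otimes> tt b) \<otimes> k' \<otimes> inv (tt a \<otimes> tt b)"
        using a b gk' kN by (simp add: group_normalize)
      also have "\<dots> = tt (\<lambda>i. a i + b i) \<otimes> k' \<otimes> inv (tt (\<lambda>i. a i + b i))" using kN q_tt_add by (intro conj_q) auto
      also have "\<dots> \<in> ?V" using a b gk' by (intro conjsI imageI) (auto simp: vsum_def)
      finally show "g \<otimes> y \<otimes> inv g \<in> ?V" .
    qed
  qed
  then have "X \<subseteq> prodn G ?V (i * j)" using i prodn_prodn[OF _ Vc] by blast
  then show ?thesis unfolding reach_def by blast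
qed

lemma reach_mono: "reach X E K \<Longrightarrow> X' \<subseteq> X \<Longrightarrow> E \<subseteq> E' \<Longrightarrow> K \<subseteq> K' \<Longrightarrow> reach X' E' K'"
  unfolding reach_def using prodn_mono[OF conjs_mono] by (meson image_mono order_trans)

lemma lattice_decomp:
  assumes "g \<in> carrier G"
  obtains a c where "a \<in> Zn n" "c \<in> C" "q g = q (tt a \<otimes> c)"
proof -
  obtain c a where ca: "c \<in> C" "a \<in> Zn n" "q g = q c \<otimes>\<^bsub>Q\<^esub> tpow Q (\<lambda>i. q (t i)) n a" using dec[OF assms] by blast
  have e: "q (tt a) = tpow Q (\<lambda>i. q (t i)) n a" using qt.q_tpow[of n t a] t by simp
  have cc: "c \<in> carrier G" using ca C compact_carrier by blast
  have "q g = q c \<otimes>\<^bsub>Q\<^esub> q (tt a)" using ca e by simp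
  also have "\<dots> = q (tt a \<otimes> c)" using cc qt.Q.m_comm[of "q c" "q (tt a)"] by simp
  finally have "q g = q (tt a \<otimes> c)" .
  then show ?thesis using that ca by blast
qed

text \<open>Baire category turns generation over an infinite set of lattice points into bounded
  generation over finitely many of them, taken from a box.\<close>

lemma generate_reach:
  assumes P: "\<And>b. b \<in> Zn n \<Longrightarrow> P b \<Longrightarrow> b \<in> E0" and K: "compactin T K" "K \<subseteq> N" "\<one> \<in> K" "\<And>k. k \<in> K \<Longrightarrow> inv k \<in> K"
    and gen: "N \<subseteq> generate G (conjs G (tt ` {b \<in> Zn n. P b}) K)" and P0: "\<exists>b\<in>Zn n. P b"
    and L: "compactin T L" "L \<subseteq> N"
  shows "\<exists>E. finite E \<and> E \<subseteq> Zn n \<and> (\<forall>b\<in>E. P b) \<and> reach L E K"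
proof -
  obtain b0 where b0: "b0 \<in> Zn n" "P b0" using P0 by blast
  \<comment> \<open>The fixed point \<open>b0\<close> keeps every set nonempty, so that the identity
    belongs to each \<open>Y j\<close>.\<close>
  define Bx where "Bx j = insert b0 {a \<in> Zn n. (\<forall>i. \<bar>a i\<bar> \<le> int j) \<and> P a}" for j
  define Y where "Y j = conjs G (tt ` Bx j) K" for j
  have Bxf: "finite (Bx j)" for j unfolding Bx_def
    by (simp, rule finite_subset[OF _ finite_box[of n j]]) auto
  have "\<exists>j. L \<subseteq> prodn G (Y j) j"
  proof (rule compact_subset_prodn[OF N_subgroup N_closed L])
    show "compactin T (Y j)" for j unfolding Y_def using Bxf by (intro compact_conjs[OF compact_finite K(1)]) auto
    show "Y j \<subseteq> N" for j unfolding Y_def by (rule tt_conj_carrier[OF K(2)])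
    show "\<one> \<in> Y j" for j
    proof -
      have "tt b0 \<otimes> \<one> \<otimes> inv (tt b0) \<in> Y j" unfolding Y_def using K(3) by (intro conjsI imageI) (auto simp: Bx_def)
      then show ?thesis by simp
    qed
    show "inv y \<in> Y j" if "y \<in> Y j" for y j
    proof -
      from that obtain g k where gk: "g \<in> tt ` Bx j" "k \<in> K" "y = g \<otimes> k \<otimes> inv g" unfolding Y_def by (rule conjsE)
      have "g \<in> carrier G" "k \<in> carrier G" using gk K N_carrier by auto
      then have "inv y = g \<otimes> inv k \<otimes> inv g" using gk by (simp add: group_normalize)
      then show ?thesis unfolding Y_def using gk K(4) conjsI by metis
    qed
    show "Y i \<subseteq> Y j" if "i \<le> j" for i j unfolding Y_def
    proof (rule conjs_mono)
      have "Bx i \<subseteq> Bx j"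
      proof
        fix a assume a: "a \<in> Bx i"
        have "\<bar>a l\<bar> \<le> int j" if "\<bar>a l\<bar> \<le> int i" for l using that \<open>i \<le> j\<close> by linarith
        then show "a \<in> Bx j" using a by (auto simp: Bx_def)
      qed
      then show "tt ` Bx i \<subseteq> tt ` Bx j" by (rule image_mono)
    qed simp
    have "conjs G (tt ` {b \<in> Zn n. P b}) K \<subseteq> (\<Union>j. Y j)"
    proof
      fix y assume "y \<in> conjs G (tt ` {b \<in> Zn n. P b}) K"
      then obtain g k where gk: "g \<in> tt ` {b \<in> Zn n. P b}" "k \<in> K" "y = g \<otimes> k \<otimes> inv g" by (rule conjsE)
      then obtain b where b: "b \<in> Zn n" "P b" "g = tt b" by blast
      obtain j where "\<forall>i. \<bar>b i\<bar> \<le> int j" using Zn_in_box[OF b(1)] by blast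
      then have "b \<in> Bx j" using b by (simp add: Bx_def)
      then have "y \<in> Y j" unfolding Y_def gk(3) b(3) using gk(2) by (intro conjsI imageI)
      then show "y \<in> (\<Union>j. Y j)" by blast
    qed
    from mono_generate[OF this] show "N \<subseteq> generate G (\<Union>j. Y j)" using gen by (rule order_trans[rotated])
  qed
  then obtain j where j: "L \<subseteq> prodn G (Y j) j" by blast
  show ?thesis
  proof (intro exI conjI)
    show "finite (Bx j)" by (rule Bxf)
    show "Bx j \<subseteq> Zn n" "\<forall>b\<in>Bx j. P b" using b0 by (auto simp: Bx_def)
    show "reach L (Bx j) K" using j unfolding reach_def Y_def by blast
  qed
qed

text \<open>Absorbing the transversal \<open>C\<close> into the compact set turns conjugates by
  arbitrary elements into conjugates by lattice elements.\<close>

lemma translate_core: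
  assumes K0: "compactin T K0" "K0 \<subseteq> N"
  shows "\<exists>K C0. compactin T C0 \<and> C \<subseteq> C0 \<and> compactin T K \<and> K \<subseteq> N \<and> \<one> \<in> K \<and> (\<forall>k\<in>K. inv k \<in> K) \<and>
    (\<forall>c\<in>C. \<forall>k\<in>K0. c \<otimes> k \<otimes> inv c \<in> K)"
proof -
  obtain K1 where K1: "compactin T K1" "K0 \<subseteq> K1" "\<one> \<in> K1" "\<And>k. k \<in> K1 \<Longrightarrow> inv k \<in> K1" "K1 \<subseteq> N"
  proof
    let ?K = "K0 \<union> m_inv G ` K0 \<union> {\<one>}"
    show "compactin T ?K" using compactin_Un[OF compactin_Un[OF K0(1) compact_inv[OF K0(1)]] compact_finite[of "{\<one>}"]] by simp
    show "\<And>k. k \<in> ?K \<Longrightarrow> inv k \<in> ?K" using compact_carrier[OF K0(1)] by auto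
    show "?K \<subseteq> N" using K0(2) N_inv subgroup.one_closed[OF N_subgroup] by auto
  qed auto
  have K1c: "K1 \<subseteq> carrier G" using K1 N_carrier by blast
  obtain C0 where C0: "compactin T C0" "C \<subseteq> C0" "\<one> \<in> C0" using compact_symmetric[OF C] by blast
  have C0c: "C0 \<subseteq> carrier G" using C0 compact_carrier by blast
  let ?K = "conjs G C0 K1"
  have "compactin T ?K" using C0 K1 by (intro compact_conjs)
  moreover have "?K \<subseteq> N" by (rule conjs_N[OF C0c K1(5)])
  moreover have "\<one> \<in> ?K" using conjsI[OF C0(3) K1(3), of G] by simp
  moreover have "\<forall>k\<in>?K. inv k \<in> ?K"
  proof
    fix y assume "y \<in> ?K"
    then obtain g k where gk: "g \<in> C0" "k \<in> K1" "y = g \<otimes> k \<otimes> inv g" by (rule conjsE)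
    have "g \<in> carrier G" "k \<in> carrier G" using gk C0c K1c by auto
    then have "inv y = g \<otimes> inv k \<otimes> inv g" using gk by (simp add: group_normalize)
    then show "inv y \<in> ?K" using gk K1(4) conjsI by metis
  qed
  moreover have "\<forall>c\<in>C. \<forall>k\<in>K0. c \<otimes> k \<otimes> inv c \<in> ?K" using C0(2) K1(2) by (blast intro: conjsI)
  ultimately show ?thesis using C0 by blast
qed

lemma conj_decomp:
  assumes "g \<in> carrier G" "k \<in> N" "a \<in> Zn n" "c \<in> C" "q g = q (tt a \<otimes> c)"
  shows "g \<otimes> k \<otimes> inv g = tt a \<otimes> (c \<otimes> k \<otimes> inv c) \<otimes> inv (tt a)"
proof -
  have c: "c \<in> carrier G" "k \<in> carrier G" using assms C compact_carrier N_carrier by auto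
  have "g \<otimes> k \<otimes> inv g = (tt a \<otimes> c) \<otimes> k \<otimes> inv (tt a \<otimes> c)" using assms c by (intro conj_q) auto
  then show ?thesis using c by (simp add: group_normalize)
qed

lemma lattice_normal_core:
  "\<exists>K. compactin T K \<and> K \<subseteq> N \<and> \<one> \<in> K \<and> (\<forall>k\<in>K. inv k \<in> K) \<and> N \<subseteq> generate G (conjs G (tt ` Zn n) K)"
proof -
  obtain K0 where K0: "compactin T K0" "K0 \<subseteq> N" "N = generate G (conjs G (carrier G) K0)"
    using N_normally_compactly_generated by blast
  obtain K where K: "compactin T K" "K \<subseteq> N" "\<one> \<in> K" "\<forall>k\<in>K. inv k \<in> K" "\<And>c k. c \<in> C \<Longrightarrow> k \<in> K0 \<Longrightarrow> c \<otimes> k \<otimes> inv c \<in> K"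
    using translate_core[OF K0(1,2)] by blast
  have "conjs G (carrier G) K0 \<subseteq> conjs G (tt ` Zn n) K"
  proof
    fix x assume "x \<in> conjs G (carrier G) K0"
    then obtain g k where gk: "g \<in> carrier G" "k \<in> K0" "x = g \<otimes> k \<otimes> inv g" by (rule conjsE)
    obtain a c where ac: "a \<in> Zn n" "c \<in> C" "q g = q (tt a \<otimes> c)" using lattice_decomp[OF gk(1)] by blast
    have kN: "k \<in> N" using gk K0 by blast
    show "x \<in> conjs G (tt ` Zn n) K" unfolding gk(3) conj_decomp[OF gk(1) kN ac]
      using ac K(5)[OF ac(2) gk(2)] by (intro conjsI imageI)
  qed
  then have "N \<subseteq> generate G (conjs G (tt ` Zn n) K)" unfolding K0(3) by (rule mono_generate)
  then show ?thesis using K by blast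
qed

text \<open>For one of the two signs the character of direction \<open>v\<close> is outside
  \<open>GammaG\<close>, so \<open>N\<close> is compactly generated over a submonoid of its half
  space. Passing to lattice points loses at most a constant \<open>D0\<close>, and a translation
  beyond \<open>D0 + 1\<close> turns the lower bound \<open>- D0\<close> into 1.\<close>

lemma contraction_at:
  assumes \<phi>: "\<And>i. i < n \<Longrightarrow> \<phi> i \<in> Gstar G T" "\<And>i b. i < n \<Longrightarrow> b \<in> Zn n \<Longrightarrow> \<phi> i (tt b) = real_of_int (b i)"
    and tame: "\<And>c. c \<in> GammaG G T \<Longrightarrow> (\<lambda>x. - c x) \<in> GammaG G T \<Longrightarrow> (\<forall>x\<in>carrier G. c x = 0)"
    and v: "i0 < n" "v i0 \<noteq> 0"
  shows "\<exists>\<epsilon>\<in>{1, - 1}. \<exists>K E. compactin T K \<and> K \<subseteq> N \<and> \<one> \<in> K \<and> (\<forall>k\<in>K. inv k \<in> K) \<and> finite E \<and> E \<subseteq> Zn n \<and>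
    (\<forall>b\<in>E. \<epsilon> * (\<Sum>i<n. v i * real_of_int (b i)) \<ge> 1) \<and> reach K E K \<and> N \<subseteq> generate G (conjs G (tt ` Zn n) K)"
proof -
  define c where "c x = (\<Sum>i<n. v i * \<phi> i x)" for x
  have cadd: "c (x \<otimes> y) = c x + c y" if "x \<in> carrier G" "y \<in> carrier G" for x y
    using that GstarD(1)[OF \<phi>(1)] by (simp add: c_def sum.distrib[symmetric] algebra_simps)
  have ccont: "continuous_map T euclideanreal c" unfolding c_def
    using GstarD(2)[OF \<phi>(1)] by (intro continuous_map_sum continuous_map_real_mult_left) auto
  have cG: "c \<in> Gstar G T" using cadd ccont by (simp add: Gstar_def)
  have ctt: "c (tt b) = (\<Sum>i<n. v i * real_of_int (b i))" if "b \<in> Zn n" for b unfolding c_def using \<phi>(2) that by simp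
  define e0 :: "int \<Rightarrow> nat \<Rightarrow> int" where "e0 m = (\<lambda>i. if i = i0 then m else 0)" for m
  have e0: "e0 m \<in> Zn n" for m using v(1) by (auto simp: e0_def Zn_def)
  have ce0: "c (tt (e0 m)) = v i0 * real_of_int m" for m
  proof -
    have "c (tt (e0 m)) = (\<Sum>i<n. if i = i0 then v i0 * real_of_int m else 0)"
      unfolding ctt[OF e0] by (intro sum.cong) (auto simp: e0_def)
    then show ?thesis using v(1) by simp
  qed
  have "c (tt (e0 1)) \<noteq> 0" using ce0[of 1] v(2) by simp
  then have nz: "\<not> (\<forall>x\<in>carrier G. c x = 0)" by auto
  have "\<exists>\<epsilon>\<in>{1, - 1::real}. (\<lambda>x. \<epsilon> * c x) \<notin> GammaG G T"
  proof (cases "c \<in> GammaG G T")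
    case True
    then have "(\<lambda>x. - c x) \<notin> GammaG G T" using tame nz by blast
    then show ?thesis by (intro bexI[of _ "- 1"]) auto
  next
    case False then show ?thesis by (intro bexI[of _ 1]) auto
  qed
  then obtain \<epsilon> :: real where \<epsilon>: "\<epsilon> \<in> {1, - 1}" "(\<lambda>x. \<epsilon> * c x) \<notin> GammaG G T" by blast
  define d where "d x = \<epsilon> * c x" for x
  have dG: "d \<in> Gstar G T" unfolding Gstar_def d_def using cadd ccont by (auto simp: algebra_simps intro!: continuous_map_real_mult_left)
  have dadd: "d (x \<otimes> y) = d x + d y" if "x \<in> carrier G" "y \<in> carrier G" for x y using GstarD(1)[OF dG] that by blast
  have "d \<notin> GammaG G T" using \<epsilon>(2) by (simp add: d_def[abs_def])
  then obtain M where M: "cg_submonoid G T M" "M \<subseteq> Gchi G d" "cg_over G T N M"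
    using dG unfolding GammaG_def N_def by blast
  obtain K0 where K0: "K0 \<subseteq> N" "compactin T K0" "generate G (conjs G M K0) = N"
    using M(3) unfolding cg_over_def conjs_def by blast
  obtain K C0 where K: "compactin T C0" "C \<subseteq> C0" "compactin T K" "K \<subseteq> N" "\<one> \<in> K" "\<forall>k\<in>K. inv k \<in> K"
    "\<And>c k. c \<in> C \<Longrightarrow> k \<in> K0 \<Longrightarrow> c \<otimes> k \<otimes> inv c \<in> K"
    using translate_core[OF K0(2,1)] by blast
  \<comment> \<open>Replacing \<open>g\<close> by its lattice part changes the value of the
    character by at most its bound on the transversal.\<close>
  obtain D0 where D0: "D0 > 0" "\<And>s. s \<in> C0 \<Longrightarrow> \<bar>d s\<bar> \<le> D0" using Gstar_bounded[OF dG K(1)] by blast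
  let ?P = "\<lambda>b. d (tt b) \<ge> - D0"
  have MG: "M \<subseteq> carrier G" using M(2) by (auto simp: Gchi_def)
  have sub: "conjs G M K0 \<subseteq> conjs G (tt ` {b \<in> Zn n. ?P b}) K"
  proof
    fix x assume "x \<in> conjs G M K0"
    then obtain g k where gk: "g \<in> M" "k \<in> K0" "x = g \<otimes> k \<otimes> inv g" by (rule conjsE)
    have gc: "g \<in> carrier G" "d g \<ge> 0" using gk M(2) by (auto simp: Gchi_def)
    obtain a s where ac: "a \<in> Zn n" "s \<in> C" "q g = q (tt a \<otimes> s)" using lattice_decomp[OF gc(1)] by blast
    have kN: "k \<in> N" using gk K0 by blast
    have sc: "s \<in> carrier G" using ac C compact_carrier by blast
    have "g \<otimes> inv (tt a \<otimes> s) \<in> N" using q_eq_iff[OF gc(1) m_closed[OF tt_closed sc], of a] ac(3) by blast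
    then have "d (g \<otimes> inv (tt a \<otimes> s)) = 0" using Gstar_N[OF dG] by blast
    then have "d g = d (tt a) + d s" using dadd gc sc additive_inv[of d "tt a \<otimes> s"] by simp
    moreover have "\<bar>d s\<bar> \<le> D0" using D0 ac K(2) by blast
    ultimately have "?P a" using gc by linarith
    then show "x \<in> conjs G (tt ` {b \<in> Zn n. ?P b}) K" unfolding gk(3) conj_decomp[OF gc(1) kN ac]
      using ac K(7)[OF ac(2) gk(2)] by (intro conjsI imageI) auto
  qed
  have gen: "N \<subseteq> generate G (conjs G (tt ` {b \<in> Zn n. ?P b}) K)" using K0(3) mono_generate[OF sub] by simp
  obtain m :: nat where "(D0 + 1) / \<bar>v i0\<bar> < real m" using reals_Archimedean2 by blast
  moreover have "0 < \<bar>v i0\<bar>" using v by simp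
  ultimately have m: "D0 + 1 < real m * \<bar>v i0\<bar>" by (simp only: pos_divide_less_eq)
  define b0 where "b0 = e0 (if \<epsilon> * v i0 > 0 then int m else - int m)"
  have b0Z: "b0 \<in> Zn n" using e0 by (simp add: b0_def)
  have db0: "d (tt b0) > D0 + 1"
  proof -
    have "d (tt b0) = real m * \<bar>v i0\<bar>" using \<epsilon>(1) v(2) ce0 unfolding d_def b0_def by (auto simp: abs_if not_less)
    then show ?thesis using m by simp
  qed
  \<comment> \<open>\<open>K\<close> is the conjugate of \<open>?L\<close> by the lift of
    \<open>b0\<close>, and \<open>?L\<close> is reached over points of value at least
    \<open>- D0\<close>; composing the two shifts all conjugators by \<open>b0\<close>.\<close>
  let ?L = "conjs G {inv (tt b0)} K"
  have Lc: "compactin T ?L" by (intro compact_conjs[OF compact_finite K(3)]) auto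
  have LN: "?L \<subseteq> N" using conjs_N[of "{inv (tt b0)}" K] K by auto
  have P0: "\<exists>b\<in>Zn n. ?P b" using b0Z db0 D0 by (intro bexI[of _ b0]) auto
  obtain E where E: "finite E" "E \<subseteq> Zn n" "\<forall>b\<in>E. ?P b" "reach ?L E K"
    using generate_reach[of ?P "{b. ?P b}", OF _ K(3,4,5) _ gen P0 Lc LN] K(6) by auto
  have "reach K {b0} ?L"
  proof -
    have "K \<subseteq> prodn G (conjs G (tt ` {b0}) ?L) 1"
    proof
      fix k assume k: "k \<in> K"
      have kc: "k \<in> carrier G" using k K N_carrier by blast
      have "tt b0 \<otimes> (inv (tt b0) \<otimes> k \<otimes> inv (inv (tt b0))) \<otimes> inv (tt b0) \<in> conjs G (tt ` {b0}) ?L"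
        using k by (intro conjsI) auto
      then have "k \<in> conjs G (tt ` {b0}) ?L" using kc by (simp add: group_normalize)
      moreover have "conjs G (tt ` {b0}) ?L \<subseteq> carrier G" using tt_conj_carrier[OF LN] N_carrier by blast
      ultimately show "k \<in> prodn G (conjs G (tt ` {b0}) ?L) 1" using prodn_1 by blast
    qed
    then show ?thesis unfolding reach_def by blast
  qed
  then have r: "reach K (vsum {b0} E) K" using E(4) LN K(4) by (rule reach_trans)
  have "\<epsilon> * (\<Sum>i<n. v i * real_of_int (b i)) \<ge> 1" if b: "b \<in> vsum {b0} E" for b
  proof -
    obtain a where a: "a \<in> E" "b = (\<lambda>i. b0 i + a i)" using b by (auto simp: vsum_def)
    have aZ: "a \<in> Zn n" using a E by blast
    have "\<epsilon> * (\<Sum>i<n. v i * real_of_int (b i)) = \<epsilon> * (\<Sum>i<n. v i * real_of_int (b0 i)) + \<epsilon> * (\<Sum>i<n. v i * real_of_int (a i))"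
      unfolding a(2) by (simp add: algebra_simps sum.distrib)
    also have "\<dots> = d (tt b0) + d (tt a)" unfolding d_def ctt[OF b0Z] ctt[OF aZ] ..
    finally show ?thesis using db0 E(3) a(1) by fastforce
  qed
  moreover have "finite (vsum {b0} E)" "vsum {b0} E \<subseteq> Zn n" using finite_vsum[of "{b0}" E] E(1,2) b0Z vsum_Zn[of "{b0}" E] by auto
  moreover have "N \<subseteq> generate G (conjs G (tt ` Zn n) K)"
  proof -
    have "conjs G (tt ` {b \<in> Zn n. ?P b}) K \<subseteq> conjs G (tt ` Zn n) K" by (rule conjs_mono) auto
    from mono_generate[OF this] show ?thesis using gen by (rule order_trans[rotated])
  qed
  ultimately show ?thesis using \<epsilon>(1) K r by (intro bexI[of _ \<epsilon>] exI[of _ K] exI[of _ "vsum {b0} E"]) auto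
qed

lemma reach_0: "A \<subseteq> N \<Longrightarrow> reach A {\<lambda>_. 0} A"
proof -
  assume A: "A \<subseteq> N"
  have t0: "tt (\<lambda>_. 0) = \<one>" using t by simp
  have "A \<subseteq> conjs G (tt ` {\<lambda>_. 0}) A"
  proof
    fix k assume k: "k \<in> A"
    then have "tt (\<lambda>_. 0) \<otimes> k \<otimes> inv (tt (\<lambda>_. 0)) \<in> conjs G (tt ` {\<lambda>_. 0}) A" by (intro conjsI) auto
    moreover have "k \<in> carrier G" using k A N_carrier by blast
    ultimately show "k \<in> conjs G (tt ` {\<lambda>_. 0}) A" unfolding t0 by simp
  qed
  moreover have "conjs G (tt ` {\<lambda>_. 0}) A \<subseteq> carrier G" using tt_conj_carrier[OF A] N_carrier by blast
  ultimately show ?thesis unfolding reach_def using prodn_1 by blast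
qed

primrec iter :: "(nat \<Rightarrow> int) set \<Rightarrow> nat \<Rightarrow> (nat \<Rightarrow> int) set" where
  "iter E 0 = {\<lambda>_. 0}"
| "iter E (Suc r) = vsum E (iter E r)"

lemma reach_iter: "reach A E A \<Longrightarrow> A \<subseteq> N \<Longrightarrow> reach A (iter E r) A"
  by (induction r) (auto intro: reach_0 reach_trans)

lemma iter_props: "finite E \<Longrightarrow> E \<subseteq> Zn n \<Longrightarrow> finite (iter E r) \<and> iter E r \<subseteq> Zn n"
  by (induction r) (simp_all add: finite_vsum vsum_Zn)

lemma iter_bound:
  fixes u :: "nat \<Rightarrow> real"
  assumes "\<And>b. b \<in> E \<Longrightarrow> 1 / 2 < s * (\<Sum>i<n. u i * real_of_int (b i))" "b \<in> iter E r"
  shows "real r / 2 \<le> s * (\<Sum>i<n. u i * real_of_int (b i))"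
  using assms(2)
proof (induction r arbitrary: b)
  case (Suc r)
  then obtain a a' where a: "a \<in> E" "a' \<in> iter E r" "b = (\<lambda>i. a i + a' i)" by (auto simp: vsum_def)
  have "s * (\<Sum>i<n. u i * real_of_int (b i)) = s * (\<Sum>i<n. u i * real_of_int (a i)) + s * (\<Sum>i<n. u i * real_of_int (a' i))"
    unfolding a(3) by (simp add: algebra_simps sum.distrib)
  then show ?case using assms(1)[OF a(1)] Suc.IH[OF a(2)] by simp
qed simp

text \<open>Each direction contracts a compact set of its own, and the contraction persists nearby
  with a weaker constant; finitely many neighbourhoods cover the sphere. To contract their common
  union \<open>K\<close>, it is first expressed through the set of one neighbourhood, at a bounded
  loss \<open>\<beta>\<close>, and the contraction of that set is then iterated until the gain
  \<open>r / 2\<close> exceeds the loss by 1.\<close>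

theorem contraction_family:
  assumes \<phi>: "\<And>i. i < n \<Longrightarrow> \<phi> i \<in> Gstar G T" "\<And>i b. i < n \<Longrightarrow> b \<in> Zn n \<Longrightarrow> \<phi> i (tt b) = real_of_int (b i)"
    and tame: "\<And>c. c \<in> GammaG G T \<Longrightarrow> (\<lambda>x. - c x) \<in> GammaG G T \<Longrightarrow> (\<forall>x\<in>carrier G. c x = 0)"
    and Ks: "compactin T Ks" "Ks \<subseteq> N"
  shows "\<exists>K \<E>. compactin T K \<and> K \<subseteq> N \<and> Ks \<subseteq> K \<and> \<one> \<in> K \<and> (\<forall>k\<in>K. inv k \<in> K) \<and> finite \<E> \<and>
    (\<forall>E\<in>\<E>. finite E \<and> E \<subseteq> Zn n \<and> reach K E K) \<and>
    (\<forall>w::nat \<Rightarrow> real. (\<Sum>i<n. (w i)\<^sup>2) = 1 \<longrightarrow> (\<exists>E\<in>\<E>. (\<forall>b\<in>E. 1 \<le> (\<Sum>i<n. w i * real_of_int (b i))) \<or>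
       (\<forall>b\<in>E. (\<Sum>i<n. w i * real_of_int (b i)) \<le> - 1))) \<and>
    (\<forall>L. compactin T L \<longrightarrow> L \<subseteq> N \<longrightarrow> (\<exists>E. finite E \<and> E \<subseteq> Zn n \<and> reach L E K))"
proof -
  \<comment> \<open>The points of this product are extensional functions on the first
    \<open>n\<close> indices, so a vector is restricted before the cover of the sphere is applied to
    it.\<close>
  define X where "X = product_topology (\<lambda>_. euclideanreal) {..<n}"
  define f where "f b u = (\<Sum>i<n. u i * real_of_int (b i))" for b :: "nat \<Rightarrow> int" and u :: "nat \<Rightarrow> real"
  have proj: "continuous_map X euclideanreal (\<lambda>u. u i)" if "i < n" for i
    unfolding X_def using continuous_map_product_projection[of i "{..<n}" "\<lambda>_. euclideanreal"] that by simp
  have fcont: "continuous_map X euclideanreal (f b)" for b unfolding f_def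
    using proj by (intro continuous_map_sum continuous_map_real_mult) auto
  have topX: "topspace X = PiE {..<n} (\<lambda>_. UNIV)" by (simp add: X_def)
  define Sph where "Sph = {u \<in> topspace X. (\<Sum>i<n. (u i)\<^sup>2) \<in> {1}}"
  have u1: "\<bar>u i\<bar> \<le> 1" if "(\<Sum>i<n. (u i)\<^sup>2) = (1::real)" "i < n" for u :: "nat \<Rightarrow> real" and i
  proof -
    have "(u i)\<^sup>2 \<le> (\<Sum>i<n. (u i)\<^sup>2)" using that(2) by (intro member_le_sum) auto
    then show ?thesis using that(1) by (simp add: abs_square_le_1)
  qed
  have Sph: "compactin X Sph"
  proof (rule closed_compactin)
    show "compactin X (PiE {..<n} (\<lambda>_. {-1..1}))" unfolding X_def by (simp add: compactin_PiE)
    show "Sph \<subseteq> PiE {..<n} (\<lambda>_. {-1..1})" 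
    proof
      fix u assume "u \<in> Sph"
      then have "u \<in> extensional {..<n}" "(\<Sum>i<n. (u i)\<^sup>2) = 1" by (simp_all add: Sph_def topX PiE_iff)
      then show "u \<in> PiE {..<n} (\<lambda>_. {-1..1})" using u1[of u] by (auto simp: PiE_iff abs_le_iff)
    qed
    have "continuous_map X euclideanreal (\<lambda>u. \<Sum>i<n. (u i)\<^sup>2)" unfolding power2_eq_square
      using proj by (intro continuous_map_sum continuous_map_real_mult) auto
    then show "closedin X Sph" unfolding Sph_def by (rule closedin_continuous_map_preimage) simp
  qed
  have "\<exists>\<epsilon> K E. w \<in> Sph \<longrightarrow> \<epsilon> \<in> {1, - 1::real} \<and> compactin T K \<and> K \<subseteq> N \<and> \<one> \<in> K \<and> (\<forall>k\<in>K. inv k \<in> K) \<and> finite E \<and> E \<subseteq> Zn n \<and>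
    (\<forall>b\<in>E. \<epsilon> * f b w \<ge> 1) \<and> reach K E K \<and> N \<subseteq> generate G (conjs G (tt ` Zn n) K)" for w
  proof (cases "w \<in> Sph")
    case True
    then have "(\<Sum>i<n. (w i)\<^sup>2) = 1" by (simp add: Sph_def)
    then obtain i0 where i0: "i0 < n" "w i0 \<noteq> 0" by (metis (mono_tags, lifting) lessThan_iff power_zero_numeral sum.neutral zero_neq_one)
    have "\<exists>\<epsilon>\<in>{1, - 1::real}. \<exists>K E. compactin T K \<and> K \<subseteq> N \<and> \<one> \<in> K \<and> (\<forall>k\<in>K. inv k \<in> K) \<and> finite E \<and> E \<subseteq> Zn n \<and>
      (\<forall>b\<in>E. \<epsilon> * (\<Sum>i<n. w i * real_of_int (b i)) \<ge> 1) \<and> reach K E K \<and> N \<subseteq> generate G (conjs G (tt ` Zn n) K)"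
    proof (rule contraction_at[of \<phi> i0 w])
      show "\<And>i. i < n \<Longrightarrow> \<phi> i \<in> Gstar G T" by (rule \<phi>(1))
      show "\<And>i b. i < n \<Longrightarrow> b \<in> Zn n \<Longrightarrow> \<phi> i (tt b) = real_of_int (b i)" by (rule \<phi>(2))
      show "\<And>c. c \<in> GammaG G T \<Longrightarrow> (\<lambda>x. - c x) \<in> GammaG G T \<Longrightarrow> \<forall>x\<in>carrier G. c x = 0" by (rule tame)
    qed (rule i0)+
    then obtain \<epsilon> K E where eKE: "\<epsilon> \<in> {1, - 1::real}" "compactin T K \<and> K \<subseteq> N \<and> \<one> \<in> K \<and> (\<forall>k\<in>K. inv k \<in> K) \<and> finite E \<and> E \<subseteq> Zn n \<and>
      (\<forall>b\<in>E. \<epsilon> * f b w \<ge> 1) \<and> reach K E K \<and> N \<subseteq> generate G (conjs G (tt ` Zn n) K)"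
      unfolding f_def by (elim bexE exE)
    then show ?thesis by (intro exI[of _ \<epsilon>] exI[of _ K] exI[of _ E]) simp
  qed simp
  then obtain eps KK EE where ch: "\<And>w. w \<in> Sph \<Longrightarrow> eps w \<in> {1, - 1::real} \<and> compactin T (KK w) \<and> KK w \<subseteq> N \<and> \<one> \<in> KK w \<and>
    (\<forall>k\<in>KK w. inv k \<in> KK w) \<and> finite (EE w) \<and> EE w \<subseteq> Zn n \<and>
    (\<forall>b\<in>EE w. eps w * f b w \<ge> 1) \<and> reach (KK w) (EE w) (KK w) \<and> N \<subseteq> generate G (conjs G (tt ` Zn n) (KK w))" by metis
  \<comment> \<open>Any constant strictly between 0 and 1 would serve: the condition becomes open
    and still leaves a definite gain for each iteration.\<close>
  define O' where "O' w = {u \<in> topspace X. \<forall>b\<in>EE w. eps w * f b u \<in> {1/2<..}}" for w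
  have openball: "openin X {u \<in> topspace X. \<forall>b\<in>E. s * f b u \<in> {1/2<..}}" if "finite E" for E and s :: real
    using that
  proof induction
    case empty then show ?case by simp
  next
    case (insert b E)
    have "openin X {u \<in> topspace X. s * f b u \<in> {1/2<..}}"
      by (rule openin_continuous_map_preimage[OF continuous_map_real_mult_left[OF fcont]]) simp
    then have "openin X ({u \<in> topspace X. s * f b u \<in> {1/2<..}} \<inter> {u \<in> topspace X. \<forall>b\<in>E. s * f b u \<in> {1/2<..}})"
      using insert.IH by (rule openin_Int)
    moreover have "{u \<in> topspace X. s * f b u \<in> {1/2<..}} \<inter> {u \<in> topspace X. \<forall>b\<in>E. s * f b u \<in> {1/2<..}}
      = {u \<in> topspace X. \<forall>b\<in>insert b E. s * f b u \<in> {1/2<..}}" by blast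
    ultimately show ?case by simp
  qed
  have opO: "openin X (O' w)" if "w \<in> Sph" for w unfolding O'_def using openball ch[OF that] by blast
  have wO: "w \<in> O' w" if "w \<in> Sph" for w using ch[OF that] that by (force simp: O'_def Sph_def)
  obtain \<F> where F0: "finite \<F>" "\<F> \<subseteq> O' ` Sph" "Sph \<subseteq> \<Union>\<F>"
  proof -
    have "\<And>U. U \<in> O' ` Sph \<Longrightarrow> openin X U" using opO by blast
    moreover have "Sph \<subseteq> \<Union>(O' ` Sph)" using wO by blast
    ultimately show ?thesis using Sph that unfolding compactin_def by (metis (no_types, lifting))
  qed
  obtain F where F: "finite F" "F \<subseteq> Sph" "\<F> = O' ` F" using finite_subset_image[OF F0(1,2)] by blast
  have cov: "Sph \<subseteq> (\<Union>w\<in>F. O' w)" using F0(3) F(3) by simp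
  obtain KN where KN: "compactin T KN" "KN \<subseteq> N" "\<one> \<in> KN" "\<forall>k\<in>KN. inv k \<in> KN" "N \<subseteq> generate G (conjs G (tt ` Zn n) KN)"
    using lattice_normal_core by blast
  define K where "K = KN \<union> \<Union>(KK ` F) \<union> (Ks \<union> m_inv G ` Ks)"
  have KKF: "compactin T (KK w)" "KK w \<subseteq> N" "\<one> \<in> KK w" "\<And>k. k \<in> KK w \<Longrightarrow> inv k \<in> KK w" if "w \<in> F" for w
    using ch F(2) that by blast+
  have Ksc: "Ks \<subseteq> carrier G" using Ks N_carrier by blast
  have Kcomp: "compactin T K" unfolding K_def
    using F(1) KKF(1) by (intro compactin_Un KN(1) Ks(1) compact_inv[OF Ks(1)] compactin_Union) auto
  have KsubN: "K \<subseteq> N" unfolding K_def using KN(2) KKF(2) Ks(2) N_inv by blast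
  have Kone: "\<one> \<in> K" unfolding K_def using KN(3) by blast
  have Kinv: "inv k \<in> K" if "k \<in> K" for k
  proof -
    consider "k \<in> KN" | w where "w \<in> F" "k \<in> KK w" | "k \<in> Ks" | k' where "k' \<in> Ks" "k = inv k'" using \<open>k \<in> K\<close> unfolding K_def by blast
    then show ?thesis
    proof cases
      case 1 then show ?thesis unfolding K_def using KN(4) by blast
    next
      case 2 then show ?thesis unfolding K_def using KKF(4) by blast
    next
      case 3 then show ?thesis unfolding K_def by blast
    next
      case 4 then show ?thesis unfolding K_def using Ksc by auto
    qed
  qed
  have KKK: "KK w \<subseteq> K" if "w \<in> F" for w unfolding K_def using that by blast
  have TrueP: "{b \<in> Zn n. True} = Zn n" by simp
  have reach_all: "\<exists>E. finite E \<and> E \<subseteq> Zn n \<and> reach L E A"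
    if L: "compactin T L" "L \<subseteq> N" and A: "compactin T A" "A \<subseteq> N" "\<one> \<in> A" "\<And>k. k \<in> A \<Longrightarrow> inv k \<in> A" "N \<subseteq> generate G (conjs G (tt ` Zn n) A)" for L A
  proof -
    have "\<exists>E. finite E \<and> E \<subseteq> Zn n \<and> (\<forall>b\<in>E. True) \<and> reach L E A"
      by (rule generate_reach[of "\<lambda>_. True" UNIV, OF _ A(1,2,3) _ _ _ L]) (use A in \<open>auto simp: TrueP\<close>, use Zn_0 in blast)
    then show ?thesis by blast
  qed
  have "\<exists>E. w \<in> F \<longrightarrow> finite E \<and> E \<subseteq> Zn n \<and> reach K E K \<and>
      (\<forall>u\<in>O' w. (\<Sum>i<n. (u i)\<^sup>2) = 1 \<longrightarrow> (\<forall>b\<in>E. 1 \<le> eps w * f b u))" for w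
  proof (cases "w \<in> F")
    case True
    then have wS: "w \<in> Sph" using F by blast
    note cw = ch[OF wS]
    have e1: "eps w \<in> {1, - 1}" and EEw: "finite (EE w)" "EE w \<subseteq> Zn n" and rE: "reach (KK w) (EE w) (KK w)"
      and gN: "N \<subseteq> generate G (conjs G (tt ` Zn n) (KK w))" using cw by simp_all
    obtain B1 where B1: "finite B1" "B1 \<subseteq> Zn n" "reach K B1 (KK w)"
      using reach_all[OF Kcomp KsubN KKF[OF True] gN] by blast
    \<comment> \<open>Bounds the loss of the first step for all unit vectors at once, since their
      coordinates are at most 1 in absolute value.\<close>
    define \<beta> where "\<beta> = (\<Sum>b\<in>B1. \<Sum>i<n. \<bar>real_of_int (b i)\<bar>)"
    obtain r :: nat where r: "2 * (\<beta> + 1) < real r" using reals_Archimedean2 by blast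
    let ?E = "vsum B1 (iter (EE w) r)"
    have "reach K ?E (KK w)" using B1(3) reach_iter[OF rE KKF(2)[OF True]] KKF(2)[OF True] KKF(2)[OF True] by (rule reach_trans)
    then have "reach K ?E K" by (rule reach_mono[OF _ order_refl order_refl KKK[OF True]])
    moreover have "finite ?E" "?E \<subseteq> Zn n" using finite_vsum[OF B1(1)] iter_props[OF EEw, of r] vsum_Zn[OF B1(2)] by auto
    moreover have "1 \<le> eps w * f b u" if u: "u \<in> O' w" "(\<Sum>i<n. (u i)\<^sup>2) = 1" and b: "b \<in> ?E" for u b
    proof -
      obtain a a' where a: "a \<in> B1" "a' \<in> iter (EE w) r" "b = (\<lambda>i. a i + a' i)" using b by (auto simp: vsum_def)
      have "\<bar>f a u\<bar> \<le> (\<Sum>i<n. \<bar>u i * real_of_int (a i)\<bar>)" unfolding f_def by (rule sum_abs)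
      also have "\<dots> \<le> (\<Sum>i<n. \<bar>real_of_int (a i)\<bar>)"
        using u1[OF u(2)] by (intro sum_mono) (simp add: abs_mult mult_left_le_one_le)
      also have "\<dots> \<le> \<beta>" unfolding \<beta>_def using a(1) B1(1) by (intro member_le_sum) (auto simp: sum_nonneg)
      finally have fa: "\<bar>eps w * f a u\<bar> \<le> \<beta>" using e1 by (auto simp: abs_mult)
      have "real r / 2 \<le> eps w * f a' u" unfolding f_def
        by (rule iter_bound[OF _ a(2)]) (use u(1) in \<open>auto simp: O'_def f_def\<close>)
      moreover have "eps w * f b u = eps w * f a u + eps w * f a' u"
        unfolding a(3) f_def by (simp add: algebra_simps sum.distrib)
      ultimately show ?thesis using fa[THEN abs_le_D2] r[THEN less_imp_le] by argo
    qed
    ultimately show ?thesis by blast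
  qed simp
  then obtain Ew where Ew: "\<And>w. w \<in> F \<Longrightarrow> finite (Ew w) \<and> Ew w \<subseteq> Zn n \<and> reach K (Ew w) K \<and>
      (\<forall>u\<in>O' w. (\<Sum>i<n. (u i)\<^sup>2) = 1 \<longrightarrow> (\<forall>b\<in>Ew w. 1 \<le> eps w * f b u))" by metis
  show ?thesis
  proof (rule exI[of _ K], rule exI[of _ "Ew ` F"], intro conjI ballI allI impI)
    show "compactin T K" "K \<subseteq> N" "\<one> \<in> K" by fact+
    show "Ks \<subseteq> K" unfolding K_def by blast
    show "finite (Ew ` F)" using F(1) by simp
    show "\<And>k. k \<in> K \<Longrightarrow> inv k \<in> K" by (rule Kinv)
    show "\<And>E. E \<in> Ew ` F \<Longrightarrow> finite E" "\<And>E. E \<in> Ew ` F \<Longrightarrow> E \<subseteq> Zn n" "\<And>E. E \<in> Ew ` F \<Longrightarrow> reach K E K" using Ew by blast+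
    show "\<exists>E. finite E \<and> E \<subseteq> Zn n \<and> reach L E K" if "compactin T L" "L \<subseteq> N" for L
    proof (rule reach_all[OF that Kcomp KsubN Kone Kinv])
      have "conjs G (tt ` Zn n) KN \<subseteq> conjs G (tt ` Zn n) K" by (rule conjs_mono) (auto simp: K_def)
      from mono_generate[OF this] show "N \<subseteq> generate G (conjs G (tt ` Zn n) K)" using KN(5) by (rule order_trans[rotated])
    qed
    fix w :: "nat \<Rightarrow> real" assume w: "(\<Sum>i<n. (w i)\<^sup>2) = 1"
    define u where "u = restrict w {..<n}"
    have us: "(\<Sum>i<n. (u i)\<^sup>2) = 1" using w by (simp add: u_def)
    have fu: "f b u = (\<Sum>i<n. w i * real_of_int (b i))" for b by (simp add: f_def u_def)
    have "u \<in> Sph" using us by (simp add: Sph_def topX u_def)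
    then obtain w0 where w0: "w0 \<in> F" "u \<in> O' w0" using cov by blast
    have "eps w0 \<in> {1, - 1}" using ch F(2) w0 by blast
    moreover have "\<forall>b\<in>Ew w0. 1 \<le> eps w0 * f b u" using Ew[OF w0(1)] w0(2) us by blast
    ultimately show "\<exists>E\<in>Ew ` F. (\<forall>b\<in>E. 1 \<le> (\<Sum>i<n. w i * real_of_int (b i))) \<or>
       (\<forall>b\<in>E. (\<Sum>i<n. w i * real_of_int (b i)) \<le> - 1)"
      using w0(1) unfolding fu by (intro bexI[of _ "Ew w0"]) auto
  qed
qed

end

section \<open>Finiteness of the kernel\<close>

text \<open>\<open>s\<close> is a section of \<open>\<pi>\<close> that is multiplicative on the ball of radius \<open>r\<close> for the word metric of \<open>B0\<close>.\<close>

locale scaled_section = group G + H: group H for G (structure) and H :: "('h, 'k) monoid_scheme" (structure) +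
  fixes B0 :: "'a set" and r :: nat and s :: "'a \<Rightarrow> 'h" and \<pi> :: "'h \<Rightarrow> 'a"
  assumes B0: "B0 \<subseteq> carrier G" "\<one> \<in> B0" "\<And>b. b \<in> B0 \<Longrightarrow> inv b \<in> B0"
    and r1: "1 \<le> r"
    and sS: "s ` prodn G B0 r \<subseteq> carrier H"
    and gen_s: "generate H (s ` prodn G B0 r) = carrier H"
    and pi_hom: "\<pi> \<in> hom H G" and pi_s: "\<And>x. x \<in> prodn G B0 r \<Longrightarrow> \<pi> (s x) = x"
    and part: "\<And>x y. x \<in> prodn G B0 r \<Longrightarrow> y \<in> prodn G B0 r \<Longrightarrow> x \<otimes> y \<in> prodn G B0 r \<Longrightarrow> s x \<otimes>\<^bsub>H\<^esub> s y = s (x \<otimes> y)"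
begin

abbreviation Bl where "Bl j \<equiv> prodn G B0 j"

lemma Bl_le: "i \<le> j \<Longrightarrow> Bl i \<subseteq> Bl j" using prodn_le[OF B0(1,2)] .
lemma Bl_carrier: "x \<in> Bl j \<Longrightarrow> x \<in> carrier G" using prodn_carrier[OF B0(1)] by blast
lemma Bl_mult: "x \<in> Bl i \<Longrightarrow> y \<in> Bl j \<Longrightarrow> x \<otimes> y \<in> Bl (i + j)" using prodn_add[OF B0(1)] .
lemma Bl_inv: "x \<in> Bl j \<Longrightarrow> inv x \<in> Bl j" using prodn_inv[OF B0(1,3)] .
lemma Bl_1: "Bl 1 = B0" using prodn_1[OF B0(1)] .
lemma Bl_one: "\<one> \<in> Bl j" using Bl_le[of 0 j] by simp

lemma s_closed: "x \<in> Bl p \<Longrightarrow> p \<le> r \<Longrightarrow> s x \<in> carrier H" using sS Bl_le by blast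

lemma s_mult: "x \<in> Bl p \<Longrightarrow> y \<in> Bl p' \<Longrightarrow> p + p' \<le> r \<Longrightarrow> s (x \<otimes> y) = s x \<otimes>\<^bsub>H\<^esub> s y"
proof -
  assume a: "x \<in> Bl p" "y \<in> Bl p'" "p + p' \<le> r"
  have "x \<in> Bl r" "y \<in> Bl r" "x \<otimes> y \<in> Bl r"
    using a Bl_le[of p r] Bl_le[of p' r] Bl_le[of "p + p'" r] Bl_mult[OF a(1,2)] by auto
  then show ?thesis using part by simp
qed

lemma s_one: "s \<one> = \<one>\<^bsub>H\<^esub>"
proof -
  have "s (\<one> \<otimes> \<one>) = s \<one> \<otimes>\<^bsub>H\<^esub> s \<one>" using s_mult[OF Bl_one[of 0] Bl_one[of 0]] by simp
  then show ?thesis using s_closed[OF Bl_one[of 0]] by (simp add: H.l_cancel_one')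
qed

lemma s_inv: "x \<in> Bl p \<Longrightarrow> p \<le> r \<Longrightarrow> s (inv x) = inv\<^bsub>H\<^esub> (s x)"
proof -
  assume a: "x \<in> Bl p" "p \<le> r"
  have xr: "x \<in> Bl r" "inv x \<in> Bl r" using a Bl_le[of p r] Bl_inv by auto
  have "s (inv x) \<otimes>\<^bsub>H\<^esub> s x = s (inv x \<otimes> x)" using xr Bl_carrier[OF a(1)] Bl_one by (intro part) auto
  then have "s (inv x) \<otimes>\<^bsub>H\<^esub> s x = \<one>\<^bsub>H\<^esub>" using s_one Bl_carrier[OF a(1)] by simp
  then show ?thesis using s_closed[OF xr(1)] s_closed[OF xr(2)] by (metis H.inv_equality order_refl)
qed

lemma s_conj:
  assumes "x \<in> Bl p" "y \<in> Bl p'" "p + p' + p \<le> r"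
  shows "s (x \<otimes> y \<otimes> inv x) = s x \<otimes>\<^bsub>H\<^esub> s y \<otimes>\<^bsub>H\<^esub> inv\<^bsub>H\<^esub> (s x)"
proof -
  have "s (x \<otimes> y \<otimes> inv x) = s (x \<otimes> y) \<otimes>\<^bsub>H\<^esub> s (inv x)"
    by (rule s_mult[OF Bl_mult[OF assms(1,2)] Bl_inv[OF assms(1)] assms(3)])
  also have "s (x \<otimes> y) = s x \<otimes>\<^bsub>H\<^esub> s y" using assms by (intro s_mult[OF assms(1,2)]) auto
  also have "s (inv x) = inv\<^bsub>H\<^esub> (s x)" using assms by (intro s_inv[OF assms(1)]) auto
  finally show ?thesis .
qed

text \<open>Products of \<open>j\<close> elements of a ball of radius \<open>p\<close> can be
  transported as long as \<open>j * p\<close> is at most \<open>r\<close>; this is the origin of the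
  products among the later constants.\<close>

lemma s_prodn:
  assumes "A \<subseteq> Bl p" "y \<in> prodn G A j" "j * p \<le> r"
  shows "y \<in> Bl (j * p) \<and> s y \<in> generate H (s ` A)"
  using assms(2,3)
proof (induction j arbitrary: y)
  case 0 then show ?case using s_one generate.one by auto
next
  case (Suc j)
  then obtain a z where az: "a \<in> A" "z \<in> prodn G A j" "y = a \<otimes> z" by (auto simp: set_mult_def)
  have IH: "z \<in> Bl (j * p)" "s z \<in> generate H (s ` A)" using Suc.IH[OF az(2)] Suc.prems by auto
  have aB: "a \<in> Bl p" using az assms(1) by blast
  have "s y = s a \<otimes>\<^bsub>H\<^esub> s z" unfolding az(3) using Suc.prems by (intro s_mult[OF aB IH(1)]) simp
  moreover have "s a \<in> generate H (s ` A)" using az by (auto intro: generate.incl)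
  ultimately have "s y \<in> generate H (s ` A)" using IH(2) generate.eng by simp
  then show ?case using Bl_mult[OF aB IH(1)] az(3) by simp
qed

lemma H_gen: "generate H (s ` B0) = carrier H"
proof
  have c: "s ` B0 \<subseteq> carrier H" using s_closed[of _ 1] Bl_1 r1 by auto
  show "generate H (s ` B0) \<subseteq> carrier H" using H.generate_incl[OF c] .
  have "s ` Bl r \<subseteq> generate H (s ` B0)"
  proof
    fix h assume "h \<in> s ` Bl r"
    then obtain y where y: "y \<in> Bl r" "h = s y" by blast
    then show "h \<in> generate H (s ` B0)" using s_prodn[of B0 1 y r] Bl_1 by simp
  qed
  then show "carrier H \<subseteq> generate H (s ` B0)"
    using H.generate_subgroup_incl[OF _ H.generate_is_subgroup[OF c]] gen_s by blast
qed

lemma s_pow: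
  assumes "t \<in> B0" "nat \<bar>k\<bar> \<le> r"
  shows "t [^] k \<in> Bl (nat \<bar>k\<bar>) \<and> s (t [^] k) = s t [^]\<^bsub>H\<^esub> k"
proof -
  have t1: "t \<in> Bl 1" "t \<in> carrier G" using assms(1) Bl_1 B0 by auto
  have stc: "s t \<in> carrier H" using s_closed[OF t1(1) r1] .
  have nat: "t [^] m \<in> Bl m \<and> s (t [^] m) = s t [^]\<^bsub>H\<^esub> m" if "m \<le> r" for m :: nat
    using that
  proof (induction m)
    case 0 then show ?case using s_one by simp
  next
    case (Suc m)
    then have IH: "t [^] m \<in> Bl m" "s (t [^] m) = s t [^]\<^bsub>H\<^esub> m" by auto
    have "t [^] m \<otimes> t \<in> Bl (m + 1)" "s (t [^] m \<otimes> t) = s (t [^] m) \<otimes>\<^bsub>H\<^esub> s t"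
      using Bl_mult[OF IH(1) t1(1)] s_mult[OF IH(1) t1(1)] Suc.prems by auto
    then show ?case using IH by simp
  qed
  show ?thesis
  proof (cases "k \<ge> 0")
    case True
    then obtain m where m: "k = int m" using nonneg_int_cases by blast
    then show ?thesis using nat[of m] assms(2) by (simp add: int_pow_int)
  next
    case False
    then obtain m where m: "k = - int m" "m > 0" by (metis not_le neg_int_cases)
    have tm: "t [^] m \<in> Bl m" "s (t [^] m) = s t [^]\<^bsub>H\<^esub> m" using nat[of m] m assms(2) by auto
    have "s (inv (t [^] m)) = inv\<^bsub>H\<^esub> (s (t [^] m))" using s_inv[OF tm(1)] m assms(2) by simp
    then show ?thesis using m tm Bl_inv[OF tm(1)] int_pow_neg_int[OF t1(2), of m] H.int_pow_neg_int[OF stc, of m] by simp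
  qed
qed

lemma s_tpow:
  assumes "\<And>i. i < n \<Longrightarrow> t i \<in> B0" "length (clist n a) \<le> r"
  shows "tpow G t n a \<in> Bl (length (clist n a)) \<and> s (tpow G t n a) = tpow H (\<lambda>i. s (t i)) n a"
  using assms
proof (induction n)
  case 0 then show ?case using s_one by simp
next
  case (Suc n)
  then have IH: "tpow G t n a \<in> Bl (length (clist n a))" "s (tpow G t n a) = tpow H (\<lambda>i. s (t i)) n a" by auto
  have p: "t n [^] a n \<in> Bl (nat \<bar>a n\<bar>)" "s (t n [^] a n) = s (t n) [^]\<^bsub>H\<^esub> a n"
    using s_pow[of "t n" "a n"] Suc.prems by auto
  show ?case using Bl_mult[OF IH(1) p(1)] s_mult[OF IH(1) p(1)] IH p Suc.prems by simp
qed

end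

text \<open>\<open>K\<close> is contracted in every direction by some member of \<open>\<E>\<close>.
  \<open>j0\<close> bounds the word length of \<open>U\<close>; \<open>j1\<close> that of
  commutators of \<open>B0\<close> and of threefold quotients of elements of length
  \<open>j0\<close>; \<open>J\<close> bounds the number of conjugates in an expression;
  \<open>l\<close> and \<open>l2\<close> bound the lengths of lattice words. The conditions on
  \<open>r\<close> keep every such expression inside the ball where \<open>s\<close> is
  multiplicative.\<close>

locale presented_metab = lattice_metab G T n t C + scaled_section G H B0 r s \<pi>
  for G (structure) and T n t C and H :: "('h, 'k) monoid_scheme" (structure) and B0 r s \<pi> +
  fixes K U :: "'a set" and \<E> :: "(nat \<Rightarrow> int) set set" and EL :: "(nat \<Rightarrow> int) set" and M :: int
    and l l2 j0 j1 J :: nat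
  assumes tB: "\<And>i. i < n \<Longrightarrow> t i \<in> B0"
    and KU: "K \<subseteq> U" and UN: "U \<subseteq> N" and UB: "U \<subseteq> prodn G B0 j0"
    and commK: "\<And>a b. a \<in> t ` {..<n} \<union> m_inv G ` t ` {..<n} \<Longrightarrow> b \<in> t ` {..<n} \<union> m_inv G ` t ` {..<n} \<Longrightarrow> a \<otimes> b \<otimes> inv a \<otimes> inv b \<in> K"
    and EE: "\<And>E. E \<in> \<E> \<Longrightarrow> E \<subseteq> Zn n \<and> (\<exists>j\<le>J. K \<subseteq> prodn G (conjs G (tpow G t n ` E) K) j)"
    and lenE: "\<And>E b. E \<in> \<E> \<Longrightarrow> b \<in> E \<Longrightarrow> length (clist n b) \<le> l"
    and dir: "\<And>w::nat \<Rightarrow> real. (\<Sum>i<n. (w i)\<^sup>2) = 1 \<Longrightarrow> \<exists>E\<in>\<E>. (\<forall>b\<in>E. 1 \<le> (\<Sum>i<n. w i * real_of_int (b i))) \<or>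
       (\<forall>b\<in>E. (\<Sum>i<n. w i * real_of_int (b i)) \<le> - 1)"
    and M0: "M \<ge> 0" and Mth: "\<And>m::int. m \<ge> M \<Longrightarrow> real l \<le> sqrt m \<and> 1 + (real l)\<^sup>2 \<le> 2 * sqrt (m + 1) \<and>
      2 + sqrt ((sqrt (m + 1) + 2 * real l)\<^sup>2 - m) + sqrt (m + 1 - (sqrt m - real l)\<^sup>2) + 2 * real l \<le> sqrt m"
    and lenM: "\<And>a. a \<in> Zn n \<Longrightarrow> nsq n a \<le> M \<Longrightarrow> length (clist n a) \<le> l2"
    and l2: "l \<le> l2"
    and EL: "EL \<subseteq> Zn n" "\<And>b. b \<in> EL \<Longrightarrow> length (clist n b) \<le> l2" "\<exists>j\<le>J. N \<inter> prodn G B0 j1 \<subseteq> prodn G (conjs G (tpow G t n ` EL) K) j"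
    and j1: "4 + 4 * j0 \<le> j1"
    and r: "J * (2 * l2 + j0) \<le> r" "2 * l2 + 2 * j0 \<le> r" "j1 + 2 \<le> r"
begin

abbreviation x where "x i \<equiv> s (t i)"

lemma x_closed: "i < n \<Longrightarrow> x i \<in> carrier H" using s_closed[of "t i" 1] tB Bl_1 r1 by auto

lemma KB: "K \<subseteq> Bl j0" using KU UB by blast

lemma KN: "K \<subseteq> N" using KU UN by blast

lemma j0r: "j0 \<le> r" using r(2) by simp

lemma sK_closed: "s ` K \<subseteq> carrier H" using s_closed[OF _ j0r] KB by blast

lemma tau: "length (clist n b) \<le> l2 \<Longrightarrow> tt b \<in> Bl l2 \<and> s (tt b) = tpow H x n b"
proof -
  assume b: "length (clist n b) \<le> l2"
  have "l2 \<le> r" using r(2) by simp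
  then have "tt b \<in> Bl (length (clist n b)) \<and> s (tt b) = tpow H x n b" using s_tpow[of n t b] tB b by simp
  then show ?thesis using Bl_le[OF b] by blast
qed

text \<open>An expression of \<open>y\<close> as a bounded product of conjugates of \<open>K\<close>
  in \<open>G\<close> is carried over by \<open>s\<close> factor by factor.\<close>

lemma s_reach:
  assumes "\<And>b. b \<in> E \<Longrightarrow> length (clist n b) \<le> l2" "y \<in> prodn G (conjs G (tt ` E) K) j" "j \<le> J"
  shows "s y \<in> generate H (conjs H (tpow H x n ` E) (s ` K))"
proof -
  let ?A = "conjs G (tt ` E) K"
  have A: "?A \<subseteq> Bl (2 * l2 + j0)" and sA: "s ` ?A \<subseteq> conjs H (tpow H x n ` E) (s ` K)"
  proof -
    have *: "z \<in> Bl (2 * l2 + j0) \<and> s z \<in> conjs H (tpow H x n ` E) (s ` K)" if z: "z \<in> ?A" for z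
    proof -
      obtain g k where gk: "g \<in> tt ` E" "k \<in> K" "z = g \<otimes> k \<otimes> inv g" using z by (rule conjsE)
      obtain b where b: "b \<in> E" "g = tt b" using gk by blast
      have tb: "tt b \<in> Bl l2" "s (tt b) = tpow H x n b" using tau assms(1) b by auto
      have kB: "k \<in> Bl j0" using gk KB by blast
      have "z \<in> Bl (l2 + j0 + l2)" unfolding gk(3) b(2) by (rule Bl_mult[OF Bl_mult[OF tb(1) kB] Bl_inv[OF tb(1)]])
      moreover have "s z = s (tt b) \<otimes>\<^bsub>H\<^esub> s k \<otimes>\<^bsub>H\<^esub> inv\<^bsub>H\<^esub> (s (tt b))" unfolding gk(3) b(2)
        using r(2) by (intro s_conj[OF tb(1) kB]) simp
      ultimately show ?thesis using gk(2) b(1) unfolding tb(2) by (auto simp: algebra_simps mult_2_right intro!: conjsI)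
    qed
    show "?A \<subseteq> Bl (2 * l2 + j0)" "s ` ?A \<subseteq> conjs H (tpow H x n ` E) (s ` K)" using * by blast+
  qed
  have "j * (2 * l2 + j0) \<le> r" using assms(3) r(1) by (meson le_trans mult_le_mono1)
  then have "s y \<in> generate H (s ` ?A)" using s_prodn[OF A assms(2)] by blast
  then show ?thesis using H.mono_generate[OF sA] by blast
qed

text \<open>Commutators of lattice generators and their inverses belong to \<open>K\<close> by
  \<open>commK\<close> and have length 4, so \<open>s\<close> maps them to the corresponding
  commutators in \<open>H\<close>.\<close>

sublocale nf: normal_form_conjugates H n x "s ` K"
proof -
  interpret cc: commuting_conjugates H n x "s ` K"
    by unfold_locales (use x_closed sK_closed in auto)
  show "normal_form_conjugates H n x (s ` K)"
  proof unfold_locales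
    fix y z :: "nat \<times> bool" assume yz: "fst y < n" "fst z < n"
    define ev where "ev w = (if snd w then t (fst w) else inv (t (fst w)))" for w :: "nat \<times> bool"
    have ev: "ev w \<in> Bl 1" "cc.lval w = s (ev w)" "ev w \<in> t ` {..<n} \<union> m_inv G ` t ` {..<n}" if "fst w < n" for w
    proof -
      have "t (fst w) \<in> Bl 1" using tB that Bl_1 by simp
      then show "ev w \<in> Bl 1" "cc.lval w = s (ev w)" "ev w \<in> t ` {..<n} \<union> m_inv G ` t ` {..<n}"
        using s_inv[of "t (fst w)" 1] r1 Bl_inv[of "t (fst w)" 1] that by (auto simp: ev_def cc.lval_def)
    qed
    have r4: "4 \<le> r" using r(3) j1 by simp
    let ?z = "ev z" and ?y = "ev y"
    have B: "?z \<in> Bl 1" "?y \<in> Bl 1" using ev yz by auto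
    have "s (?z \<otimes> ?y \<otimes> inv ?z \<otimes> inv ?y) = s (?z \<otimes> ?y \<otimes> inv ?z) \<otimes>\<^bsub>H\<^esub> s (inv ?y)"
      using r4 by (intro s_mult[OF Bl_mult[OF Bl_mult[OF B] Bl_inv[OF B(1)]] Bl_inv[OF B(2)]]) simp
    also have "\<dots> = s ?z \<otimes>\<^bsub>H\<^esub> s ?y \<otimes>\<^bsub>H\<^esub> inv\<^bsub>H\<^esub> (s ?z) \<otimes>\<^bsub>H\<^esub> inv\<^bsub>H\<^esub> (s ?y)"
      using s_conj[OF B] s_inv[OF B(2)] r4 by simp
    finally have "s (?z \<otimes> ?y \<otimes> inv ?z \<otimes> inv ?y) = cc.lval z \<otimes>\<^bsub>H\<^esub> cc.lval y \<otimes>\<^bsub>H\<^esub> inv\<^bsub>H\<^esub> (cc.lval z) \<otimes>\<^bsub>H\<^esub> inv\<^bsub>H\<^esub> (cc.lval y)"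
      using ev yz by simp
    moreover have "?z \<otimes> ?y \<otimes> inv ?z \<otimes> inv ?y \<in> K" by (rule commK[OF ev(3)[OF yz(2)] ev(3)[OF yz(1)]])
    ultimately show "cc.lval z \<otimes>\<^bsub>H\<^esub> cc.lval y \<otimes>\<^bsub>H\<^esub> inv\<^bsub>H\<^esub> (cc.lval z) \<otimes>\<^bsub>H\<^esub> inv\<^bsub>H\<^esub> (cc.lval y) \<in> s ` K" by (metis imageI)
  qed
qed

text \<open>For short lattice points the commutation holds in the abelian group \<open>N\<close>,
  and both sides are short enough to be transported by \<open>s\<close>.\<close>

lemma Comm_base:
  assumes "a \<in> Zn n" "nsq n a \<le> M"
  shows "nf.Comm (tpow H x n a)"
  unfolding nf.Comm_def
proof (intro ballI)
  fix u v assume "u \<in> s ` K" "v \<in> s ` K"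
  then obtain k k' where k: "k \<in> K" "u = s k" "k' \<in> K" "v = s k'" by blast
  have ta: "tt a \<in> Bl l2" "s (tt a) = tpow H x n a" using tau lenM assms by auto
  have kB: "k \<in> Bl j0" "k' \<in> Bl j0" using k KB by auto
  let ?X = "tt a \<otimes> k' \<otimes> inv (tt a)"
  have XB: "?X \<in> Bl (l2 + j0 + l2)" by (rule Bl_mult[OF Bl_mult[OF ta(1) kB(2)] Bl_inv[OF ta(1)]])
  have sX: "s ?X = tpow H x n a \<otimes>\<^bsub>H\<^esub> v \<otimes>\<^bsub>H\<^esub> inv\<^bsub>H\<^esub> (tpow H x n a)"
    using s_conj[OF ta(1) kB(2)] r(2) unfolding ta(2) k(4) by simp
  have "k \<otimes> ?X = ?X \<otimes> k" using N_comm[of k ?X] N_conj[of "tt a" k'] k KN by auto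
  moreover have "s (k \<otimes> ?X) = s k \<otimes>\<^bsub>H\<^esub> s ?X" using r(2) by (intro s_mult[OF kB(1) XB]) simp
  moreover have "s (?X \<otimes> k) = s ?X \<otimes>\<^bsub>H\<^esub> s k" using r(2) by (intro s_mult[OF XB kB(1)]) simp
  ultimately show "u \<otimes>\<^bsub>H\<^esub> (tpow H x n a \<otimes>\<^bsub>H\<^esub> v \<otimes>\<^bsub>H\<^esub> inv\<^bsub>H\<^esub> (tpow H x n a)) = tpow H x n a \<otimes>\<^bsub>H\<^esub> v \<otimes>\<^bsub>H\<^esub> inv\<^bsub>H\<^esub> (tpow H x n a) \<otimes>\<^bsub>H\<^esub> u"
    unfolding sX[symmetric] k(2) by simp
qed

lemma Comm_lattice:
  assumes "a \<in> Zn n"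
  shows "nf.Comm (tpow H x n a)"
proof (rule nf.Comm_tpow[of \<E> l M, OF _ _ _ Mth Comm_base M0 assms])
  fix E assume E: "E \<in> \<E>"
  have "s ` K \<subseteq> generate H (conjs H (tpow H x n ` E) (s ` K))"
  proof
    fix h assume "h \<in> s ` K"
    then obtain k where k: "k \<in> K" "h = s k" by blast
    obtain j where j: "j \<le> J" "K \<subseteq> prodn G (conjs G (tt ` E) K) j" using EE[OF E] by blast
    show "h \<in> generate H (conjs H (tpow H x n ` E) (s ` K))" unfolding k(2)
      by (rule s_reach[of E k j]) (use lenE[OF E] l2 j k(1) le_trans in blast)+
  qed
  then show "E \<subseteq> Zn n \<and> s ` K \<subseteq> generate H (conjs H (tpow H x n ` E) (s ` K))" using EE[OF E] by blast
next
  fix E b assume "E \<in> \<E>" "b \<in> E" then show "length (clist n b) \<le> l" by (rule lenE)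
next
  fix a assume a: "a \<in> Zn n" "nsq n a > 0"
  define w where "w i = real_of_int (a i) / nm n a" for i
  have np: "nm n a > 0" using a(2) by (simp add: nm_def)
  have "(\<Sum>i<n. (w i)\<^sup>2) = (\<Sum>i<n. (real_of_int (a i))\<^sup>2) / (nm n a)\<^sup>2"
    by (simp add: w_def power_divide sum_divide_distrib)
  also have "\<dots> = 1" unfolding nm_sq using a(2) by (simp add: nsq_def flip: of_int_power of_int_sum)
  finally obtain E where E: "E \<in> \<E>" "(\<forall>b\<in>E. 1 \<le> (\<Sum>i<n. w i * real_of_int (b i))) \<or> (\<forall>b\<in>E. (\<Sum>i<n. w i * real_of_int (b i)) \<le> - 1)"
    using dir by blast
  have ws: "(\<Sum>i<n. w i * real_of_int (b i)) = real_of_int (\<Sum>i<n. a i * b i) / nm n a" for b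
    by (simp add: w_def sum_divide_distrib)
  have iff: "1 \<le> (\<Sum>i<n. w i * real_of_int (b i)) \<longleftrightarrow> nm n a \<le> real_of_int (\<Sum>i<n. a i * b i)"
    "(\<Sum>i<n. w i * real_of_int (b i)) \<le> - 1 \<longleftrightarrow> real_of_int (\<Sum>i<n. a i * b i) \<le> - nm n a" for b
    unfolding ws using np by (simp_all add: field_simps del: of_int_sum)
  show "\<exists>E\<in>\<E>. (\<forall>b\<in>E. real_of_int (\<Sum>i<n. a i * b i) \<le> - nm n a) \<or> (\<forall>b\<in>E. nm n a \<le> real_of_int (\<Sum>i<n. a i * b i))"
    using E unfolding iff by blast
qed

section \<open>The abelian normal subgroup of the presented group\<close>

definition X where "X = generate H (x ` {..<n})"

lemma X_gens: "x ` {..<n} \<subseteq> carrier H" using x_closed by auto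

lemma X_sub: "subgroup X H" unfolding X_def using H.generate_is_subgroup[OF X_gens] .

lemma X_carrier: "g \<in> X \<Longrightarrow> g \<in> carrier H" using subgroup.mem_carrier[OF X_sub] .

lemma Comm_X: "g \<in> X \<Longrightarrow> nf.Comm g" using nf.Comm_generate[OF Comm_lattice] unfolding X_def .

lemma tpow_X: "tpow H x n a \<in> X"
proof -
  have "m \<le> n \<Longrightarrow> tpow H x m a \<in> X" for m
  proof (induction m)
    case 0 then show ?case using subgroup.one_closed[OF X_sub] by simp
  next
    case (Suc m)
    have "x m \<in> X" unfolding X_def using Suc.prems by (auto intro: generate.incl)
    then have "x m [^]\<^bsub>H\<^esub> a m \<in> X" using H.subgroup_int_pow_closed[OF X_sub] by blast
    then show ?case using Suc subgroup.m_closed[OF X_sub] by simp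
  qed
  then show ?thesis by simp
qed

definition A1 where "A1 = generate H (conjs H X (s ` K))"

lemma gens_A1: "conjs H X (s ` K) \<subseteq> carrier H"
  by (rule H.conjs_carrier) (use X_carrier sK_closed in auto)

lemma A1_sub: "subgroup A1 H" unfolding A1_def using H.generate_is_subgroup[OF gens_A1] .

lemma A1_carrier: "g \<in> A1 \<Longrightarrow> g \<in> carrier H" using subgroup.mem_carrier[OF A1_sub] .

lemma A1_comm: "a \<in> A1 \<Longrightarrow> b \<in> A1 \<Longrightarrow> a \<otimes>\<^bsub>H\<^esub> b = b \<otimes>\<^bsub>H\<^esub> a"
proof -
  have gg: "a \<otimes>\<^bsub>H\<^esub> b = b \<otimes>\<^bsub>H\<^esub> a" if ab: "a \<in> conjs H X (s ` K)" "b \<in> conjs H X (s ` K)" for a b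
  proof -
    obtain g u where gu: "g \<in> X" "u \<in> s ` K" "a = g \<otimes>\<^bsub>H\<^esub> u \<otimes>\<^bsub>H\<^esub> inv\<^bsub>H\<^esub> g" using ab(1) by (rule conjsE)
    obtain g' v where gv: "g' \<in> X" "v \<in> s ` K" "b = g' \<otimes>\<^bsub>H\<^esub> v \<otimes>\<^bsub>H\<^esub> inv\<^bsub>H\<^esub> g'" using ab(2) by (rule conjsE)
    have c: "g \<in> carrier H" "g' \<in> carrier H" "u \<in> carrier H" "v \<in> carrier H" using gu gv X_carrier sK_closed by auto
    let ?w = "inv\<^bsub>H\<^esub> g \<otimes>\<^bsub>H\<^esub> g'"
    have "?w \<in> X" using gu gv X_sub by (simp add: subgroup.m_closed subgroup.m_inv_closed)
    then have "nf.Comm ?w" by (rule Comm_X)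
    then have "u \<otimes>\<^bsub>H\<^esub> (?w \<otimes>\<^bsub>H\<^esub> v \<otimes>\<^bsub>H\<^esub> inv\<^bsub>H\<^esub> ?w) = ?w \<otimes>\<^bsub>H\<^esub> v \<otimes>\<^bsub>H\<^esub> inv\<^bsub>H\<^esub> ?w \<otimes>\<^bsub>H\<^esub> u"
      using gu(2) gv(2) unfolding nf.Comm_def by blast
    then have "g \<otimes>\<^bsub>H\<^esub> (u \<otimes>\<^bsub>H\<^esub> (?w \<otimes>\<^bsub>H\<^esub> v \<otimes>\<^bsub>H\<^esub> inv\<^bsub>H\<^esub> ?w)) \<otimes>\<^bsub>H\<^esub> inv\<^bsub>H\<^esub> g = g \<otimes>\<^bsub>H\<^esub> (?w \<otimes>\<^bsub>H\<^esub> v \<otimes>\<^bsub>H\<^esub> inv\<^bsub>H\<^esub> ?w \<otimes>\<^bsub>H\<^esub> u) \<otimes>\<^bsub>H\<^esub> inv\<^bsub>H\<^esub> g" by simp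
    then show ?thesis using gu(3) gv(3) c by (simp add: H.group_normalize)
  qed
  have ga: "b \<otimes>\<^bsub>H\<^esub> a = a \<otimes>\<^bsub>H\<^esub> b" if a: "a \<in> conjs H X (s ` K)" and b: "b \<in> A1" for a b
    by (rule H.generate_centralizes[OF gens_A1 subsetD[OF gens_A1 a] gg[OF _ a] b[unfolded A1_def]])
  assume a: "a \<in> A1" and b: "b \<in> A1"
  show ?thesis by (rule H.generate_centralizes[OF gens_A1 A1_carrier[OF b] ga[OF _ b, symmetric] a[unfolded A1_def]])
qed

lemma X_conj_A1: "g \<in> X \<Longrightarrow> a \<in> A1 \<Longrightarrow> g \<otimes>\<^bsub>H\<^esub> a \<otimes>\<^bsub>H\<^esub> inv\<^bsub>H\<^esub> g \<in> A1"
proof -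
  assume g: "g \<in> X" and a: "a \<in> A1"
  have gc: "g \<in> carrier H" using g X_carrier by blast
  show ?thesis
  proof (rule H.generate_conj_closed[OF gens_A1 gc A1_sub _ a[unfolded A1_def]])
    fix z assume "z \<in> conjs H X (s ` K)"
    then obtain g' v where gv: "g' \<in> X" "v \<in> s ` K" "z = g' \<otimes>\<^bsub>H\<^esub> v \<otimes>\<^bsub>H\<^esub> inv\<^bsub>H\<^esub> g'" by (rule conjsE)
    have c: "g' \<in> carrier H" "v \<in> carrier H" using gv X_carrier sK_closed by auto
    have "g \<otimes>\<^bsub>H\<^esub> g' \<in> X" using g gv subgroup.m_closed[OF X_sub] by blast
    then have "(g \<otimes>\<^bsub>H\<^esub> g') \<otimes>\<^bsub>H\<^esub> v \<otimes>\<^bsub>H\<^esub> inv\<^bsub>H\<^esub> (g \<otimes>\<^bsub>H\<^esub> g') \<in> A1" unfolding A1_def using gv(2) by (intro generate.incl conjsI)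
    then show "g \<otimes>\<^bsub>H\<^esub> z \<otimes>\<^bsub>H\<^esub> inv\<^bsub>H\<^esub> g \<in> A1" using gv(3) c gc by (simp add: H.group_normalize)
  qed
qed

text \<open>\<open>EL\<close> reaches all elements of \<open>N\<close> of length at most
  \<open>j1\<close> from \<open>K\<close>, so their lifts are products of conjugates of lifts of
  \<open>K\<close>.\<close>

lemma s_small: "y \<in> N \<Longrightarrow> y \<in> Bl j1 \<Longrightarrow> s y \<in> A1"
proof -
  assume y: "y \<in> N" "y \<in> Bl j1"
  obtain j where j: "j \<le> J" "N \<inter> Bl j1 \<subseteq> prodn G (conjs G (tt ` EL) K) j" using EL(3) by blast
  have "s y \<in> generate H (conjs H (tpow H x n ` EL) (s ` K))"
  proof (rule s_reach[OF _ _ j(1)])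
    show "\<And>b. b \<in> EL \<Longrightarrow> length (clist n b) \<le> l2" by (rule EL(2))
    show "y \<in> prodn G (conjs G (tt ` EL) K) j" by (rule subsetD[OF j(2)]) (use y in simp)
  qed
  moreover have "conjs H (tpow H x n ` EL) (s ` K) \<subseteq> conjs H X (s ` K)" by (rule conjs_mono) (use tpow_X in auto)
  note subsetD[OF H.mono_generate[OF this]]
  ultimately show ?thesis unfolding A1_def by blast
qed

lemma comm_small:
  assumes "y \<in> B0" "z \<in> B0"
  shows "s y \<otimes>\<^bsub>H\<^esub> s z \<otimes>\<^bsub>H\<^esub> inv\<^bsub>H\<^esub> (s y) \<otimes>\<^bsub>H\<^esub> inv\<^bsub>H\<^esub> (s z) \<in> A1"
proof -
  have B: "y \<in> Bl 1" "z \<in> Bl 1" using assms Bl_1 by auto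
  have r4: "4 \<le> r" using r(3) j1 by simp
  have "s (y \<otimes> z \<otimes> inv y \<otimes> inv z) = s (y \<otimes> z \<otimes> inv y) \<otimes>\<^bsub>H\<^esub> s (inv z)"
    using r4 by (intro s_mult[OF Bl_mult[OF Bl_mult[OF B] Bl_inv[OF B(1)]] Bl_inv[OF B(2)]]) simp
  also have "\<dots> = s y \<otimes>\<^bsub>H\<^esub> s z \<otimes>\<^bsub>H\<^esub> inv\<^bsub>H\<^esub> (s y) \<otimes>\<^bsub>H\<^esub> inv\<^bsub>H\<^esub> (s z)"
    using s_conj[OF B] s_inv[OF B(2)] r4 by simp
  finally have e: "s (y \<otimes> z \<otimes> inv y \<otimes> inv z) = s y \<otimes>\<^bsub>H\<^esub> s z \<otimes>\<^bsub>H\<^esub> inv\<^bsub>H\<^esub> (s y) \<otimes>\<^bsub>H\<^esub> inv\<^bsub>H\<^esub> (s z)" .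
  have "y \<otimes> z \<otimes> inv y \<otimes> inv z \<in> Bl (1 + 1 + 1 + 1)"
    by (rule Bl_mult[OF Bl_mult[OF Bl_mult[OF B] Bl_inv[OF B(1)]] Bl_inv[OF B(2)]])
  then have "y \<otimes> z \<otimes> inv y \<otimes> inv z \<in> Bl j1" by (rule subsetD[OF Bl_le, rotated]) (use j1 in simp)
  moreover have "y \<otimes> z \<otimes> inv y \<otimes> inv z \<in> N" using comm_N assms B0(1) by blast
  ultimately show ?thesis using s_small e by metis
qed

text \<open>From \<open>[y, g z] = [y, g] (g [y, z] inv g)\<close> it follows that commutators with
  single letters suffice.\<close>

lemma comm_X:
  assumes y: "y \<in> B0" and g: "g \<in> X"
  shows "s y \<otimes>\<^bsub>H\<^esub> g \<otimes>\<^bsub>H\<^esub> inv\<^bsub>H\<^esub> (s y) \<otimes>\<^bsub>H\<^esub> inv\<^bsub>H\<^esub> g \<in> A1"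
proof -
  have yc: "s y \<in> carrier H" using s_closed[of y 1] y Bl_1 r1 by auto
  let ?Y = "{g \<in> X. s y \<otimes>\<^bsub>H\<^esub> g \<otimes>\<^bsub>H\<^esub> inv\<^bsub>H\<^esub> (s y) \<otimes>\<^bsub>H\<^esub> inv\<^bsub>H\<^esub> g \<in> A1}"
  have step: "g \<otimes>\<^bsub>H\<^esub> s z \<in> ?Y" if g: "g \<in> ?Y" and z: "z \<in> B0" "s z \<in> X" for g z
  proof -
    have c: "g \<in> carrier H" "s z \<in> carrier H" "g \<in> X" using g z X_carrier by auto
    have "g \<otimes>\<^bsub>H\<^esub> (s y \<otimes>\<^bsub>H\<^esub> s z \<otimes>\<^bsub>H\<^esub> inv\<^bsub>H\<^esub> (s y) \<otimes>\<^bsub>H\<^esub> inv\<^bsub>H\<^esub> (s z)) \<otimes>\<^bsub>H\<^esub> inv\<^bsub>H\<^esub> g \<in> A1"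
      by (rule X_conj_A1[OF c(3) comm_small[OF y z(1)]])
    then have "(s y \<otimes>\<^bsub>H\<^esub> g \<otimes>\<^bsub>H\<^esub> inv\<^bsub>H\<^esub> (s y) \<otimes>\<^bsub>H\<^esub> inv\<^bsub>H\<^esub> g) \<otimes>\<^bsub>H\<^esub> (g \<otimes>\<^bsub>H\<^esub> (s y \<otimes>\<^bsub>H\<^esub> s z \<otimes>\<^bsub>H\<^esub> inv\<^bsub>H\<^esub> (s y) \<otimes>\<^bsub>H\<^esub> inv\<^bsub>H\<^esub> (s z)) \<otimes>\<^bsub>H\<^esub> inv\<^bsub>H\<^esub> g) \<in> A1"
      using g subgroup.m_closed[OF A1_sub] by blast
    then have "s y \<otimes>\<^bsub>H\<^esub> (g \<otimes>\<^bsub>H\<^esub> s z) \<otimes>\<^bsub>H\<^esub> inv\<^bsub>H\<^esub> (s y) \<otimes>\<^bsub>H\<^esub> inv\<^bsub>H\<^esub> (g \<otimes>\<^bsub>H\<^esub> s z) \<in> A1"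
      using c yc by (simp add: H.group_normalize)
    then show ?thesis using c z subgroup.m_closed[OF X_sub] by blast
  qed
  have "X \<subseteq> ?Y" unfolding X_def
  proof (rule H.generate_subset_right_closed[OF X_gens])
    show "{g \<in> generate H (x ` {..<n}). s y \<otimes>\<^bsub>H\<^esub> g \<otimes>\<^bsub>H\<^esub> inv\<^bsub>H\<^esub> (s y) \<otimes>\<^bsub>H\<^esub> inv\<^bsub>H\<^esub> g \<in> A1} \<subseteq> carrier H"
      using X_carrier unfolding X_def by blast
    show "\<one>\<^bsub>H\<^esub> \<in> {g \<in> generate H (x ` {..<n}). s y \<otimes>\<^bsub>H\<^esub> g \<otimes>\<^bsub>H\<^esub> inv\<^bsub>H\<^esub> (s y) \<otimes>\<^bsub>H\<^esub> inv\<^bsub>H\<^esub> g \<in> A1}"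
      using yc subgroup.one_closed[OF A1_sub] generate.one by auto
    fix g z assume gz: "g \<in> {g \<in> generate H (x ` {..<n}). s y \<otimes>\<^bsub>H\<^esub> g \<otimes>\<^bsub>H\<^esub> inv\<^bsub>H\<^esub> (s y) \<otimes>\<^bsub>H\<^esub> inv\<^bsub>H\<^esub> g \<in> A1}" "z \<in> x ` {..<n}"
    then obtain i where i: "i < n" "z = x i" by blast
    have tB: "t i \<in> B0" "inv (t i) \<in> B0" using tB i B0 by auto
    have "s (t i) \<in> X" unfolding X_def using i by (auto intro: generate.incl)
    moreover have "s (inv (t i)) = inv\<^bsub>H\<^esub> (s (t i))" using s_inv[of "t i" 1] tB Bl_1 r1 by auto
    ultimately have zX: "s (t i) \<in> X" "s (inv (t i)) \<in> X" "s (inv (t i)) = inv\<^bsub>H\<^esub> z"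
      using subgroup.m_inv_closed[OF X_sub] i by auto
    show "g \<otimes>\<^bsub>H\<^esub> z \<in> {g \<in> generate H (x ` {..<n}). s y \<otimes>\<^bsub>H\<^esub> g \<otimes>\<^bsub>H\<^esub> inv\<^bsub>H\<^esub> (s y) \<otimes>\<^bsub>H\<^esub> inv\<^bsub>H\<^esub> g \<in> A1}"
      using step[OF gz(1)[folded X_def] tB(1) zX(1)] i(2) unfolding X_def by simp
    show "g \<otimes>\<^bsub>H\<^esub> inv\<^bsub>H\<^esub> z \<in> {g \<in> generate H (x ` {..<n}). s y \<otimes>\<^bsub>H\<^esub> g \<otimes>\<^bsub>H\<^esub> inv\<^bsub>H\<^esub> (s y) \<otimes>\<^bsub>H\<^esub> inv\<^bsub>H\<^esub> g \<in> A1}"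
      using step[OF gz(1)[folded X_def] tB(2) zX(2)] zX(3) unfolding X_def by simp
  qed
  then show ?thesis using g by blast
qed

text \<open>Conjugation by \<open>s y\<close> is moved past \<open>g\<close> at the cost of their
  commutator, which lies in \<open>A1\<close>. It then acts on the lift of an element of
  \<open>K\<close>, whose conjugate is still short enough for \<open>s_small\<close>.\<close>

lemma B0_conj_A1: "y \<in> B0 \<Longrightarrow> a \<in> A1 \<Longrightarrow> s y \<otimes>\<^bsub>H\<^esub> a \<otimes>\<^bsub>H\<^esub> inv\<^bsub>H\<^esub> (s y) \<in> A1"
proof -
  assume y: "y \<in> B0" and a: "a \<in> A1"
  have yB: "y \<in> Bl 1" using y Bl_1 by simp
  have yc: "s y \<in> carrier H" using s_closed[OF yB r1] .
  show ?thesis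
  proof (rule H.generate_conj_closed[OF gens_A1 yc A1_sub _ a[unfolded A1_def]])
    fix z assume "z \<in> conjs H X (s ` K)"
    then obtain g v where gv: "g \<in> X" "v \<in> s ` K" "z = g \<otimes>\<^bsub>H\<^esub> v \<otimes>\<^bsub>H\<^esub> inv\<^bsub>H\<^esub> g" by (rule conjsE)
    then obtain k where k: "k \<in> K" "v = s k" by blast
    have kB: "k \<in> Bl j0" using k KB by blast
    have c: "g \<in> carrier H" "v \<in> carrier H" using gv X_carrier sK_closed by auto
    have "s (y \<otimes> k \<otimes> inv y) = s y \<otimes>\<^bsub>H\<^esub> s k \<otimes>\<^bsub>H\<^esub> inv\<^bsub>H\<^esub> (s y)" using r(3) j1 by (intro s_conj[OF yB kB]) simp
    moreover have "y \<otimes> k \<otimes> inv y \<in> Bl (1 + j0 + 1)" by (rule Bl_mult[OF Bl_mult[OF yB kB] Bl_inv[OF yB]])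
    then have "y \<otimes> k \<otimes> inv y \<in> Bl j1" using Bl_le[of "1 + j0 + 1" j1] j1 by auto
    moreover have "y \<otimes> k \<otimes> inv y \<in> N" using N_conj[of y k] k KN Bl_carrier[OF yB] by blast
    ultimately have yk: "s y \<otimes>\<^bsub>H\<^esub> v \<otimes>\<^bsub>H\<^esub> inv\<^bsub>H\<^esub> (s y) \<in> A1" using s_small k(2) by metis
    let ?c = "s y \<otimes>\<^bsub>H\<^esub> g \<otimes>\<^bsub>H\<^esub> inv\<^bsub>H\<^esub> (s y) \<otimes>\<^bsub>H\<^esub> inv\<^bsub>H\<^esub> g"
    have cA: "?c \<in> A1" using comm_X[OF y gv(1)] .
    have "?c \<otimes>\<^bsub>H\<^esub> (g \<otimes>\<^bsub>H\<^esub> (s y \<otimes>\<^bsub>H\<^esub> v \<otimes>\<^bsub>H\<^esub> inv\<^bsub>H\<^esub> (s y)) \<otimes>\<^bsub>H\<^esub> inv\<^bsub>H\<^esub> g) \<otimes>\<^bsub>H\<^esub> inv\<^bsub>H\<^esub> ?c \<in> A1"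
      using cA X_conj_A1[OF gv(1) yk] A1_sub by (simp add: subgroup.m_closed subgroup.m_inv_closed)
    then show "s y \<otimes>\<^bsub>H\<^esub> z \<otimes>\<^bsub>H\<^esub> inv\<^bsub>H\<^esub> (s y) \<in> A1" using gv(3) c yc by (simp add: H.group_normalize)
  qed
qed

lemma A1_normal: "A1 \<lhd> H"
proof -
  have "h \<otimes>\<^bsub>H\<^esub> a \<otimes>\<^bsub>H\<^esub> inv\<^bsub>H\<^esub> h \<in> A1" if h: "h \<in> generate H (s ` B0)" and "a \<in> A1" for h a
    using h \<open>a \<in> A1\<close>
  proof (induction arbitrary: a)
    case one then show ?case using A1_carrier by simp
  next
    case (incl h) then show ?case using B0_conj_A1 by blast
  next
    case (inv h)
    then obtain y where y: "y \<in> B0" "h = s y" by blast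
    have "s (inv y) = inv\<^bsub>H\<^esub> (s y)" using s_inv[of y 1] y Bl_1 r1 by auto
    then show ?case using B0_conj_A1[of "inv y" a] y B0(3) inv by simp
  next
    case (eng h1 h2)
    have sc: "s ` B0 \<subseteq> carrier H" using s_closed[of _ 1] Bl_1 r1 by auto
    have c: "h1 \<in> carrier H" "h2 \<in> carrier H" "a \<in> carrier H" using eng H.generate_in_carrier[OF sc] A1_carrier by auto
    have "h1 \<otimes>\<^bsub>H\<^esub> (h2 \<otimes>\<^bsub>H\<^esub> a \<otimes>\<^bsub>H\<^esub> inv\<^bsub>H\<^esub> h2) \<otimes>\<^bsub>H\<^esub> inv\<^bsub>H\<^esub> h1 \<in> A1" using eng by blast
    then show ?case using c by (simp add: H.group_normalize)
  qed
  then show ?thesis using A1_sub H_gen by (simp add: H.normal_inv_iff)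
qed

lemma sB0: "s ` B0 \<subseteq> carrier H" using s_closed[of _ 1] Bl_1 r1 by auto

lemma quot_comm: "comm_group (H Mod A1)"
  by (rule H.quotient_comm[OF A1_normal sB0 H_gen]) (use comm_small in blast)

lemma A1_conj_eq:
  assumes "h \<in> carrier H" "h' \<in> carrier H" "A1 #>\<^bsub>H\<^esub> h = A1 #>\<^bsub>H\<^esub> h'" "a \<in> A1"
  shows "h \<otimes>\<^bsub>H\<^esub> a \<otimes>\<^bsub>H\<^esub> inv\<^bsub>H\<^esub> h = h' \<otimes>\<^bsub>H\<^esub> a \<otimes>\<^bsub>H\<^esub> inv\<^bsub>H\<^esub> h'"
proof -
  let ?c = "h \<otimes>\<^bsub>H\<^esub> inv\<^bsub>H\<^esub> h'" and ?Y = "h' \<otimes>\<^bsub>H\<^esub> a \<otimes>\<^bsub>H\<^esub> inv\<^bsub>H\<^esub> h'"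
  have a: "a \<in> carrier H" using assms A1_carrier by auto
  have c: "?c \<in> A1" "?Y \<in> A1" using H.quotient_eq_iff[OF A1_normal] assms A1_normal by (auto simp: H.normal_inv_iff)
  have cc: "?c \<in> carrier H" "?Y \<in> carrier H" using c A1_carrier by auto
  have "h \<otimes>\<^bsub>H\<^esub> a \<otimes>\<^bsub>H\<^esub> inv\<^bsub>H\<^esub> h = ?c \<otimes>\<^bsub>H\<^esub> ?Y \<otimes>\<^bsub>H\<^esub> inv\<^bsub>H\<^esub> ?c" using assms a by (simp add: H.group_normalize)
  also have "\<dots> = ?Y \<otimes>\<^bsub>H\<^esub> ?c \<otimes>\<^bsub>H\<^esub> inv\<^bsub>H\<^esub> ?c" using A1_comm[OF c] by simp
  also have "\<dots> = ?Y" using cc by (simp add: H.m_assoc)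
  finally show ?thesis .
qed

lemma quot_tpow:
  "A1 #>\<^bsub>H\<^esub> (tpow H x n a \<otimes>\<^bsub>H\<^esub> tpow H x n b) = A1 #>\<^bsub>H\<^esub> tpow H x n (\<lambda>i. a i + b i)"
proof -
  interpret A1: normal A1 H by (rule A1_normal)
  interpret q: comm_group "H Mod A1" by (rule quot_comm)
  let ?p = "\<lambda>h. A1 #>\<^bsub>H\<^esub> h"
  have hom: "?p \<in> hom H (H Mod A1)" by (rule A1.r_coset_hom_Mod)
  have pt: "?p (tpow H x n a) = tpow (H Mod A1) (\<lambda>i. ?p (x i)) n a" for a
    using tpow_hom[OF H.is_group q.is_group hom, of n x a] x_closed by (simp add: o_def)
  have tc: "tpow H x n a \<in> carrier H" for a using x_closed by simp
  have xc: "?p (x i) \<in> carrier (H Mod A1)" if "i < n" for i using hom x_closed[OF that] hom_in_carrier by metis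
  show ?thesis using hom_mult[OF hom tc tc] q.tpow_add[of n "\<lambda>i. ?p (x i)" a b] xc unfolding pt by simp
qed

lemma tpow_unit: "m \<le> n \<Longrightarrow> tpow H x m (\<lambda>j. if j = i then c else 0) = (if i < m then x i [^]\<^bsub>H\<^esub> (c::int) else \<one>\<^bsub>H\<^esub>)"
  by (induction m) (auto simp: x_closed less_Suc_eq)

lemma X_mod_A1: "g \<in> X \<Longrightarrow> \<exists>b\<in>Zn n. A1 #>\<^bsub>H\<^esub> g = A1 #>\<^bsub>H\<^esub> tpow H x n b"
proof -
  interpret A1: normal A1 H by (rule A1_normal)
  let ?p = "\<lambda>h. A1 #>\<^bsub>H\<^esub> h"
  have hom: "?p \<in> hom H (H Mod A1)" by (rule A1.r_coset_hom_Mod)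
  have tc: "tpow H x n a \<in> carrier H" for a using x_closed by simp
  let ?Y = "{g \<in> carrier H. \<exists>b\<in>Zn n. ?p g = ?p (tpow H x n b)}"
  have step: "g \<otimes>\<^bsub>H\<^esub> x i [^]\<^bsub>H\<^esub> c \<in> ?Y" if g: "g \<in> ?Y" and i: "i < n" for g i and c :: int
  proof -
    obtain b where b: "b \<in> Zn n" "?p g = ?p (tpow H x n b)" and gc: "g \<in> carrier H" using g by blast
    let ?e = "\<lambda>j. if j = i then c else 0"
    have e: "?e \<in> Zn n" "x i [^]\<^bsub>H\<^esub> c = tpow H x n ?e" using i tpow_unit[of n i c] by (auto simp: Zn_def)
    have "?p (g \<otimes>\<^bsub>H\<^esub> tpow H x n ?e) = ?p g \<otimes>\<^bsub>H Mod A1\<^esub> ?p (tpow H x n ?e)" by (rule hom_mult[OF hom gc tc])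
    also have "\<dots> = ?p (tpow H x n b \<otimes>\<^bsub>H\<^esub> tpow H x n ?e)" unfolding b(2) by (rule hom_mult[OF hom tc tc, symmetric])
    also have "\<dots> = ?p (tpow H x n (\<lambda>i. b i + ?e i))" by (rule quot_tpow)
    finally show ?thesis unfolding e(2) using gc tc Zn_add[OF b(1) e(1)] by blast
  qed
  have "X \<subseteq> ?Y" unfolding X_def
  proof (rule H.generate_subset_right_closed[OF X_gens])
    have "tpow H x n (\<lambda>_. 0) = \<one>\<^bsub>H\<^esub>" using x_closed by simp
    then show "\<one>\<^bsub>H\<^esub> \<in> ?Y" using Zn_0[of n] H.one_closed by (metis (mono_tags, lifting) mem_Collect_eq)
    fix g z assume g: "g \<in> ?Y" and "z \<in> x ` {..<n}"
    then obtain i where i: "i < n" "z = x i" by blast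
    show "g \<otimes>\<^bsub>H\<^esub> z \<in> ?Y" using step[OF g i(1), of 1] i x_closed by simp
    show "g \<otimes>\<^bsub>H\<^esub> inv\<^bsub>H\<^esub> z \<in> ?Y" using step[OF g i(1), of "- 1"] i x_closed by (simp add: H.int_pow_neg)
  qed blast
  then show "g \<in> X \<Longrightarrow> \<exists>b\<in>Zn n. A1 #>\<^bsub>H\<^esub> g = A1 #>\<^bsub>H\<^esub> tpow H x n b" by blast
qed

end

text \<open>\<open>DQ\<close> and \<open>DV\<close> are the domains on which partial homomorphisms
  are tested before being extended to \<open>G\<close> modulo \<open>N\<close> and to the group
  generated by \<open>U\<close>. \<open>Fu\<close> expresses that conjugation by a lattice generator
  leaves \<open>U\<close> only through finitely many elements, which becomes the hypothesis
  \<open>act_V\<close> of \<open>monomial_module\<close>.\<close>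

locale extended_metab = presented_metab G T n t C H B0 r s \<pi> K U \<E> EL M l l2 j0 j1 J
  for G (structure) and T n t C and H :: "('h, 'k) monoid_scheme" (structure) and B0 r s \<pi> K U \<E> EL M l l2 j0 j1 J +
  fixes DQ DV Fu :: "'a set"
  assumes Uinv: "\<And>u. u \<in> U \<Longrightarrow> inv u \<in> U"
    and DQ: "DQ \<subseteq> prodn G B0 j0" "\<And>(A :: 'h set monoid) f. \<lbrakk>comm_group A; f ` DQ \<subseteq> carrier A;
      \<And>x y z. x \<in> DQ \<Longrightarrow> y \<in> DQ \<Longrightarrow> z \<in> DQ \<Longrightarrow> q x \<otimes>\<^bsub>Q\<^esub> q y = q z \<Longrightarrow> f x \<otimes>\<^bsub>A\<^esub> f y = f z\<rbrakk> \<Longrightarrow>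
      \<exists>F\<in>hom G A. (\<forall>g\<in>carrier G. q g = \<one>\<^bsub>Q\<^esub> \<longrightarrow> F g = \<one>\<^bsub>A\<^esub>) \<and> (\<forall>x\<in>B0. F x = f x)"
    and DV: "DV \<subseteq> prodn G B0 j0" "DV \<subseteq> N" "U \<subseteq> DV" "\<And>(A :: ('h, 'k) monoid_scheme) f. \<lbrakk>comm_group A; f ` DV \<subseteq> carrier A;
      \<And>x y z. x \<in> DV \<Longrightarrow> y \<in> DV \<Longrightarrow> z \<in> DV \<Longrightarrow> x \<otimes> y = z \<Longrightarrow> f x \<otimes>\<^bsub>A\<^esub> f y = f z\<rbrakk> \<Longrightarrow>
      \<exists>F\<in>hom (G\<lparr>carrier := generate G U\<rparr>) A. \<forall>x\<in>U. F x = f x"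
    and Fu: "finite Fu" "Fu \<subseteq> U" "\<And>u. u \<in> U \<Longrightarrow> \<exists>f\<in>Fu. \<exists>w\<in>U. u = f \<otimes> w \<and>
      (\<forall>a\<in>t ` {..<n} \<union> m_inv G ` t ` {..<n}. a \<otimes> w \<otimes> inv a \<in> U)"
begin

lemma pi_closed: "h \<in> carrier H \<Longrightarrow> \<pi> h \<in> carrier G" using pi_hom hom_in_carrier by metis

lemma pi_mult: "h \<in> carrier H \<Longrightarrow> h' \<in> carrier H \<Longrightarrow> \<pi> (h \<otimes>\<^bsub>H\<^esub> h') = \<pi> h \<otimes> \<pi> h'" using pi_hom hom_mult by metis

lemma pi_inv: "h \<in> carrier H \<Longrightarrow> \<pi> (inv\<^bsub>H\<^esub> h) = inv (\<pi> h)"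
  using pi_hom group_hom.hom_inv[of H G \<pi>] by (simp add: group_hom_def group_hom_axioms_def)

lemma pi_one: "\<pi> \<one>\<^bsub>H\<^esub> = \<one>"
  using pi_hom group_hom.hom_one[of H G \<pi>] by (simp add: group_hom_def group_hom_axioms_def)

text \<open>Modulo \<open>A1\<close> the map \<open>s\<close> respects the products modulo
  \<open>N\<close> visible in \<open>DQ\<close>, so it extends to a homomorphism \<open>F\<close> on
  \<open>G\<close> that is trivial on \<open>N\<close>. On generators \<open>F\<close> after
  \<open>\<pi>\<close> is the projection of \<open>H\<close>, hence on all of
  \<open>H\<close>.\<close>

lemma pi_N_A1:
  assumes h: "h \<in> carrier H" and hN: "\<pi> h \<in> N"
  shows "h \<in> A1"
proof -
  interpret A1: normal A1 H by (rule A1_normal)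
  interpret q: comm_group "H Mod A1" by (rule quot_comm)
  let ?f = "\<lambda>y. A1 #>\<^bsub>H\<^esub> s y"
  have hom: "(\<lambda>h. A1 #>\<^bsub>H\<^esub> h) \<in> hom H (H Mod A1)" by (rule A1.r_coset_hom_Mod)
  have sc: "s y \<in> carrier H" if "y \<in> DQ" for y using that DQ(1) s_closed[OF _ j0r] by blast
  have "\<exists>F\<in>hom G (H Mod A1). (\<forall>g\<in>carrier G. q g = \<one>\<^bsub>Q\<^esub> \<longrightarrow> F g = \<one>\<^bsub>H Mod A1\<^esub>) \<and> (\<forall>x\<in>B0. F x = ?f x)"
  proof (rule DQ(2)[OF quot_comm])
    show "?f ` DQ \<subseteq> carrier (H Mod A1)" using hom_in_carrier[OF hom] sc by blast
    fix a b c assume abc: "a \<in> DQ" "b \<in> DQ" "c \<in> DQ" "q a \<otimes>\<^bsub>Q\<^esub> q b = q c"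
    have B: "a \<in> Bl j0" "b \<in> Bl j0" "c \<in> Bl j0" using abc DQ(1) by auto
    have c: "a \<in> carrier G" "b \<in> carrier G" "c \<in> carrier G" using B Bl_carrier by auto
    have "q (a \<otimes> b) = q c" using abc(4) c by simp
    then have 1: "a \<otimes> b \<otimes> inv c \<in> N" using q_eq_iff[of "a \<otimes> b" c] c by simp
    have "a \<otimes> b \<otimes> inv c \<in> Bl (j0 + j0 + j0)" by (rule Bl_mult[OF Bl_mult[OF B(1,2)] Bl_inv[OF B(3)]])
    then have "a \<otimes> b \<otimes> inv c \<in> Bl j1" by (rule subsetD[OF Bl_le, rotated]) (use j1 in simp)
    from s_small[OF 1 this] have "s (a \<otimes> b \<otimes> inv c) \<in> A1" .
    moreover have "s (a \<otimes> b \<otimes> inv c) = s (a \<otimes> b) \<otimes>\<^bsub>H\<^esub> s (inv c)"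
      using r(3) j1 by (intro s_mult[OF Bl_mult[OF B(1,2)] Bl_inv[OF B(3)]]) simp
    moreover have "s (a \<otimes> b) = s a \<otimes>\<^bsub>H\<^esub> s b" using r(3) j1 by (intro s_mult[OF B(1,2)]) simp
    moreover have "s (inv c) = inv\<^bsub>H\<^esub> s c" by (rule s_inv[OF B(3) j0r])
    ultimately have "s a \<otimes>\<^bsub>H\<^esub> s b \<otimes>\<^bsub>H\<^esub> inv\<^bsub>H\<^esub> s c \<in> A1" by simp
    then have "A1 #>\<^bsub>H\<^esub> (s a \<otimes>\<^bsub>H\<^esub> s b) = A1 #>\<^bsub>H\<^esub> s c"
      using H.quotient_eq_iff[OF A1_normal, of "s a \<otimes>\<^bsub>H\<^esub> s b" "s c"] sc abc by simp
    then show "?f a \<otimes>\<^bsub>H Mod A1\<^esub> ?f b = ?f c" using hom_mult[OF hom, of "s a" "s b"] sc abc by simp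
  qed
  then obtain F where F: "F \<in> hom G (H Mod A1)" "\<And>g. g \<in> carrier G \<Longrightarrow> q g = \<one>\<^bsub>Q\<^esub> \<Longrightarrow> F g = \<one>\<^bsub>H Mod A1\<^esub>" "\<And>x. x \<in> B0 \<Longrightarrow> F x = ?f x"
    by blast
  have "A1 #>\<^bsub>H\<^esub> h = (F \<circ> \<pi>) h"
  proof (rule hom_eq_on_generate[OF H.is_group q.is_group hom Group.hom_compose[OF pi_hom F(1)] sB0])
    show "h \<in> generate H (s ` B0)" using h H_gen by simp
    fix z assume "z \<in> s ` B0"
    then obtain y where y: "y \<in> B0" "z = s y" by blast
    have "y \<in> Bl r" using y Bl_1 Bl_le[OF r1] by blast
    then show "A1 #>\<^bsub>H\<^esub> z = (F \<circ> \<pi>) z" using F(3)[OF y(1)] pi_s y(2) by simp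
  qed
  also have "\<dots> = \<one>\<^bsub>H Mod A1\<^esub>" using F(2)[OF pi_closed[OF h]] hN q_one_iff[OF pi_closed[OF h]] by simp
  finally show ?thesis using H.quotient_one_iff[OF A1_normal h] by simp
qed

abbreviation A where "A \<equiv> H\<lparr>carrier := A1\<rparr>"

definition V where "V = generate H (s ` U)"

lemma A_comm_group: "comm_group A"
proof (rule group.group_comm_groupI)
  show "group A" using A1_sub H.is_group by (rule subgroup.subgroup_is_group)
qed (use A1_comm in auto)

lemma sDV: "y \<in> DV \<Longrightarrow> s y \<in> A1"
proof (rule s_small)
  assume y: "y \<in> DV"
  show "y \<in> N" using y DV(2) by blast
  show "y \<in> Bl j1" using y DV(1) Bl_le[of j0 j1] j1 by auto
qed

lemma sU: "s ` U \<subseteq> A1" using sDV DV(3) by blast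

lemma sU_carrier: "s ` U \<subseteq> carrier H" using sU A1_carrier by blast

lemma V_sub: "subgroup V H" unfolding V_def by (rule H.generate_is_subgroup[OF sU_carrier])

lemma V_A1: "V \<subseteq> A1" unfolding V_def by (rule H.generate_subgroup_incl[OF sU A1_sub])

text \<open>The partial map \<open>s\<close> extends to a homomorphism \<open>F\<close> on the group
  generated by \<open>U\<close>, and \<open>F\<close> inverts \<open>\<pi>\<close> on
  \<open>V\<close>.\<close>

lemma pi_inj_V:
  assumes "v \<in> V" "\<pi> v = \<one>"
  shows "v = \<one>\<^bsub>H\<^esub>"
proof -
  interpret A: comm_group A by (rule A_comm_group)
  have Uc: "U \<subseteq> carrier G" using UN N_carrier by blast
  let ?VV = "G\<lparr>carrier := generate G U\<rparr>"
  have "\<exists>F\<in>hom ?VV A. \<forall>x\<in>U. F x = s x"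
  proof (rule DV(4)[OF A_comm_group])
    show "s ` DV \<subseteq> carrier A" using sDV by auto
    fix a b c assume abc: "a \<in> DV" "b \<in> DV" "c \<in> DV" "a \<otimes> b = c"
    have "s (a \<otimes> b) = s a \<otimes>\<^bsub>H\<^esub> s b" using r(2) by (intro s_mult[of _ j0 _ j0]) (use abc DV(1) in auto)
    then show "s a \<otimes>\<^bsub>A\<^esub> s b = s c" using abc(4) by simp
  qed
  then obtain F where F: "F \<in> hom ?VV A" "\<And>x. x \<in> U \<Longrightarrow> F x = s x" by blast
  interpret VV: group ?VV by (rule subgroup.subgroup_is_group[OF generate_is_subgroup[OF Uc] is_group])
  interpret F: group_hom ?VV A F using F(1) by unfold_locales
  have sb: "s y \<in> carrier H \<and> \<pi> (s y) = y" if "y \<in> U" for y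
    using that UB s_closed[OF _ j0r] pi_s Bl_le[OF j0r] by blast
  have "\<pi> v \<in> generate G U \<and> F (\<pi> v) = v" if "v \<in> generate H (s ` U)" for v
    using that
  proof induction
    case one show ?case using F.hom_one pi_one generate.one by auto
  next
    case (incl h)
    then obtain y where y: "y \<in> U" "h = s y" by blast
    then show ?case using sb F(2) by (auto intro: generate.incl)
  next
    case (inv h)
    then obtain y where y: "y \<in> U" "h = s y" by blast
    have "inv\<^bsub>H\<^esub> h = s (inv y)" using s_inv[OF _ j0r, of y] y UB by auto
    then show ?case using sb[OF Uinv[OF y(1)]] F(2)[OF Uinv[OF y(1)]] Uinv[OF y(1)] by (auto intro: generate.incl)
  next
    case (eng h1 h2)
    have c: "h1 \<in> carrier H" "h2 \<in> carrier H" using eng H.generate_in_carrier[OF sU_carrier] by auto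
    have "F (\<pi> h1 \<otimes> \<pi> h2) = F (\<pi> h1) \<otimes>\<^bsub>H\<^esub> F (\<pi> h2)" using F.hom_mult[of "\<pi> h1" "\<pi> h2"] eng by simp
    then show ?case using eng pi_mult[OF c] by (auto intro: generate.eng)
  qed
  then have "v = F \<one>" using assms unfolding V_def by metis
  then show ?thesis using F.hom_one by simp
qed

section \<open>The kernel as a module over a monoid of exponents\<close>

definition ex :: "nat list \<Rightarrow> nat \<Rightarrow> int" where "ex m i = (if i < n then int (m ! i) - int (m ! (n + i)) else 0)"

text \<open>Doubling the variables turns an action of the lattice into one with nonnegative
  exponents: the first \<open>n\<close> entries count generators, the last \<open>n\<close> their
  inverses.\<close>

definition act :: "nat list \<Rightarrow> 'h \<Rightarrow> 'h" where
  "act m h = tpow H x n (ex m) \<otimes>\<^bsub>H\<^esub> h \<otimes>\<^bsub>H\<^esub> inv\<^bsub>H\<^esub> tpow H x n (ex m)"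

lemma tau_closed: "tpow H x n a \<in> carrier H" using x_closed by simp

lemma A1_conj: "g \<in> carrier H \<Longrightarrow> h \<in> A1 \<Longrightarrow> g \<otimes>\<^bsub>H\<^esub> h \<otimes>\<^bsub>H\<^esub> inv\<^bsub>H\<^esub> g \<in> A1"
  using A1_normal by (simp add: H.normal_inv_iff)

lemma generate_A: "S \<subseteq> A1 \<Longrightarrow> generate A S = generate H S"
  using H.generate_consistent[OF _ A1_sub] by simp

lemma act_munit:
  assumes "i < 2 * n"
  shows "\<exists>a\<in>t ` {..<n} \<union> m_inv G ` t ` {..<n}. tpow H x n (ex (munit (2 * n) i)) = s a"
proof (cases "i < n")
  case True
  have "ex (munit (2 * n) i) = (\<lambda>j. if j = i then 1 else 0)" using True by (auto simp: ex_def munit_def nth_list_update fun_eq_iff)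
  then have "tpow H x n (ex (munit (2 * n) i)) = s (t i)" using tpow_unit[of n i 1] True x_closed[OF True] by simp
  then show ?thesis using True by blast
next
  case False
  define i' where "i' = i - n"
  have i': "i' < n" "i = n + i'" using False assms by (auto simp: i'_def)
  have "ex (munit (2 * n) i) = (\<lambda>j. if j = i' then - 1 else 0)" using i' by (auto simp: ex_def munit_def nth_list_update fun_eq_iff)
  then have "tpow H x n (ex (munit (2 * n) i)) = inv\<^bsub>H\<^esub> x i'" using tpow_unit[of n i' "- 1"] i' x_closed[OF i'(1)] by (simp add: H.int_pow_neg)
  also have "\<dots> = s (inv (t i'))" using s_inv[of "t i'" 1] tB[OF i'(1)] Bl_1 r1 by simp
  finally show ?thesis using i' by blast
qed

text \<open>Each \<open>u\<close> in \<open>U\<close> is \<open>f w\<close> with \<open>w\<close> so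
  small that its conjugate is still in \<open>U\<close>. Only the finitely many \<open>f\<close> are
  moved out of \<open>V\<close>.\<close>

lemma act_V:
  assumes i: "i < 2 * n" and v: "v \<in> V"
  shows "act (munit (2 * n) i) v \<in> generate H (V \<union> act (munit (2 * n) i) ` s ` Fu)"
proof -
  obtain a where a: "a \<in> t ` {..<n} \<union> m_inv G ` t ` {..<n}" "tpow H x n (ex (munit (2 * n) i)) = s a"
    using act_munit[OF i] by blast
  have aB: "a \<in> Bl 1" using a(1) tB Bl_1 B0(3) by auto
  have ac: "s a \<in> carrier H" using s_closed[OF aB r1] .
  have act: "act (munit (2 * n) i) h = s a \<otimes>\<^bsub>H\<^esub> h \<otimes>\<^bsub>H\<^esub> inv\<^bsub>H\<^esub> s a" for h by (simp add: act_def a(2))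
  let ?W = "V \<union> act (munit (2 * n) i) ` s ` Fu"
  have fc: "s f \<in> carrier H" if "f \<in> U" for f using that sU_carrier by blast
  have Wc: "?W \<subseteq> carrier H" using V_A1 A1_carrier ac fc Fu(2) unfolding act by auto
  show ?thesis unfolding act
  proof (rule H.generate_conj_closed[OF sU_carrier ac H.generate_is_subgroup _ v[unfolded V_def]])
    show "V \<union> (\<lambda>h. s a \<otimes>\<^bsub>H\<^esub> h \<otimes>\<^bsub>H\<^esub> inv\<^bsub>H\<^esub> s a) ` s ` Fu \<subseteq> carrier H" using Wc unfolding act .
    fix z assume "z \<in> s ` U"
    then obtain u where u: "u \<in> U" "z = s u" by blast
    obtain f w where fw: "f \<in> Fu" "w \<in> U" "u = f \<otimes> w" "a \<otimes> w \<otimes> inv a \<in> U" using Fu(3)[OF u(1)] a(1) by blast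
    have fwB: "f \<in> Bl j0" "w \<in> Bl j0" using fw Fu(2) UB by auto
    have c: "s f \<in> carrier H" "s w \<in> carrier H" using fc fw Fu(2) by auto
    have "z = s f \<otimes>\<^bsub>H\<^esub> s w" unfolding u(2) fw(3) using r(2) by (intro s_mult[OF fwB]) simp
    then have "s a \<otimes>\<^bsub>H\<^esub> z \<otimes>\<^bsub>H\<^esub> inv\<^bsub>H\<^esub> s a = (s a \<otimes>\<^bsub>H\<^esub> s f \<otimes>\<^bsub>H\<^esub> inv\<^bsub>H\<^esub> s a) \<otimes>\<^bsub>H\<^esub> (s a \<otimes>\<^bsub>H\<^esub> s w \<otimes>\<^bsub>H\<^esub> inv\<^bsub>H\<^esub> s a)"
      using c ac by (simp add: H.group_normalize)
    moreover have "s a \<otimes>\<^bsub>H\<^esub> s w \<otimes>\<^bsub>H\<^esub> inv\<^bsub>H\<^esub> s a = s (a \<otimes> w \<otimes> inv a)" using r(3) j1 by (intro s_conj[OF aB fwB(2), symmetric]) simp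
    moreover have "s (a \<otimes> w \<otimes> inv a) \<in> V" unfolding V_def using fw(4) by (intro generate.incl imageI)
    moreover have "s a \<otimes>\<^bsub>H\<^esub> s f \<otimes>\<^bsub>H\<^esub> inv\<^bsub>H\<^esub> s a \<in> (\<lambda>h. s a \<otimes>\<^bsub>H\<^esub> h \<otimes>\<^bsub>H\<^esub> inv\<^bsub>H\<^esub> s a) ` s ` Fu" using fw(1) by blast
    ultimately show "s a \<otimes>\<^bsub>H\<^esub> z \<otimes>\<^bsub>H\<^esub> inv\<^bsub>H\<^esub> s a \<in> generate H (V \<union> (\<lambda>h. s a \<otimes>\<^bsub>H\<^esub> h \<otimes>\<^bsub>H\<^esub> inv\<^bsub>H\<^esub> s a) ` s ` Fu)"
      by (metis UnI1 UnI2 generate.eng generate.incl)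
  qed
qed

text \<open>An element of \<open>X\<close> acts on \<open>A1\<close> like a lattice normal form,
  since the two agree modulo the abelian group \<open>A1\<close>.\<close>

lemma A1_act: "A1 \<subseteq> generate H {act m v |m v. length m = 2 * n \<and> v \<in> V}"
proof -
  have "conjs H X (s ` K) \<subseteq> {act m v |m v. length m = 2 * n \<and> v \<in> V}"
  proof
    fix z assume "z \<in> conjs H X (s ` K)"
    then obtain g v where gv: "g \<in> X" "v \<in> s ` K" "z = g \<otimes>\<^bsub>H\<^esub> v \<otimes>\<^bsub>H\<^esub> inv\<^bsub>H\<^esub> g" by (rule conjsE)
    have vV: "v \<in> V" unfolding V_def using gv(2) KU by (intro generate.incl) blast
    obtain b where b: "b \<in> Zn n" "A1 #>\<^bsub>H\<^esub> g = A1 #>\<^bsub>H\<^esub> tpow H x n b" using X_mod_A1[OF gv(1)] by blast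
    define m where "m = map (\<lambda>i. nat (b i)) [0..<n] @ map (\<lambda>i. nat (- b i)) [0..<n]"
    have "ex m = b" using b(1) by (auto simp: ex_def m_def nth_append Zn_def fun_eq_iff)
    moreover have "z = tpow H x n b \<otimes>\<^bsub>H\<^esub> v \<otimes>\<^bsub>H\<^esub> inv\<^bsub>H\<^esub> tpow H x n b"
      unfolding gv(3) by (rule A1_conj_eq[OF X_carrier[OF gv(1)] tau_closed b(2)]) (use vV V_A1 in blast)
    ultimately have "z = act m v" "length m = 2 * n" by (simp_all add: act_def m_def)
    then show "z \<in> {act m v |m v. length m = 2 * n \<and> v \<in> V}" using vV by blast
  qed
  then show ?thesis unfolding A1_def by (rule H.mono_generate)
qed

text \<open>The kernel of \<open>\<pi>\<close> lies in \<open>A1\<close> by \<open>pi_N_A1\<close>,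
  is invariant under conjugation and meets \<open>V\<close> trivially by \<open>pi_inj_V\<close>; it
  is the submodule \<open>D\<close> of \<open>monomial_module\<close>.\<close>

theorem kernel_finitely_generated:
  "\<exists>E. finite E \<and> E \<subseteq> carrier H \<and> (\<forall>e\<in>E. \<pi> e = \<one>) \<and> (\<forall>h\<in>carrier H. \<pi> h = \<one> \<longrightarrow> h \<in> generate H (conjs H (carrier H) E))"
proof -
  define D where "D = {h \<in> carrier H. \<pi> h = \<one>}"
  have DA: "D \<subseteq> A1" using pi_N_A1 subgroup.one_closed[OF N_subgroup] unfolding D_def by auto
  have Dsub: "subgroup D H"
  proof (rule H.subgroupI)
    show "D \<noteq> {}" using pi_one H.one_closed unfolding D_def by blast
  qed (simp_all add: D_def pi_inv pi_mult subset_iff)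
  obtain fs where fs: "set fs = s ` Fu" using finite_list[OF finite_imageI[OF Fu(1), of s]] by (elim exE)
  have fsV: "s ` Fu \<subseteq> V" unfolding V_def using Fu(2) by (auto intro: generate.incl)
  have actA: "act m h \<in> A1" if "h \<in> A1" for m h unfolding act_def by (rule A1_conj[OF tau_closed that])
  interpret mm: monomial_module A "2 * n" act V fs D
  proof (rule monomial_module.intro[OF A_comm_group], rule monomial_module_axioms.intro)
    fix m :: "nat list"
    have "act m (h \<otimes>\<^bsub>H\<^esub> h') = act m h \<otimes>\<^bsub>H\<^esub> act m h'" if "h \<in> A1" "h' \<in> A1" for h h'
      unfolding act_def using A1_carrier[OF that(1)] A1_carrier[OF that(2)] tau_closed by (simp add: H.group_normalize)
    then show "act m \<in> hom A A" using actA by (auto simp: hom_def)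
  next
    fix m m' :: "nat list" and h assume m: "length m = 2 * n" "length m' = 2 * n" and h: "h \<in> carrier A"
    have hA: "h \<in> A1" "h \<in> carrier H" using h A1_carrier by auto
    have e: "ex (madd m m') = (\<lambda>i. ex m i + ex m' i)" using m by (auto simp: ex_def madd_def fun_eq_iff)
    have "act m (act m' h) = (tpow H x n (ex m) \<otimes>\<^bsub>H\<^esub> tpow H x n (ex m')) \<otimes>\<^bsub>H\<^esub> h \<otimes>\<^bsub>H\<^esub> inv\<^bsub>H\<^esub> (tpow H x n (ex m) \<otimes>\<^bsub>H\<^esub> tpow H x n (ex m'))"
      unfolding act_def using hA tau_closed by (simp add: H.group_normalize)
    also have "\<dots> = act (madd m m') h" unfolding act_def e
      by (rule A1_conj_eq[OF _ tau_closed quot_tpow hA(1)]) (use tau_closed in simp)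
    finally show "act (madd m m') h = act m (act m' h)" by simp
  next
    fix h assume h: "h \<in> carrier A"
    have "ex (replicate (2 * n) 0) = (\<lambda>_. 0)" by (auto simp: ex_def fun_eq_iff)
    then show "act (replicate (2 * n) 0) h = h" using A1_carrier h x_closed by (simp add: act_def)
  next
    show "subgroup V A" by (rule H.subgroup_incl[OF V_sub A1_sub V_A1])
    show "set fs \<subseteq> V" using fs fsV by simp
    show "subgroup D A" by (rule H.subgroup_incl[OF Dsub A1_sub DA])
    have "v = \<one>\<^bsub>H\<^esub>" if "v \<in> D \<inter> V" for v by (rule pi_inj_V) (use that in \<open>simp_all add: D_def\<close>)
    moreover have "\<one>\<^bsub>H\<^esub> \<in> D \<inter> V" using subgroup.one_closed[OF V_sub] subgroup.one_closed[OF Dsub] by (rule IntI[rotated])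
    ultimately have "D \<inter> V = {\<one>\<^bsub>H\<^esub>}" by blast
    then show "D \<inter> V = {\<one>\<^bsub>A\<^esub>}" by simp
    have "{act m v |m v. length m = 2 * n \<and> v \<in> V} \<subseteq> A1" using actA V_A1 by blast
    then show "carrier A = generate A {act m v |m v. length m = 2 * n \<and> v \<in> V}"
      using A1_act H.generate_subgroup_incl[OF _ A1_sub] by (simp add: generate_A) blast
  next
    fix i v assume iv: "i < 2 * n" "v \<in> V"
    have "V \<union> act (munit (2 * n) i) ` set fs \<subseteq> A1" using V_A1 fsV actA fs by blast
    then show "act (munit (2 * n) i) v \<in> generate A (V \<union> act (munit (2 * n) i) ` set fs)"
      using act_V[OF iv] by (simp add: generate_A fs)
  next
    fix m d assume d: "d \<in> D"
    then show "act m d \<in> D" using tau_closed by (auto simp: D_def act_def pi_mult pi_inv pi_closed)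
  qed
  obtain E where E: "finite E" "E \<subseteq> D" "D = generate A {act m e |m e. length m = 2 * n \<and> e \<in> E}"
    using mm.invariant_subgroup_finitely_generated by blast
  have "{act m e |m e. length m = 2 * n \<and> e \<in> E} \<subseteq> A1" using actA DA E(2) by blast
  then have "D = generate H {act m e |m e. length m = 2 * n \<and> e \<in> E}" using E(3) by (simp add: generate_A)
  also have "\<dots> \<subseteq> generate H (conjs H (carrier H) E)"
  proof (rule H.mono_generate)
    show "{act m e |m e. length m = 2 * n \<and> e \<in> E} \<subseteq> conjs H (carrier H) E"
      unfolding act_def using tau_closed by (auto intro!: conjsI)
  qed
  finally show ?thesis using E(1,2) unfolding D_def by (intro exI[of _ E]) blast
qed

end

section \<open>The characterisation of compact presentability\<close>

lemma (in lc_grp) lc_group_subgroup: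
  assumes V: "subgroup V G" and lcV: "locally_compact_space (subtopology T V)"
  shows "lc_group (G\<lparr>carrier := V\<rparr>) (subtopology T V)"
  unfolding lc_group_def
proof (intro conjI)
  have Vc: "V \<subseteq> carrier G" using subgroup.subset[OF V] .
  show "group (G\<lparr>carrier := V\<rparr>)" by (rule subgroup.subgroup_is_group[OF V is_group])
  show ts: "topspace (subtopology T V) = carrier (G\<lparr>carrier := V\<rparr>)" using Vc by (auto simp: topspace)
  show "Hausdorff_space (subtopology T V)" using Haus by (rule Hausdorff_space_subtopology)
  show "locally_compact_space (subtopology T V)" by fact
  have "continuous_map (subtopology (prod_topology T T) (V \<times> V)) T (\<lambda>p. fst p \<otimes> snd p)"
    by (rule continuous_map_from_subtopology) (intro cont_intros)
  then show "continuous_map (prod_topology (subtopology T V) (subtopology T V)) (subtopology T V) (\<lambda>(x, y). x \<otimes>\<^bsub>G\<lparr>carrier := V\<rparr>\<^esub> y)"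
    using subgroup.m_closed[OF V] by (auto simp: continuous_map_in_subtopology subtopology_Times case_prod_beta')
  have "continuous_map (subtopology T V) T (\<lambda>x. inv x)"
    by (intro continuous_map_from_subtopology cont_inv continuous_map_id[unfolded id_def])
  then have "continuous_map (subtopology T V) (subtopology T V) (\<lambda>x. inv x)"
    using subgroup.m_inv_closed[OF V] by (auto simp: continuous_map_in_subtopology)
  then show "continuous_map (subtopology T V) (subtopology T V) (\<lambda>x. inv\<^bsub>G\<lparr>carrier := V\<rparr>\<^esub> x)"
    by (rule continuous_map_eq) (use m_inv_consistent[OF V] in auto)
qed

context metab
begin

text \<open>The group generated by \<open>U\<close> is open in \<open>N\<close>, hence itself
  locally compact, abelian and compactly generated, and \<open>extend_partial_hom\<close> applies to
  it with the identity as quotient map.\<close>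

lemma extend_partial_hom_N:
  assumes U: "compactin T U" "U \<subseteq> N" and W: "openin T W" "\<one> \<in> W" "N \<inter> W \<subseteq> U"
  shows "\<exists>D. compactin T D \<and> U \<subseteq> D \<and> D \<subseteq> N \<and> (\<forall>(A::('e,'f) monoid_scheme) f. comm_group A \<longrightarrow> f ` D \<subseteq> carrier A \<longrightarrow>
    (\<forall>x\<in>D. \<forall>y\<in>D. \<forall>z\<in>D. x \<otimes> y = z \<longrightarrow> f x \<otimes>\<^bsub>A\<^esub> f y = f z) \<longrightarrow>
    (\<exists>F\<in>hom (G\<lparr>carrier := generate G U\<rparr>) A. \<forall>x\<in>U. F x = f x))"
proof -
  let ?V = "generate G U"
  let ?G = "G\<lparr>carrier := ?V\<rparr>" and ?T = "subtopology T ?V"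
  have Uc: "U \<subseteq> carrier G" using U N_carrier by blast
  have V: "subgroup ?V G" by (rule generate_is_subgroup[OF Uc])
  have VN: "?V \<subseteq> N" by (rule generate_subgroup_incl[OF U(2) N_subgroup])
  have "openin (subtopology T N) ?V"
    unfolding openin_subopen[of "subtopology T N" ?V]
  proof
    fix v assume v: "v \<in> ?V"
    have vc: "v \<in> carrier G" "v \<in> N" using v VN N_carrier by auto
    have "N \<inter> (v <# W) \<subseteq> ?V"
    proof
      fix y assume y: "y \<in> N \<inter> (v <# W)"
      then obtain w where w: "w \<in> W" "y = v \<otimes> w" by (auto simp: l_coset_def)
      have wc: "w \<in> carrier G" using w(1) openin_subset[OF W(1)] topspace by auto
      have "w = inv v \<otimes> y" using w(2) vc wc by simp
      then have "w \<in> N" using N_mult[OF N_inv[OF vc(2)]] y by simp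
      then have "w \<in> U" using W(3) w(1) by blast
      then have "v \<otimes> w \<in> ?V" by (intro generate.eng[OF v] generate.incl)
      then show "y \<in> ?V" using w(2) by simp
    qed
    moreover have "openin (subtopology T N) (N \<inter> (v <# W))" by (rule openin_subtopology_Int2[OF open_translate[OF W(1) vc(1)]])
    moreover have "v = v \<otimes> \<one>" using vc by simp
    then have "v \<in> N \<inter> (v <# W)" using vc W(2) unfolding l_coset_def by blast
    ultimately show "\<exists>O'. openin (subtopology T N) O' \<and> v \<in> O' \<and> O' \<subseteq> ?V" by (intro exI conjI)
  qed
  then have "locally_compact_space (subtopology (subtopology T N) ?V)"
    by (rule locally_compact_space_open_subset[OF disjI1[OF Hausdorff_space_subtopology[OF Haus]]
      locally_compact_space_closed_subset[OF loc_compact N_closed]])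
  then have lcV: "locally_compact_space ?T" using VN by (simp add: subtopology_subtopology Int_absorb1)
  have lg: "lc_group ?G ?T" by (rule lc_group_subgroup[OF V lcV])
  have gG: "group ?G" by (rule subgroup.subgroup_is_group[OF V is_group])
  have cG: "comm_group ?G" by (rule group.group_comm_groupI[OF gG]) (use VN N_comm in auto)
  interpret v: lc_ab ?G ?T ?G id
    by (intro lc_ab.intro lc_grp.intro lc_grp_axioms.intro lc_ab_axioms.intro gG cG lg) (auto simp: hom_def)
  have UV: "U \<subseteq> ?V" by (auto intro: generate.incl)
  have cU: "compactin ?T U" using U(1) UV by (simp add: compactin_subtopology)
  have cg': "compactly_generated ?G ?T" unfolding compactly_generated_def
    by (rule exI[of _ U]) (use UV cU generate_consistent[OF UV V] in auto)
  from v.extend_partial_hom[OF cg' cU, where ?'e = 'e and ?'f = 'f]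
  obtain D where D: "compactin ?T D" "U \<subseteq> D" and ext: "\<forall>(A::('e,'f) monoid_scheme) f. comm_group A \<longrightarrow> f ` D \<subseteq> carrier A \<longrightarrow>
    (\<forall>x\<in>D. \<forall>y\<in>D. \<forall>z\<in>D. id x \<otimes>\<^bsub>?G\<^esub> id y = id z \<longrightarrow> f x \<otimes>\<^bsub>A\<^esub> f y = f z) \<longrightarrow>
    (\<exists>F\<in>hom ?G A. (\<forall>g\<in>carrier ?G. id g = \<one>\<^bsub>?G\<^esub> \<longrightarrow> F g = \<one>\<^bsub>A\<^esub>) \<and> (\<forall>x\<in>U. F x = f x))"
    by (elim exE conjE)
  show ?thesis
  proof (intro exI[of _ D] conjI allI impI)
    show "compactin T D" "D \<subseteq> N" using D(1) VN by (auto simp: compactin_subtopology)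
    show "U \<subseteq> D" by fact
    fix A :: "('e,'f) monoid_scheme" and f
    assume A: "comm_group A" "f ` D \<subseteq> carrier A" "\<forall>x\<in>D. \<forall>y\<in>D. \<forall>z\<in>D. x \<otimes> y = z \<longrightarrow> f x \<otimes>\<^bsub>A\<^esub> f y = f z"
    have "\<forall>x\<in>D. \<forall>y\<in>D. \<forall>z\<in>D. id x \<otimes>\<^bsub>?G\<^esub> id y = id z \<longrightarrow> f x \<otimes>\<^bsub>A\<^esub> f y = f z" using A(3) by simp
    from ext[rule_format, OF A(1,2)] this show "\<exists>F\<in>hom ?G A. \<forall>x\<in>U. F x = f x" by blast
  qed
qed

text \<open>The elements of \<open>W\<close> whose conjugates by the finite set \<open>P\<close>
  stay in \<open>W\<close> form a neighbourhood of the identity, and finitely many translates of it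
  cover \<open>U\<close>. The quotients involved lie in \<open>N\<close>, so they fall into
  \<open>U\<close>.\<close>

lemma compact_cover_conj:
  assumes U: "compactin T U" "U \<subseteq> N" and W: "openin T W" "\<one> \<in> W" "N \<inter> W \<subseteq> U" and P: "finite P" "P \<subseteq> carrier G"
  shows "\<exists>F. finite F \<and> F \<subseteq> U \<and> (\<forall>u\<in>U. \<exists>f\<in>F. \<exists>w\<in>U. u = f \<otimes> w \<and> (\<forall>a\<in>P. a \<otimes> w \<otimes> inv a \<in> U))"
proof -
  let ?O = "W \<inter> ((\<Inter>a\<in>P. {w \<in> topspace T. a \<otimes> w \<otimes> inv a \<in> W}) \<inter> topspace T)"
  have "openin T {w \<in> topspace T. a \<otimes> w \<otimes> inv a \<in> W}" if "a \<in> P" for a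
    by (rule openin_continuous_map_preimage[OF _ W(1)])
      (use that P in \<open>intro cont_mult cont_const continuous_map_id[unfolded id_def], auto\<close>)
  then have Oo: "openin T ?O" using W(1) P(1) by (intro openin_Int openin_INT) auto
  have O1: "\<one> \<in> ?O" using W(2) P(2) by (auto simp: topspace subset_iff)
  obtain F where F: "finite F" "F \<subseteq> U" "U \<subseteq> (\<Union>x\<in>F. x <# ?O)" using compact_cover[OF U(1) Oo O1] by (elim exE conjE)
  show ?thesis
  proof (intro exI[of _ F] conjI ballI F)
    fix u assume u: "u \<in> U"
    then obtain f where f: "f \<in> F" "u \<in> f <# ?O" using F(3) by blast
    then obtain w where w: "w \<in> ?O" "u = f \<otimes> w" unfolding l_coset_def by blast
    have N: "u \<in> N" "f \<in> N" "f \<in> carrier G" using u f F(2) U(2) N_carrier by auto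
    have wc: "w \<in> carrier G" using w(1) by (simp add: topspace)
    have "w = inv f \<otimes> u" using w(2) N wc by simp
    then have wN: "w \<in> N" using N_mult[OF N_inv[OF N(2)] N(1)] by simp
    have "a \<otimes> w \<otimes> inv a \<in> U" if a: "a \<in> P" for a
    proof -
      have "a \<otimes> w \<otimes> inv a \<in> N" using N_conj[OF _ wN] a P(2) by blast
      moreover have "a \<otimes> w \<otimes> inv a \<in> W" using w(1) a by blast
      ultimately show ?thesis using W(3) by blast
    qed
    moreover have "w \<in> U" using wN w(1) W(3) by blast
    ultimately show "\<exists>f\<in>F. \<exists>w\<in>U. u = f \<otimes> w \<and> (\<forall>a\<in>P. a \<otimes> w \<otimes> inv a \<in> U)" using f(1) w(2) by blast
  qed
qed

end

lemma finite_nsq_le: "finite {a \<in> Zn n. nsq n a \<le> M}"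
proof (rule finite_subset[OF _ finite_box[of n "nat M"]], clarify)
  fix a i assume a: "a \<in> Zn n" "nsq n a \<le> M"
  show "\<bar>a i\<bar> \<le> int (nat M)"
  proof (cases "i < n")
    case True
    have "\<bar>a i\<bar> * 1 \<le> \<bar>a i\<bar> * \<bar>a i\<bar>" by (cases "a i = 0") (auto intro!: mult_left_mono simp del: abs_mult_self_eq)
    then have "\<bar>a i\<bar> \<le> (a i)\<^sup>2" by (simp add: power2_eq_square)
    also have "\<dots> \<le> nsq n a" unfolding nsq_def using True by (intro member_le_sum) auto
    finally show ?thesis using a(2) by linarith
  next
    case False then show ?thesis using a(1) by (simp add: Zn_def)
  qed
qed

lemma finite_bounded_nat:
  assumes "finite X" shows "\<exists>m::nat. \<forall>x\<in>X. f x \<le> m"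
  using finite_nat_set_iff_bounded_le[of "f ` X"] assms by auto

text \<open>The constants are fixed in the order of their dependence: \<open>K\<close> and its
  contractions, \<open>U\<close> and the domains \<open>DV\<close> and \<open>DQ\<close>, a radius
  \<open>j0\<close> containing them, the set \<open>EL\<close> for elements of \<open>N\<close> of
  length \<open>j1\<close>, and last the radius \<open>r\<close> of the ball that serves as
  generating set.\<close>

theorem (in metab) compactly_presentable_if_Gamma_no_line:
  assumes tame: "\<And>c. c \<in> GammaG G T \<Longrightarrow> (\<lambda>x. - c x) \<in> GammaG G T \<Longrightarrow> (\<forall>x\<in>carrier G. c x = 0)"
  shows "compactly_presentable G T"
proof -
  obtain n t C where t: "\<forall>i<n. t i \<in> carrier G" and pr: "qt.proper n t" and C: "compactin T C"
    and dec: "\<forall>g\<in>carrier G. \<exists>c\<in>C. \<exists>a\<in>Zn n. q g = q c \<otimes>\<^bsub>Q\<^esub> qt.tp n t a"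
    using qt.lattice_exists[OF cg] by (elim exE conjE)
  interpret lm: lattice_metab G T n t C
    by (intro lattice_metab.intro lattice_metab_axioms.intro metab_axioms) (use t C dec in auto)
  have "\<exists>f. f \<in> Gstar G T \<and> (\<forall>b\<in>Zn n. f (lm.tt b) = real_of_int (b i))" if i: "i < n" for i
  proof -
    have "\<exists>f::'a \<Rightarrow> real. (\<forall>x\<in>carrier G. \<forall>y\<in>carrier G. f (x \<otimes> y) = f x + f y) \<and> continuous_map T euclideanreal f \<and>
      (\<forall>b\<in>Zn n. f (tpow G t n b) = real_of_int (b i))"
      by (rule qt.coordinate_characters[OF _ pr C _ i]) (erule lm.t, erule lm.dec)
    then show ?thesis unfolding Gstar_def by blast
  qed
  then obtain \<phi> where \<phi>: "\<And>i. i < n \<Longrightarrow> \<phi> i \<in> Gstar G T \<and> (\<forall>b\<in>Zn n. \<phi> i (lm.tt b) = real_of_int (b i))" by metis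
  then have \<phi>1: "\<And>i. i < n \<Longrightarrow> \<phi> i \<in> Gstar G T" and \<phi>2: "\<And>i b. i < n \<Longrightarrow> b \<in> Zn n \<Longrightarrow> \<phi> i (lm.tt b) = real_of_int (b i)"
    by simp_all
  define P where "P = t ` {..<n} \<union> m_inv G ` t ` {..<n}"
  have P: "finite P" "P \<subseteq> carrier G" using lm.t by (auto simp: P_def)
  \<comment> \<open>Sorting lattice words creates these commutators, so they must belong to
    \<open>K\<close> from the start.\<close>
  define Ks where "Ks = (\<lambda>(a, b). a \<otimes> b \<otimes> inv a \<otimes> inv b) ` (P \<times> P)"
  have KsN: "Ks \<subseteq> N" using comm_N P(2) by (auto simp: Ks_def)
  have Ks: "compactin T Ks" using P(1) KsN N_carrier by (intro compact_finite) (auto simp: Ks_def)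
  obtain K \<E> where K: "compactin T K" "K \<subseteq> N" "Ks \<subseteq> K" "\<one> \<in> K" "\<forall>k\<in>K. inv k \<in> K" and \<E>: "finite \<E>"
    "\<forall>E\<in>\<E>. finite E \<and> E \<subseteq> Zn n \<and> lm.reach K E K"
    and dir: "\<forall>w::nat \<Rightarrow> real. (\<Sum>i<n. (w i)\<^sup>2) = 1 \<longrightarrow> (\<exists>E\<in>\<E>. (\<forall>b\<in>E. 1 \<le> (\<Sum>i<n. w i * real_of_int (b i))) \<or>
       (\<forall>b\<in>E. (\<Sum>i<n. w i * real_of_int (b i)) \<le> - 1))"
    and rch: "\<forall>L. compactin T L \<longrightarrow> L \<subseteq> N \<longrightarrow> (\<exists>E. finite E \<and> E \<subseteq> Zn n \<and> lm.reach L E K)"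
    by (rule exE[OF lm.contraction_family[of \<phi> Ks, OF \<phi>1 \<phi>2 tame Ks KsN]], assumption+, elim exE conjE)
  obtain W V0 where W: "openin T W" "\<one> \<in> W" "W \<subseteq> V0" "compactin T V0" using compact_nbhd_one by (elim exE conjE)
  obtain V1 where V1: "compactin T V1" "V0 \<union> K \<subseteq> V1" "\<one> \<in> V1" "\<forall>v\<in>V1. inv v \<in> V1"
    using compact_symmetric[OF compactin_Un[OF W(4) K(1)]] by (elim exE conjE)
  define U where "U = N \<inter> V1"
  have U: "compactin T U" "U \<subseteq> N" "K \<subseteq> U" "N \<inter> W \<subseteq> U" "\<And>u. u \<in> U \<Longrightarrow> inv u \<in> U"
    using closed_Int_compactin[OF N_closed V1(1)] V1 W(3) K(2) N_inv unfolding U_def by auto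
  obtain DV where DV: "compactin T DV" "U \<subseteq> DV" "DV \<subseteq> N" and DVx: "\<forall>(A::'a word set monoid) f. comm_group A \<longrightarrow> f ` DV \<subseteq> carrier A \<longrightarrow>
    (\<forall>x\<in>DV. \<forall>y\<in>DV. \<forall>z\<in>DV. x \<otimes> y = z \<longrightarrow> f x \<otimes>\<^bsub>A\<^esub> f y = f z) \<longrightarrow>
    (\<exists>F\<in>hom (G\<lparr>carrier := generate G U\<rparr>) A. \<forall>x\<in>U. F x = f x)"
    using extend_partial_hom_N[OF U(1,2) W(1,2) U(4), where ?'e = "'a word set" and ?'f = unit] by (elim exE conjE)
  obtain Fu where Fu: "finite Fu" "Fu \<subseteq> U" "\<forall>u\<in>U. \<exists>f\<in>Fu. \<exists>w\<in>U. u = f \<otimes> w \<and> (\<forall>a\<in>P. a \<otimes> w \<otimes> inv a \<in> U)"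
    using compact_cover_conj[OF U(1,2) W(1,2) U(4) P] by (elim exE conjE)
  obtain S0 where S0: "compactin T S0" "generate G S0 = carrier G" using gens by (elim exE conjE)
  have "compactin T (t ` {..<n})" by (rule compact_finite) (use lm.t in auto)
  from compact_symmetric[OF compactin_Un[OF S0(1) this]]
  obtain B0 where B0: "compactin T B0" "S0 \<union> t ` {..<n} \<subseteq> B0" "\<one> \<in> B0" "\<forall>b\<in>B0. inv b \<in> B0" by (elim exE conjE)
  have B0c: "B0 \<subseteq> carrier G" by (rule compact_carrier[OF B0(1)])
  have genB: "generate G B0 = carrier G"
    using S0(2) mono_generate[of S0 B0] B0(2) generate_incl[OF B0c] by blast
  \<comment> \<open>The target here is a quotient of \<open>H\<close>, whose elements are sets of
    elements of \<open>H\<close>, whereas for \<open>DV\<close> it is a subgroup of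
    \<open>H\<close>; hence the two type instances.\<close>
  obtain DQ where DQ: "compactin T DQ" "B0 \<subseteq> DQ" and DQx: "\<forall>(A::'a word set set monoid) f. comm_group A \<longrightarrow> f ` DQ \<subseteq> carrier A \<longrightarrow>
    (\<forall>x\<in>DQ. \<forall>y\<in>DQ. \<forall>z\<in>DQ. q x \<otimes>\<^bsub>Q\<^esub> q y = q z \<longrightarrow> f x \<otimes>\<^bsub>A\<^esub> f y = f z) \<longrightarrow>
    (\<exists>F\<in>hom G A. (\<forall>g\<in>carrier G. q g = \<one>\<^bsub>Q\<^esub> \<longrightarrow> F g = \<one>\<^bsub>A\<^esub>) \<and> (\<forall>x\<in>B0. F x = f x))"
    using qt.extend_partial_hom[OF cg B0(1), where ?'e = "'a word set set" and ?'f = unit] by (elim exE conjE)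
  have DD: "compactin T (DQ \<union> DV)" by (rule compactin_Un[OF DQ(1) DV(1)])
  have "\<exists>j. DQ \<union> DV \<subseteq> prodn G B0 j"
  proof (rule compact_subset_prodn[of "carrier G" _ "\<lambda>_. B0"])
    show "closedin T (carrier G)" using closedin_topspace[of T] topspace by simp
  qed (use DD compact_carrier[OF DD] B0 B0c genB subgroup_self in auto)
  then obtain j0 where j0: "DQ \<union> DV \<subseteq> prodn G B0 j0" by (elim exE)
  define j1 where "j1 = 4 + 4 * j0"
  have "compactin T (N \<inter> prodn G B0 j1)" by (rule closed_Int_compactin[OF N_closed compact_prodn[OF B0(1)]])
  with rch obtain EL where EL: "finite EL" "EL \<subseteq> Zn n" "lm.reach (N \<inter> prodn G B0 j1) EL K" by blast
  then obtain jL where jL: "N \<inter> prodn G B0 j1 \<subseteq> prodn G (conjs G (lm.tt ` EL) K) jL" unfolding lm.reach_def by (elim exE)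
  have "\<forall>E\<in>\<E>. \<exists>j. K \<subseteq> prodn G (conjs G (lm.tt ` E) K) j" using \<E>(2) unfolding lm.reach_def by blast
  then obtain jE where jE: "\<And>E. E \<in> \<E> \<Longrightarrow> K \<subseteq> prodn G (conjs G (lm.tt ` E) K) (jE E)" using bchoice by metis
  obtain J0 where J0: "\<forall>E\<in>\<E>. jE E \<le> J0" using finite_bounded_nat[OF \<E>(1), of jE] by (elim exE)
  have "finite (\<Union>\<E>)" using \<E> by blast
  from finite_bounded_nat[OF this, of "\<lambda>b. length (clist n b)"]
  obtain l where l: "\<forall>b\<in>\<Union>\<E>. length (clist n b) \<le> l" by (elim exE)
  obtain M :: int where M: "M \<ge> 0" "\<forall>m::int. m \<ge> M \<longrightarrow> real l \<le> sqrt m \<and> 1 + (real l)\<^sup>2 \<le> 2 * sqrt (m + 1) \<and>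
      2 + sqrt ((sqrt (m + 1) + 2 * l)\<^sup>2 - m) + sqrt (m + 1 - (sqrt m - l)\<^sup>2) + 2 * l \<le> sqrt m"
    using reroute_threshold[of l] unfolding of_int_le_iff of_int_0_le_iff of_int_add of_int_1 by (elim exE conjE)
  from finite_bounded_nat[OF finite_UnI[OF finite_nsq_le[of n M] EL(1)], of "\<lambda>b. length (clist n b)"]
  obtain l1 where l1: "\<forall>b\<in>{a \<in> Zn n. nsq n a \<le> M} \<union> EL. length (clist n b) \<le> l1" by (elim exE)
  define l2 where "l2 = l + l1"
  define J where "J = J0 + jL"
  define r where "r = J * (2 * l2 + j0) + 2 * l2 + 2 * j0 + j1 + 2"
  let ?S = "prodn G B0 r"
  have BS: "B0 \<subseteq> ?S" using prodn_le[OF B0c B0(3), of 1 r] prodn_1[OF B0c] by (simp add: r_def)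
  have Sc: "?S \<subseteq> carrier G" by (rule prodn_carrier[OF B0c])
  show ?thesis
  proof (rule compactly_presentable_if_kernel_finitely_generated[of ?S])
    show "?S \<subseteq> carrier G" by fact
    show "compactin T ?S" by (rule compact_prodn[OF B0(1)])
    show "generate G ?S = carrier G" using genB mono_generate[OF BS] generate_incl[OF Sc] by blast
    fix H :: "'a word set monoid" and s \<pi>
    assume H: "group H" "s ` ?S \<subseteq> carrier H" "generate H (s ` ?S) = carrier H" "\<pi> \<in> hom H G" "\<And>x. x \<in> ?S \<Longrightarrow> \<pi> (s x) = x"
      "\<And>x y. x \<in> ?S \<Longrightarrow> y \<in> ?S \<Longrightarrow> x \<otimes> y \<in> ?S \<Longrightarrow> s x \<otimes>\<^bsub>H\<^esub> s y = s (x \<otimes> y)"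
    have ss: "scaled_section G H B0 r s \<pi>"
    proof (intro scaled_section.intro scaled_section_axioms.intro is_group H)
      show "1 \<le> r" by (simp add: r_def)
    qed (use B0c B0 in auto)
    have pm: "presented_metab G T n t C H B0 r s \<pi> K U \<E> EL M l l2 j0 j1 J"
    proof (intro presented_metab.intro presented_metab_axioms.intro lm.lattice_metab_axioms ss)
      show "\<And>i. i < n \<Longrightarrow> t i \<in> B0" using B0(2) by auto
      show "K \<subseteq> U" "U \<subseteq> N" by fact+
      show "U \<subseteq> prodn G B0 j0" using j0 DV(2) by blast
      fix a b assume "a \<in> t ` {..<n} \<union> m_inv G ` t ` {..<n}" "b \<in> t ` {..<n} \<union> m_inv G ` t ` {..<n}"
      then have "a \<otimes> b \<otimes> inv a \<otimes> inv b \<in> Ks" unfolding Ks_def P_def[symmetric] by (intro image_eqI[of _ _ "(a, b)"]) auto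
      then show "a \<otimes> b \<otimes> inv a \<otimes> inv b \<in> K" using K(3) by blast
    next
      fix E assume E: "E \<in> \<E>"
      have "jE E \<le> J" using J0 E by (auto simp: J_def intro: trans_le_add1)
      then show "E \<subseteq> Zn n \<and> (\<exists>j\<le>J. K \<subseteq> prodn G (conjs G (lm.tt ` E) K) j)" using \<E>(2) E jE[OF E] by blast
    next
      show "\<And>E b. E \<in> \<E> \<Longrightarrow> b \<in> E \<Longrightarrow> length (clist n b) \<le> l" using l by blast
      show "\<And>w::nat \<Rightarrow> real. (\<Sum>i<n. (w i)\<^sup>2) = 1 \<Longrightarrow> \<exists>E\<in>\<E>. (\<forall>b\<in>E. 1 \<le> (\<Sum>i<n. w i * real_of_int (b i))) \<or>
         (\<forall>b\<in>E. (\<Sum>i<n. w i * real_of_int (b i)) \<le> - 1)" using dir by simp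
      show "M \<ge> 0" by fact
    next
      fix m :: int assume "m \<ge> M"
      with M(2) show "real l \<le> sqrt m \<and> 1 + (real l)\<^sup>2 \<le> 2 * sqrt (m + 1) \<and>
        2 + sqrt ((sqrt (m + 1) + 2 * real l)\<^sup>2 - m) + sqrt (m + 1 - (sqrt m - real l)\<^sup>2) + 2 * real l \<le> sqrt m" by simp
    next
      show "\<And>a. a \<in> Zn n \<Longrightarrow> nsq n a \<le> M \<Longrightarrow> length (clist n a) \<le> l2" using l1 by (simp add: l2_def trans_le_add2)
      show "l \<le> l2" by (simp add: l2_def)
      show "EL \<subseteq> Zn n" by fact
      show "\<And>b. b \<in> EL \<Longrightarrow> length (clist n b) \<le> l2" using l1 by (simp add: l2_def trans_le_add2)
      show "\<exists>j\<le>J. N \<inter> prodn G B0 j1 \<subseteq> prodn G (conjs G (lm.tt ` EL) K) j" using jL by (intro exI[of _ jL]) (simp add: J_def)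
      show "4 + 4 * j0 \<le> j1" by (simp add: j1_def)
      show "J * (2 * l2 + j0) \<le> r" "2 * l2 + 2 * j0 \<le> r" "j1 + 2 \<le> r" by (simp_all add: r_def)
    qed
    interpret em: extended_metab G T n t C H B0 r s \<pi> K U \<E> EL M l l2 j0 j1 J DQ DV Fu
    proof (intro extended_metab.intro extended_metab_axioms.intro pm)
      show "\<And>u. u \<in> U \<Longrightarrow> inv u \<in> U" by (rule U(5))
      show "DQ \<subseteq> prodn G B0 j0" "DV \<subseteq> prodn G B0 j0" using j0 by auto
      show "DV \<subseteq> N" "U \<subseteq> DV" "finite Fu" "Fu \<subseteq> U" by fact+
      show "\<And>u. u \<in> U \<Longrightarrow> \<exists>f\<in>Fu. \<exists>w\<in>U. u = f \<otimes> w \<and> (\<forall>a\<in>t ` {..<n} \<union> m_inv G ` t ` {..<n}. a \<otimes> w \<otimes> inv a \<in> U)"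
        using Fu(3) unfolding P_def by simp
    next
      fix A :: "'a word set set monoid" and f assume A: "comm_group A" "f ` DQ \<subseteq> carrier A"
        and p: "\<And>x y z. x \<in> DQ \<Longrightarrow> y \<in> DQ \<Longrightarrow> z \<in> DQ \<Longrightarrow> q x \<otimes>\<^bsub>Q\<^esub> q y = q z \<Longrightarrow> f x \<otimes>\<^bsub>A\<^esub> f y = f z"
      have p': "\<forall>x\<in>DQ. \<forall>y\<in>DQ. \<forall>z\<in>DQ. q x \<otimes>\<^bsub>Q\<^esub> q y = q z \<longrightarrow> f x \<otimes>\<^bsub>A\<^esub> f y = f z" by (intro ballI impI p)
      show "\<exists>F\<in>hom G A. (\<forall>g\<in>carrier G. q g = \<one>\<^bsub>Q\<^esub> \<longrightarrow> F g = \<one>\<^bsub>A\<^esub>) \<and> (\<forall>x\<in>B0. F x = f x)"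
        by (rule DQx[THEN spec, THEN spec, THEN mp, THEN mp, THEN mp, OF A p'])
    next
      fix A :: "'a word set monoid" and f assume A: "comm_group A" "f ` DV \<subseteq> carrier A"
        and p: "\<And>x y z. x \<in> DV \<Longrightarrow> y \<in> DV \<Longrightarrow> z \<in> DV \<Longrightarrow> x \<otimes> y = z \<Longrightarrow> f x \<otimes>\<^bsub>A\<^esub> f y = f z"
      have p': "\<forall>x\<in>DV. \<forall>y\<in>DV. \<forall>z\<in>DV. x \<otimes> y = z \<longrightarrow> f x \<otimes>\<^bsub>A\<^esub> f y = f z" by (intro ballI impI p)
      show "\<exists>F\<in>hom (G\<lparr>carrier := generate G U\<rparr>) A. \<forall>x\<in>U. F x = f x"
        by (rule DVx[THEN spec, THEN spec, THEN mp, THEN mp, THEN mp, OF A p'])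
    qed
    show "\<exists>E. finite E \<and> E \<subseteq> carrier H \<and> (\<forall>e\<in>E. \<pi> e = \<one>) \<and> (\<forall>h\<in>carrier H. \<pi> h = \<one> \<longrightarrow> h \<in> generate H (conjs H (carrier H) E))"
      by (rule em.kernel_finitely_generated)
  qed
qed

theorem mainTheorem19:
  fixes G :: "('a, 'b) monoid_scheme" and T :: "'a topology"
  assumes "lc_group G T"
    and "metabelian G"
    and "compactly_generated G T"
  shows "compactly_presentable G T \<longleftrightarrow>
    (\<forall>c. c \<in> GammaG G T \<and> (\<lambda>x. - c x) \<in> GammaG G T \<longrightarrow> (\<forall>x \<in> carrier G. c x = 0))"
proof -
  have "group G" using assms(1) by (simp add: lc_group_def)
  then interpret metab G T
    by (intro metab.intro metab_axioms.intro lc_grp.intro lc_grp_axioms.intro assms)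
  show ?thesis
  proof
    assume "compactly_presentable G T"
    from Gamma_no_line_if_compactly_presentable[OF this]
    show "\<forall>c. c \<in> GammaG G T \<and> (\<lambda>x. - c x) \<in> GammaG G T \<longrightarrow> (\<forall>x \<in> carrier G. c x = 0)" by blast
  next
    assume "\<forall>c. c \<in> GammaG G T \<and> (\<lambda>x. - c x) \<in> GammaG G T \<longrightarrow> (\<forall>x \<in> carrier G. c x = 0)"
    then show "compactly_presentable G T" by (intro compactly_presentable_if_Gamma_no_line) blast
  qed
qed

end
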